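(* Let $(\mathcal{B},\mathcal{L},\theta)$ be a Boolean dynamical system, let $T$ be its associated inverse semigroup, and let $C^*(\mathcal{B},\mathcal{L},\theta)^{\sim}$ be the minimal unitization of $C^*(\mathcal{B},\mathcal{L},\theta)$ (equal to $C^*(\mathcal{B},\mathcal{L},\theta)$ itself if that algebra is already unital). Then the inclusion $\iota:T\to C^*(\mathcal{B},\mathcal{L},\theta)^{\sim}$ is the universal tight representation of $T$; that is, $\iota$ is a tight representation, and for every unital $C^*$-algebra $\mathcal{A}$ and every tight representation $\rho:T\to\mathcal{A}$ there is a unique unital $*$-homomorphism $\psi:C^*(\mathcal{B},\mathcal{L},\theta)^{\sim}\to\mathcal{A}$ with $\psi\circ\iota=\rho$.
   Context: A Boolean algebra $\mathcal{B}$ here is a set with a distinguished element $\emptyset$ and operations $\cap,\cup,\setminus$ satisfying the usual axioms (a Boolean ring; no top element required); $A\subseteq B$ iff $A\cap B=A$. An action on $\mathcal{B}$ is a map $\theta:\mathcal{B}\to\mathcal{B}$ preserving $\cap,\cup,\setminus$ and $\emptyset$; it has compact range if $\{\theta(A)\}_{A\in\mathcal{B}}$ has a least upper bound $\mathcal{R}_\theta\in\mathcal{B}$, and closed domain if there is (a fixed) $\mathcal{D}_\theta\in\mathcal{B}$ with $\theta(\mathcal{D}_\theta)=\mathcal{R}_\theta$. A Boolean dynamical system $(\mathcal{B},\mathcal{L},\theta)$ consists of a Boolean algebra, a set $\mathcal{L}$, and actions $\{\theta_\alpha\}_{\alpha\in\mathcal{L}}$ such that for every nonempty word $\alpha=\alpha_1\cdots\alpha_n$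 the action $\theta_\alpha=\theta_{\alpha_n}\circ\cdots\circ\theta_{\alpha_1}$ has compact range $\mathcal{R}_\alpha$ and closed domain $\mathcal{D}_\alpha$. $\Delta_B=\{\alpha\in\mathcal{L}:\theta_\alpha(B)\ne\emptyset\}$, $\lambda_B=|\Delta_B|$; $\mathcal{B}_{reg}$ is the set of $A$ with $0<\lambda_B<\infty$ for all $\emptyset\neq B\subseteq A$ (including $\emptyset$). $C^*(\mathcal{B},\mathcal{L},\theta)$ is the universal $C^*$-algebra generated by projections $p_A$ ($A\in\mathcal{B}$) and partial isometries $s_\alpha$ ($\alpha\in\mathcal{L}$) subject to: (1) $p_Ap_B=p_{A\cap B}$, $p_{A\cup B}=p_A+p_B-p_{A\cap B}$, $p_\emptyset=0$; (2) $p_As_\alpha=s_\alpha p_{\theta_\alpha(A)}$; (3) $s_\alpha^*s_\beta=\delta_{\alpha,\beta}p_{\mathcal{R}_\alpha}$; (4) $p_A=\sum_{\alpha\in\Delta_A}s_\alpha p_{\theta_\alpha(A)}s_\alpha^*$ for $A\in\mathcal{B}_{reg}$. $\mathcal{L}^*$ is the set of finite words, including the empty word $\emptyset$; $s_\alpha=s_{\alpha_1}\cdots s_{\alpha_n}$, $\theta_\emptyset=\mathrm{id}$, $s_\emptyset$ is a formal unit (so $s_\emptyset p_As_\emptyset^*=p_A$) and $\mathcal{R}_\emptyset$ is a formal top element (every $A\subseteq\mathcal{R}_\emptyset$). Put $$T=\{s_\alpha p_As_\beta^*:\alpha,\beta\in\mathcal{L}^*,A\in\mathcal{B},A\subseteq\mathcal{R}_\alpha\cap\mathcal{R}_\beta\neq\emptyset\}\cup\{0\}\subseteq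 C^*(\mathcal{B},\mathcal{L},\theta),$$ a $*$-semigroup (an inverse semigroup with zero) under the operations of $C^*(\mathcal{B},\mathcal{L},\theta)$, and let $\mathcal{E}=\mathcal{E}(T)$ be its semilattice of idempotents, ordered by $e\le f$ iff $ef=e$; $e\perp f$ means $ef=0$. For finite $X,Y\subseteq\mathcal{E}$ let $\mathcal{E}^{X,Y}=\{z\in\mathcal{E}:z\le x\ \forall x\in X,\ z\perp y\ \forall y\in Y\}$. A cover for $F\subseteq\mathcal{E}$ is a subset $Z\subseteq F$ such that for every $0\ne x\in F$ there is $z\in Z$ with $zx\ne0$. A representation of $T$ in a unital $C^*$-algebra $\mathcal{A}$ is a map $\rho:T\to\mathcal{A}$ with $\rho(0)=0$, $\rho(st)=\rho(s)\rho(t)$, $\rho(s^* )=\rho(s)^*$. It is tight if for all finite $X,Y\subseteq\mathcal{E}$ and every finite cover $Z$ for $\mathcal{E}^{X,Y}$ one has $\bigvee_{z\in Z}\rho(z)\ge\prod_{x\in X}\rho(x)\prod_{y\in Y}(1-\rho(y))$, where $\bigvee$ is the supremum of commuting projections (empty supremum $0$, empty product $1$). *)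

theory Defs
  imports "HOL-Analysis.Analysis" "HOL-Algebra.Module" "HOL-Library.Poly_Mapping"
begin

hide_const (open) Lattice.inf Lattice.sup

section \<open>Boolean dynamical systems\<close>

text \<open>Boolean algebras without a required top element; \<open>x - y\<close> is the relative complement.\<close>

class generalized_boolean_algebra = distrib_lattice + order_bot + minus +
  assumes inf_diff_bot: "inf (x - y) y = bot"
    and sup_diff_inf: "sup (x - y) (inf x y) = x"

definition boolean_action :: "('b::generalized_boolean_algebra \<Rightarrow> 'b) \<Rightarrow> bool" where
  "boolean_action f \<longleftrightarrow> f bot = bot \<and>
     (\<forall>A B. f (inf A B) = inf (f A) (f B) \<and> f (sup A B) = sup (f A) (f B) \<and> f (A - B) = f A - f B)"

definition compact_range :: "('b::generalized_boolean_algebra \<Rightarrow> 'b) \<Rightarrow> bool" where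
  "compact_range f \<longleftrightarrow> (\<exists>R. (\<forall>A. f A \<le> R) \<and> (\<forall>U. (\<forall>A. f A \<le> U) \<longrightarrow> R \<le> U))"

definition range_lub :: "('b::generalized_boolean_algebra \<Rightarrow> 'b) \<Rightarrow> 'b" where
  "range_lub f = (LEAST R. \<forall>A. f A \<le> R)"

definition closed_domain :: "('b::generalized_boolean_algebra \<Rightarrow> 'b) \<Rightarrow> bool" where
  "closed_domain f \<longleftrightarrow> (\<exists>D. f D = range_lub f)"

text \<open>For a word \<open>w = [a\<^sub>1, \<dots>, a\<^sub>n]\<close>, \<open>fold \<theta> w\<close> is the composite
  \<open>\<theta> a\<^sub>n \<circ> \<dots> \<circ> \<theta> a\<^sub>1\<close>.\<close>

definition boolean_dynamical_system ::
    "'l set \<Rightarrow> ('l \<Rightarrow> 'b::generalized_boolean_algebra \<Rightarrow> 'b) \<Rightarrow> bool" where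
  "boolean_dynamical_system L \<theta> \<longleftrightarrow>
     (\<forall>a\<in>L. boolean_action (\<theta> a)) \<and>
     (\<forall>w. w \<noteq> [] \<and> set w \<subseteq> L \<longrightarrow> compact_range (fold \<theta> w) \<and> closed_domain (fold \<theta> w))"

definition Delta ::
    "'l set \<Rightarrow> ('l \<Rightarrow> 'b::generalized_boolean_algebra \<Rightarrow> 'b) \<Rightarrow> 'b \<Rightarrow> 'l set" where
  "Delta L \<theta> B = {a\<in>L. \<theta> a B \<noteq> bot}"

definition B_reg ::
    "'l set \<Rightarrow> ('l \<Rightarrow> 'b::generalized_boolean_algebra \<Rightarrow> 'b) \<Rightarrow> 'b set" where
  "B_reg L \<theta> = {A. \<forall>B. B \<noteq> bot \<and> B \<le> A \<longrightarrow> finite (Delta L \<theta> B) \<and> 0 < card (Delta L \<theta> B)}"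

section \<open>C*-algebras\<close>

text \<open>The field \<open>one\<close> inherited from the ring record has no meaning for algebras that are
  not assumed unital.  The zero algebra counts as a unital C*-algebra.\<close>

record 'a cstar = "(complex, 'a) module" +
  adj :: "'a \<Rightarrow> 'a"
  nrm :: "'a \<Rightarrow> real"

definition complex_ring :: "complex ring" where
  "complex_ring = \<lparr>carrier = UNIV, monoid.mult = (*), one = 1, zero = 0, add = (+)\<rparr>"

locale cstar_algebra = module complex_ring A for A :: "('a, 'm) cstar_scheme" (structure) +
  assumes mult_closed: "x \<in> carrier A \<Longrightarrow> y \<in> carrier A \<Longrightarrow> x \<otimes> y \<in> carrier A"
    and mult_assoc: "x \<in> carrier A \<Longrightarrow> y \<in> carrier A \<Longrightarrow> z \<in> carrier A \<Longrightarrow>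
      (x \<otimes> y) \<otimes> z = x \<otimes> (y \<otimes> z)"
    and distr_left: "x \<in> carrier A \<Longrightarrow> y \<in> carrier A \<Longrightarrow> z \<in> carrier A \<Longrightarrow>
      (x \<oplus> y) \<otimes> z = x \<otimes> z \<oplus> y \<otimes> z"
    and distr_right: "x \<in> carrier A \<Longrightarrow> y \<in> carrier A \<Longrightarrow> z \<in> carrier A \<Longrightarrow>
      z \<otimes> (x \<oplus> y) = z \<otimes> x \<oplus> z \<otimes> y"
    and smult_mult_left: "x \<in> carrier A \<Longrightarrow> y \<in> carrier A \<Longrightarrow> (c \<odot> x) \<otimes> y = c \<odot> (x \<otimes> y)"
    and smult_mult_right: "x \<in> carrier A \<Longrightarrow> y \<in> carrier A \<Longrightarrow> x \<otimes> (c \<odot> y) = c \<odot> (x \<otimes> y)"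
    and adj_closed: "x \<in> carrier A \<Longrightarrow> adj A x \<in> carrier A"
    and adj_adj: "x \<in> carrier A \<Longrightarrow> adj A (adj A x) = x"
    and adj_add: "x \<in> carrier A \<Longrightarrow> y \<in> carrier A \<Longrightarrow> adj A (x \<oplus> y) = adj A x \<oplus> adj A y"
    and adj_smult: "x \<in> carrier A \<Longrightarrow> adj A (c \<odot> x) = cnj c \<odot> adj A x"
    and adj_mult: "x \<in> carrier A \<Longrightarrow> y \<in> carrier A \<Longrightarrow> adj A (x \<otimes> y) = adj A y \<otimes> adj A x"
    and nrm_nonneg: "x \<in> carrier A \<Longrightarrow> 0 \<le> nrm A x"
    and nrm_eq_0: "x \<in> carrier A \<Longrightarrow> nrm A x = 0 \<longleftrightarrow> x = \<zero>"
    and nrm_triangle: "x \<in> carrier A \<Longrightarrow> y \<in> carrier A \<Longrightarrow> nrm A (x \<oplus> y) \<le> nrm A x + nrm A y"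
    and nrm_smult: "x \<in> carrier A \<Longrightarrow> nrm A (c \<odot> x) = cmod c * nrm A x"
    and nrm_mult: "x \<in> carrier A \<Longrightarrow> y \<in> carrier A \<Longrightarrow> nrm A (x \<otimes> y) \<le> nrm A x * nrm A y"
    and cstar_identity: "x \<in> carrier A \<Longrightarrow> nrm A (adj A x \<otimes> x) = (nrm A x)\<^sup>2"
    and complete: "(\<And>n. X n \<in> carrier A) \<Longrightarrow>
      (\<And>e. e > 0 \<Longrightarrow> \<exists>M. \<forall>m\<ge>M. \<forall>n\<ge>M. nrm A (X m \<ominus> X n) < e) \<Longrightarrow>
      \<exists>x\<in>carrier A. (\<lambda>n. nrm A (X n \<ominus> x)) \<longlonglongrightarrow> 0"

locale unital_cstar_algebra = cstar_algebra A + monoid A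
  for A :: "('a, 'm) cstar_scheme" (structure)

definition unital_star_hom ::
    "('a, 'm) cstar_scheme \<Rightarrow> ('c, 'n) cstar_scheme \<Rightarrow> ('a \<Rightarrow> 'c) \<Rightarrow> bool" where
  "unital_star_hom A B h \<longleftrightarrow> h \<in> ring_hom A B \<and>
     (\<forall>c. \<forall>x\<in>carrier A. h (c \<odot>\<^bsub>A\<^esub> x) = c \<odot>\<^bsub>B\<^esub> h x) \<and>
     (\<forall>x\<in>carrier A. h (adj A x) = adj B (h x))"

definition is_unit :: "('a, 'm) cstar_scheme \<Rightarrow> 'a \<Rightarrow> bool" where
  "is_unit C e \<longleftrightarrow> e \<in> carrier C \<and> (\<forall>x\<in>carrier C. e \<otimes>\<^bsub>C\<^esub> x = x \<and> x \<otimes>\<^bsub>C\<^esub> e = x)"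

text \<open>The minimal unitization, on pairs \<open>(a, k)\<close> standing for \<open>a + k1\<close>.  If \<open>C\<close> is unital,
  only the pairs \<open>(a, 0)\<close> occur, so the result is \<open>C\<close> itself up to renaming \<open>a\<close> to \<open>(a, 0)\<close>.
  The norm is that of left multiplication on \<open>C\<close>, which equals \<open>nrm C a\<close> at \<open>(a, 0)\<close>.\<close>

definition min_unitization :: "('a, 'm) cstar_scheme \<Rightarrow> ('a \<times> complex) cstar" where
  "min_unitization C =
    \<lparr>carrier = (if \<exists>e. is_unit C e then carrier C \<times> {0} else carrier C \<times> UNIV),
     monoid.mult = (\<lambda>(a, k) (b, l). ((a \<otimes>\<^bsub>C\<^esub> b) \<oplus>\<^bsub>C\<^esub> (l \<odot>\<^bsub>C\<^esub> a) \<oplus>\<^bsub>C\<^esub> (k \<odot>\<^bsub>C\<^esub> b), k * l)),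
     one = (if \<exists>e. is_unit C e then (THE e. is_unit C e, 0) else (\<zero>\<^bsub>C\<^esub>, 1)),
     zero = (\<zero>\<^bsub>C\<^esub>, 0),
     add = (\<lambda>(a, k) (b, l). (a \<oplus>\<^bsub>C\<^esub> b, k + l)),
     smult = (\<lambda>c (a, k). (c \<odot>\<^bsub>C\<^esub> a, c * k)),
     adj = (\<lambda>(a, k). (adj C a, cnj k)),
     nrm = (\<lambda>(a, k). SUP b\<in>{b\<in>carrier C. nrm C b \<le> 1}. nrm C ((a \<otimes>\<^bsub>C\<^esub> b) \<oplus>\<^bsub>C\<^esub> (k \<odot>\<^bsub>C\<^esub> b)))\<rparr>"

definition unitization_incl :: "'a \<Rightarrow> 'a \<times> complex" where
  "unitization_incl a = (a, 0)"

section \<open>Universal C*-algebras given by generators and relations\<close>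

text \<open>Words in the generators and their formal adjoints; the letter \<open>(g, True)\<close> is the adjoint
  of \<open>g\<close>.  The monoid of words is written additively, so that \<open>star_poly\<close> with its convolution
  product is the free unital *-algebra on the generators.\<close>

datatype 'g star_word = Word (letters: "('g \<times> bool) list")

instantiation star_word :: (type) monoid_add
begin
definition "0 = Word []"
definition "v + w = Word (letters v @ letters w)"
instance
  by standard (simp_all add: zero_star_word_def plus_star_word_def)
end

type_synonym 'g star_poly = "'g star_word \<Rightarrow>\<^sub>0 complex"

definition gen :: "'g \<Rightarrow> 'g star_poly" where
  "gen g = Poly_Mapping.single (Word [(g, False)]) 1"

definition scale :: "complex \<Rightarrow> 'g star_poly \<Rightarrow> 'g star_poly" where
  "scale c x = Poly_Mapping.single 0 c * x"

definition adj_word :: "'g star_word \<Rightarrow> 'g star_word" where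
  "adj_word w = Word (rev (map (\<lambda>(g, b). (g, \<not> b)) (letters w)))"

definition star :: "'g star_poly \<Rightarrow> 'g star_poly" where
  "star x = (\<Sum>w\<in>Poly_Mapping.keys x.
     Poly_Mapping.single (adj_word w) (cnj (Poly_Mapping.lookup x w)))"

text \<open>The non-unital free *-algebra on \<open>G\<close>: no constant terms.\<close>

definition free_star_algebra :: "'g set \<Rightarrow> 'g star_poly set" where
  "free_star_algebra G =
     {x. \<forall>w\<in>Poly_Mapping.keys x. w \<noteq> 0 \<and> fst ` set (letters w) \<subseteq> G}"

definition cstar_seminorm :: "'g set \<Rightarrow> ('g star_poly \<Rightarrow> real) \<Rightarrow> bool" where
  "cstar_seminorm G N \<longleftrightarrow>
     (\<forall>x\<in>free_star_algebra G. 0 \<le> N x \<and> (\<forall>c. N (scale c x) = cmod c * N x) \<and>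
        N (star x * x) = (N x)\<^sup>2) \<and>
     (\<forall>x\<in>free_star_algebra G. \<forall>y\<in>free_star_algebra G.
        N (x + y) \<le> N x + N y \<and> N (x * y) \<le> N x * N y)"

text \<open>The universal C*-algebra on generators \<open>G\<close> subject to the relations \<open>r = 0\<close>, \<open>r \<in> R\<close>, is the
  Hausdorff completion of the free *-algebra in the largest C*-seminorm vanishing on \<open>R\<close>.
  The C*-seminorms vanishing on \<open>R\<close> are exactly the functions \<open>x \<mapsto> \<parallel>\<pi>(x)\<parallel>\<close> for families of
  elements of C*-algebras that satisfy the relations.  The supremum is taken in the reals, so
  \<open>R\<close> has to bound the norms of the generators.\<close>

definition universal_norm :: "'g set \<Rightarrow> 'g star_poly set \<Rightarrow> 'g star_poly \<Rightarrow> real" where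
  "universal_norm G R x = (SUP N\<in>{N. cstar_seminorm G N \<and> (\<forall>r\<in>R. N r = 0)}. N x)"

definition cauchy_seqs :: "'g set \<Rightarrow> 'g star_poly set \<Rightarrow> (nat \<Rightarrow> 'g star_poly) set" where
  "cauchy_seqs G R = {x. (\<forall>n. x n \<in> free_star_algebra G) \<and>
     (\<forall>e>0. \<exists>M. \<forall>m\<ge>M. \<forall>n\<ge>M. universal_norm G R (x m - x n) < e)}"

definition seq_class ::
    "'g set \<Rightarrow> 'g star_poly set \<Rightarrow> (nat \<Rightarrow> 'g star_poly) \<Rightarrow> (nat \<Rightarrow> 'g star_poly) set" where
  "seq_class G R x =
     {y \<in> cauchy_seqs G R. (\<lambda>n. universal_norm G R (x n - y n)) \<longlonglongrightarrow> 0}"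

definition seq_rep :: "(nat \<Rightarrow> 'g star_poly) set \<Rightarrow> nat \<Rightarrow> 'g star_poly" where
  "seq_rep X = (SOME x. x \<in> X)"

definition universal_cstar ::
    "'g set \<Rightarrow> 'g star_poly set \<Rightarrow> (nat \<Rightarrow> 'g star_poly) set cstar" where
  "universal_cstar G R =
    \<lparr>carrier = seq_class G R ` cauchy_seqs G R,
     monoid.mult = (\<lambda>X Y. seq_class G R (\<lambda>n. seq_rep X n * seq_rep Y n)),
     one = undefined,
     zero = seq_class G R (\<lambda>n. 0),
     add = (\<lambda>X Y. seq_class G R (\<lambda>n. seq_rep X n + seq_rep Y n)),
     smult = (\<lambda>c X. seq_class G R (\<lambda>n. scale c (seq_rep X n))),
     adj = (\<lambda>X. seq_class G R (\<lambda>n. star (seq_rep X n))),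
     nrm = (\<lambda>X. lim (\<lambda>n. universal_norm G R (seq_rep X n)))\<rparr>"

definition universal_map ::
    "'g set \<Rightarrow> 'g star_poly set \<Rightarrow> 'g star_poly \<Rightarrow> (nat \<Rightarrow> 'g star_poly) set" where
  "universal_map G R x = seq_class G R (\<lambda>n. x)"

section \<open>The C*-algebra and the inverse semigroup of a Boolean dynamical system\<close>

datatype ('b, 'l) bds_gen = P 'b | S 'l

abbreviation gen_p :: "'b \<Rightarrow> ('b, 'l) bds_gen star_poly" where
  "gen_p A \<equiv> gen (P A)"

abbreviation gen_s :: "'l \<Rightarrow> ('b, 'l) bds_gen star_poly" where
  "gen_s a \<equiv> gen (S a)"

definition bds_gens :: "'l set \<Rightarrow> ('b, 'l) bds_gen set" where
  "bds_gens L = range P \<union> S ` L"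

inductive_set bds_rels ::
    "'l set \<Rightarrow> ('l \<Rightarrow> 'b::generalized_boolean_algebra \<Rightarrow> 'b) \<Rightarrow> ('b, 'l) bds_gen star_poly set"
  for L :: "'l set" and \<theta> :: "'l \<Rightarrow> 'b \<Rightarrow> 'b" where
  p_selfadjoint: "star (gen_p A) - gen_p A \<in> bds_rels L \<theta>"
| p_idempotent: "gen_p A * gen_p A - gen_p A \<in> bds_rels L \<theta>"
| s_partial_isometry: "a \<in> L \<Longrightarrow> gen_s a * star (gen_s a) * gen_s a - gen_s a \<in> bds_rels L \<theta>"
| p_inf: "gen_p A * gen_p B - gen_p (inf A B) \<in> bds_rels L \<theta>"
| p_sup: "gen_p (sup A B) - (gen_p A + gen_p B - gen_p (inf A B)) \<in> bds_rels L \<theta>"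
| p_bot: "gen_p bot \<in> bds_rels L \<theta>"
| p_s: "a \<in> L \<Longrightarrow> gen_p A * gen_s a - gen_s a * gen_p (\<theta> a A) \<in> bds_rels L \<theta>"
| s_s_same: "a \<in> L \<Longrightarrow> star (gen_s a) * gen_s a - gen_p (range_lub (\<theta> a)) \<in> bds_rels L \<theta>"
| s_s_diff: "a \<in> L \<Longrightarrow> b \<in> L \<Longrightarrow> a \<noteq> b \<Longrightarrow> star (gen_s a) * gen_s b \<in> bds_rels L \<theta>"
| p_reg: "A \<in> B_reg L \<theta> \<Longrightarrow>
    gen_p A - (\<Sum>a\<in>Delta L \<theta> A. gen_s a * gen_p (\<theta> a A) * star (gen_s a)) \<in> bds_rels L \<theta>"

definition bds_cstar ::
    "'l set \<Rightarrow> ('l \<Rightarrow> 'b::generalized_boolean_algebra \<Rightarrow> 'b) \<Rightarrow>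
     (nat \<Rightarrow> ('b, 'l) bds_gen star_poly) set cstar" where
  "bds_cstar L \<theta> = universal_cstar (bds_gens L) (bds_rels L \<theta>)"

definition bds_map ::
    "'l set \<Rightarrow> ('l \<Rightarrow> 'b::generalized_boolean_algebra \<Rightarrow> 'b) \<Rightarrow>
     ('b, 'l) bds_gen star_poly \<Rightarrow> (nat \<Rightarrow> ('b, 'l) bds_gen star_poly) set" where
  "bds_map L \<theta> = universal_map (bds_gens L) (bds_rels L \<theta>)"

text \<open>The empty product is the unit of the free unital *-algebra: the formal unit
  attached to the empty word.\<close>

definition s_word :: "'l list \<Rightarrow> ('b, 'l) bds_gen star_poly" where
  "s_word w = prod_list (map gen_s w)"

text \<open>Ranges of words; \<open>None\<close> is the formal top element, the range of the empty word.\<close>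

definition word_range ::
    "('l \<Rightarrow> 'b::generalized_boolean_algebra \<Rightarrow> 'b) \<Rightarrow> 'l list \<Rightarrow> 'b option" where
  "word_range \<theta> w = (if w = [] then None else Some (range_lub (fold \<theta> w)))"

fun top_inf :: "'b::generalized_boolean_algebra option \<Rightarrow> 'b option \<Rightarrow> 'b option" where
  "top_inf None Y = Y"
| "top_inf X None = X"
| "top_inf (Some A) (Some B) = Some (inf A B)"

fun below_top :: "'b::generalized_boolean_algebra \<Rightarrow> 'b option \<Rightarrow> bool" where
  "below_top A None \<longleftrightarrow> True"
| "below_top A (Some B) \<longleftrightarrow> A \<le> B"

definition bds_semigroup ::
    "'l set \<Rightarrow> ('l \<Rightarrow> 'b::generalized_boolean_algebra \<Rightarrow> 'b) \<Rightarrow>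
     (nat \<Rightarrow> ('b, 'l) bds_gen star_poly) set set" where
  "bds_semigroup L \<theta> =
     {bds_map L \<theta> (s_word v * gen_p A * star (s_word w)) | v w A.
        set v \<subseteq> L \<and> set w \<subseteq> L \<and>
        below_top A (top_inf (word_range \<theta> v) (word_range \<theta> w)) \<and>
        top_inf (word_range \<theta> v) (word_range \<theta> w) \<noteq> Some bot}
     \<union> {\<zero>\<^bsub>bds_cstar L \<theta>\<^esub>}"

section \<open>Tight representations\<close>

text \<open>Below, \<open>T\<close> is a *-semigroup with zero inside the algebra \<open>C\<close>, with the operations of \<open>C\<close>.\<close>

definition idempotents :: "('c, 'm) cstar_scheme \<Rightarrow> 'c set \<Rightarrow> 'c set" where
  "idempotents C T = {e\<in>T. e \<otimes>\<^bsub>C\<^esub> e = e}"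

definition idempotents_between ::
    "('c, 'm) cstar_scheme \<Rightarrow> 'c set \<Rightarrow> 'c set \<Rightarrow> 'c set \<Rightarrow> 'c set" where
  "idempotents_between C T X Y =
     {z\<in>idempotents C T. (\<forall>x\<in>X. z \<otimes>\<^bsub>C\<^esub> x = z) \<and> (\<forall>y\<in>Y. z \<otimes>\<^bsub>C\<^esub> y = \<zero>\<^bsub>C\<^esub>)}"

definition is_cover :: "('c, 'm) cstar_scheme \<Rightarrow> 'c set \<Rightarrow> 'c set \<Rightarrow> bool" where
  "is_cover C F Z \<longleftrightarrow>
     Z \<subseteq> F \<and> (\<forall>x\<in>F. x \<noteq> \<zero>\<^bsub>C\<^esub> \<longrightarrow> (\<exists>z\<in>Z. z \<otimes>\<^bsub>C\<^esub> x \<noteq> \<zero>\<^bsub>C\<^esub>))"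

definition is_projection :: "('a, 'm) cstar_scheme \<Rightarrow> 'a \<Rightarrow> bool" where
  "is_projection A p \<longleftrightarrow> p \<in> carrier A \<and> p \<otimes>\<^bsub>A\<^esub> p = p \<and> adj A p = p"

text \<open>The order of the lattice of commuting projections; on projections it agrees with the order
  of selfadjoint elements.\<close>

definition proj_le :: "('a, 'm) cstar_scheme \<Rightarrow> 'a \<Rightarrow> 'a \<Rightarrow> bool" where
  "proj_le A p q \<longleftrightarrow> p \<otimes>\<^bsub>A\<^esub> q = p"

definition proj_sup :: "('a, 'm) cstar_scheme \<Rightarrow> 'a set \<Rightarrow> 'a" where
  "proj_sup A Q = (THE u. is_projection A u \<and> (\<forall>p\<in>Q. proj_le A p u) \<and>
     (\<forall>v. is_projection A v \<and> (\<forall>p\<in>Q. proj_le A p v) \<longrightarrow> proj_le A u v))"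

definition representation ::
    "('c, 'm) cstar_scheme \<Rightarrow> 'c set \<Rightarrow> ('a, 'n) cstar_scheme \<Rightarrow> ('c \<Rightarrow> 'a) \<Rightarrow> bool" where
  "representation C T A \<rho> \<longleftrightarrow> unital_cstar_algebra A \<and> \<rho> \<in> T \<rightarrow> carrier A \<and>
     \<rho> \<zero>\<^bsub>C\<^esub> = \<zero>\<^bsub>A\<^esub> \<and>
     (\<forall>s\<in>T. \<forall>t\<in>T. \<rho> (s \<otimes>\<^bsub>C\<^esub> t) = \<rho> s \<otimes>\<^bsub>A\<^esub> \<rho> t) \<and>
     (\<forall>s\<in>T. \<rho> (adj C s) = adj A (\<rho> s))"

text \<open>The finite sets \<open>X\<close>, \<open>Y\<close> are enumerated by lists because the product is taken in a
  noncommutative algebra; its factors commute.\<close>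

definition tight_representation ::
    "('c, 'm) cstar_scheme \<Rightarrow> 'c set \<Rightarrow> ('a, 'n) cstar_scheme \<Rightarrow> ('c \<Rightarrow> 'a) \<Rightarrow> bool" where
  "tight_representation C T A \<rho> \<longleftrightarrow> representation C T A \<rho> \<and>
     (\<forall>xs ys Z. set xs \<subseteq> idempotents C T \<and> set ys \<subseteq> idempotents C T \<and> finite Z \<and>
        is_cover C (idempotents_between C T (set xs) (set ys)) Z \<longrightarrow>
        proj_le A
          (foldr (monoid.mult A) (map \<rho> xs @ map (\<lambda>y. \<one>\<^bsub>A\<^esub> \<ominus>\<^bsub>A\<^esub> \<rho> y) ys) \<one>\<^bsub>A\<^esub>)
          (proj_sup A (\<rho> ` Z)))"

end

(*
Tightness of the inclusion. Every idempotent of T is a projection s_w p_B s_w^*. If z_1, ..., z_n cover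
the idempotents below x and orthogonal to y_1, ..., y_m, no nonzero idempotent lies below
q = x (1 - y_1) ... (1 - y_m) (1 - z_1) ... (1 - z_n). Conjugating by words reduces q to
p_A (1 - e_1) ... (1 - e_k), and an induction on the length of the words in the e_i, which uses
relation (4) when A is regular and finds an idempotent below q otherwise, gives q = 0. This requires
p_A to be nonzero for nonempty A, which is seen on the l2-space of the boundary paths of the system.

Universality. Tightness of rho, applied to the covers {p_A, p_B} of p_(A u B) and
{s_a p_(theta_a A) s_a^* : a in Delta_A} of p_A, gives relations (1) and (4) for the images of the
generators, hence a homomorphism on the universal algebra. If that algebra has a unit, finitely many
idempotents cover all of T, so that tightness forces the homomorphism to be unital. Uniqueness
follows from density and the automatic contractivity of unital *-homomorphisms.
*)

theory Submission
  imports Defs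
begin

section \<open>C*-algebras\<close>

text \<open>The universal algebra may lack a unit, so the factors 1 - e exist only in the
  unitization. The word calculus is therefore carried out with operators on the algebra, such as x
  |-> x - e x, and an element of the unitization is recognised by how it multiplies the algebra from
  the left; by density it suffices to test products e b with e an idempotent.

  Why a non-regular A yields an idempotent: some nonempty E below A emits either no letter, and then
  p_E annihilates every e_i with a nonempty word, or infinitely many, and then some letter a starts
  none of the finitely many words, so that s_a p_(theta_a E) s_a^* is orthogonal to all of them.

  Since the universal norm is a supremum of seminorms, p_A is nonzero as soon as one seminorm sees
  it; operators on finitely supported functions provide one, without completing to a Hilbert space.
  A boundary path is a sequence of prime filters with labels. The rule that it may stop only at a
  filter free of regular sets is what makes relation (4) hold, and finiteness of Delta is what lets
  it continue elsewhere.\<close>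

lemma carrier_complex_ring [simp]: "carrier complex_ring = UNIV"
  by (simp add: complex_ring_def)

lemma cring_complex_ring: "cring complex_ring"
  unfolding complex_ring_def
  by (intro cringI abelian_groupI comm_monoidI)
    (auto simp: algebra_simps intro: exI[of _ "- x" for x])

lemma a_inv_complex_ring: "\<ominus>\<^bsub>complex_ring\<^esub> c = - c"
proof -
  interpret cring complex_ring by (rule cring_complex_ring)
  show ?thesis by (rule minus_equality) (simp_all add: complex_ring_def)
qed

context cstar_algebra
begin

lemma smult_plus: "x \<in> carrier A \<Longrightarrow> (b + c) \<odot> x = b \<odot> x \<oplus> c \<odot> x"
  using smult_l_distr[of b c x] by (simp add: complex_ring_def)

lemma smult_add: "x \<in> carrier A \<Longrightarrow> y \<in> carrier A \<Longrightarrow> c \<odot> (x \<oplus> y) = c \<odot> x \<oplus> c \<odot> y"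
  using smult_r_distr[of c x y] by simp

lemma smult_times: "x \<in> carrier A \<Longrightarrow> (b * c) \<odot> x = b \<odot> (c \<odot> x)"
  using smult_assoc1[of b c x] by (simp add: complex_ring_def)

lemma smult_1 [simp]: "x \<in> carrier A \<Longrightarrow> 1 \<odot> x = x"
  using smult_one[of x] by (simp add: complex_ring_def)

lemma smult_0 [simp]: "x \<in> carrier A \<Longrightarrow> 0 \<odot> x = \<zero>"
  using smult_l_null[of x] by (simp add: complex_ring_def)

lemma smult_zero [simp]: "c \<odot> \<zero> = \<zero>"
  using smult_r_null[of c] by simp

lemma smult_uminus: "x \<in> carrier A \<Longrightarrow> (- c) \<odot> x = \<ominus> (c \<odot> x)"
  using smult_l_minus[of c x] by (simp add: a_inv_complex_ring)

lemma a_inv_eq_smult: "x \<in> carrier A \<Longrightarrow> \<ominus> x = (-1) \<odot> x"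
  by (simp add: smult_uminus)

lemma smult_a_inv: "x \<in> carrier A \<Longrightarrow> c \<odot> (\<ominus> x) = \<ominus> (c \<odot> x)"
  using smult_r_minus[of c x] by simp

lemma smult_minus: "x \<in> carrier A \<Longrightarrow> y \<in> carrier A \<Longrightarrow> c \<odot> (x \<ominus> y) = c \<odot> x \<ominus> c \<odot> y"
  by (simp add: M.minus_eq smult_add smult_a_inv)

lemmas cstar_closed [simp, intro] = mult_closed adj_closed

lemma minus_self [simp]: "x \<in> carrier A \<Longrightarrow> x \<ominus> x = \<zero>"
  by (simp add: M.minus_eq M.r_neg)

lemma minus_zero' [simp]: "x \<in> carrier A \<Longrightarrow> x \<ominus> \<zero> = x"
  by (simp add: M.minus_eq)

lemma zero_minus: "x \<in> carrier A \<Longrightarrow> \<zero> \<ominus> x = \<ominus> x"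
  by (simp add: M.minus_eq)

lemma minus_eq_zero_iff: "x \<in> carrier A \<Longrightarrow> y \<in> carrier A \<Longrightarrow> x \<ominus> y = \<zero> \<longleftrightarrow> x = y"
  by (metis M.add.inv_closed M.minus_eq M.minus_equality M.minus_minus M.r_neg M.a_comm)

text \<open>Without a unit the algebra is not an instance of \<open>ring\<close>, so annihilation
  comes from bilinearity: zero is its own multiple by the scalar 0, and the scalar moves out of the
  product.\<close>

lemma mult_zero [simp]: "x \<in> carrier A \<Longrightarrow> x \<otimes> \<zero> = \<zero>"
  by (metis M.zero_closed smult_0 smult_mult_right smult_zero mult_closed)

lemma zero_mult [simp]: "x \<in> carrier A \<Longrightarrow> \<zero> \<otimes> x = \<zero>"
  by (metis M.zero_closed smult_0 smult_mult_left mult_closed)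

lemma mult_a_inv: "x \<in> carrier A \<Longrightarrow> y \<in> carrier A \<Longrightarrow> x \<otimes> (\<ominus> y) = \<ominus> (x \<otimes> y)"
  by (simp add: a_inv_eq_smult smult_mult_right)

lemma a_inv_mult: "x \<in> carrier A \<Longrightarrow> y \<in> carrier A \<Longrightarrow> (\<ominus> x) \<otimes> y = \<ominus> (x \<otimes> y)"
  by (simp add: a_inv_eq_smult smult_mult_left)

lemma mult_minus: "x \<in> carrier A \<Longrightarrow> y \<in> carrier A \<Longrightarrow> z \<in> carrier A \<Longrightarrow> z \<otimes> (x \<ominus> y) = z \<otimes> x \<ominus> z \<otimes> y"
  by (simp add: M.minus_eq distr_right mult_a_inv)

lemma minus_mult: "x \<in> carrier A \<Longrightarrow> y \<in> carrier A \<Longrightarrow> z \<in> carrier A \<Longrightarrow> (x \<ominus> y) \<otimes> z = x \<otimes> z \<ominus> y \<otimes> z"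
  by (simp add: M.minus_eq distr_left a_inv_mult)

lemma adj_zero [simp]: "adj A \<zero> = \<zero>"
  by (metis M.zero_closed adj_smult complex_cnj_zero smult_0 adj_closed)

lemma adj_a_inv: "x \<in> carrier A \<Longrightarrow> adj A (\<ominus> x) = \<ominus> (adj A x)"
  by (simp add: a_inv_eq_smult adj_smult)

lemma adj_minus: "x \<in> carrier A \<Longrightarrow> y \<in> carrier A \<Longrightarrow> adj A (x \<ominus> y) = adj A x \<ominus> adj A y"
  by (simp add: M.minus_eq adj_add adj_a_inv)

lemma mult_finsum: "x \<in> carrier A \<Longrightarrow> (\<And>i. i \<in> I \<Longrightarrow> f i \<in> carrier A) \<Longrightarrow>
    x \<otimes> finsum A f I = finsum A (\<lambda>i. x \<otimes> f i) I"
proof (induction I rule: infinite_finite_induct)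
  case (insert i I)
  then show ?case by (simp add: M.finsum_insert distr_right M.finsum_closed Pi_def)
qed simp_all

lemma finsum_mult: "x \<in> carrier A \<Longrightarrow> (\<And>i. i \<in> I \<Longrightarrow> f i \<in> carrier A) \<Longrightarrow>
    finsum A f I \<otimes> x = finsum A (\<lambda>i. f i \<otimes> x) I"
proof (induction I rule: infinite_finite_induct)
  case (insert i I)
  then show ?case by (simp add: M.finsum_insert distr_left M.finsum_closed Pi_def)
qed simp_all

lemma finsum_0_neutral: "(\<And>i. i \<in> I \<Longrightarrow> f i = \<zero>) \<Longrightarrow> finsum A f I = \<zero>"
  by (rule M.add.finprod_one_eqI) simp

lemma nrm_zero [simp]: "nrm A \<zero> = 0"
  using nrm_eq_0 by blast

lemma nrm_a_inv: "x \<in> carrier A \<Longrightarrow> nrm A (\<ominus> x) = nrm A x"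
  by (simp add: a_inv_eq_smult nrm_smult)

lemma nrm_minus_commute: "x \<in> carrier A \<Longrightarrow> y \<in> carrier A \<Longrightarrow> nrm A (x \<ominus> y) = nrm A (y \<ominus> x)"
  using nrm_a_inv[of "x \<ominus> y"] by (simp add: M.minus_eq M.minus_add M.a_comm)

lemma minus_add_minus: "x \<in> carrier A \<Longrightarrow> y \<in> carrier A \<Longrightarrow> z \<in> carrier A \<Longrightarrow>
    (x \<ominus> y) \<oplus> (y \<ominus> z) = x \<ominus> z"
  by (simp add: M.minus_eq M.a_assoc M.r_neg1)

lemma nrm_triangle_ineq4: "x \<in> carrier A \<Longrightarrow> y \<in> carrier A \<Longrightarrow> z \<in> carrier A \<Longrightarrow>
    nrm A (x \<ominus> z) \<le> nrm A (x \<ominus> y) + nrm A (y \<ominus> z)"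
  using nrm_triangle[of "x \<ominus> y" "y \<ominus> z"] by (simp add: minus_add_minus)

lemma nrm_diff_le: "x \<in> carrier A \<Longrightarrow> y \<in> carrier A \<Longrightarrow> \<bar>nrm A x - nrm A y\<bar> \<le> nrm A (x \<ominus> y)"
  using nrm_triangle_ineq4[of x y \<zero>] nrm_triangle_ineq4[of y x \<zero>] nrm_minus_commute[of x y]
  by simp

text \<open>The C*-identity and submultiplicativity bound the squared norm of y by the norm of its
  adjoint times that of y. Cancelling, for x and for its adjoint, gives both inequalities.\<close>

lemma nrm_adj: assumes x: "x \<in> carrier A" shows "nrm A (adj A x) = nrm A x"
proof -
  have le: "nrm A y \<le> nrm A (adj A y)" if y: "y \<in> carrier A" for y
  proof (cases "nrm A y = 0")
    case False
    have "nrm A y * nrm A y \<le> nrm A (adj A y) * nrm A y"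
      using cstar_identity[OF y] nrm_mult[of "adj A y" y] y by (simp add: power2_eq_square)
    then show ?thesis using False nrm_nonneg[OF y] by simp
  qed (use y in \<open>simp add: nrm_nonneg\<close>)
  show ?thesis using le[OF x] le[of "adj A x"] x by (simp add: adj_adj)
qed

text \<open>The carrier is a subset of a type without topology, so limits are stated through the
  real sequence of distances. Closedness is included so that convergence facts chain without side
  conditions.\<close>

definition conv :: "(nat \<Rightarrow> 'a) \<Rightarrow> 'a \<Rightarrow> bool" where
  "conv X x \<longleftrightarrow> (\<forall>n. X n \<in> carrier A) \<and> x \<in> carrier A \<and> (\<lambda>n. nrm A (X n \<ominus> x)) \<longlonglongrightarrow> 0"

lemma convI:
  assumes "\<And>n. X n \<in> carrier A" "x \<in> carrier A" "B \<longlonglongrightarrow> 0" "\<And>n. nrm A (X n \<ominus> x) \<le> B n"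
  shows "conv X x"
proof -
  have "(\<lambda>n. nrm A (X n \<ominus> x)) \<longlonglongrightarrow> 0"
    by (rule Lim_null_comparison[OF always_eventually assms(3)])
      (use assms in \<open>simp add: nrm_nonneg\<close>)
  then show ?thesis using assms by (simp add: conv_def)
qed

lemma conv_unique: assumes "conv X x" "conv X y" shows "x = y"
proof -
  have c: "x \<in> carrier A" "y \<in> carrier A" "\<And>n. X n \<in> carrier A"
    using assms by (auto simp: conv_def)
  have "(\<lambda>n. nrm A (X n \<ominus> x) + nrm A (X n \<ominus> y)) \<longlonglongrightarrow> 0 + 0"
    using assms unfolding conv_def by (intro tendsto_add) auto
  moreover have "nrm A (x \<ominus> y) \<le> nrm A (X n \<ominus> x) + nrm A (X n \<ominus> y)" for n
    using nrm_triangle_ineq4[of x "X n" y] nrm_minus_commute[of x "X n"] c by simp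
  ultimately have "nrm A (x \<ominus> y) \<le> 0"
    by (intro LIMSEQ_le_const[of _ 0]) auto
  then show ?thesis
    using c nrm_nonneg[of "x \<ominus> y"] nrm_eq_0[of "x \<ominus> y"] minus_eq_zero_iff by auto
qed

lemma conv_const: "x \<in> carrier A \<Longrightarrow> conv (\<lambda>_. x) x"
  by (simp add: conv_def)

lemma conv_add: assumes "conv X x" "conv Y y" shows "conv (\<lambda>n. X n \<oplus> Y n) (x \<oplus> y)"
proof (rule convI)
  have c: "x \<in> carrier A" "y \<in> carrier A" "\<And>n. X n \<in> carrier A" "\<And>n. Y n \<in> carrier A"
    using assms by (auto simp: conv_def)
  then show "X n \<oplus> Y n \<in> carrier A" "x \<oplus> y \<in> carrier A" for n by auto
  show "(\<lambda>n. nrm A (X n \<ominus> x) + nrm A (Y n \<ominus> y)) \<longlonglongrightarrow> 0"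
    using tendsto_add[of "\<lambda>n. nrm A (X n \<ominus> x)" 0 _ "\<lambda>n. nrm A (Y n \<ominus> y)" 0] assms
    unfolding conv_def by simp
  show "nrm A (X n \<oplus> Y n \<ominus> (x \<oplus> y)) \<le> nrm A (X n \<ominus> x) + nrm A (Y n \<ominus> y)" for n
  proof -
    have "X n \<oplus> Y n \<ominus> (x \<oplus> y) = (X n \<ominus> x) \<oplus> (Y n \<ominus> y)"
      using c by (simp add: M.minus_eq M.minus_add M.a_ac)
    then show ?thesis using nrm_triangle[of "X n \<ominus> x" "Y n \<ominus> y"] c by simp
  qed
qed

lemma conv_smult: assumes "conv X x" shows "conv (\<lambda>n. c \<odot> X n) (c \<odot> x)"
proof (rule convI)
  have c: "x \<in> carrier A" "\<And>n. X n \<in> carrier A"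
    using assms by (auto simp: conv_def)
  then show "c \<odot> X n \<in> carrier A" "c \<odot> x \<in> carrier A" for n by auto
  show "(\<lambda>n. cmod c * nrm A (X n \<ominus> x)) \<longlonglongrightarrow> 0"
    using assms unfolding conv_def by (intro tendsto_mult_right_zero) blast
  show "nrm A (c \<odot> X n \<ominus> c \<odot> x) \<le> cmod c * nrm A (X n \<ominus> x)" for n
    using c by (simp add: smult_minus[symmetric] nrm_smult)
qed

lemma conv_adj: assumes "conv X x" shows "conv (\<lambda>n. adj A (X n)) (adj A x)"
proof (rule convI)
  have c: "x \<in> carrier A" "\<And>n. X n \<in> carrier A"
    using assms by (auto simp: conv_def)
  then show "adj A (X n) \<in> carrier A" "adj A x \<in> carrier A" for n by auto
  show "(\<lambda>n. nrm A (X n \<ominus> x)) \<longlonglongrightarrow> 0"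
    using assms unfolding conv_def by blast
  show "nrm A (adj A (X n) \<ominus> adj A x) \<le> nrm A (X n \<ominus> x)" for n
    using c by (simp add: adj_minus[symmetric] nrm_adj)
qed

lemma conv_nrm: assumes "conv X x" shows "(\<lambda>n. nrm A (X n)) \<longlonglongrightarrow> nrm A x"
proof -
  have c: "x \<in> carrier A" "\<And>n. X n \<in> carrier A"
    using assms by (auto simp: conv_def)
  have "(\<lambda>n. nrm A (X n) - nrm A x) \<longlonglongrightarrow> 0"
    by (rule Lim_null_comparison[of _ "\<lambda>n. nrm A (X n \<ominus> x)"])
      (use assms c nrm_diff_le in \<open>auto simp: conv_def\<close>)
  then show ?thesis by (simp add: LIM_zero_iff)
qed

lemma conv_mult: assumes "conv X x" "conv Y y" shows "conv (\<lambda>n. X n \<otimes> Y n) (x \<otimes> y)"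
proof (rule convI)
  have c: "x \<in> carrier A" "y \<in> carrier A" "\<And>n. X n \<in> carrier A" "\<And>n. Y n \<in> carrier A"
    using assms by (auto simp: conv_def)
  then show "X n \<otimes> Y n \<in> carrier A" "x \<otimes> y \<in> carrier A" for n by auto
  have "(\<lambda>n. nrm A (X n) * nrm A (Y n \<ominus> y) + nrm A (X n \<ominus> x) * nrm A y) \<longlonglongrightarrow> nrm A x * 0 + 0 * nrm A y"
    by (intro tendsto_intros conv_nrm assms) (use assms in \<open>auto simp: conv_def\<close>)
  then show "(\<lambda>n. nrm A (X n) * nrm A (Y n \<ominus> y) + nrm A (X n \<ominus> x) * nrm A y) \<longlonglongrightarrow> 0" by simp
  show "nrm A (X n \<otimes> Y n \<ominus> x \<otimes> y) \<le> nrm A (X n) * nrm A (Y n \<ominus> y) + nrm A (X n \<ominus> x) * nrm A y" for n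
  proof -
    have "X n \<otimes> Y n \<ominus> x \<otimes> y = X n \<otimes> (Y n \<ominus> y) \<oplus> (X n \<ominus> x) \<otimes> y"
      using c by (simp add: mult_minus minus_mult minus_add_minus)
    moreover have "nrm A (X n \<otimes> (Y n \<ominus> y) \<oplus> (X n \<ominus> x) \<otimes> y)
        \<le> nrm A (X n \<otimes> (Y n \<ominus> y)) + nrm A ((X n \<ominus> x) \<otimes> y)"
      using c by (intro nrm_triangle) auto
    moreover have "nrm A (X n \<otimes> (Y n \<ominus> y)) \<le> nrm A (X n) * nrm A (Y n \<ominus> y)"
      using c by (intro nrm_mult) auto
    moreover have "nrm A ((X n \<ominus> x) \<otimes> y) \<le> nrm A (X n \<ominus> x) * nrm A y"
      using c by (intro nrm_mult) auto
    ultimately show ?thesis by simp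
  qed
qed

lemma Cauchy_conv:
  assumes "\<And>n. X n \<in> carrier A" "\<And>e. e > 0 \<Longrightarrow> \<exists>M. \<forall>m\<ge>M. \<forall>n\<ge>M. nrm A (X m \<ominus> X n) < e"
  shows "\<exists>x. conv X x"
proof -
  obtain x where "x \<in> carrier A" "(\<lambda>n. nrm A (X n \<ominus> x)) \<longlonglongrightarrow> 0"
    using complete[OF assms] by blast
  then show ?thesis using assms(1) unfolding conv_def by blast
qed

end

section \<open>Contractivity of unital *-homomorphisms\<close>

lemma (in cstar_algebra) geometric_conv:
  assumes X: "\<And>n. X n \<in> carrier A" and s: "0 \<le> s" "s < 1"
    and step: "\<And>n. nrm A (X (Suc n) \<ominus> X n) \<le> s ^ n"
  obtains x where "conv X x"
proof -
  \<comment> \<open>\<open>n\<close> is generalised: the induction on \<open>k\<close> splits off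
    the first step and treats the rest as \<open>k\<close> steps starting at \<open>Suc n\<close>,
    so the closed form of the geometric tail reproduces itself.\<close>
  have bound: "nrm A (X (n + k) \<ominus> X n) \<le> s ^ n / (1 - s)" for n k
  proof (induction k arbitrary: n)
    case 0
    then show ?case using X s by simp
  next
    case (Suc k)
    have "nrm A (X (n + Suc k) \<ominus> X n) \<le> nrm A (X (Suc n + k) \<ominus> X (Suc n)) + nrm A (X (Suc n) \<ominus> X n)"
      using nrm_triangle_ineq4[OF X X X, of "n + Suc k" n "Suc n"] by simp
    also have "\<dots> \<le> s ^ Suc n / (1 - s) + s ^ n"
      by (intro add_mono Suc step)
    also have "\<dots> = s ^ n / (1 - s)"
      using s by (simp add: field_simps)
    finally show ?case .
  qed
  \<comment> \<open>The factor 2 comes from comparing both indices with the same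
    \<open>M\<close>.\<close>
  have lim: "(\<lambda>n. 2 * (s ^ n / (1 - s))) \<longlonglongrightarrow> 0"
    using tendsto_mult_right_zero[OF tendsto_divide_zero[OF LIMSEQ_power_zero[of s]]] s by simp
  have cauchy: "\<exists>M. \<forall>m\<ge>M. \<forall>n\<ge>M. nrm A (X m \<ominus> X n) < e" if e: "e > 0" for e
  proof -
    obtain M where M: "2 * (s ^ M / (1 - s)) < e"
      using order_tendstoD(2)[OF lim e] by (auto simp: eventually_sequentially)
    have "nrm A (X m \<ominus> X n) < e" if "m \<ge> M" "n \<ge> M" for m n
    proof -
      have "nrm A (X m \<ominus> X n) \<le> nrm A (X m \<ominus> X M) + nrm A (X M \<ominus> X n)"
        by (rule nrm_triangle_ineq4) (use X in auto)
      also have "\<dots> = nrm A (X m \<ominus> X M) + nrm A (X n \<ominus> X M)"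
        using nrm_minus_commute[OF X X] by simp
      also have "\<dots> \<le> s ^ M / (1 - s) + s ^ M / (1 - s)"
        using bound[of M "m - M"] bound[of M "n - M"] that by (intro add_mono) simp_all
      finally show ?thesis using M by simp
    qed
    then show ?thesis by blast
  qed
  have "\<exists>x. conv X x"
  proof (rule Cauchy_conv[of X])
    show "\<And>n. X n \<in> carrier A" by (rule X)
    show "\<And>e. 0 < e \<Longrightarrow> \<exists>M. \<forall>m\<ge>M. \<forall>n\<ge>M. nrm A (X m \<ominus> X n) < e" by (rule cauchy)
  qed
  then show thesis using that by blast
qed

context unital_cstar_algebra
begin

lemma is_ring: "ring A"
  by (intro ringI) (auto intro: M.abelian_group_axioms monoid_axioms distr_left distr_right)

lemma adj_one [simp]: "adj A \<one> = \<one>"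
  using adj_mult[of \<one> "adj A \<one>"] by (simp add: adj_adj)

lemma nrm_one_le: "nrm A \<one> \<le> 1"
proof -
  have "nrm A \<one> * nrm A \<one> = nrm A \<one> * 1"
    using cstar_identity[of \<one>] by (simp add: power2_eq_square)
  then show ?thesis by auto
qed

lemma nrm_isometry_le: assumes "u \<in> carrier A" "adj A u \<otimes> u = \<one>" shows "nrm A u \<le> 1"
  using cstar_identity[OF assms(1)] assms nrm_one_le nrm_nonneg[OF assms(1)]
  by (simp add: power_le_one_iff)

text \<open>The fixed point of \<open>c \<mapsto> (y + c\<^sup>2) / 2\<close> is \<open>1 - \<surd>(1 - y)\<close>.\<close>

lemma sqrt_one_minus:
  assumes y: "y \<in> carrier A" and sa: "adj A y = y" and less: "nrm A y < 1"
  obtains b where "b \<in> carrier A" "adj A b = b" "b \<otimes> b = \<one> \<ominus> y"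
    "\<And>z. z \<in> carrier A \<Longrightarrow> z \<otimes> y = y \<otimes> z \<Longrightarrow> z \<otimes> b = b \<otimes> z"
proof -
  interpret ring A by (rule is_ring)
  define s where "s = nrm A y"
  have s: "0 \<le> s" "s < 1" using nrm_nonneg[OF y] less by (auto simp: s_def)
  define c where "c = rec_nat \<zero> (\<lambda>_ c. (1/2) \<odot> (y \<oplus> c \<otimes> c))"
  have c0: "c 0 = \<zero>" and cS: "c (Suc n) = (1/2) \<odot> (y \<oplus> c n \<otimes> c n)" for n
    by (simp_all add: c_def)
  have cc: "c n \<in> carrier A" for n
    by (induction n) (simp_all add: c0 cS y)
  have csa: "adj A (c n) = c n" for n
    by (induction n) (simp_all add: c0 cS y sa cc adj_add adj_smult adj_mult)
  have cn: "nrm A (c n) \<le> s" for n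
  proof (induction n)
    case (Suc n)
    have "nrm A (c (Suc n)) = 1/2 * nrm A (y \<oplus> c n \<otimes> c n)"
      using y cc by (simp add: cS nrm_smult)
    also have "nrm A (y \<oplus> c n \<otimes> c n) \<le> s + nrm A (c n) * nrm A (c n)"
      using nrm_triangle[of y "c n \<otimes> c n"] nrm_mult[of "c n" "c n"] y cc by (simp add: s_def)
    also have "nrm A (c n) * nrm A (c n) \<le> s * 1"
      using Suc s nrm_nonneg[OF cc] by (intro mult_mono) auto
    finally show ?case by simp
  qed (use s in \<open>simp add: c0\<close>)
  have step: "nrm A (c (Suc n) \<ominus> c n) \<le> s ^ n" for n
  proof (induction n)
    case 0
    have "nrm A (c 1 \<ominus> c 0) = s / 2"
      using y by (simp add: c0 cS nrm_smult s_def)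
    then show ?case using s by simp
  next
    case (Suc n)
    let ?d = "c (Suc n) \<ominus> c n"
    \<comment> \<open>Consecutive increments are half a difference of squares, which splits as below
      even if the factors do not commute. All iterates have norm at most \<open>s\<close>, so each
      increment shrinks by the factor \<open>s\<close>.\<close>
    have "c (Suc (Suc n)) \<ominus> c (Suc n) = (1/2) \<odot> (c (Suc n) \<otimes> c (Suc n) \<ominus> c n \<otimes> c n)"
      unfolding cS[of "Suc n"] cS[of n, THEN arg_cong, of "\<lambda>x. _ \<ominus> x"]
      using y cc by (simp add: smult_add smult_a_inv M.minus_eq minus_add a_ac r_neg1 r_neg2 r_neg)
    also have "c (Suc n) \<otimes> c (Suc n) \<ominus> c n \<otimes> c n = c (Suc n) \<otimes> ?d \<oplus> ?d \<otimes> c n"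
      using cc by (simp add: mult_minus minus_mult minus_add_minus)
    finally have eq: "c (Suc (Suc n)) \<ominus> c (Suc n) = (1/2) \<odot> (c (Suc n) \<otimes> ?d \<oplus> ?d \<otimes> c n)" .
    have "nrm A (c (Suc n) \<otimes> ?d \<oplus> ?d \<otimes> c n) \<le> nrm A (c (Suc n) \<otimes> ?d) + nrm A (?d \<otimes> c n)"
      using cc by (intro nrm_triangle) auto
    also have "\<dots> \<le> nrm A (c (Suc n)) * nrm A ?d + nrm A ?d * nrm A (c n)"
      using cc by (intro add_mono nrm_mult) auto
    also have "\<dots> \<le> s * nrm A ?d + nrm A ?d * s"
      using cn cc by (intro add_mono mult_mono) (auto simp: nrm_nonneg s)
    finally have "nrm A (c (Suc (Suc n)) \<ominus> c (Suc n)) \<le> s * nrm A ?d"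
      unfolding eq using cc by (simp add: nrm_smult)
    also have "\<dots> \<le> s * s ^ n" using Suc s by (intro mult_left_mono) auto
    finally show ?case by simp
  qed
  obtain l where l: "conv c l" using geometric_conv[OF cc s step] .
  have lc: "l \<in> carrier A" using l by (simp add: conv_def)
  have lsa: "adj A l = l"
    using conv_adj[OF l] l conv_unique by (simp add: csa)
  \<comment> \<open>The shifted sequence converges both to \<open>l\<close> and to the image of
    \<open>l\<close> under the recursion; this is the fixed point equation.\<close>
  have "conv (\<lambda>n. c (Suc n)) l"
    using l by (auto simp: conv_def intro: LIMSEQ_Suc)
  moreover have "conv (\<lambda>n. c (Suc n)) ((1/2) \<odot> (y \<oplus> l \<otimes> l))"
    unfolding cS by (intro conv_smult conv_add conv_mult conv_const y l)
  ultimately have fixp: "l = (1/2) \<odot> (y \<oplus> l \<otimes> l)" by (rule conv_unique)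
  have "l \<oplus> l = (2::complex) \<odot> l"
    using smult_plus[OF lc, of 1 1] lc by simp
  also have "\<dots> = y \<oplus> l \<otimes> l"
    by (subst fixp) (use y lc in \<open>simp add: smult_times[symmetric]\<close>)
  finally have ll: "l \<oplus> l = y \<oplus> l \<otimes> l" .
  have sq: "(\<one> \<ominus> l) \<otimes> (\<one> \<ominus> l) = \<one> \<ominus> y"
  proof -
    have "(\<one> \<ominus> l) \<otimes> (\<one> \<ominus> l) = \<one> \<oplus> l \<otimes> l \<ominus> (l \<oplus> l)"
      using lc by (simp add: ring_simprules)
    also have "\<dots> = \<one> \<ominus> y" unfolding ll using lc y by (simp add: ring_simprules)
    finally show ?thesis .
  qed
  \<comment> \<open>Whatever commutes with \<open>y\<close> commutes with every iterate and hence
    with the limit.\<close>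
  have comm: "z \<otimes> (\<one> \<ominus> l) = (\<one> \<ominus> l) \<otimes> z" if z: "z \<in> carrier A" "z \<otimes> y = y \<otimes> z" for z
  proof -
    have "z \<otimes> c n = c n \<otimes> z" for n
    proof (induction n)
      case (Suc n)
      have "z \<otimes> (c n \<otimes> c n) = (c n \<otimes> c n) \<otimes> z"
        using z cc Suc by (metis mult_assoc)
      then show ?case
        using z y cc by (simp add: cS smult_mult_left smult_mult_right distr_left distr_right)
    qed (simp add: c0 z)
    then have "z \<otimes> l = l \<otimes> z"
      using conv_unique[OF conv_mult[OF conv_const[OF z(1)] l]] conv_mult[OF l conv_const[OF z(1)]]
      by simp
    then show ?thesis using z lc by (simp add: mult_minus minus_mult)
  qed
  show thesis
    by (rule that[of "\<one> \<ominus> l"]) (use lc lsa sq comm in \<open>auto simp: adj_minus\<close>)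
qed

text \<open>Take u = a + i b with b a selfadjoint square root of 1 - a^2 that commutes with a. In
  the product of u with its adjoint the mixed terms cancel and a^2 + b^2 = 1 remains.\<close>

lemma selfadjoint_real_part_unitary:
  assumes a: "a \<in> carrier A" and sa: "adj A a = a" and less: "nrm A a < 1"
  obtains u where "u \<in> carrier A" "adj A u \<otimes> u = \<one>" "a = (1/2) \<odot> (u \<oplus> adj A u)"
proof -
  interpret ring A by (rule is_ring)
  have "nrm A (a \<otimes> a) < 1"
    using cstar_identity[OF a] less nrm_nonneg[OF a] by (simp add: sa power_less_one_iff)
  then obtain b where b: "b \<in> carrier A" "adj A b = b" "b \<otimes> b = \<one> \<ominus> a \<otimes> a" "a \<otimes> b = b \<otimes> a"
    using sqrt_one_minus[of "a \<otimes> a"] a sa mult_assoc by (metis adj_mult m_closed)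
  define u where "u = a \<oplus> \<i> \<odot> b"
  have adj_u: "adj A u = a \<ominus> \<i> \<odot> b"
    using a b by (simp add: u_def adj_add adj_smult sa smult_uminus minus_eq)
  have "adj A u \<otimes> u = a \<otimes> a \<oplus> (\<i> \<odot> (a \<otimes> b)) \<ominus> (\<i> \<odot> (b \<otimes> a) \<oplus> (\<i> \<odot> b) \<otimes> (\<i> \<odot> b))"
    unfolding adj_u unfolding u_def using a b(1)
    by (simp add: minus_mult distr_right smult_mult_left smult_mult_right smult_add smult_a_inv
        M.minus_eq minus_add a_ac distr_left a_inv_mult)
  also have "(\<i> \<odot> b) \<otimes> (\<i> \<odot> b) = \<ominus> (b \<otimes> b)"
    using b(1) by (simp add: smult_mult_left smult_mult_right smult_times[symmetric] smult_uminus)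
  also have "a \<otimes> a \<oplus> (\<i> \<odot> (a \<otimes> b)) \<ominus> (\<i> \<odot> (b \<otimes> a) \<oplus> \<ominus> (b \<otimes> b)) = a \<otimes> a \<oplus> b \<otimes> b"
    using a b(1) b(4) by (simp add: ring_simprules)
  also have "\<dots> = \<one>" unfolding b(3) using a by (simp add: ring_simprules)
  finally have isometry: "adj A u \<otimes> u = \<one>" .
  have re: "a = (1/2) \<odot> (u \<oplus> adj A u)"
  proof -
    have "u \<oplus> adj A u = a \<oplus> a" unfolding adj_u unfolding u_def using a b(1) by (simp add: ring_simprules)
    also have "(1/2) \<odot> (a \<oplus> a) = a"
      using a smult_plus[OF a, of "1/2" "1/2"] by (simp add: smult_add)
    finally show ?thesis by (rule sym)
  qed
  have "u \<in> carrier A" using a b(1) by (simp add: u_def)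
  then show thesis using isometry re by (rule that)
qed

end

lemma unital_star_homD:
  assumes "unital_star_hom A B h"
  shows "x \<in> carrier A \<Longrightarrow> h x \<in> carrier B"
    and "x \<in> carrier A \<Longrightarrow> y \<in> carrier A \<Longrightarrow> h (x \<otimes>\<^bsub>A\<^esub> y) = h x \<otimes>\<^bsub>B\<^esub> h y"
    and "x \<in> carrier A \<Longrightarrow> y \<in> carrier A \<Longrightarrow> h (x \<oplus>\<^bsub>A\<^esub> y) = h x \<oplus>\<^bsub>B\<^esub> h y"
    and "h \<one>\<^bsub>A\<^esub> = \<one>\<^bsub>B\<^esub>"
    and "x \<in> carrier A \<Longrightarrow> h (c \<odot>\<^bsub>A\<^esub> x) = c \<odot>\<^bsub>B\<^esub> h x"
    and "x \<in> carrier A \<Longrightarrow> h (adj A x) = adj B (h x)"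
  using assms by (auto simp: unital_star_hom_def ring_hom_def)

text \<open>A selfadjoint element of norm less than one is the real part of a unitary, and unitaries
  are mapped to unitaries; this replaces the usual spectral radius argument.\<close>

theorem unital_star_hom_contractive:
  assumes A: "unital_cstar_algebra A" and B: "unital_cstar_algebra B"
    and h: "unital_star_hom A B h" and x: "x \<in> carrier A"
  shows "nrm B (h x) \<le> nrm A x"
proof -
  interpret A: unital_cstar_algebra A by (rule A)
  interpret B: unital_cstar_algebra B by (rule B)
  note h' = unital_star_homD[OF h]
  have unit_ball: "nrm B (h a) \<le> 1" if a: "a \<in> carrier A" "adj A a = a" "nrm A a < 1" for a
  proof -
    obtain u where u: "u \<in> carrier A" "adj A u \<otimes>\<^bsub>A\<^esub> u = \<one>\<^bsub>A\<^esub>"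
        "a = (1/2) \<odot>\<^bsub>A\<^esub> (u \<oplus>\<^bsub>A\<^esub> adj A u)"
      using A.selfadjoint_real_part_unitary[OF a] .
    have hu: "h u \<in> carrier B" "adj B (h u) \<otimes>\<^bsub>B\<^esub> h u = \<one>\<^bsub>B\<^esub>"
      using u(1,2) h' by (auto simp flip: h'(6) h'(2))
    have "h a = (1/2) \<odot>\<^bsub>B\<^esub> (h u \<oplus>\<^bsub>B\<^esub> adj B (h u))"
      unfolding u(3) using u(1) by (simp add: h')
    then have "nrm B (h a) = 1/2 * nrm B (h u \<oplus>\<^bsub>B\<^esub> adj B (h u))"
      using hu by (simp add: B.nrm_smult)
    also have "nrm B (h u \<oplus>\<^bsub>B\<^esub> adj B (h u)) \<le> nrm B (h u) + nrm B (h u)"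
      using B.nrm_triangle[of "h u" "adj B (h u)"] hu by (simp add: B.nrm_adj)
    also have "nrm B (h u) \<le> 1" using hu by (rule B.nrm_isometry_le)
    finally show ?thesis by simp
  qed
  \<comment> \<open>Scaling by slightly more than the norm brings \<open>a\<close> into the open
    unit ball; the excess \<open>e\<close> is arbitrary.\<close>
  have sa: "nrm B (h a) \<le> nrm A a" if a: "a \<in> carrier A" "adj A a = a" for a
  proof (rule field_le_epsilon)
    fix e :: real assume e: "e > 0"
    define r where "r = nrm A a + e"
    have r: "r > 0" "nrm A a < r" using e A.nrm_nonneg[OF a(1)] by (auto simp: r_def)
    let ?a = "complex_of_real (1/r) \<odot>\<^bsub>A\<^esub> a"
    have "nrm B (h ?a) \<le> 1"
      by (rule unit_ball) (use a r in \<open>auto simp: A.adj_smult A.nrm_smult norm_divide\<close>)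
    moreover have "nrm B (h ?a) = nrm B (h a) / r"
      using a r h' by (simp add: B.nrm_smult norm_divide)
    ultimately show "nrm B (h a) \<le> nrm A a + e"
      using r(1) by (simp add: r_def)
  qed
  \<comment> \<open>The C*-identity reduces the general case to the product of x with its adjoint,
    which is selfadjoint.\<close>
  have "(nrm B (h x))\<^sup>2 = nrm B (h (adj A x \<otimes>\<^bsub>A\<^esub> x))"
    using B.cstar_identity[of "h x"] x h' by simp
  also have "\<dots> \<le> nrm A (adj A x \<otimes>\<^bsub>A\<^esub> x)"
    by (rule sa) (use x in \<open>auto simp: A.adj_mult A.adj_adj\<close>)
  also have "\<dots> = (nrm A x)\<^sup>2" by (rule A.cstar_identity[OF x])
  finally show ?thesis using A.nrm_nonneg[OF x] by (rule power2_le_imp_le)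
qed

section \<open>The free *-algebra\<close>

lemma adj_word_0 [simp]: "adj_word 0 = 0"
  by (simp add: adj_word_def zero_star_word_def)

lemma adj_word_add: "adj_word (v + w) = adj_word w + adj_word v"
  by (simp add: adj_word_def plus_star_word_def)

lemma adj_word_adj_word [simp]: "adj_word (adj_word w) = w"
proof -
  have "map (\<lambda>(g, b). (g, \<not> b)) (map (\<lambda>(g, b). (g, \<not> b)) xs) = xs" for xs :: "('g \<times> bool) list"
    by (induction xs) auto
  then show ?thesis by (cases w) (simp add: adj_word_def rev_map)
qed

lemma adj_word_eq_0_iff [simp]: "adj_word w = 0 \<longleftrightarrow> w = 0"
  by (metis adj_word_0 adj_word_adj_word)

lemma letters_0 [simp]: "letters 0 = []"
  by (simp add: zero_star_word_def)

lemma letters_add [simp]: "letters (v + w) = letters v @ letters w"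
  by (simp add: plus_star_word_def)

lemma fst_letters_adj_word: "fst ` set (letters (adj_word w)) = fst ` set (letters w)"
  by (force simp: adj_word_def)

lemma add_eq_0_star_word [simp]: "v + w = 0 \<longleftrightarrow> v = 0 \<and> w = (0 :: 'g star_word)"
  by (cases v; cases w) (simp add: plus_star_word_def zero_star_word_def)

lemma sum_single_lookup:
  assumes "finite K" "Poly_Mapping.keys x \<subseteq> K"
  shows "(\<Sum>w\<in>K. Poly_Mapping.single w (Poly_Mapping.lookup x w)) = x"
proof (rule poly_mapping_eqI)
  fix k
  have "Poly_Mapping.lookup (\<Sum>w\<in>K. Poly_Mapping.single w (Poly_Mapping.lookup x w)) k =
      (\<Sum>w\<in>K. if w = k then Poly_Mapping.lookup x w else 0)"
    by (simp add: lookup_sum lookup_single when_def)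
  also have "\<dots> = Poly_Mapping.lookup x k"
    using assms by (auto simp: sum.delta in_keys_iff)
  finally show "Poly_Mapping.lookup (\<Sum>w\<in>K. Poly_Mapping.single w (Poly_Mapping.lookup x w)) k =
    Poly_Mapping.lookup x k" .
qed

text \<open>Additivity leaves only monomials to check; nested in both arguments, this proves the
  bilinear identities of the convolution product. The case \<open>single\<close> offers only words
  occurring in \<open>x\<close>, as needed for a subalgebra cut out by a condition on words.\<close>

lemma poly_mapping_monomial_induct [case_names zero single add]:
  fixes x :: "'k \<Rightarrow>\<^sub>0 'a::comm_monoid_add"
  assumes zero: "Q 0" and single: "\<And>k c. k \<in> Poly_Mapping.keys x \<Longrightarrow> Q (Poly_Mapping.single k c)"
    and add: "\<And>y z. Q y \<Longrightarrow> Q z \<Longrightarrow> Q (y + z)"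
  shows "Q x"
proof -
  have "Q (\<Sum>w\<in>K. Poly_Mapping.single w (Poly_Mapping.lookup x w))"
    if "finite K" "K \<subseteq> Poly_Mapping.keys x" for K
    using that by (induction K) (auto intro: zero add single)
  from this[of "Poly_Mapping.keys x"] show ?thesis
    by (simp add: sum_single_lookup)
qed

text \<open>\<open>adj_word\<close> is an involution, so at most one summand of the defining sum
  contributes to the coefficient of \<open>w\<close>. The laws of the star then become comparisons
  of coefficients.\<close>

lemma lookup_star: "Poly_Mapping.lookup (star x) w = cnj (Poly_Mapping.lookup x (adj_word w))"
proof -
  have "Poly_Mapping.lookup (star x) w =
      (\<Sum>v\<in>Poly_Mapping.keys x. if v = adj_word w then cnj (Poly_Mapping.lookup x v) else 0)"
    unfolding star_def lookup_sum
    by (intro sum.cong) (auto simp: lookup_single when_def)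
  also have "\<dots> = cnj (Poly_Mapping.lookup x (adj_word w))"
    by (auto simp: sum.delta in_keys_iff)
  finally show ?thesis .
qed

lemma star_0 [simp]: "star 0 = 0"
  by (rule poly_mapping_eqI) (simp add: lookup_star)

lemma star_add: "star (x + y) = star x + star y"
  by (rule poly_mapping_eqI) (simp add: lookup_star lookup_add)

lemma star_minus: "star (x - y) = star x - star y"
  by (rule poly_mapping_eqI) (simp add: lookup_star lookup_minus)

lemma star_star [simp]: "star (star x) = x"
  by (rule poly_mapping_eqI) (simp add: lookup_star)

lemma star_single: "star (Poly_Mapping.single w c) = Poly_Mapping.single (adj_word w) (cnj c)"
  by (rule poly_mapping_eqI) (auto simp: lookup_star lookup_single when_def)

lemma star_mult: "star (x * y) = star y * star x"
proof (induction x rule: poly_mapping_monomial_induct)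
  case (single v c)
  show ?case
    by (induction y rule: poly_mapping_monomial_induct)
      (simp_all add: mult_single star_single adj_word_add distrib_left distrib_right star_add mult.commute)
qed (simp_all add: distrib_left distrib_right star_add)

lemma keys_star: "Poly_Mapping.keys (star x) = adj_word ` Poly_Mapping.keys x"
proof -
  have "w \<in> Poly_Mapping.keys (star x) \<longleftrightarrow> adj_word w \<in> Poly_Mapping.keys x" for w
    by (simp add: in_keys_iff lookup_star)
  moreover have "w \<in> adj_word ` Poly_Mapping.keys x \<longleftrightarrow> adj_word w \<in> Poly_Mapping.keys x" for w
    by (auto intro: image_eqI[of w adj_word "adj_word w"])
  ultimately show ?thesis by blast
qed

lemma scale_single: "scale c (Poly_Mapping.single w d) = Poly_Mapping.single w (c * d)"
  by (simp add: scale_def mult_single)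

lemma scale_add: "scale c (x + y) = scale c x + scale c y"
  by (simp add: scale_def distrib_left)

lemma scale_0 [simp]: "scale c 0 = 0"
  by (simp add: scale_def)

lemma lookup_scale: "Poly_Mapping.lookup (scale c x) w = c * Poly_Mapping.lookup x w"
  by (induction x rule: poly_mapping_monomial_induct)
    (simp_all add: scale_add scale_single lookup_add lookup_single when_def distrib_left)

lemma keys_scale: "Poly_Mapping.keys (scale c x) \<subseteq> Poly_Mapping.keys x"
  by (auto simp: in_keys_iff lookup_scale)

lemma scale_zero_left [simp]: "scale 0 x = 0"
  by (rule poly_mapping_eqI) (simp add: lookup_scale)

lemma scale_minus_one: "scale (-1) x = - x"
  by (rule poly_mapping_eqI) (simp add: lookup_scale)

lemma scale_one [simp]: "scale 1 x = x"
  by (rule poly_mapping_eqI) (simp add: lookup_scale)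

lemma scale_scale: "scale c (scale d x) = scale (c * d) x"
  by (rule poly_mapping_eqI) (simp add: lookup_scale)

lemma scale_plus: "scale (c + d) x = scale c x + scale d x"
  by (rule poly_mapping_eqI) (simp add: lookup_scale lookup_add distrib_right)

lemma scale_minus: "scale c (x - y) = scale c x - scale c y"
  by (rule poly_mapping_eqI) (simp add: lookup_scale lookup_minus right_diff_distrib)

lemma scale_mult_left: "scale c x * y = scale c (x * y)"
  by (simp add: scale_def mult.assoc)

lemma mult_scale_right: "x * scale c y = scale c (x * y)"
proof (induction x rule: poly_mapping_monomial_induct)
  case (single v d)
  show ?case
    by (induction y rule: poly_mapping_monomial_induct)
      (simp_all add: mult_single scale_single scale_add distrib_left mult_ac)
qed (simp_all add: distrib_right scale_add)

lemma star_scale: "star (scale c x) = scale (cnj c) (star x)"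
  by (rule poly_mapping_eqI) (simp add: lookup_scale lookup_star)

context
  fixes G :: "'g set"
begin

lemma free_0 [simp, intro]: "0 \<in> free_star_algebra G"
  by (simp add: free_star_algebra_def)

lemma free_add [simp, intro]:
  "x \<in> free_star_algebra G \<Longrightarrow> y \<in> free_star_algebra G \<Longrightarrow> x + y \<in> free_star_algebra G"
  using keys_add[of x y] by (fastforce simp: free_star_algebra_def)

lemma free_minus [simp, intro]:
  "x \<in> free_star_algebra G \<Longrightarrow> y \<in> free_star_algebra G \<Longrightarrow> x - y \<in> free_star_algebra G"
  using keys_diff[of x y] by (fastforce simp: free_star_algebra_def)

lemma free_scale [simp, intro]: "x \<in> free_star_algebra G \<Longrightarrow> scale c x \<in> free_star_algebra G"
  using keys_scale[of c x] by (fastforce simp: free_star_algebra_def)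

lemma free_star [simp, intro]: "x \<in> free_star_algebra G \<Longrightarrow> star x \<in> free_star_algebra G"
  by (auto simp: free_star_algebra_def keys_star fst_letters_adj_word)

lemma free_mult [simp, intro]:
  assumes "x \<in> free_star_algebra G" "y \<in> free_star_algebra G"
  shows "x * y \<in> free_star_algebra G"
  unfolding free_star_algebra_def
proof (intro CollectI ballI)
  fix w assume "w \<in> Poly_Mapping.keys (x * y)"
  then obtain u v where "w = u + v" "u \<in> Poly_Mapping.keys x" "v \<in> Poly_Mapping.keys y"
    using keys_mult[of x y] by auto
  then show "w \<noteq> 0 \<and> fst ` set (letters w) \<subseteq> G"
    using assms by (auto simp: free_star_algebra_def image_Un)
qed

lemma free_sum [simp, intro]:
  "(\<And>i. i \<in> I \<Longrightarrow> f i \<in> free_star_algebra G) \<Longrightarrow> sum f I \<in> free_star_algebra G"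
  by (induction I rule: infinite_finite_induct) auto

lemma free_single: "w \<noteq> 0 \<Longrightarrow> fst ` set (letters w) \<subseteq> G \<Longrightarrow> Poly_Mapping.single w c \<in> free_star_algebra G"
  by (auto simp: free_star_algebra_def)

lemma free_gen [simp, intro]: "g \<in> G \<Longrightarrow> gen g \<in> free_star_algebra G"
  unfolding gen_def by (rule free_single) (auto simp: zero_star_word_def)

text \<open>Words without constant term are nonempty, so each is a product of letters, and a letter
  is a generator or the adjoint of one; the star is therefore asked for on generators alone.\<close>

lemma free_star_algebra_induct [consumes 1, case_names zero scale gen star mult add]:
  assumes x: "x \<in> free_star_algebra G"
    and zero: "Q 0" and scale: "\<And>c x. x \<in> free_star_algebra G \<Longrightarrow> Q x \<Longrightarrow> Q (scale c x)"
    and gen: "\<And>g. g \<in> G \<Longrightarrow> Q (gen g)"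
    and star: "\<And>g. g \<in> G \<Longrightarrow> Q (star (gen g))"
    and mult: "\<And>x y. x \<in> free_star_algebra G \<Longrightarrow> y \<in> free_star_algebra G \<Longrightarrow> Q x \<Longrightarrow> Q y \<Longrightarrow> Q (x * y)"
    and add: "\<And>x y. x \<in> free_star_algebra G \<Longrightarrow> y \<in> free_star_algebra G \<Longrightarrow> Q x \<Longrightarrow> Q y \<Longrightarrow> Q (x + y)"
  shows "Q x"
proof -
  have letter: "Q (Poly_Mapping.single (Word [l]) 1)" if "fst l \<in> G" for l
  proof (cases l)
    case (Pair g b)
    show ?thesis
    proof (cases b)
      case True
      then have "Poly_Mapping.single (Word [l]) 1 = Defs.star (Defs.gen g)"
        by (simp add: Defs.gen_def star_single adj_word_def Pair)
      then show ?thesis using star that by (simp add: Pair)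
    next
      case False
      then have "Poly_Mapping.single (Word [l]) 1 = Defs.gen g"
        by (simp add: Defs.gen_def Pair)
      then show ?thesis using gen that by (simp add: Pair)
    qed
  qed
  \<comment> \<open>Writing the word as \<open>l # ls\<close> keeps every factor nonempty and thus
    inside the non-unital algebra.\<close>
  have word: "Q (Poly_Mapping.single (Word (l # ls)) 1)" if "fst ` set (l # ls) \<subseteq> G" for l ls
    using that
  proof (induction ls arbitrary: l)
    case Nil
    then show ?case using letter by simp
  next
    case (Cons l' ls)
    have "Poly_Mapping.single (Word (l # l' # ls)) (1::complex) =
        Poly_Mapping.single (Word [l]) 1 * Poly_Mapping.single (Word (l' # ls)) 1"
      by (simp add: mult_single plus_star_word_def)
    then show ?case
      using mult[OF _ _ letter Cons.IH, of l l'] Cons.prems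
      by (simp add: free_single zero_star_word_def)
  qed
  have monomial: "Q (Poly_Mapping.single w c) \<and> Poly_Mapping.single w c \<in> free_star_algebra G"
    if w: "w \<noteq> 0" "fst ` set (letters w) \<subseteq> G" for w c
  proof -
    obtain l ls where "w = Word (l # ls)"
      using w(1) by (cases w; cases "letters w") (auto simp: zero_star_word_def)
    then have "Q (Poly_Mapping.single w 1)" using word w by simp
    then show ?thesis
      using scale[OF free_single[of w 1], of c] w by (simp add: scale_single free_single)
  qed
  have "Q x \<and> x \<in> free_star_algebra G"
  proof (rule poly_mapping_monomial_induct[of "\<lambda>y. Q y \<and> y \<in> free_star_algebra G" x])
    fix k c assume "k \<in> Poly_Mapping.keys x"
    then have "k \<noteq> 0" "fst ` set (letters k) \<subseteq> G" using x by (auto simp: free_star_algebra_def)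
    then show "Q (Poly_Mapping.single k c) \<and> Poly_Mapping.single k c \<in> free_star_algebra G"
      by (rule monomial)
  qed (simp_all add: zero add)
  then show ?thesis by blast
qed

end

section \<open>Evaluation of free polynomials at elements of a unital C*-algebra\<close>

context unital_cstar_algebra
begin

definition eval_letter :: "('g \<Rightarrow> 'a) \<Rightarrow> 'g \<times> bool \<Rightarrow> 'a" where
  "eval_letter \<phi> l = (if snd l then adj A (\<phi> (fst l)) else \<phi> (fst l))"

text \<open>The unit of the target gives the empty word a value, so that convolution products can be
  evaluated without separating constant terms.\<close>

definition eval_word :: "('g \<Rightarrow> 'a) \<Rightarrow> 'g star_word \<Rightarrow> 'a" where
  "eval_word \<phi> w = foldr (\<lambda>l x. eval_letter \<phi> l \<otimes> x) (letters w) \<one>"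

definition eval_poly :: "('g \<Rightarrow> 'a) \<Rightarrow> 'g star_poly \<Rightarrow> 'a" where
  "eval_poly \<phi> x = finsum A (\<lambda>w. Poly_Mapping.lookup x w \<odot> eval_word \<phi> w) (Poly_Mapping.keys x)"

context
  fixes \<phi> :: "'g \<Rightarrow> 'a"
  assumes \<phi>: "\<And>g. \<phi> g \<in> carrier A"
begin

lemma eval_letter_closed: "eval_letter \<phi> l \<in> carrier A"
  by (simp add: eval_letter_def \<phi>)

lemma foldr_eval_closed: "y \<in> carrier A \<Longrightarrow> foldr (\<lambda>l x. eval_letter \<phi> l \<otimes> x) ls y \<in> carrier A"
  by (induction ls) (simp_all add: eval_letter_closed)

lemma foldr_eval: "y \<in> carrier A \<Longrightarrow> foldr (\<lambda>l x. eval_letter \<phi> l \<otimes> x) ls y =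
    foldr (\<lambda>l x. eval_letter \<phi> l \<otimes> x) ls \<one> \<otimes> y"
  by (induction ls) (simp_all add: eval_letter_closed foldr_eval_closed mult_assoc)

lemma eval_word_closed [simp]: "eval_word \<phi> w \<in> carrier A"
  by (simp add: eval_word_def foldr_eval_closed)

lemma eval_word_add: "eval_word \<phi> (v + w) = eval_word \<phi> v \<otimes> eval_word \<phi> w"
  unfolding eval_word_def letters_add foldr_append
  by (subst foldr_eval) (simp_all add: foldr_eval_closed)

lemma eval_word_0 [simp]: "eval_word \<phi> 0 = \<one>"
  by (simp add: eval_word_def)

lemma eval_word_letter: "eval_word \<phi> (Word [l]) = eval_letter \<phi> l"
  by (simp add: eval_word_def eval_letter_closed)

lemma eval_word_adj: "eval_word \<phi> (adj_word w) = adj A (eval_word \<phi> w)"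
proof -
  have "eval_word \<phi> (adj_word (Word ls)) = adj A (eval_word \<phi> (Word ls))" for ls
  proof (induction ls)
    case Nil
    then show ?case by (simp add: zero_star_word_def[symmetric])
  next
    case (Cons l ls)
    have split: "Word (l # ls) = Word [l] + Word ls" by (simp add: plus_star_word_def)
    have "eval_word \<phi> (adj_word (Word [l])) = adj A (eval_word \<phi> (Word [l]))"
      by (cases l) (simp add: adj_word_def eval_word_letter eval_letter_def adj_adj \<phi>)
    then show ?case
      unfolding split adj_word_add eval_word_add by (simp add: Cons adj_mult)
  qed
  from this[of "letters w"] show ?thesis by simp
qed

lemma eval_poly_superset:
  assumes "finite K" "Poly_Mapping.keys x \<subseteq> K"
  shows "eval_poly \<phi> x = finsum A (\<lambda>w. Poly_Mapping.lookup x w \<odot> eval_word \<phi> w) K"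
  unfolding eval_poly_def
  by (rule M.add.finprod_mono_neutral_cong_left) (use assms in \<open>auto simp: in_keys_iff\<close>)

lemma eval_poly_closed [simp]: "eval_poly \<phi> x \<in> carrier A"
  unfolding eval_poly_def by (intro M.finsum_closed) auto

lemma eval_poly_add: "eval_poly \<phi> (x + y) = eval_poly \<phi> x \<oplus> eval_poly \<phi> y"
proof -
  let ?K = "Poly_Mapping.keys x \<union> Poly_Mapping.keys y"
  have "eval_poly \<phi> (x + y) = finsum A (\<lambda>w. Poly_Mapping.lookup (x + y) w \<odot> eval_word \<phi> w) ?K"
    by (rule eval_poly_superset) (use keys_add[of x y] in auto)
  also have "\<dots> = finsum A (\<lambda>w. Poly_Mapping.lookup x w \<odot> eval_word \<phi> w) ?K \<oplus>
      finsum A (\<lambda>w. Poly_Mapping.lookup y w \<odot> eval_word \<phi> w) ?K"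
    by (subst M.finsum_addf[symmetric]) (auto simp: lookup_add smult_plus intro!: M.finsum_cong')
  also have "\<dots> = eval_poly \<phi> x \<oplus> eval_poly \<phi> y"
    using eval_poly_superset[of ?K x] eval_poly_superset[of ?K y] by simp
  finally show ?thesis .
qed

lemma eval_poly_single: "eval_poly \<phi> (Poly_Mapping.single w c) = c \<odot> eval_word \<phi> w"
  using eval_poly_superset[of "{w}" "Poly_Mapping.single w c"]
  by (simp add: M.finsum_insert)

lemma eval_poly_0 [simp]: "eval_poly \<phi> 0 = \<zero>"
  by (simp add: eval_poly_def)

lemma eval_poly_mult: "eval_poly \<phi> (x * y) = eval_poly \<phi> x \<otimes> eval_poly \<phi> y"
proof (induction x rule: poly_mapping_monomial_induct)
  case (single v c)
  show ?case
    by (induction y rule: poly_mapping_monomial_induct)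
      (simp_all add: mult_single eval_poly_single eval_word_add distrib_left eval_poly_add
        distr_right smult_mult_left smult_mult_right smult_times[symmetric] mult.commute)
qed (simp_all add: distrib_right eval_poly_add distr_left)

lemma eval_poly_scale: "eval_poly \<phi> (scale c x) = c \<odot> eval_poly \<phi> x"
  by (induction x rule: poly_mapping_monomial_induct)
    (simp_all add: scale_single eval_poly_single scale_add eval_poly_add smult_add smult_times)

lemma eval_poly_star: "eval_poly \<phi> (star x) = adj A (eval_poly \<phi> x)"
  by (induction x rule: poly_mapping_monomial_induct)
    (simp_all add: star_single eval_poly_single star_add eval_poly_add eval_word_adj adj_smult adj_add)

lemma eval_poly_minus: "eval_poly \<phi> (x - y) = eval_poly \<phi> x \<ominus> eval_poly \<phi> y"
  using eval_poly_add[of x "scale (-1) y"]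
  by (simp only: eval_poly_scale) (simp add: scale_minus_one M.minus_eq smult_uminus)

lemma eval_poly_gen: "eval_poly \<phi> (gen g) = \<phi> g"
  by (simp add: gen_def eval_poly_single eval_word_letter eval_letter_def \<phi>)

lemma eval_poly_sum: "eval_poly \<phi> (sum f I) = finsum A (\<lambda>i. eval_poly \<phi> (f i)) I"
  by (induction I rule: infinite_finite_induct) (simp_all add: eval_poly_add)

text \<open>This is how a family of elements enters the supremum defining the universal norm: if it
  satisfies the relations, its evaluation is dominated by that norm.\<close>

lemma cstar_seminorm_eval: "cstar_seminorm G (\<lambda>x. nrm A (eval_poly \<phi> x))"
  unfolding cstar_seminorm_def
  by (simp add: nrm_nonneg eval_poly_scale nrm_smult eval_poly_mult eval_poly_star cstar_identity
      eval_poly_add nrm_triangle nrm_mult)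

end

end

section \<open>Universal C*-algebras\<close>

context
  fixes G :: "'g set" and N :: "'g star_poly \<Rightarrow> real"
  assumes N: "cstar_seminorm G N"
begin

lemma seminorm_nonneg: "x \<in> free_star_algebra G \<Longrightarrow> 0 \<le> N x"
  and seminorm_scale: "x \<in> free_star_algebra G \<Longrightarrow> N (scale c x) = cmod c * N x"
  and seminorm_star_mult: "x \<in> free_star_algebra G \<Longrightarrow> N (star x * x) = (N x)\<^sup>2"
  and seminorm_add: "x \<in> free_star_algebra G \<Longrightarrow> y \<in> free_star_algebra G \<Longrightarrow> N (x + y) \<le> N x + N y"
  and seminorm_mult: "x \<in> free_star_algebra G \<Longrightarrow> y \<in> free_star_algebra G \<Longrightarrow> N (x * y) \<le> N x * N y"
  using N by (simp_all add: cstar_seminorm_def)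

lemma seminorm_0: "N 0 = 0"
  using seminorm_scale[of 0 0] by simp

lemma seminorm_uminus: "x \<in> free_star_algebra G \<Longrightarrow> N (- x) = N x"
  using seminorm_scale[of x "-1"] by (simp add: scale_minus_one)

lemma seminorm_minus_commute:
  "x \<in> free_star_algebra G \<Longrightarrow> y \<in> free_star_algebra G \<Longrightarrow> N (x - y) = N (y - x)"
  using seminorm_uminus[of "x - y"] by simp

lemma seminorm_triangle:
  assumes "x \<in> free_star_algebra G" "y \<in> free_star_algebra G" "z \<in> free_star_algebra G"
  shows "N (x - z) \<le> N (x - y) + N (y - z)"
  using seminorm_add[of "x - y" "y - z"] assms by simp

lemma seminorm_diff:
  assumes "x \<in> free_star_algebra G" "y \<in> free_star_algebra G"
  shows "\<bar>N x - N y\<bar> \<le> N (x - y)"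
  using seminorm_triangle[of x y 0] seminorm_triangle[of y x 0] seminorm_minus_commute[of x y] assms
  by simp

lemma seminorm_star_le: assumes x: "x \<in> free_star_algebra G" shows "N x \<le> N (star x)"
proof (cases "N x = 0")
  case False
  have "N x * N x \<le> N (star x) * N x"
    using seminorm_star_mult[OF x] seminorm_mult[of "star x" x] x by (simp add: power2_eq_square)
  then show ?thesis using False seminorm_nonneg[OF x] by simp
qed (use x in \<open>simp add: seminorm_nonneg\<close>)

lemma seminorm_star: assumes x: "x \<in> free_star_algebra G" shows "N (star x) = N x"
  using seminorm_star_le[OF x] seminorm_star_le[of "star x"] x by simp

lemma seminorm_mult_diff:
  assumes "a \<in> free_star_algebra G" "b \<in> free_star_algebra G" "c \<in> free_star_algebra G" "d \<in> free_star_algebra G"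
  shows "N (a * b - c * d) \<le> N a * N (b - d) + N (a - c) * N d"
proof -
  have "a * b - c * d = a * (b - d) + (a - c) * d" by (simp add: algebra_simps)
  then have "N (a * b - c * d) \<le> N (a * (b - d)) + N ((a - c) * d)"
    using seminorm_add[of "a * (b - d)" "(a - c) * d"] assms by simp
  also have "\<dots> \<le> N a * N (b - d) + N (a - c) * N d"
    using assms by (intro add_mono seminorm_mult) auto
  finally show ?thesis .
qed

end

lemma cstar_seminorm_0: "cstar_seminorm G (\<lambda>_. 0)"
  by (simp add: cstar_seminorm_def)

context
  fixes G :: "'g set" and R :: "'g star_poly set"
begin

abbreviation (input) "vanishing_seminorms \<equiv> {N. cstar_seminorm G N \<and> (\<forall>r\<in>R. N r = 0)}"

lemma vanishing_seminorms_nonempty: "vanishing_seminorms \<noteq> {}"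
  using cstar_seminorm_0 by blast

text \<open>A bound uniform in the seminorm propagates along the generation of the free algebra by
  homogeneity, isometry of the star, submultiplicativity and the triangle inequality. It makes the
  real supremum in \<open>universal_norm\<close> genuine.\<close>

lemma bounded_on_free_star_algebra:
  assumes gens: "\<And>g. g \<in> G \<Longrightarrow> \<exists>M. \<forall>N\<in>vanishing_seminorms. N (gen g) \<le> M"
    and x: "x \<in> free_star_algebra G"
  shows "bdd_above ((\<lambda>N. N x) ` vanishing_seminorms)"
proof -
  have "\<exists>M. \<forall>N\<in>vanishing_seminorms. N x \<le> M"
    using x
  proof (induction rule: free_star_algebra_induct)
    case zero
    show ?case by (rule exI[of _ 0]) (auto dest: seminorm_0)
  next
    case (scale c x)
    then obtain M where M: "\<forall>N\<in>vanishing_seminorms. N x \<le> M" by blast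
    have "N (Defs.scale c x) \<le> cmod c * M" if "N \<in> vanishing_seminorms" for N
      using seminorm_scale[of G N x c] scale(1) that M by (simp add: mult_left_mono)
    then show ?case by blast
  next
    case (gen g)
    then show ?case by (rule gens)
  next
    case (star g)
    then obtain M where M: "\<forall>N\<in>vanishing_seminorms. N (gen g) \<le> M" using gens by blast
    have "N (Defs.star (gen g)) \<le> M" if "N \<in> vanishing_seminorms" for N
      using seminorm_star[of G N "gen g"] star that M by simp
    then show ?case by blast
  next
    case (mult x y)
    then obtain M M' where M: "\<forall>N\<in>vanishing_seminorms. N x \<le> M" "\<forall>N\<in>vanishing_seminorms. N y \<le> M'"
      by blast
    have "N (x * y) \<le> M * M'" if N: "N \<in> vanishing_seminorms" for N
    proof -
      have sn: "cstar_seminorm G N" using N by simp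
      have "N (x * y) \<le> N x * N y" using seminorm_mult[OF sn] mult by simp
      also have "\<dots> \<le> M * M'"
        using M N seminorm_nonneg[OF sn mult(1)] seminorm_nonneg[OF sn mult(2)]
        by (intro mult_mono) (auto intro: order_trans)
      finally show ?thesis .
    qed
    then show ?case by blast
  next
    case (add x y)
    then obtain M M' where M: "\<forall>N\<in>vanishing_seminorms. N x \<le> M" "\<forall>N\<in>vanishing_seminorms. N y \<le> M'"
      by blast
    have "N (x + y) \<le> M + M'" if N: "N \<in> vanishing_seminorms" for N
    proof -
      have "N (x + y) \<le> N x + N y" using seminorm_add[of G N x y] add(1,2) N by simp
      also have "\<dots> \<le> M + M'" using M N by (intro add_mono) auto
      finally show ?thesis .
    qed
    then show ?case by blast
  qed
  then show ?thesis by (auto simp: bdd_above_def)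
qed

context
  assumes bdd: "\<And>x. x \<in> free_star_algebra G \<Longrightarrow> bdd_above ((\<lambda>N. N x) ` vanishing_seminorms)"
begin

lemma le_universal_norm:
  "cstar_seminorm G N \<Longrightarrow> (\<And>r. r \<in> R \<Longrightarrow> N r = 0) \<Longrightarrow> x \<in> free_star_algebra G \<Longrightarrow> N x \<le> universal_norm G R x"
  unfolding universal_norm_def by (rule cSUP_upper[OF _ bdd]) auto

lemma universal_norm_le:
  "(\<And>N. cstar_seminorm G N \<Longrightarrow> (\<And>r. r \<in> R \<Longrightarrow> N r = 0) \<Longrightarrow> N x \<le> M) \<Longrightarrow> universal_norm G R x \<le> M"
  unfolding universal_norm_def by (rule cSUP_least[OF vanishing_seminorms_nonempty]) auto

lemma universal_norm_nonneg: "x \<in> free_star_algebra G \<Longrightarrow> 0 \<le> universal_norm G R x"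
  using le_universal_norm[OF cstar_seminorm_0] by simp

lemma universal_norm_relation: assumes "R \<subseteq> free_star_algebra G" "r \<in> R" shows "universal_norm G R r = 0"
proof (rule antisym)
  show "universal_norm G R r \<le> 0" using assms by (intro universal_norm_le) auto
  show "0 \<le> universal_norm G R r" using assms by (intro universal_norm_nonneg) auto
qed

text \<open>The axioms are stable under pointwise suprema; homogeneity and the C*-identity, being
  equalities, need a second argument for the reverse inequality.\<close>

lemma cstar_seminorm_universal_norm: "cstar_seminorm G (universal_norm G R)"
proof -
  let ?U = "universal_norm G R"
  note ge = universal_norm_nonneg
  have scale_le: "?U (scale c x) \<le> cmod c * ?U x" if x: "x \<in> free_star_algebra G" for c x
  proof (rule universal_norm_le)
    fix N assume N: "cstar_seminorm G N" "\<And>r. r \<in> R \<Longrightarrow> N r = 0"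
    show "N (scale c x) \<le> cmod c * ?U x"
      using seminorm_scale[OF N(1) x] le_universal_norm[OF N x] by (simp add: mult_left_mono)
  qed
  have scale: "?U (scale c x) = cmod c * ?U x" if x: "x \<in> free_star_algebra G" for c x
  proof (cases "c = 0")
    case True
    then show ?thesis using scale_le[OF x, of 0] ge[of 0] by simp
  next
    case False
    \<comment> \<open>The reverse inequality is the first one for the scalar 1/c and the already
      scaled element.\<close>
    have "?U x \<le> cmod (1/c) * ?U (scale c x)"
      using scale_le[of "scale c x" "1/c"] x False by (simp add: scale_scale)
    then have "cmod c * ?U x \<le> ?U (scale c x)"
      using False by (simp add: norm_divide field_simps)
    then show ?thesis using scale_le[OF x] by (simp add: antisym)
  qed
  have star: "?U (star x * x) = (?U x)\<^sup>2" if x: "x \<in> free_star_algebra G" for x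
  proof (rule antisym)
    show "?U (star x * x) \<le> (?U x)\<^sup>2"
    proof (rule universal_norm_le)
      fix N assume N: "cstar_seminorm G N" "\<And>r. r \<in> R \<Longrightarrow> N r = 0"
      show "N (star x * x) \<le> (?U x)\<^sup>2"
        using le_universal_norm[OF N x] seminorm_nonneg[OF N(1) x] seminorm_star_mult[OF N(1) x]
        by (simp add: power_mono)
    qed
    \<comment> \<open>The square root turns the C*-identity of each single seminorm into a bound on
      \<open>N x\<close>, a form that survives the supremum.\<close>
    have "?U x \<le> sqrt (?U (star x * x))"
    proof (rule universal_norm_le)
      fix N assume N: "cstar_seminorm G N" "\<And>r. r \<in> R \<Longrightarrow> N r = 0"
      have "(N x)\<^sup>2 \<le> ?U (star x * x)"
        using le_universal_norm[OF N, of "star x * x"] seminorm_star_mult[OF N(1) x] x by simp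
      then show "N x \<le> sqrt (?U (star x * x))" by (rule real_le_rsqrt)
    qed
    then have "(?U x)\<^sup>2 \<le> (sqrt (?U (star x * x)))\<^sup>2" using ge[OF x] by (intro power_mono)
    then show "(?U x)\<^sup>2 \<le> ?U (star x * x)" using ge[of "star x * x"] x by simp
  qed
  have add: "?U (x + y) \<le> ?U x + ?U y" if "x \<in> free_star_algebra G" "y \<in> free_star_algebra G" for x y
  proof (rule universal_norm_le)
    fix N assume N: "cstar_seminorm G N" "\<And>r. r \<in> R \<Longrightarrow> N r = 0"
    show "N (x + y) \<le> ?U x + ?U y"
      using seminorm_add[OF N(1) that] le_universal_norm[OF N that(1)] le_universal_norm[OF N that(2)]
      by linarith
  qed
  have mult: "?U (x * y) \<le> ?U x * ?U y" if xy: "x \<in> free_star_algebra G" "y \<in> free_star_algebra G" for x y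
  proof (rule universal_norm_le)
    fix N assume N: "cstar_seminorm G N" "\<And>r. r \<in> R \<Longrightarrow> N r = 0"
    have "N (x * y) \<le> N x * N y" using seminorm_mult[OF N(1)] xy .
    also have "\<dots> \<le> ?U x * ?U y"
      using le_universal_norm[OF N] seminorm_nonneg[OF N(1)] ge xy by (intro mult_mono) auto
    finally show "N (x * y) \<le> ?U x * ?U y" .
  qed
  show ?thesis unfolding cstar_seminorm_def
    by (intro conjI ballI allI ge scale star add mult)
qed

end

end

text \<open>Homomorphisms without a condition on units: the universal algebra need not have one, and
  its field \<open>one\<close> is undefined.\<close>

definition star_hom :: "('a, 'm) cstar_scheme \<Rightarrow> ('c, 'n) cstar_scheme \<Rightarrow> ('a \<Rightarrow> 'c) \<Rightarrow> bool" where
  "star_hom A B h \<longleftrightarrow> h \<in> carrier A \<rightarrow> carrier B \<and>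
     (\<forall>x\<in>carrier A. \<forall>y\<in>carrier A. h (x \<oplus>\<^bsub>A\<^esub> y) = h x \<oplus>\<^bsub>B\<^esub> h y \<and> h (x \<otimes>\<^bsub>A\<^esub> y) = h x \<otimes>\<^bsub>B\<^esub> h y) \<and>
     (\<forall>x\<in>carrier A. h (adj A x) = adj B (h x) \<and> (\<forall>c. h (c \<odot>\<^bsub>A\<^esub> x) = c \<odot>\<^bsub>B\<^esub> h x))"

section \<open>The Hausdorff completion of the free star algebra\<close>

locale presentation =
  fixes G :: "'g set" and R :: "'g star_poly set"
  assumes seminorm: "cstar_seminorm G (universal_norm G R)"
begin

abbreviation "N \<equiv> universal_norm G R"
abbreviation "F \<equiv> free_star_algebra G"
abbreviation "CS \<equiv> cauchy_seqs G R"
abbreviation "cl \<equiv> seq_class G R"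
abbreviation "U \<equiv> universal_cstar G R"
abbreviation "\<iota> \<equiv> universal_map G R"

lemmas N_nonneg = seminorm_nonneg[OF seminorm]
  and N_scale = seminorm_scale[OF seminorm]
  and N_star_mult = seminorm_star_mult[OF seminorm]
  and N_add = seminorm_add[OF seminorm]
  and N_mult = seminorm_mult[OF seminorm]
  and N_0 [simp] = seminorm_0[OF seminorm]
  and N_minus_commute = seminorm_minus_commute[OF seminorm]
  and N_triangle = seminorm_triangle[OF seminorm]
  and N_diff = seminorm_diff[OF seminorm]
  and N_star = seminorm_star[OF seminorm]
  and N_mult_diff = seminorm_mult_diff[OF seminorm]

lemma CS_free: "x \<in> CS \<Longrightarrow> x n \<in> F"
  by (simp add: cauchy_seqs_def)

lemma CS_Cauchy: "x \<in> CS \<Longrightarrow> e > 0 \<Longrightarrow> \<exists>M. \<forall>m\<ge>M. \<forall>n\<ge>M. N (x m - x n) < e"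
  by (simp add: cauchy_seqs_def)

lemma CS_I:
  "(\<And>n. x n \<in> F) \<Longrightarrow> (\<And>e. e > 0 \<Longrightarrow> \<exists>M. \<forall>m\<ge>M. \<forall>n\<ge>M. N (x m - x n) < e) \<Longrightarrow> x \<in> CS"
  by (simp add: cauchy_seqs_def)

lemma CS_convergent_N: assumes x: "x \<in> CS" shows "convergent (\<lambda>n. N (x n))"
proof -
  have "Cauchy (\<lambda>n. N (x n))"
  proof (rule metric_CauchyI)
    fix e :: real assume "e > 0"
    then obtain M where M: "\<forall>m\<ge>M. \<forall>n\<ge>M. N (x m - x n) < e" using CS_Cauchy[OF x] by blast
    have "dist (N (x m)) (N (x n)) < e" if "m \<ge> M" "n \<ge> M" for m n
      using N_diff[OF CS_free[OF x] CS_free[OF x], of m n] M that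
      by (fastforce simp: dist_real_def)
    then show "\<exists>M. \<forall>m\<ge>M. \<forall>n\<ge>M. dist (N (x m)) (N (x n)) < e" by blast
  qed
  then show ?thesis by (simp add: Cauchy_convergent_iff)
qed

lemma CS_bounded: assumes x: "x \<in> CS" obtains B where "B > 0" "\<And>n. N (x n) \<le> B"
proof -
  obtain B where "B > 0" "\<forall>n. norm (N (x n)) \<le> B"
    using convergent_imp_Bseq[OF CS_convergent_N[OF x]] by (auto simp: Bseq_def)
  then show thesis using that[of B] by (simp add: abs_le_iff)
qed

lemma CS_const [simp]: "a \<in> F \<Longrightarrow> (\<lambda>_. a) \<in> CS"
  by (rule CS_I) auto

text \<open>One criterion for sums, scalar multiples, adjoints and products, since the increments of
  each of them are dominated by those of the given sequences.\<close>

lemma CS_le: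
  assumes x: "x \<in> CS" and y: "y \<in> CS" and z: "\<And>n. z n \<in> F" and B: "B \<ge> 0"
    and le: "\<And>m n. N (z m - z n) \<le> B * N (x m - x n) + B * N (y m - y n)"
  shows "z \<in> CS"
proof (rule CS_I[OF z])
  fix e :: real assume e: "e > 0"
  \<comment> \<open>Adding 1 to \<open>B\<close> makes the division safe for \<open>B = 0\<close>
    and gives 2 * B * d = e - 2 * d, strictly below \<open>e\<close>.\<close>
  define d where "d = e / 2 / (B + 1)"
  have d: "d > 0" using e B by (simp add: d_def)
  obtain M where M: "\<forall>m\<ge>M. \<forall>n\<ge>M. N (x m - x n) < d" using CS_Cauchy[OF x d] by blast
  obtain M' where M': "\<forall>m\<ge>M'. \<forall>n\<ge>M'. N (y m - y n) < d" using CS_Cauchy[OF y d] by blast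
  have "N (z m - z n) < e" if "m \<ge> max M M'" "n \<ge> max M M'" for m n
  proof -
    have "N (z m - z n) \<le> B * N (x m - x n) + B * N (y m - y n)" by (rule le)
    also have "\<dots> \<le> B * d + B * d"
      using M M' that B by (intro add_mono mult_left_mono) (auto intro: less_imp_le)
    also have "\<dots> = e - 2 * d"
    proof -
      have "B + 1 \<noteq> 0" using B by simp
      then have "(B + 1) * d = e / 2" unfolding d_def by (rule nonzero_mult_div_cancel_left[of "B + 1" "e / 2", unfolded times_divide_eq_right[symmetric]])
      then show ?thesis by (simp add: algebra_simps)
    qed
    also have "\<dots> < e" using d by simp
    finally show ?thesis .
  qed
  then show "\<exists>M. \<forall>m\<ge>M. \<forall>n\<ge>M. N (z m - z n) < e" by blast
qed

lemma CS_add [simp]: assumes "x \<in> CS" "y \<in> CS" shows "(\<lambda>n. x n + y n) \<in> CS"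
proof (rule CS_le[OF assms, of _ 1])
  fix m n
  show "N (x m + y m - (x n + y n)) \<le> 1 * N (x m - x n) + 1 * N (y m - y n)"
    using N_add[of "x m - x n" "y m - y n"] assms by (simp add: CS_free algebra_simps)
qed (use assms in \<open>auto simp: CS_free\<close>)

lemma CS_scale [simp]: assumes "x \<in> CS" shows "(\<lambda>n. scale c (x n)) \<in> CS"
proof (rule CS_le[OF assms assms, of _ "cmod c"])
  fix m n
  show "N (scale c (x m) - scale c (x n)) \<le> cmod c * N (x m - x n) + cmod c * N (x m - x n)"
    using assms by (simp add: CS_free scale_minus[symmetric] N_scale N_nonneg)
qed (use assms in \<open>auto simp: CS_free\<close>)

lemma CS_minus [simp]: assumes "x \<in> CS" "y \<in> CS" shows "(\<lambda>n. x n - y n) \<in> CS"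
  using CS_add[OF assms(1) CS_scale[OF assms(2), of "-1"]] by (simp add: scale_minus_one)

lemma CS_uminus [simp]: "x \<in> CS \<Longrightarrow> (\<lambda>n. - x n) \<in> CS"
  using CS_minus[of "\<lambda>_. 0" x] by simp

lemma CS_star [simp]: assumes "x \<in> CS" shows "(\<lambda>n. star (x n)) \<in> CS"
proof (rule CS_le[OF assms assms, of _ 1])
  fix m n
  show "N (star (x m) - star (x n)) \<le> 1 * N (x m - x n) + 1 * N (x m - x n)"
    using assms by (simp add: CS_free star_minus[symmetric] N_star N_nonneg)
qed (use assms in \<open>auto simp: CS_free\<close>)

lemma CS_mult [simp]: assumes "x \<in> CS" "y \<in> CS" shows "(\<lambda>n. x n * y n) \<in> CS"
proof -
  obtain B where B: "B > 0" "\<And>n. N (x n) \<le> B" using CS_bounded[OF assms(1)] by blast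
  obtain B' where B': "B' > 0" "\<And>n. N (y n) \<le> B'" using CS_bounded[OF assms(2)] by blast
  show ?thesis
  proof (rule CS_le[OF assms, of _ "max B B'"])
    fix m n
    have "N (x m * y m - x n * y n) \<le> N (x m) * N (y m - y n) + N (x m - x n) * N (y n)"
      using assms by (intro N_mult_diff) (auto simp: CS_free)
    also have "\<dots> \<le> max B B' * N (y m - y n) + N (x m - x n) * max B B'"
      using assms B(1) B(2)[of m] B'(2)[of n]
      by (intro add_mono mult_mono) (auto simp: CS_free N_nonneg le_max_iff_disj)
    finally show "N (x m * y m - x n * y n) \<le> max B B' * N (x m - x n) + max B B' * N (y m - y n)"
      by (simp add: mult.commute)
  qed (use assms B in \<open>auto simp: CS_free\<close>)
qed

text \<open>Equality of classes, with both memberships built in so that the congruence lemmas chain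
  without side conditions.\<close>

definition near :: "(nat \<Rightarrow> 'g star_poly) \<Rightarrow> (nat \<Rightarrow> 'g star_poly) \<Rightarrow> bool" where
  "near x y \<longleftrightarrow> x \<in> CS \<and> y \<in> CS \<and> (\<lambda>n. N (x n - y n)) \<longlonglongrightarrow> 0"

lemma near_refl [simp]: "x \<in> CS \<Longrightarrow> near x x"
  by (simp add: near_def)

lemma near_sym: "near x y \<Longrightarrow> near y x"
  using N_minus_commute[OF CS_free CS_free] by (simp add: near_def)

lemma near_I:
  assumes "x \<in> CS" "y \<in> CS" "B \<longlonglongrightarrow> 0" "\<And>n. N (x n - y n) \<le> B n"
  shows "near x y"
proof -
  have "(\<lambda>n. N (x n - y n)) \<longlonglongrightarrow> 0"
    by (rule Lim_null_comparison[OF always_eventually assms(3)])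
      (use assms in \<open>simp add: N_nonneg CS_free\<close>)
  then show ?thesis using assms by (simp add: near_def)
qed

lemma near_trans: assumes "near x y" "near y z" shows "near x z"
proof (rule near_I)
  show "(\<lambda>n. N (x n - y n) + N (y n - z n)) \<longlonglongrightarrow> 0"
    using tendsto_add[of "\<lambda>n. N (x n - y n)" 0 _ "\<lambda>n. N (y n - z n)" 0] assms by (simp add: near_def)
  show "N (x n - z n) \<le> N (x n - y n) + N (y n - z n)" for n
    using assms by (intro N_triangle) (auto simp: near_def CS_free)
qed (use assms in \<open>auto simp: near_def\<close>)

lemma mem_cl_iff: "x \<in> CS \<Longrightarrow> y \<in> cl x \<longleftrightarrow> near x y"
  by (auto simp: seq_class_def near_def)

lemma cl_eq_iff: assumes "x \<in> CS" "y \<in> CS" shows "cl x = cl y \<longleftrightarrow> near x y"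
proof
  assume "cl x = cl y"
  then have "y \<in> cl x" using mem_cl_iff[OF assms(2), of y] assms by simp
  then show "near x y" using mem_cl_iff assms by blast
next
  assume "near x y"
  then have "near x z \<longleftrightarrow> near y z" for z using near_trans near_sym by blast
  then show "cl x = cl y" using mem_cl_iff assms by blast
qed

lemma near_seq_rep: assumes "x \<in> CS" shows "near x (seq_rep (cl x))"
proof -
  have "x \<in> cl x" using mem_cl_iff[OF assms, of x] assms by simp
  then have "seq_rep (cl x) \<in> cl x" unfolding seq_rep_def by (rule someI[of "\<lambda>z. z \<in> cl x"])
  then show ?thesis using mem_cl_iff[OF assms] by simp
qed

lemma near_add: assumes "near x x'" "near y y'" shows "near (\<lambda>n. x n + y n) (\<lambda>n. x' n + y' n)"
proof (rule near_I)
  show "(\<lambda>n. N (x n - x' n) + N (y n - y' n)) \<longlonglongrightarrow> 0"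
    using tendsto_add[of "\<lambda>n. N (x n - x' n)" 0 _ "\<lambda>n. N (y n - y' n)" 0] assms by (simp add: near_def)
  show "N (x n + y n - (x' n + y' n)) \<le> N (x n - x' n) + N (y n - y' n)" for n
    using N_add[of "x n - x' n" "y n - y' n"] assms by (simp add: near_def CS_free algebra_simps)
qed (use assms in \<open>auto simp: near_def\<close>)

lemma near_scale: assumes "near x x'" shows "near (\<lambda>n. scale c (x n)) (\<lambda>n. scale c (x' n))"
proof (rule near_I)
  show "(\<lambda>n. cmod c * N (x n - x' n)) \<longlonglongrightarrow> 0"
    using assms unfolding near_def by (intro tendsto_mult_right_zero) blast
  show "N (scale c (x n) - scale c (x' n)) \<le> cmod c * N (x n - x' n)" for n
    using assms by (simp add: near_def CS_free scale_minus[symmetric] N_scale)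
qed (use assms in \<open>auto simp: near_def\<close>)

lemma near_star: assumes "near x x'" shows "near (\<lambda>n. star (x n)) (\<lambda>n. star (x' n))"
proof (rule near_I)
  show "(\<lambda>n. N (x n - x' n)) \<longlonglongrightarrow> 0"
    using assms unfolding near_def by blast
  show "N (star (x n) - star (x' n)) \<le> N (x n - x' n)" for n
    using assms by (simp add: near_def CS_free star_minus[symmetric] N_star)
qed (use assms in \<open>auto simp: near_def\<close>)

lemma near_mult: assumes "near x x'" "near y y'" shows "near (\<lambda>n. x n * y n) (\<lambda>n. x' n * y' n)"
proof -
  have CS: "x \<in> CS" "x' \<in> CS" "y \<in> CS" "y' \<in> CS" using assms by (auto simp: near_def)
  obtain B where B: "B > 0" "\<And>n. N (x n) \<le> B" using CS_bounded[OF CS(1)] by blast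
  obtain B' where B': "B' > 0" "\<And>n. N (y' n) \<le> B'" using CS_bounded[OF CS(4)] by blast
  show ?thesis
  proof (rule near_I)
    show "(\<lambda>n. B * N (y n - y' n) + N (x n - x' n) * B') \<longlonglongrightarrow> 0"
      using tendsto_add[OF tendsto_mult_right_zero[of "\<lambda>n. N (y n - y' n)" _ B]
          tendsto_mult_left_zero[of "\<lambda>n. N (x n - x' n)" _ B']] assms
      by (simp add: near_def)
    show "N (x n * y n - x' n * y' n) \<le> B * N (y n - y' n) + N (x n - x' n) * B'" for n
    proof -
      have "N (x n * y n - x' n * y' n) \<le> N (x n) * N (y n - y' n) + N (x n - x' n) * N (y' n)"
        using CS by (intro N_mult_diff) (auto simp: CS_free)
      also have "\<dots> \<le> B * N (y n - y' n) + N (x n - x' n) * B'"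
        using CS B(1) B(2)[of n] B'(2)[of n]
        by (intro add_mono mult_mono) (auto simp: CS_free N_nonneg)
      finally show ?thesis .
    qed
  qed (use CS in auto)
qed

lemma carrier_U: "carrier U = cl ` CS"
  by (simp add: universal_cstar_def)

lemma cl_closed [simp]: "x \<in> CS \<Longrightarrow> cl x \<in> carrier U"
  by (simp add: carrier_U)

lemma U_cases: assumes "X \<in> carrier U" obtains x where "x \<in> CS" "X = cl x"
  using assms by (auto simp: carrier_U)

lemma U_zero: "\<zero>\<^bsub>U\<^esub> = cl (\<lambda>_. 0)"
  by (simp add: universal_cstar_def)

text \<open>The operations of \<open>universal_cstar\<close> act on an arbitrarily chosen member of
  each class. The congruence lemmas make the result independent of the choice, so from here on any
  representative may be used.\<close>

lemma U_add [simp]: "x \<in> CS \<Longrightarrow> y \<in> CS \<Longrightarrow> cl x \<oplus>\<^bsub>U\<^esub> cl y = cl (\<lambda>n. x n + y n)"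
  using near_add[OF near_seq_rep near_seq_rep, of x y, THEN near_sym] cl_eq_iff
  by (simp add: universal_cstar_def near_def)

lemma U_mult [simp]: "x \<in> CS \<Longrightarrow> y \<in> CS \<Longrightarrow> cl x \<otimes>\<^bsub>U\<^esub> cl y = cl (\<lambda>n. x n * y n)"
  using near_mult[OF near_seq_rep near_seq_rep, of x y, THEN near_sym] cl_eq_iff
  by (simp add: universal_cstar_def near_def)

lemma U_smult [simp]: "x \<in> CS \<Longrightarrow> c \<odot>\<^bsub>U\<^esub> cl x = cl (\<lambda>n. scale c (x n))"
  using near_scale[OF near_seq_rep, of x c, THEN near_sym] cl_eq_iff
  by (simp add: universal_cstar_def near_def)

lemma U_adj [simp]: "x \<in> CS \<Longrightarrow> adj U (cl x) = cl (\<lambda>n. star (x n))"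
  using near_star[OF near_seq_rep, of x, THEN near_sym] cl_eq_iff
  by (simp add: universal_cstar_def near_def)

text \<open>The norm is defined as a limit along a chosen representative; along any other one the
  seminorms differ by a null sequence.\<close>

lemma U_nrm: assumes x: "x \<in> CS" shows "(\<lambda>n. N (x n)) \<longlonglongrightarrow> nrm U (cl x)"
proof -
  let ?y = "seq_rep (cl x)"
  have near: "near x ?y" by (rule near_seq_rep[OF x])
  have "(\<lambda>n. N (?y n)) \<longlonglongrightarrow> lim (\<lambda>n. N (?y n))"
    using CS_convergent_N near by (simp add: near_def convergent_LIMSEQ_iff)
  moreover have "(\<lambda>n. N (x n) - N (?y n)) \<longlonglongrightarrow> 0"
    by (rule Lim_null_comparison[of _ "\<lambda>n. N (x n - ?y n)"])
      (use near N_diff CS_free in \<open>auto simp: near_def\<close>)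
  ultimately have "(\<lambda>n. N (x n) - N (?y n) + N (?y n)) \<longlonglongrightarrow> 0 + lim (\<lambda>n. N (?y n))"
    by (intro tendsto_add)
  then show ?thesis by (simp add: universal_cstar_def)
qed

lemma U_nrm_eqI: "x \<in> CS \<Longrightarrow> (\<lambda>n. N (x n)) \<longlonglongrightarrow> l \<Longrightarrow> nrm U (cl x) = l"
  using U_nrm LIMSEQ_unique by blast

lemma abelian_group_U: "abelian_group U"
proof (rule abelian_groupI)
  fix X assume "X \<in> carrier U"
  then obtain x where "x \<in> CS" "X = cl x" by (rule U_cases)
  then show "\<exists>Y\<in>carrier U. Y \<oplus>\<^bsub>U\<^esub> X = \<zero>\<^bsub>U\<^esub>"
    by (intro bexI[of _ "cl (\<lambda>n. - x n)"]) (simp_all add: U_zero)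
qed (auto elim!: U_cases simp: U_zero add_ac)

lemma U_minus [simp]: assumes "x \<in> CS" "y \<in> CS" shows "cl x \<ominus>\<^bsub>U\<^esub> cl y = cl (\<lambda>n. x n - y n)"
proof -
  interpret abelian_group U by (rule abelian_group_U)
  have "\<ominus>\<^bsub>U\<^esub> cl y = cl (\<lambda>n. - y n)"
    by (rule minus_equality) (use assms in \<open>simp_all add: U_zero\<close>)
  then show ?thesis
    using assms by (simp add: minus_eq)
qed

lemma module_U: "module complex_ring U"
  by (rule moduleI[OF cring_complex_ring abelian_group_U])
    (auto elim!: U_cases simp: complex_ring_def scale_plus scale_add scale_scale)

lemma U_dist: "x \<in> CS \<Longrightarrow> y \<in> CS \<Longrightarrow> (\<lambda>n. N (x n - y n)) \<longlonglongrightarrow> nrm U (cl x \<ominus>\<^bsub>U\<^esub> cl y)"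
  using U_nrm[of "\<lambda>n. x n - y n"] by simp

lemma U_dist_triangle:
  assumes "x \<in> CS" "y \<in> CS" "z \<in> CS"
  shows "nrm U (cl x \<ominus>\<^bsub>U\<^esub> cl z) \<le> nrm U (cl x \<ominus>\<^bsub>U\<^esub> cl y) + nrm U (cl y \<ominus>\<^bsub>U\<^esub> cl z)"
  by (rule LIMSEQ_le[OF U_dist tendsto_add[OF U_dist U_dist]])
    (use assms in \<open>auto simp: CS_free intro!: N_triangle\<close>)

lemma U_dist_commute:
  assumes "x \<in> CS" "y \<in> CS" shows "nrm U (cl x \<ominus>\<^bsub>U\<^esub> cl y) = nrm U (cl y \<ominus>\<^bsub>U\<^esub> cl x)"
  using U_dist[OF assms] U_dist[OF assms(2,1)] N_minus_commute[OF CS_free CS_free, OF assms] LIMSEQ_unique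
  by simp

lemma U_dist_const:
  assumes "x \<in> CS" "M \<le> k" "\<And>m n. m \<ge> M \<Longrightarrow> n \<ge> M \<Longrightarrow> N (x m - x n) < e"
  shows "nrm U (cl x \<ominus>\<^bsub>U\<^esub> cl (\<lambda>_. x k)) \<le> e"
proof (rule LIMSEQ_le_const2)
  show "(\<lambda>n. N (x n - x k)) \<longlonglongrightarrow> nrm U (cl x \<ominus>\<^bsub>U\<^esub> cl (\<lambda>_. x k))"
    using U_dist[of x "\<lambda>_. x k"] assms(1) by (simp add: CS_free)
  show "\<exists>K. \<forall>n\<ge>K. N (x n - x k) \<le> e"
    using assms(2,3) by (intro exI[of _ M]) (auto intro: less_imp_le)
qed

text \<open>Diagonal argument: each class is replaced by a constant sequence within 1/(k+1) of it,
  and the sequence of these constants is Cauchy and represents the limit.\<close>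

lemma U_complete:
  assumes X: "\<And>n. X n \<in> carrier U"
    and Cauchy: "\<And>e. e > 0 \<Longrightarrow> \<exists>M. \<forall>m\<ge>M. \<forall>n\<ge>M. nrm U (X m \<ominus>\<^bsub>U\<^esub> X n) < e"
  shows "\<exists>x\<in>carrier U. (\<lambda>n. nrm U (X n \<ominus>\<^bsub>U\<^esub> x)) \<longlonglongrightarrow> 0"
proof -
  have "\<forall>k. \<exists>x. x \<in> CS \<and> X k = cl x" using X U_cases by metis
  then obtain xs where xs: "\<And>k. xs k \<in> CS" "\<And>k. X k = cl (xs k)" by metis
  have "\<forall>k. \<exists>M. \<forall>m\<ge>M. \<forall>n\<ge>M. N (xs k m - xs k n) < inverse (real (Suc k))"
    using CS_Cauchy[OF xs(1)] by simp
  then obtain M where M: "\<And>k m n. m \<ge> M k \<Longrightarrow> n \<ge> M k \<Longrightarrow> N (xs k m - xs k n) < inverse (real (Suc k))"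
    by metis
  \<comment> \<open>\<open>M k\<close> is an index at which the k-th representing sequence has
    settled to precision 1/(k+1).\<close>
  define y where "y k = xs k (M k)" for k
  have yF: "y k \<in> F" for k unfolding y_def using xs(1) by (rule CS_free)
  have yX: "nrm U (X k \<ominus>\<^bsub>U\<^esub> cl (\<lambda>_. y k)) \<le> inverse (real (Suc k))" for k
    unfolding xs(2) y_def by (rule U_dist_const[of _ "M k"]) (use xs M in auto)
  have yN: "N (y k - y l) \<le> inverse (real (Suc k)) + nrm U (X k \<ominus>\<^bsub>U\<^esub> X l) + inverse (real (Suc l))" for k l
  proof -
    have "N (y k - y l) = nrm U (cl (\<lambda>_. y k) \<ominus>\<^bsub>U\<^esub> cl (\<lambda>_. y l))"
      using U_nrm_eqI[of "\<lambda>_. y k - y l" "N (y k - y l)"] yF by simp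
    also have "\<dots> \<le> nrm U (cl (\<lambda>_. y k) \<ominus>\<^bsub>U\<^esub> X k) + nrm U (X k \<ominus>\<^bsub>U\<^esub> cl (\<lambda>_. y l))"
      unfolding xs(2) using xs yF by (intro U_dist_triangle) auto
    also have "nrm U (X k \<ominus>\<^bsub>U\<^esub> cl (\<lambda>_. y l)) \<le> nrm U (X k \<ominus>\<^bsub>U\<^esub> X l) + nrm U (X l \<ominus>\<^bsub>U\<^esub> cl (\<lambda>_. y l))"
      unfolding xs(2) using xs yF by (intro U_dist_triangle) auto
    also have "nrm U (cl (\<lambda>_. y k) \<ominus>\<^bsub>U\<^esub> X k) = nrm U (X k \<ominus>\<^bsub>U\<^esub> cl (\<lambda>_. y k))"
      unfolding xs(2) using xs yF by (intro U_dist_commute) auto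
    finally show ?thesis using yX[of k] yX[of l] by linarith
  qed
  have "y \<in> CS"
  proof (rule CS_I[OF yF])
    fix e :: real assume e: "e > 0"
    obtain K where K: "\<forall>m\<ge>K. \<forall>n\<ge>K. nrm U (X m \<ominus>\<^bsub>U\<^esub> X n) < e/3" using Cauchy[of "e/3"] e by auto
    obtain K' where K': "inverse (real (Suc K')) < e/3" using reals_Archimedean[of "e/3"] e by auto
    have "N (y k - y l) < e" if "k \<ge> max K K'" "l \<ge> max K K'" for k l
    proof -
      have "inverse (real (Suc k)) \<le> inverse (real (Suc K'))" "inverse (real (Suc l)) \<le> inverse (real (Suc K'))"
        using that by (auto intro!: le_imp_inverse_le)
      moreover have "nrm U (X k \<ominus>\<^bsub>U\<^esub> X l) < e/3" using K that by simp
      ultimately show ?thesis using yN[of k l] K' by linarith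
    qed
    then show "\<exists>M. \<forall>m\<ge>M. \<forall>n\<ge>M. N (y m - y n) < e" by blast
  qed
  have lim: "(\<lambda>n. nrm U (X n \<ominus>\<^bsub>U\<^esub> cl y)) \<longlonglongrightarrow> 0"
  proof (rule LIMSEQ_I)
    fix e :: real assume e: "e > 0"
    obtain K where K: "\<And>m n. m \<ge> K \<Longrightarrow> n \<ge> K \<Longrightarrow> N (y m - y n) < e/3"
      using CS_Cauchy[OF \<open>y \<in> CS\<close>, of "e/3"] e by auto
    obtain K' where K': "inverse (real (Suc K')) < e/3" using reals_Archimedean[of "e/3"] e by auto
    have "norm (nrm U (X n \<ominus>\<^bsub>U\<^esub> cl y) - 0) < e" if n: "n \<ge> max K K'" for n
    proof -
      have "nrm U (X n \<ominus>\<^bsub>U\<^esub> cl y) \<le> nrm U (X n \<ominus>\<^bsub>U\<^esub> cl (\<lambda>_. y n)) + nrm U (cl (\<lambda>_. y n) \<ominus>\<^bsub>U\<^esub> cl y)"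
        unfolding xs(2) using xs yF \<open>y \<in> CS\<close> by (intro U_dist_triangle) auto
      also have "nrm U (cl (\<lambda>_. y n) \<ominus>\<^bsub>U\<^esub> cl y) = nrm U (cl y \<ominus>\<^bsub>U\<^esub> cl (\<lambda>_. y n))"
        using yF \<open>y \<in> CS\<close> by (intro U_dist_commute) auto
      also have "\<dots> \<le> e/3"
        by (rule U_dist_const[of _ K]) (use \<open>y \<in> CS\<close> n K in auto)
      finally have "nrm U (X n \<ominus>\<^bsub>U\<^esub> cl y) \<le> inverse (real (Suc n)) + e/3" using yX[of n] by linarith
      moreover have "inverse (real (Suc n)) \<le> inverse (real (Suc K'))"
        using n by (auto intro!: le_imp_inverse_le)
      moreover have "0 \<le> nrm U (X n \<ominus>\<^bsub>U\<^esub> cl y)"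
        unfolding xs(2) by (rule LIMSEQ_le_const[OF U_dist])
          (use xs \<open>y \<in> CS\<close> in \<open>auto simp: N_nonneg CS_free\<close>)
      moreover have "inverse (real (Suc n)) + e/3 < e"
        using \<open>inverse (real (Suc n)) \<le> inverse (real (Suc K'))\<close> K' e by linarith
      ultimately show ?thesis by (simp del: of_nat_Suc)
    qed
    then show "\<exists>no. \<forall>n\<ge>no. norm (nrm U (X n \<ominus>\<^bsub>U\<^esub> cl y) - 0) < e" by blast
  qed
  then show ?thesis using \<open>y \<in> CS\<close> by (intro bexI[of _ "cl y"]) auto
qed

text \<open>Algebraic laws hold termwise in the free algebra, and the norm laws pass from the
  seminorm to limits. Definiteness is built into the equality of classes.\<close>

theorem cstar_algebra_U: "cstar_algebra U"
proof (rule cstar_algebra.intro[OF module_U], rule cstar_algebra_axioms.intro)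
  fix X assume "X \<in> carrier U"
  then obtain x where x: "x \<in> CS" "X = cl x" by (rule U_cases)
  show "0 \<le> nrm U X"
    unfolding x(2) by (rule LIMSEQ_le_const[OF U_nrm[OF x(1)]]) (simp add: N_nonneg CS_free[OF x(1)])
  have "nrm U X = 0 \<longleftrightarrow> (\<lambda>n. N (x n)) \<longlonglongrightarrow> 0"
    unfolding x(2) using U_nrm[OF x(1)] U_nrm_eqI[OF x(1), of 0] by metis
  also have "\<dots> \<longleftrightarrow> X = \<zero>\<^bsub>U\<^esub>"
    unfolding x(2) U_zero using x(1) by (subst cl_eq_iff) (auto simp: near_def)
  finally show "nrm U X = 0 \<longleftrightarrow> X = \<zero>\<^bsub>U\<^esub>" .
  show "nrm U (c \<odot>\<^bsub>U\<^esub> X) = cmod c * nrm U X" for c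
    unfolding x(2) U_smult[OF x(1)]
    by (rule U_nrm_eqI) (use x U_nrm in \<open>auto simp: N_scale CS_free intro: tendsto_mult_left\<close>)
  show "nrm U (adj U X \<otimes>\<^bsub>U\<^esub> X) = (nrm U X)\<^sup>2"
    unfolding x(2) U_adj[OF x(1)] U_mult[OF CS_star[OF x(1)] x(1)]
    by (rule U_nrm_eqI) (use x U_nrm in \<open>auto simp: N_star_mult CS_free intro: tendsto_power\<close>)
  fix Y assume "Y \<in> carrier U"
  then obtain y where y: "y \<in> CS" "Y = cl y" by (rule U_cases)
  show "nrm U (X \<oplus>\<^bsub>U\<^esub> Y) \<le> nrm U X + nrm U Y"
    unfolding x(2) y(2) U_add[OF x(1) y(1)]
    by (rule LIMSEQ_le[OF U_nrm tendsto_add[OF U_nrm U_nrm]]) (use x y in \<open>auto simp: CS_free intro!: N_add\<close>)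
  show "nrm U (X \<otimes>\<^bsub>U\<^esub> Y) \<le> nrm U X * nrm U Y"
    unfolding x(2) y(2) U_mult[OF x(1) y(1)]
    by (rule LIMSEQ_le[OF U_nrm tendsto_mult[OF U_nrm U_nrm]]) (use x y in \<open>auto simp: CS_free intro!: N_mult\<close>)
next
  fix X :: "nat \<Rightarrow> _"
  assume "\<And>n. X n \<in> carrier U" "\<And>e. e > 0 \<Longrightarrow> \<exists>M. \<forall>m\<ge>M. \<forall>n\<ge>M. nrm U (X m \<ominus>\<^bsub>U\<^esub> X n) < e"
  then show "\<exists>x\<in>carrier U. (\<lambda>n. nrm U (X n \<ominus>\<^bsub>U\<^esub> x)) \<longlonglongrightarrow> 0" by (rule U_complete)
qed (auto elim!: U_cases simp: mult.assoc distrib_left distrib_right scale_mult_left mult_scale_right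
    star_add star_scale star_mult)

sublocale U: cstar_algebra U by (rule cstar_algebra_U)

lemma map_eq_cl: "\<iota> x = cl (\<lambda>_. x)"
  by (simp add: universal_map_def)

lemma map_closed [simp]: "x \<in> F \<Longrightarrow> \<iota> x \<in> carrier U"
  by (simp add: map_eq_cl)

lemma map_0 [simp]: "\<iota> 0 = \<zero>\<^bsub>U\<^esub>"
  by (simp add: map_eq_cl U_zero)

lemma map_add: "x \<in> F \<Longrightarrow> y \<in> F \<Longrightarrow> \<iota> (x + y) = \<iota> x \<oplus>\<^bsub>U\<^esub> \<iota> y"
  and map_mult: "x \<in> F \<Longrightarrow> y \<in> F \<Longrightarrow> \<iota> (x * y) = \<iota> x \<otimes>\<^bsub>U\<^esub> \<iota> y"
  and map_minus: "x \<in> F \<Longrightarrow> y \<in> F \<Longrightarrow> \<iota> (x - y) = \<iota> x \<ominus>\<^bsub>U\<^esub> \<iota> y"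
  and map_scale: "x \<in> F \<Longrightarrow> \<iota> (scale c x) = c \<odot>\<^bsub>U\<^esub> \<iota> x"
  and map_star: "x \<in> F \<Longrightarrow> \<iota> (star x) = adj U (\<iota> x)"
  by (simp_all add: map_eq_cl)

lemma map_sum: "(\<And>i. i \<in> I \<Longrightarrow> f i \<in> F) \<Longrightarrow> \<iota> (sum f I) = finsum U (\<lambda>i. \<iota> (f i)) I"
proof (induction I rule: infinite_finite_induct)
  case (insert i I)
  then show ?case by (simp add: map_add U.M.finsum_insert Pi_def)
qed simp_all

lemma nrm_map: "x \<in> F \<Longrightarrow> nrm U (\<iota> x) = N x"
  unfolding map_eq_cl by (rule U_nrm_eqI) auto

lemma map_eq_0_iff: "x \<in> F \<Longrightarrow> \<iota> x = \<zero>\<^bsub>U\<^esub> \<longleftrightarrow> N x = 0"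
  using U.nrm_eq_0[of "\<iota> x"] by (simp add: nrm_map)

text \<open>The terms of a representing sequence, each embedded as a constant sequence, converge to
  the class.\<close>

lemma map_dense: assumes "X \<in> carrier U" obtains x where "\<forall>n. x n \<in> F" "U.conv (\<lambda>n. \<iota> (x n)) X"
proof -
  obtain x where x: "x \<in> CS" "X = cl x" using assms by (rule U_cases)
  have "(\<lambda>n. nrm U (\<iota> (x n) \<ominus>\<^bsub>U\<^esub> X)) \<longlonglongrightarrow> 0"
  proof (rule LIMSEQ_I)
    fix e :: real assume e: "e > 0"
    obtain K where K: "\<And>m n. m \<ge> K \<Longrightarrow> n \<ge> K \<Longrightarrow> N (x m - x n) < e/2"
      using CS_Cauchy[OF x(1), of "e/2"] e by auto
    have "norm (nrm U (\<iota> (x n) \<ominus>\<^bsub>U\<^esub> X) - 0) < e" if "n \<ge> K" for n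
      using U_dist_const[OF x(1) that K] U_dist_commute[of x "\<lambda>_. x n"] x e
        U.nrm_nonneg[of "\<iota> (x n) \<ominus>\<^bsub>U\<^esub> X"]
      by (simp add: map_eq_cl CS_free)
    then show "\<exists>no. \<forall>n\<ge>no. norm (nrm U (\<iota> (x n) \<ominus>\<^bsub>U\<^esub> X) - 0) < e" by blast
  qed
  then show thesis using that[of x] x by (simp add: U.conv_def CS_free)
qed

text \<open>Extension by continuity: a map dominated by the universal norm carries Cauchy sequences
  to convergent ones, and equivalent sequences to the same limit, so the limit along any
  representative defines \<open>h\<close>.\<close>

theorem universal_property:
  assumes B: "cstar_algebra B"
    and closed: "\<And>x. x \<in> F \<Longrightarrow> \<pi> x \<in> carrier B"
    and add: "\<And>x y. x \<in> F \<Longrightarrow> y \<in> F \<Longrightarrow> \<pi> (x + y) = \<pi> x \<oplus>\<^bsub>B\<^esub> \<pi> y"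
    and minus: "\<And>x y. x \<in> F \<Longrightarrow> y \<in> F \<Longrightarrow> \<pi> (x - y) = \<pi> x \<ominus>\<^bsub>B\<^esub> \<pi> y"
    and mult: "\<And>x y. x \<in> F \<Longrightarrow> y \<in> F \<Longrightarrow> \<pi> (x * y) = \<pi> x \<otimes>\<^bsub>B\<^esub> \<pi> y"
    and smult: "\<And>x c. x \<in> F \<Longrightarrow> \<pi> (scale c x) = c \<odot>\<^bsub>B\<^esub> \<pi> x"
    and adj: "\<And>x. x \<in> F \<Longrightarrow> \<pi> (star x) = adj B (\<pi> x)"
    and le: "\<And>x. x \<in> F \<Longrightarrow> nrm B (\<pi> x) \<le> N x"
  obtains h where "star_hom U B h" "\<And>x. x \<in> F \<Longrightarrow> h (\<iota> x) = \<pi> x"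
proof -
  interpret B: cstar_algebra B by (rule B)
  define h where "h X = (THE b. B.conv (\<lambda>n. \<pi> (seq_rep X n)) b)" for X
  have near_conv: "B.conv (\<lambda>n. \<pi> (y n)) b" if xy: "near x y" and x: "B.conv (\<lambda>n. \<pi> (x n)) b" for x y b
  proof (rule B.convI)
    have F: "x n \<in> F" "y n \<in> F" for n using xy by (auto simp: near_def CS_free)
    show "(\<lambda>n. N (x n - y n) + nrm B (\<pi> (x n) \<ominus>\<^bsub>B\<^esub> b)) \<longlonglongrightarrow> 0"
      using tendsto_add[of "\<lambda>n. N (x n - y n)" 0 _ "\<lambda>n. nrm B (\<pi> (x n) \<ominus>\<^bsub>B\<^esub> b)" 0] xy x
      by (simp add: near_def B.conv_def)
    have b: "b \<in> carrier B" using x by (simp add: B.conv_def)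
    then show "b \<in> carrier B" "\<And>n. \<pi> (y n) \<in> carrier B" using F closed by auto
    show "nrm B (\<pi> (y n) \<ominus>\<^bsub>B\<^esub> b) \<le> N (x n - y n) + nrm B (\<pi> (x n) \<ominus>\<^bsub>B\<^esub> b)" for n
    proof -
      have "nrm B (\<pi> (y n) \<ominus>\<^bsub>B\<^esub> b) \<le> nrm B (\<pi> (y n) \<ominus>\<^bsub>B\<^esub> \<pi> (x n)) + nrm B (\<pi> (x n) \<ominus>\<^bsub>B\<^esub> b)"
        using F closed b by (intro B.nrm_triangle_ineq4) auto
      also have "nrm B (\<pi> (y n) \<ominus>\<^bsub>B\<^esub> \<pi> (x n)) \<le> N (x n - y n)"
        using le[of "y n - x n"] F N_minus_commute[of "x n" "y n"] by (simp add: minus)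
      finally show ?thesis by simp
    qed
  qed
  have h: "B.conv (\<lambda>n. \<pi> (x n)) (h (cl x))" if x: "x \<in> CS" for x
  proof -
    have "\<exists>b. B.conv (\<lambda>n. \<pi> (x n)) b"
    proof (rule B.Cauchy_conv)
      fix e :: real assume "e > 0"
      then obtain M where M: "\<forall>m\<ge>M. \<forall>n\<ge>M. N (x m - x n) < e" using CS_Cauchy[OF x] by blast
      have "nrm B (\<pi> (x m) \<ominus>\<^bsub>B\<^esub> \<pi> (x n)) < e" if "m \<ge> M" "n \<ge> M" for m n
        using le[of "x m - x n"] M that x by (fastforce simp: minus CS_free)
      then show "\<exists>M. \<forall>m\<ge>M. \<forall>n\<ge>M. nrm B (\<pi> (x m) \<ominus>\<^bsub>B\<^esub> \<pi> (x n)) < e" by blast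
    qed (use x closed in \<open>simp add: CS_free\<close>)
    then obtain b where b: "B.conv (\<lambda>n. \<pi> (x n)) b" by blast
    have "B.conv (\<lambda>n. \<pi> (seq_rep (cl x) n)) b" by (rule near_conv[OF near_seq_rep[OF x] b])
    then have "h (cl x) = b" unfolding h_def using B.conv_unique by blast
    with b show ?thesis by simp
  qed
  have h_eqI: "h (cl x) = b" if "x \<in> CS" "B.conv (\<lambda>n. \<pi> (x n)) b" for x b
    using h that B.conv_unique by blast
  have "star_hom U B h"
    unfolding star_hom_def
  proof (intro conjI ballI allI Pi_I)
    fix X assume "X \<in> carrier U"
    then obtain x where x: "x \<in> CS" "X = cl x" by (rule U_cases)
    show "h X \<in> carrier B" using h[OF x(1)] x(2) by (simp add: B.conv_def)
    show "h (adj U X) = adj B (h X)"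
      unfolding x(2) U_adj[OF x(1)]
      using B.conv_adj[OF h[OF x(1)]] x(1) by (intro h_eqI) (auto simp: adj CS_free)
    show "h (c \<odot>\<^bsub>U\<^esub> X) = c \<odot>\<^bsub>B\<^esub> h X" for c
      unfolding x(2) U_smult[OF x(1)]
      using B.conv_smult[OF h[OF x(1)]] x(1) by (intro h_eqI) (auto simp: smult CS_free)
    fix Y assume "Y \<in> carrier U"
    then obtain y where y: "y \<in> CS" "Y = cl y" by (rule U_cases)
    show "h (X \<oplus>\<^bsub>U\<^esub> Y) = h X \<oplus>\<^bsub>B\<^esub> h Y"
      unfolding x(2) y(2) U_add[OF x(1) y(1)]
      using B.conv_add[OF h[OF x(1)] h[OF y(1)]] x(1) y(1) by (intro h_eqI) (auto simp: add CS_free)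
    show "h (X \<otimes>\<^bsub>U\<^esub> Y) = h X \<otimes>\<^bsub>B\<^esub> h Y"
      unfolding x(2) y(2) U_mult[OF x(1) y(1)]
      using B.conv_mult[OF h[OF x(1)] h[OF y(1)]] x(1) y(1) by (intro h_eqI) (auto simp: mult CS_free)
  qed
  moreover have "h (\<iota> x) = \<pi> x" if "x \<in> F" for x
    unfolding map_eq_cl by (rule h_eqI) (use that closed B.conv_const in auto)
  ultimately show thesis by (rule that)
qed

end

section \<open>The minimal unitization\<close>

lemma real_le_mult_cancel_sq: "(a::real) * a \<le> b * a \<Longrightarrow> 0 \<le> a \<Longrightarrow> 0 \<le> b \<Longrightarrow> a \<le> b"
  by (cases "a = 0") auto

context cstar_algebra
begin

text \<open>The left multiplication on the algebra by a + k1, for which the pair (a, k) stands.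
  Elements of the unitization are compared through this action.\<close>

definition lact :: "'a \<times> complex \<Rightarrow> 'a \<Rightarrow> 'a" where
  "lact x b = fst x \<otimes> b \<oplus> snd x \<odot> b"

lemma lact_closed [simp]: "fst x \<in> carrier A \<Longrightarrow> b \<in> carrier A \<Longrightarrow> lact x b \<in> carrier A"
  by (simp add: lact_def)

lemma nrm_lact_le:
  assumes "fst x \<in> carrier A" "b \<in> carrier A"
  shows "nrm A (lact x b) \<le> (nrm A (fst x) + cmod (snd x)) * nrm A b"
proof -
  have "nrm A (lact x b) \<le> nrm A (fst x \<otimes> b) + nrm A (snd x \<odot> b)"
    unfolding lact_def using assms by (intro nrm_triangle) auto
  also have "\<dots> \<le> nrm A (fst x) * nrm A b + cmod (snd x) * nrm A b"
    using assms by (intro add_mono nrm_mult) (auto simp: nrm_smult)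
  finally show ?thesis by (simp add: distrib_right)
qed

definition opn :: "'a \<times> complex \<Rightarrow> real" where
  "opn x = (SUP b\<in>{b\<in>carrier A. nrm A b \<le> 1}. nrm A (lact x b))"

lemma bdd_opn: "fst x \<in> carrier A \<Longrightarrow> bdd_above ((\<lambda>b. nrm A (lact x b)) ` {b\<in>carrier A. nrm A b \<le> 1})"
proof (rule bdd_aboveI2)
  fix b assume x: "fst x \<in> carrier A" and b: "b \<in> {b\<in>carrier A. nrm A b \<le> 1}"
  have "nrm A (lact x b) \<le> (nrm A (fst x) + cmod (snd x)) * nrm A b"
    using x b by (intro nrm_lact_le) auto
  also have "\<dots> \<le> (nrm A (fst x) + cmod (snd x)) * 1"
    using x b by (intro mult_left_mono) (auto simp: nrm_nonneg)
  finally show "nrm A (lact x b) \<le> nrm A (fst x) + cmod (snd x)" by simp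
qed

lemma le_opn1: "fst x \<in> carrier A \<Longrightarrow> b \<in> carrier A \<Longrightarrow> nrm A b \<le> 1 \<Longrightarrow> nrm A (lact x b) \<le> opn x"
  unfolding opn_def by (rule cSUP_upper[OF _ bdd_opn]) auto

lemma opn_leI: "(\<And>b. b \<in> carrier A \<Longrightarrow> nrm A b \<le> 1 \<Longrightarrow> nrm A (lact x b) \<le> M) \<Longrightarrow> opn x \<le> M"
  unfolding opn_def by (rule cSUP_least) (auto intro!: exI[of _ \<zero>])

lemma lact_smult: "fst x \<in> carrier A \<Longrightarrow> b \<in> carrier A \<Longrightarrow> lact x (c \<odot> b) = c \<odot> lact x b"
  by (simp add: lact_def smult_mult_right smult_add smult_times[symmetric] mult.commute)

lemma lact_zero [simp]: "fst x \<in> carrier A \<Longrightarrow> lact x \<zero> = \<zero>"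
  by (simp add: lact_def)

lemma opn_nonneg: "fst x \<in> carrier A \<Longrightarrow> 0 \<le> opn x"
  using le_opn1[of x \<zero>] by simp

lemma le_opn: assumes "fst x \<in> carrier A" "b \<in> carrier A" shows "nrm A (lact x b) \<le> opn x * nrm A b"
proof (cases "nrm A b = 0")
  case True
  then show ?thesis using assms nrm_eq_0 by auto
next
  case False
  then have pos: "nrm A b > 0" using nrm_nonneg[OF assms(2)] by simp
  let ?c = "complex_of_real (1 / nrm A b)"
  have "nrm A (lact x (?c \<odot> b)) \<le> opn x"
    by (rule le_opn1) (use assms pos in \<open>auto simp: nrm_smult norm_divide\<close>)
  then show ?thesis
    using assms pos by (simp add: lact_smult nrm_smult norm_divide divide_le_eq)
qed

text \<open>Testing on the adjoint of \<open>a\<close> gives the lower bound, since by the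
  C*-identity the product has the squared norm of \<open>a\<close>.\<close>

lemma opn_fst: assumes "a \<in> carrier A" shows "opn (a, 0) = nrm A a"
proof (rule antisym)
  show "opn (a, 0) \<le> nrm A a"
  proof (rule opn_leI)
    fix b assume b: "b \<in> carrier A" "nrm A b \<le> 1"
    have "nrm A (a \<otimes> b) \<le> nrm A a * nrm A b" using assms b by (intro nrm_mult) auto
    also have "\<dots> \<le> nrm A a * 1" using b assms by (intro mult_left_mono) (auto simp: nrm_nonneg)
    finally show "nrm A (lact (a, 0) b) \<le> nrm A a" using assms b by (simp add: lact_def)
  qed
  have "nrm A a * nrm A a = nrm A (a \<otimes> adj A a)"
    using cstar_identity[of "adj A a"] assms by (simp add: adj_adj nrm_adj power2_eq_square)
  also have "\<dots> \<le> opn (a, 0) * nrm A a"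
    using le_opn[of "(a, 0)" "adj A a"] assms by (simp add: lact_def nrm_adj)
  finally show "nrm A a \<le> opn (a, 0)"
    by (rule real_le_mult_cancel_sq) (use assms in \<open>auto simp: nrm_nonneg opn_nonneg\<close>)
qed

text \<open>If k were nonzero, - a / k would be a left unit; a left unit is selfadjoint and hence
  two-sided, against the assumption.\<close>

lemma lact_eq_0_imp:
  assumes nonunital: "\<nexists>e. is_unit A e" and a: "a \<in> carrier A"
    and zero: "\<And>b. b \<in> carrier A \<Longrightarrow> lact (a, k) b = \<zero>"
  shows "a = \<zero> \<and> k = 0"
proof -
  have "k = 0"
  proof (rule ccontr)
    assume k: "k \<noteq> 0"
    define e where "e = (- 1 / k) \<odot> a"
    have e: "e \<in> carrier A" using a by (simp add: e_def)
    have left: "e \<otimes> b = b" if b: "b \<in> carrier A" for b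
    proof -
      have "a \<otimes> b = \<ominus> (k \<odot> b)"
        using zero[OF b] a b by (intro M.minus_equality[symmetric]) (auto simp: lact_def)
      then show ?thesis
        using a b k by (simp add: e_def smult_mult_left smult_a_inv smult_uminus a_inv_mult smult_times[symmetric])
    qed
    \<comment> \<open>\<open>e \<otimes> adj A e\<close> is selfadjoint and equals
      \<open>adj A e\<close>.\<close>
    have "adj A e = e"
      using left[of "adj A e"] adj_mult[of e "adj A e"] e left[of e] by (simp add: adj_adj)
    then have "b \<otimes> e = b" if "b \<in> carrier A" for b
      using left[of "adj A b"] adj_mult[of e "adj A b"] that e by (simp add: adj_adj)
    then have "is_unit A e" using left e by (simp add: is_unit_def)
    then show False using nonunital by blast
  qed
  then have "a \<otimes> adj A a = \<zero>" using zero[of "adj A a"] a by (simp add: lact_def)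
  then have "nrm A (adj A (adj A a) \<otimes> adj A a) = 0" using a by (simp add: adj_adj)
  then have "nrm A a = 0" using cstar_identity[of "adj A a"] a by (simp add: nrm_adj)
  then show ?thesis using \<open>k = 0\<close> a by (simp add: nrm_eq_0)
qed

abbreviation (input) "MU \<equiv> min_unitization A"

lemma MU_carrier_iff:
  "x \<in> carrier MU \<longleftrightarrow> fst x \<in> carrier A \<and> ((\<exists>e. is_unit A e) \<longrightarrow> snd x = 0)"
  by (auto simp: min_unitization_def mem_Times_iff)

lemma MU_carrier: "x \<in> carrier MU \<Longrightarrow> fst x \<in> carrier A"
  by (auto simp: min_unitization_def split: if_splits)

lemma MU_ops:
  "x \<otimes>\<^bsub>MU\<^esub> y = (fst x \<otimes> fst y \<oplus> snd y \<odot> fst x \<oplus> snd x \<odot> fst y, snd x * snd y)"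
  "x \<oplus>\<^bsub>MU\<^esub> y = (fst x \<oplus> fst y, snd x + snd y)"
  "c \<odot>\<^bsub>MU\<^esub> x = (c \<odot> fst x, c * snd x)"
  "adj MU x = (adj A (fst x), cnj (snd x))"
  "\<zero>\<^bsub>MU\<^esub> = (\<zero>, 0)"
  "nrm MU x = opn x"
  by (cases x; cases y; simp add: min_unitization_def opn_def lact_def)+

lemma MU_closed [simp, intro]:
  "x \<in> carrier MU \<Longrightarrow> y \<in> carrier MU \<Longrightarrow> x \<otimes>\<^bsub>MU\<^esub> y \<in> carrier MU"
  "x \<in> carrier MU \<Longrightarrow> y \<in> carrier MU \<Longrightarrow> x \<oplus>\<^bsub>MU\<^esub> y \<in> carrier MU"
  "x \<in> carrier MU \<Longrightarrow> c \<odot>\<^bsub>MU\<^esub> x \<in> carrier MU"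
  "x \<in> carrier MU \<Longrightarrow> adj MU x \<in> carrier MU"
  "\<zero>\<^bsub>MU\<^esub> \<in> carrier MU"
  unfolding MU_ops by (auto simp: MU_carrier_iff)

lemma abelian_group_MU: "abelian_group MU"
proof (rule abelian_groupI)
  fix x assume x: "x \<in> carrier MU"
  show "\<exists>y\<in>carrier MU. y \<oplus>\<^bsub>MU\<^esub> x = \<zero>\<^bsub>MU\<^esub>"
    by (rule bexI[of _ "(\<ominus> fst x, - snd x)"])
      (use x in \<open>auto simp: MU_ops(2,5) MU_carrier_iff M.l_neg\<close>)
qed (auto simp: MU_ops(2,5) MU_carrier_iff M.a_ac)

lemma MU_minus: assumes "x \<in> carrier MU" "y \<in> carrier MU"
  shows "x \<ominus>\<^bsub>MU\<^esub> y = (fst x \<ominus> fst y, snd x - snd y)"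
proof -
  interpret MU: abelian_group MU by (rule abelian_group_MU)
  have "\<ominus>\<^bsub>MU\<^esub> y = (\<ominus> fst y, - snd y)"
    by (rule MU.minus_equality) (use assms in \<open>auto simp: MU_ops(2,5) MU_carrier_iff M.l_neg\<close>)
  then show ?thesis
    using assms MU_carrier by (simp add: MU.minus_eq MU_ops(2) M.minus_eq)
qed

lemma module_MU: "module complex_ring MU"
  by (rule moduleI[OF cring_complex_ring abelian_group_MU])
    (auto simp: complex_ring_def MU_ops(2,3) MU_carrier_iff smult_plus smult_add smult_times algebra_simps)

lemma lact_mult: "fst x \<in> carrier A \<Longrightarrow> fst y \<in> carrier A \<Longrightarrow> b \<in> carrier A \<Longrightarrow>
    lact (x \<otimes>\<^bsub>MU\<^esub> y) b = lact x (lact y b)"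
  by (simp add: lact_def MU_ops(1) distr_left distr_right smult_mult_left smult_mult_right smult_add
      smult_times mult_assoc M.a_ac)

lemma lact_add: "fst x \<in> carrier A \<Longrightarrow> fst y \<in> carrier A \<Longrightarrow> b \<in> carrier A \<Longrightarrow>
    lact (x \<oplus>\<^bsub>MU\<^esub> y) b = lact x b \<oplus> lact y b"
  by (simp add: lact_def MU_ops(2) distr_left smult_plus M.a_ac)

lemma adj_lact: "fst x \<in> carrier A \<Longrightarrow> b \<in> carrier A \<Longrightarrow> c \<in> carrier A \<Longrightarrow>
    adj A (lact x b) \<otimes> c = adj A b \<otimes> lact (adj MU x) c"
  by (simp add: lact_def MU_ops(4) adj_add adj_smult adj_mult distr_left distr_right
      smult_mult_left smult_mult_right mult_assoc)

text \<open>The action separates the elements of the minimal unitization. This is why pairs are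
  restricted to second coordinate 0 when there is a unit e: otherwise (e, -1) would act as
  zero.\<close>

lemma MU_definite: assumes x: "x \<in> carrier MU" and zero: "\<And>b. b \<in> carrier A \<Longrightarrow> lact x b = \<zero>"
  shows "x = \<zero>\<^bsub>MU\<^esub>"
proof (cases "\<exists>e. is_unit A e")
  case True
  then obtain a where a: "x = (a, 0)" "a \<in> carrier A" using x by (auto simp: min_unitization_def)
  have "a \<otimes> adj A a = \<zero>" using zero[of "adj A a"] a by (simp add: lact_def)
  then have "nrm A (adj A (adj A a) \<otimes> adj A a) = 0" using a by (simp add: adj_adj)
  then have "nrm A a = 0" using cstar_identity[of "adj A a"] a by (simp add: nrm_adj)
  then show ?thesis using a by (simp add: nrm_eq_0 MU_ops(5))
next
  case False
  then show ?thesis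
    using lact_eq_0_imp[OF False, of "fst x" "snd x"] zero MU_carrier[OF x]
    by (simp add: MU_ops(5) prod_eq_iff)
qed

lemma opn_eq_0_iff: assumes x: "x \<in> carrier MU" shows "opn x = 0 \<longleftrightarrow> x = \<zero>\<^bsub>MU\<^esub>"
proof
  assume "opn x = 0"
  then have "nrm A (lact x b) \<le> 0" if "b \<in> carrier A" for b
    using le_opn[OF MU_carrier[OF x] that] by simp
  then show "x = \<zero>\<^bsub>MU\<^esub>"
    using MU_definite[OF x] nrm_nonneg nrm_eq_0 MU_carrier[OF x] by (meson antisym lact_closed)
qed (simp add: MU_ops(5) opn_fst)

lemma opn_add: assumes "fst x \<in> carrier A" "fst y \<in> carrier A"
  shows "opn (x \<oplus>\<^bsub>MU\<^esub> y) \<le> opn x + opn y"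
proof (rule opn_leI)
  fix b assume b: "b \<in> carrier A" "nrm A b \<le> 1"
  have "nrm A (lact x b \<oplus> lact y b) \<le> nrm A (lact x b) + nrm A (lact y b)"
    using assms b by (intro nrm_triangle) auto
  then show "nrm A (lact (x \<oplus>\<^bsub>MU\<^esub> y) b) \<le> opn x + opn y"
    using le_opn1[OF assms(1) b] le_opn1[OF assms(2) b] lact_add[OF assms b(1)] by simp
qed

lemma opn_mult: assumes "fst x \<in> carrier A" "fst y \<in> carrier A"
  shows "opn (x \<otimes>\<^bsub>MU\<^esub> y) \<le> opn x * opn y"
proof (rule opn_leI)
  fix b assume b: "b \<in> carrier A" "nrm A b \<le> 1"
  have "nrm A (lact x (lact y b)) \<le> opn x * nrm A (lact y b)"
    using assms b by (intro le_opn) auto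
  also have "\<dots> \<le> opn x * opn y"
    using assms b by (intro mult_left_mono le_opn1 opn_nonneg)
  finally show "nrm A (lact (x \<otimes>\<^bsub>MU\<^esub> y) b) \<le> opn x * opn y"
    using lact_mult[OF assms b(1)] by simp
qed

lemma opn_smult_le: assumes "fst x \<in> carrier A" shows "opn (c \<odot>\<^bsub>MU\<^esub> x) \<le> cmod c * opn x"
proof (rule opn_leI)
  fix b assume b: "b \<in> carrier A" "nrm A b \<le> 1"
  have "lact (c \<odot>\<^bsub>MU\<^esub> x) b = c \<odot> lact x b"
    using assms b by (simp add: lact_def MU_ops(3) smult_mult_left smult_add smult_times)
  then show "nrm A (lact (c \<odot>\<^bsub>MU\<^esub> x) b) \<le> cmod c * opn x"
    using le_opn1[OF assms b] assms b by (simp add: nrm_smult mult_left_mono)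
qed

lemma opn_smult: assumes "fst x \<in> carrier A" shows "opn (c \<odot>\<^bsub>MU\<^esub> x) = cmod c * opn x"
proof (cases "c = 0")
  case True
  then show ?thesis using opn_smult_le[OF assms, of 0] opn_nonneg[of "0 \<odot>\<^bsub>MU\<^esub> x"] assms
    by (simp add: MU_ops(3))
next
  case False
  have "(1/c) \<odot>\<^bsub>MU\<^esub> (c \<odot>\<^bsub>MU\<^esub> x) = x"
    using False assms by (simp add: MU_ops(3) smult_times[symmetric])
  then have "opn x \<le> cmod (1/c) * opn (c \<odot>\<^bsub>MU\<^esub> x)"
    using opn_smult_le[of "c \<odot>\<^bsub>MU\<^esub> x" "1/c"] assms by (simp add: MU_ops(3))
  then have "cmod c * opn x \<le> opn (c \<odot>\<^bsub>MU\<^esub> x)"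
    using False by (simp add: norm_divide field_simps)
  then show ?thesis using opn_smult_le[OF assms] by (simp add: antisym)
qed

text \<open>For b in the unit ball, the C*-identity applied to \<open>lact x b\<close> and
  \<open>adj_lact\<close> leave the action on b of the product of x with its adjoint, multiplied by
  the adjoint of b, which has norm at most 1.\<close>

lemma opn_sq_le: assumes "fst x \<in> carrier A" shows "(opn x)\<^sup>2 \<le> opn (adj MU x \<otimes>\<^bsub>MU\<^esub> x)"
proof -
  have adj_closed: "fst (adj MU x) \<in> carrier A" using assms by (simp add: MU_ops(4))
  have prod_closed: "fst (adj MU x \<otimes>\<^bsub>MU\<^esub> x) \<in> carrier A"
    using assms adj_closed by (simp add: MU_ops(1))
  have "opn x \<le> sqrt (opn (adj MU x \<otimes>\<^bsub>MU\<^esub> x))"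
  proof (rule opn_leI, rule real_le_rsqrt)
    fix b assume b: "b \<in> carrier A" "nrm A b \<le> 1"
    have "(nrm A (lact x b))\<^sup>2 = nrm A (adj A b \<otimes> lact (adj MU x) (lact x b))"
      using cstar_identity[of "lact x b"] adj_lact[of x b "lact x b"] assms b by simp
    also have "\<dots> \<le> nrm A (adj A b) * nrm A (lact (adj MU x) (lact x b))"
      using assms b adj_closed by (intro nrm_mult) auto
    also have "\<dots> \<le> 1 * opn (adj MU x \<otimes>\<^bsub>MU\<^esub> x)"
      using le_opn1[OF prod_closed b] lact_mult[OF adj_closed assms b(1)] b assms adj_closed
      by (intro mult_mono) (auto simp: nrm_adj nrm_nonneg)
    finally show "(nrm A (lact x b))\<^sup>2 \<le> opn (adj MU x \<otimes>\<^bsub>MU\<^esub> x)" by simp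
  qed
  then have "(opn x)\<^sup>2 \<le> (sqrt (opn (adj MU x \<otimes>\<^bsub>MU\<^esub> x)))\<^sup>2"
    using opn_nonneg[OF assms] by (intro power_mono)
  then show ?thesis using opn_nonneg[OF prod_closed] by simp
qed

text \<open>The other inequality needs the adjoint to be isometric for the operator norm, which
  follows by the same cancellation as in \<open>nrm_adj\<close>.\<close>

lemma opn_cstar: assumes "fst x \<in> carrier A" shows "opn (adj MU x \<otimes>\<^bsub>MU\<^esub> x) = (opn x)\<^sup>2"
proof -
  have le: "opn y \<le> opn (adj MU y)" if y: "fst y \<in> carrier A" for y
  proof -
    have c: "fst (adj MU y) \<in> carrier A" using y by (simp add: MU_ops(4))
    have "opn y * opn y \<le> opn (adj MU y) * opn y"
      using opn_sq_le[OF y] opn_mult[OF c y] by (simp add: power2_eq_square)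
    then show ?thesis by (rule real_le_mult_cancel_sq) (use y c in \<open>auto intro: opn_nonneg\<close>)
  qed
  have c: "fst (adj MU x) \<in> carrier A" using assms by (simp add: MU_ops(4))
  have "adj MU (adj MU x) = x" using assms by (simp add: MU_ops(4) adj_adj)
  then have "opn (adj MU x) = opn x" using le[OF assms] le[OF c] by simp
  then show ?thesis using opn_sq_le[OF assms] opn_mult[OF c assms] by (simp add: power2_eq_square)
qed

text \<open>The algebra is a closed hyperplane of its unitization, so the second coordinate is
  a bounded functional.\<close>

lemma snd_bounded:
  obtains d where "d > 0" "\<And>x. x \<in> carrier MU \<Longrightarrow> d * cmod (snd x) \<le> opn x"
proof (cases "\<exists>e. is_unit A e")
  case True
  then have "snd x = 0" if "x \<in> carrier MU" for x using that by (auto simp: min_unitization_def)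
  then show thesis using that[of 1] opn_nonneg MU_carrier by simp
next
  case False
  have "\<exists>d>0. \<forall>a\<in>carrier A. d \<le> opn (a, 1)"
  proof (rule ccontr)
    \<comment> \<open>Otherwise some X n + 1 tend to 0 in operator norm. Then the X n converge in
      the algebra, and their limit a makes a + 1 act as zero, which the absence of a unit
      forbids.\<close>
    assume "\<not> ?thesis"
    then have "\<forall>n. \<exists>a\<in>carrier A. opn (a, 1) < inverse (real (Suc n))"
      by (metis inverse_positive_iff_positive not_le of_nat_0_less_iff zero_less_Suc)
    then obtain X where X: "\<And>n. X n \<in> carrier A" "\<And>n. opn (X n, 1) < inverse (real (Suc n))"
      by metis
    have diff: "nrm A (X m \<ominus> X n) \<le> opn (X m, 1) + opn (X n, 1)" for m n
    proof -
      \<comment> \<open>The scalar parts cancel, and at second coordinate 0 the operator norm is the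
        given norm.\<close>
      have "(X m, 1) \<oplus>\<^bsub>MU\<^esub> ((-1) \<odot>\<^bsub>MU\<^esub> (X n, 1)) = (X m \<ominus> X n, 0)"
        using X by (simp add: MU_ops(2,3) smult_uminus M.minus_eq)
      then show ?thesis
        using opn_add[of "(X m, 1)" "(-1) \<odot>\<^bsub>MU\<^esub> (X n, 1)"] opn_smult[of "(X n, 1)" "-1"] X
        by (simp add: opn_fst MU_ops(3))
    qed
    have "\<exists>x. conv X x"
    proof (rule Cauchy_conv)
      fix e :: real assume "e > 0"
      then obtain K where K: "inverse (real (Suc K)) < e / 2" using reals_Archimedean[of "e/2"] by auto
      have "nrm A (X m \<ominus> X n) < e" if "m \<ge> K" "n \<ge> K" for m n
      proof -
        have "inverse (real (Suc m)) \<le> inverse (real (Suc K))" "inverse (real (Suc n)) \<le> inverse (real (Suc K))"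
          using that by (auto intro!: le_imp_inverse_le)
        then show ?thesis using diff[of m n] X(2)[of m] X(2)[of n] K by linarith
      qed
      then show "\<exists>M. \<forall>m\<ge>M. \<forall>n\<ge>M. nrm A (X m \<ominus> X n) < e" by blast
    qed (rule X)
    then obtain a where a: "conv X a" by blast
    have ac: "a \<in> carrier A" using a by (simp add: conv_def)
    have zero: "lact (a, 1) b = \<zero>" if b: "b \<in> carrier A" for b
    proof (rule conv_unique)
      show "conv (\<lambda>n. lact (X n, 1) b) (lact (a, 1) b)"
        unfolding lact_def fst_conv snd_conv
        by (intro conv_add conv_mult conv_const a conv_smult b)
      show "conv (\<lambda>n. lact (X n, 1) b) \<zero>"
      proof (rule convI)
        show "(\<lambda>n. inverse (real (Suc n)) * nrm A b) \<longlonglongrightarrow> 0"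
          by (intro tendsto_mult_left_zero LIMSEQ_inverse_real_of_nat)
        show "nrm A (lact (X n, 1) b \<ominus> \<zero>) \<le> inverse (real (Suc n)) * nrm A b" for n
        proof -
          have "nrm A (lact (X n, 1) b) \<le> opn (X n, 1) * nrm A b" using X b by (intro le_opn) auto
          also have "\<dots> \<le> inverse (real (Suc n)) * nrm A b"
            using X(2)[of n] b by (intro mult_right_mono) (auto simp: nrm_nonneg)
          finally show ?thesis using X b by simp
        qed
      qed (use X b in auto)
    qed
    show False using lact_eq_0_imp[OF False ac zero] by simp
  qed
  then obtain d where d: "d > 0" "\<And>a. a \<in> carrier A \<Longrightarrow> d \<le> opn (a, 1)" by blast
  have "d * cmod (snd x) \<le> opn x" if x: "x \<in> carrier MU" for x
  proof (cases "snd x = 0")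
    case True
    then show ?thesis using opn_nonneg MU_carrier[OF x] by simp
  next
    case False
    let ?k = "snd x"
    have a: "fst x \<in> carrier A" by (rule MU_carrier[OF x])
    have "?k \<odot>\<^bsub>MU\<^esub> ((1/?k) \<odot> fst x, 1) = x"
      using False a by (simp add: MU_ops(3) smult_times[symmetric] prod_eq_iff)
    then have "opn x = cmod ?k * opn ((1/?k) \<odot> fst x, 1)"
      using opn_smult[of "((1/?k) \<odot> fst x, 1)" ?k] a by simp
    moreover have "cmod ?k * d \<le> cmod ?k * opn ((1/?k) \<odot> fst x, 1)"
      using d(2)[of "(1/?k) \<odot> fst x"] a by (intro mult_left_mono) auto
    ultimately show ?thesis by (simp add: mult.commute)
  qed
  with d(1) show thesis by (rule that)
qed

text \<open>Boundedness of the second coordinate makes the scalar parts Cauchy; subtracting them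
  shows that the algebra parts are Cauchy as well.\<close>

lemma MU_complete:
  assumes X: "\<And>n. X n \<in> carrier MU"
    and Cauchy: "\<And>e. e > 0 \<Longrightarrow> \<exists>M. \<forall>m\<ge>M. \<forall>n\<ge>M. nrm MU (X m \<ominus>\<^bsub>MU\<^esub> X n) < e"
  shows "\<exists>x\<in>carrier MU. (\<lambda>n. nrm MU (X n \<ominus>\<^bsub>MU\<^esub> x)) \<longlonglongrightarrow> 0"
proof -
  obtain d where d: "d > 0" "\<And>x. x \<in> carrier MU \<Longrightarrow> d * cmod (snd x) \<le> opn x"
    using snd_bounded by blast
  note Xc = MU_carrier[OF X]
  have Dc: "X m \<ominus>\<^bsub>MU\<^esub> X n \<in> carrier MU" for m n
    using abelian_group.minus_closed[OF abelian_group_MU] X by blast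
  have D: "X m \<ominus>\<^bsub>MU\<^esub> X n = (fst (X m) \<ominus> fst (X n), snd (X m) - snd (X n))" for m n
    by (rule MU_minus[OF X X])
  have k_le: "d * cmod (snd (X m) - snd (X n)) \<le> nrm MU (X m \<ominus>\<^bsub>MU\<^esub> X n)" for m n
    using d(2)[OF Dc, of m n] by (simp add: D MU_ops(6))
  have "Cauchy (\<lambda>n. snd (X n))"
  proof (rule metric_CauchyI)
    fix e :: real assume "e > 0"
    then obtain M where M: "\<forall>m\<ge>M. \<forall>n\<ge>M. nrm MU (X m \<ominus>\<^bsub>MU\<^esub> X n) < d * e"
      using Cauchy[of "d * e"] d(1) by auto
    have "dist (snd (X m)) (snd (X n)) < e" if "m \<ge> M" "n \<ge> M" for m n
    proof -
      have "d * cmod (snd (X m) - snd (X n)) < d * e" using k_le[of m n] M that by fastforce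
      then show ?thesis using d(1) by (simp add: dist_norm)
    qed
    then show "\<exists>M. \<forall>m\<ge>M. \<forall>n\<ge>M. dist (snd (X m)) (snd (X n)) < e" by blast
  qed
  then obtain k where k: "(\<lambda>n. snd (X n)) \<longlonglongrightarrow> k"
    by (auto simp: Cauchy_convergent_iff convergent_def)
  have opn_pair: "opn (a, l) \<le> nrm A a + cmod l" if "a \<in> carrier A" for a l
  proof (rule opn_leI)
    fix b assume b: "b \<in> carrier A" "nrm A b \<le> 1"
    have "nrm A (lact (a, l) b) \<le> (nrm A a + cmod l) * nrm A b" using nrm_lact_le[of "(a, l)" b] that b by simp
    also have "\<dots> \<le> (nrm A a + cmod l) * 1" using that b by (intro mult_left_mono) (auto simp: nrm_nonneg)
    finally show "nrm A (lact (a, l) b) \<le> nrm A a + cmod l" by simp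
  qed
  have a_le: "nrm A (fst (X m) \<ominus> fst (X n)) \<le> nrm MU (X m \<ominus>\<^bsub>MU\<^esub> X n) + cmod (snd (X m) - snd (X n))" for m n
  proof -
    let ?a = "fst (X m) \<ominus> fst (X n)" and ?l = "snd (X m) - snd (X n)"
    have a: "?a \<in> carrier A" using Xc by simp
    have "nrm A ?a = opn ((?a, ?l) \<oplus>\<^bsub>MU\<^esub> (\<zero>, - ?l))" using a by (simp add: MU_ops(2) opn_fst)
    also have "\<dots> \<le> opn (?a, ?l) + opn (\<zero>, - ?l)" using a by (intro opn_add) auto
    also have "opn (\<zero>, - ?l) \<le> cmod ?l" using opn_pair[of \<zero> "- ?l"] by (simp add: norm_minus_commute)
    finally show ?thesis by (simp add: D MU_ops(6))
  qed
  have "\<exists>a. conv (\<lambda>n. fst (X n)) a"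
  proof (rule Cauchy_conv)
    fix e :: real assume e: "e > 0"
    obtain M where M: "\<forall>m\<ge>M. \<forall>n\<ge>M. nrm MU (X m \<ominus>\<^bsub>MU\<^esub> X n) < e/2" using Cauchy[of "e/2"] e by auto
    obtain M' where M': "\<forall>m\<ge>M'. \<forall>n\<ge>M'. dist (snd (X m)) (snd (X n)) < e/2"
      using metric_CauchyD[OF \<open>Cauchy (\<lambda>n. snd (X n))\<close>, of "e/2"] e by auto
    have "nrm A (fst (X m) \<ominus> fst (X n)) < e" if "m \<ge> max M M'" "n \<ge> max M M'" for m n
    proof -
      have "nrm MU (X m \<ominus>\<^bsub>MU\<^esub> X n) < e/2" "cmod (snd (X m) - snd (X n)) < e/2"
        using M M' that by (auto simp: dist_norm)
      then show ?thesis using a_le[of m n] by linarith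
    qed
    then show "\<exists>M. \<forall>m\<ge>M. \<forall>n\<ge>M. nrm A (fst (X m) \<ominus> fst (X n)) < e" by blast
  qed (rule Xc)
  then obtain a where a: "conv (\<lambda>n. fst (X n)) a" by blast
  have ac: "a \<in> carrier A" using a by (simp add: conv_def)
  \<comment> \<open>In the unital case the carrier admits only second coordinate 0, so the limit
    must inherit it.\<close>
  have "k = 0" if "\<exists>e. is_unit A e"
  proof -
    have "snd (X n) = 0" for n using X[of n] that by (auto simp: min_unitization_def)
    then show ?thesis using k by (simp add: LIMSEQ_const_iff)
  qed
  then have xc: "(a, k) \<in> carrier MU" using ac by (auto simp: min_unitization_def)
  have bound0: "(\<lambda>n. nrm A (fst (X n) \<ominus> a) + cmod (snd (X n) - k)) \<longlonglongrightarrow> 0"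
  proof -
    have "(\<lambda>n. nrm A (fst (X n) \<ominus> a)) \<longlonglongrightarrow> 0" using a by (simp add: conv_def)
    moreover have "(\<lambda>n. cmod (snd (X n) - k)) \<longlonglongrightarrow> 0" using k by (simp add: tendsto_norm_zero LIM_zero)
    ultimately show ?thesis using tendsto_add_zero by blast
  qed
  have "(\<lambda>n. nrm MU (X n \<ominus>\<^bsub>MU\<^esub> (a, k))) \<longlonglongrightarrow> 0"
  proof (rule Lim_null_comparison[OF always_eventually bound0], rule allI)
    fix n
    have c: "fst (X n) \<ominus> a \<in> carrier A" using Xc ac by simp
    show "norm (nrm MU (X n \<ominus>\<^bsub>MU\<^esub> (a, k))) \<le> nrm A (fst (X n) \<ominus> a) + cmod (snd (X n) - k)"
      unfolding MU_minus[OF X xc] MU_ops(6) using opn_pair[OF c] opn_nonneg[of "(fst (X n) \<ominus> a, snd (X n) - k)"] c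
      by simp
  qed
  with xc show ?thesis by blast
qed

theorem cstar_algebra_MU: "cstar_algebra MU"
proof (rule cstar_algebra.intro[OF module_MU], rule cstar_algebra_axioms.intro)
  fix x y z assume x: "x \<in> carrier MU" and y: "y \<in> carrier MU" and z: "z \<in> carrier MU"
  note c = MU_carrier[OF x] MU_carrier[OF y] MU_carrier[OF z]
  show "x \<otimes>\<^bsub>MU\<^esub> y \<otimes>\<^bsub>MU\<^esub> z = x \<otimes>\<^bsub>MU\<^esub> (y \<otimes>\<^bsub>MU\<^esub> z)"
    using c by (simp add: MU_ops(1) distr_left distr_right smult_mult_left smult_mult_right smult_add
      smult_times[symmetric] mult_assoc M.a_ac mult_ac)
  show "(x \<oplus>\<^bsub>MU\<^esub> y) \<otimes>\<^bsub>MU\<^esub> z = x \<otimes>\<^bsub>MU\<^esub> z \<oplus>\<^bsub>MU\<^esub> y \<otimes>\<^bsub>MU\<^esub> z"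
    using c by (simp add: MU_ops(1,2) distr_left smult_add smult_plus M.a_ac distrib_right)
  show "z \<otimes>\<^bsub>MU\<^esub> (x \<oplus>\<^bsub>MU\<^esub> y) = z \<otimes>\<^bsub>MU\<^esub> x \<oplus>\<^bsub>MU\<^esub> z \<otimes>\<^bsub>MU\<^esub> y"
    using c by (simp add: MU_ops(1,2) distr_right smult_add smult_plus M.a_ac distrib_left)
next
  fix x y assume x: "x \<in> carrier MU" and y: "y \<in> carrier MU"
  note c = MU_carrier[OF x] MU_carrier[OF y]
  show "(k \<odot>\<^bsub>MU\<^esub> x) \<otimes>\<^bsub>MU\<^esub> y = k \<odot>\<^bsub>MU\<^esub> (x \<otimes>\<^bsub>MU\<^esub> y)"
    "x \<otimes>\<^bsub>MU\<^esub> (k \<odot>\<^bsub>MU\<^esub> y) = k \<odot>\<^bsub>MU\<^esub> (x \<otimes>\<^bsub>MU\<^esub> y)" for k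
    using c by (simp_all add: MU_ops(1,3) smult_mult_left smult_mult_right smult_add smult_times[symmetric] mult_ac)
  show "adj MU (x \<oplus>\<^bsub>MU\<^esub> y) = adj MU x \<oplus>\<^bsub>MU\<^esub> adj MU y"
    using c by (simp add: MU_ops(2,4) adj_add)
  show "adj MU (x \<otimes>\<^bsub>MU\<^esub> y) = adj MU y \<otimes>\<^bsub>MU\<^esub> adj MU x"
    using c by (simp add: MU_ops(1,4) adj_add adj_mult adj_smult M.a_ac)
  show "nrm MU (x \<oplus>\<^bsub>MU\<^esub> y) \<le> nrm MU x + nrm MU y"
    "nrm MU (x \<otimes>\<^bsub>MU\<^esub> y) \<le> nrm MU x * nrm MU y"
    using c by (simp_all add: MU_ops(6) opn_add opn_mult)
next
  fix x assume x: "x \<in> carrier MU"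
  note c = MU_carrier[OF x]
  show "adj MU (adj MU x) = x" "adj MU (k \<odot>\<^bsub>MU\<^esub> x) = cnj k \<odot>\<^bsub>MU\<^esub> adj MU x" for k
    using c by (simp_all add: MU_ops(3,4) adj_adj adj_smult)
  show "0 \<le> nrm MU x" "nrm MU (k \<odot>\<^bsub>MU\<^esub> x) = cmod k * nrm MU x"
    "nrm MU (adj MU x \<otimes>\<^bsub>MU\<^esub> x) = (nrm MU x)\<^sup>2" for k
    using c unfolding MU_ops(6) by (simp_all add: opn_nonneg opn_smult opn_cstar)
  show "nrm MU x = 0 \<longleftrightarrow> x = \<zero>\<^bsub>MU\<^esub>"
    unfolding MU_ops(6) by (rule opn_eq_0_iff[OF x])
next
  fix X :: "nat \<Rightarrow> _"
  assume "\<And>n. X n \<in> carrier MU" "\<And>e. e > 0 \<Longrightarrow> \<exists>M. \<forall>m\<ge>M. \<forall>n\<ge>M. nrm MU (X m \<ominus>\<^bsub>MU\<^esub> X n) < e"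
  then show "\<exists>x\<in>carrier MU. (\<lambda>n. nrm MU (X n \<ominus>\<^bsub>MU\<^esub> x)) \<longlonglongrightarrow> 0" by (rule MU_complete)
qed auto

lemma is_unit_unique: "is_unit A e \<Longrightarrow> is_unit A e' \<Longrightarrow> e = e'"
  unfolding is_unit_def by metis

lemma MU_one_unital: assumes "is_unit A e" shows "\<one>\<^bsub>MU\<^esub> = (e, 0)"
proof -
  have "(THE e. is_unit A e) = e" using assms is_unit_unique by blast
  then show ?thesis using assms by (auto simp: min_unitization_def)
qed

lemma MU_one_nonunital: "\<nexists>e. is_unit A e \<Longrightarrow> \<one>\<^bsub>MU\<^esub> = (\<zero>, 1)"
  by (simp add: min_unitization_def)

lemma lact_one: "b \<in> carrier A \<Longrightarrow> lact \<one>\<^bsub>MU\<^esub> b = b"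
  using MU_one_unital MU_one_nonunital
  by (cases "\<exists>e. is_unit A e") (auto simp: lact_def is_unit_def)

lemma monoid_MU: "monoid MU"
proof
  show "\<one>\<^bsub>MU\<^esub> \<in> carrier MU"
  proof (cases "\<exists>e. is_unit A e")
    case True
    then obtain e where e: "is_unit A e" by blast
    show ?thesis unfolding MU_one_unital[OF e] using e by (auto simp: min_unitization_def is_unit_def)
  next
    case False
    then show ?thesis using MU_one_nonunital by (simp add: min_unitization_def)
  qed
  fix x assume x: "x \<in> carrier MU"
  note c = MU_carrier[OF x]
  have "\<one>\<^bsub>MU\<^esub> \<otimes>\<^bsub>MU\<^esub> x = x \<and> x \<otimes>\<^bsub>MU\<^esub> \<one>\<^bsub>MU\<^esub> = x"
  proof (cases "\<exists>e. is_unit A e")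
    case True
    then obtain e where e: "is_unit A e" by blast
    have "snd x = 0" using x True by (auto simp: min_unitization_def)
    then show ?thesis unfolding MU_one_unital[OF e] using e c by (auto simp: MU_ops(1) is_unit_def prod_eq_iff)
  next
    case False
    then show ?thesis using MU_one_nonunital c by (simp add: MU_ops(1))
  qed
  then show "\<one>\<^bsub>MU\<^esub> \<otimes>\<^bsub>MU\<^esub> x = x" "x \<otimes>\<^bsub>MU\<^esub> \<one>\<^bsub>MU\<^esub> = x" by auto
qed (use cstar_algebra.mult_assoc[OF cstar_algebra_MU] in auto)

theorem unital_cstar_algebra_MU: "unital_cstar_algebra MU"
  by (intro unital_cstar_algebra.intro cstar_algebra_MU monoid_MU)

lemma unitization_incl_closed [simp]: "a \<in> carrier A \<Longrightarrow> unitization_incl a \<in> carrier MU"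
  by (simp add: unitization_incl_def min_unitization_def)

lemma lact_incl: "a \<in> carrier A \<Longrightarrow> b \<in> carrier A \<Longrightarrow> lact (unitization_incl a) b = a \<otimes> b"
  by (simp add: lact_def unitization_incl_def)

lemma unitization_incl_hom:
  "a \<in> carrier A \<Longrightarrow> b \<in> carrier A \<Longrightarrow> unitization_incl (a \<otimes> b) = unitization_incl a \<otimes>\<^bsub>MU\<^esub> unitization_incl b"
  "unitization_incl (a \<oplus> b) = unitization_incl a \<oplus>\<^bsub>MU\<^esub> unitization_incl b"
  "unitization_incl (adj A a) = adj MU (unitization_incl a)"
  "unitization_incl (c \<odot> a) = c \<odot>\<^bsub>MU\<^esub> unitization_incl a"
  by (simp_all add: unitization_incl_def MU_ops(1-4))

lemma MU_decomp: assumes x: "x \<in> carrier MU"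
  shows "x = unitization_incl (fst x) \<oplus>\<^bsub>MU\<^esub> snd x \<odot>\<^bsub>MU\<^esub> \<one>\<^bsub>MU\<^esub>"
proof (cases "\<exists>e. is_unit A e")
  case True
  then obtain e where e: "is_unit A e" by blast
  have "snd x = 0" using x True by (auto simp: min_unitization_def)
  then show ?thesis using MU_carrier[OF x] e unfolding MU_one_unital[OF e]
    by (auto simp: MU_ops(2,3) unitization_incl_def prod_eq_iff is_unit_def)
next
  case False
  then show ?thesis using MU_one_nonunital MU_carrier[OF x]
    by (simp add: MU_ops(2,3) unitization_incl_def)
qed

text \<open>If the algebra has a unit e, the unit of the unitization is (e, 0), with image h e:
  hence the last hypothesis. Otherwise it is (0, 1), and the scalar part alone produces the unit of
  the target.\<close>

lemma unitization_extend:
  assumes B: "unital_cstar_algebra B" and h: "star_hom A B h"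
    and unit: "\<And>e. is_unit A e \<Longrightarrow> h e = \<one>\<^bsub>B\<^esub>"
  shows "unital_star_hom MU B (\<lambda>x. h (fst x) \<oplus>\<^bsub>B\<^esub> snd x \<odot>\<^bsub>B\<^esub> \<one>\<^bsub>B\<^esub>)"
proof -
  interpret B: unital_cstar_algebra B by (rule B)
  interpret BR: ring B by (rule B.is_ring)
  have hc: "\<And>x. x \<in> carrier A \<Longrightarrow> h x \<in> carrier B"
    and ha: "\<And>x y. x \<in> carrier A \<Longrightarrow> y \<in> carrier A \<Longrightarrow> h (x \<oplus> y) = h x \<oplus>\<^bsub>B\<^esub> h y"
    and hm: "\<And>x y. x \<in> carrier A \<Longrightarrow> y \<in> carrier A \<Longrightarrow> h (x \<otimes> y) = h x \<otimes>\<^bsub>B\<^esub> h y"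
    and hs: "\<And>x c. x \<in> carrier A \<Longrightarrow> h (c \<odot> x) = c \<odot>\<^bsub>B\<^esub> h x"
    and hj: "\<And>x. x \<in> carrier A \<Longrightarrow> h (adj A x) = adj B (h x)"
    using h by (auto simp: star_hom_def)
  have h0: "h \<zero> = \<zero>\<^bsub>B\<^esub>" using hs[of \<zero> 0] hc[of \<zero>] by simp
  show ?thesis
    unfolding unital_star_hom_def
  proof (intro conjI ballI allI ring_hom_memI)
    fix x assume x: "x \<in> carrier MU"
    note cx = MU_carrier[OF x]
    show "h (fst x) \<oplus>\<^bsub>B\<^esub> snd x \<odot>\<^bsub>B\<^esub> \<one>\<^bsub>B\<^esub> \<in> carrier B" using cx hc by simp
    show "h (fst (c \<odot>\<^bsub>MU\<^esub> x)) \<oplus>\<^bsub>B\<^esub> snd (c \<odot>\<^bsub>MU\<^esub> x) \<odot>\<^bsub>B\<^esub> \<one>\<^bsub>B\<^esub> =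
        c \<odot>\<^bsub>B\<^esub> (h (fst x) \<oplus>\<^bsub>B\<^esub> snd x \<odot>\<^bsub>B\<^esub> \<one>\<^bsub>B\<^esub>)" for c
      using cx hc by (simp add: MU_ops(3) hs B.smult_add B.smult_times)
    show "h (fst (adj MU x)) \<oplus>\<^bsub>B\<^esub> snd (adj MU x) \<odot>\<^bsub>B\<^esub> \<one>\<^bsub>B\<^esub> =
        adj B (h (fst x) \<oplus>\<^bsub>B\<^esub> snd x \<odot>\<^bsub>B\<^esub> \<one>\<^bsub>B\<^esub>)"
      using cx hc by (simp add: MU_ops(4) hj B.adj_add B.adj_smult)
    fix y assume y: "y \<in> carrier MU"
    note cy = MU_carrier[OF y]
    show "h (fst (x \<oplus>\<^bsub>MU\<^esub> y)) \<oplus>\<^bsub>B\<^esub> snd (x \<oplus>\<^bsub>MU\<^esub> y) \<odot>\<^bsub>B\<^esub> \<one>\<^bsub>B\<^esub> =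
        (h (fst x) \<oplus>\<^bsub>B\<^esub> snd x \<odot>\<^bsub>B\<^esub> \<one>\<^bsub>B\<^esub>) \<oplus>\<^bsub>B\<^esub> (h (fst y) \<oplus>\<^bsub>B\<^esub> snd y \<odot>\<^bsub>B\<^esub> \<one>\<^bsub>B\<^esub>)"
      using cx cy hc by (simp add: MU_ops(2) ha B.smult_plus B.M.a_ac)
    show "h (fst (x \<otimes>\<^bsub>MU\<^esub> y)) \<oplus>\<^bsub>B\<^esub> snd (x \<otimes>\<^bsub>MU\<^esub> y) \<odot>\<^bsub>B\<^esub> \<one>\<^bsub>B\<^esub> =
        (h (fst x) \<oplus>\<^bsub>B\<^esub> snd x \<odot>\<^bsub>B\<^esub> \<one>\<^bsub>B\<^esub>) \<otimes>\<^bsub>B\<^esub> (h (fst y) \<oplus>\<^bsub>B\<^esub> snd y \<odot>\<^bsub>B\<^esub> \<one>\<^bsub>B\<^esub>)"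
      using cx cy hc
      by (simp add: MU_ops(1) ha hm hs B.distr_left B.distr_right B.smult_mult_left
          B.smult_mult_right B.smult_add B.smult_times[symmetric] B.M.a_ac mult.commute)
  next
    show "h (fst \<one>\<^bsub>MU\<^esub>) \<oplus>\<^bsub>B\<^esub> snd \<one>\<^bsub>MU\<^esub> \<odot>\<^bsub>B\<^esub> \<one>\<^bsub>B\<^esub> = \<one>\<^bsub>B\<^esub>"
      using MU_one_unital MU_one_nonunital unit
      by (cases "\<exists>e. is_unit A e") (auto simp: h0)
  qed
qed

end

section \<open>Seminorms from partial bijections\<close>

text \<open>The assumption says that opposite letters act by mutually inverse partial maps, so every
  letter is a partial bijection of the points and yields a partial isometry on functions.\<close>

context
  fixes m :: "'g \<times> bool \<Rightarrow> 'x \<Rightarrow> 'x option"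
  assumes m_adj: "\<And>g b x y. m (g, b) y = Some x \<longleftrightarrow> m (g, \<not> b) x = Some y"
begin

text \<open>Finitely supported functions form a pre-Hilbert space stable under all the operators.
  Only operator norms are extracted from it, so no completion is formed.\<close>

definition fin_supp :: "('x \<Rightarrow> complex) \<Rightarrow> bool" where
  "fin_supp f \<longleftrightarrow> finite {x. f x \<noteq> 0}"

definition nrm2 :: "('x \<Rightarrow> complex) \<Rightarrow> real" where
  "nrm2 f = L2_set (\<lambda>x. cmod (f x)) {x. f x \<noteq> 0}"

definition dot :: "('x \<Rightarrow> complex) \<Rightarrow> ('x \<Rightarrow> complex) \<Rightarrow> complex" where
  "dot f h = (\<Sum>x\<in>{x. f x \<noteq> 0}. f x * cnj (h x))"

text \<open>Composition with the partial map, 0 where it is undefined. The letters of a word then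
  act in the order of an operator product, although points move the opposite way.\<close>

definition op_letter :: "'g \<times> bool \<Rightarrow> ('x \<Rightarrow> complex) \<Rightarrow> 'x \<Rightarrow> complex" where
  "op_letter l f y = (case m l y of None \<Rightarrow> 0 | Some x \<Rightarrow> f x)"

definition op_word :: "'g star_word \<Rightarrow> ('x \<Rightarrow> complex) \<Rightarrow> 'x \<Rightarrow> complex" where
  "op_word w f = foldr op_letter (letters w) f"

definition op_poly :: "'g star_poly \<Rightarrow> ('x \<Rightarrow> complex) \<Rightarrow> 'x \<Rightarrow> complex" where
  "op_poly p f y = (\<Sum>w\<in>Poly_Mapping.keys p. Poly_Mapping.lookup p w * op_word w f y)"

definition op_norm :: "'g star_poly \<Rightarrow> real" where
  "op_norm p = (SUP f\<in>{f. fin_supp f \<and> nrm2 f \<le> 1}. nrm2 (op_poly p f))"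

lemma nrm2_superset: "finite K \<Longrightarrow> {x. f x \<noteq> 0} \<subseteq> K \<Longrightarrow> nrm2 f = L2_set (\<lambda>x. cmod (f x)) K"
  unfolding nrm2_def L2_set_def by (intro arg_cong[of _ _ sqrt] sum.mono_neutral_left) auto

lemma dot_superset: "finite K \<Longrightarrow> {x. f x \<noteq> 0} \<subseteq> K \<Longrightarrow> dot f h = (\<Sum>x\<in>K. f x * cnj (h x))"
  unfolding dot_def by (intro sum.mono_neutral_left) auto

lemma nrm2_nonneg [simp]: "0 \<le> nrm2 f"
  by (simp add: nrm2_def)

lemma fin_supp_add: "fin_supp f \<Longrightarrow> fin_supp h \<Longrightarrow> fin_supp (\<lambda>x. f x + h x)"
  unfolding fin_supp_def by (rule finite_subset[of _ "{x. f x \<noteq> 0} \<union> {x. h x \<noteq> 0}"]) auto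

lemma fin_supp_scale: "fin_supp f \<Longrightarrow> fin_supp (\<lambda>x. c * f x)"
  unfolding fin_supp_def by (rule finite_subset[of _ "{x. f x \<noteq> 0}"]) auto

lemma fin_supp_0 [simp]: "fin_supp (\<lambda>_. 0)"
  by (simp add: fin_supp_def)

lemma nrm2_add: assumes "fin_supp f" "fin_supp h" shows "nrm2 (\<lambda>x. f x + h x) \<le> nrm2 f + nrm2 h"
proof -
  let ?K = "{x. f x \<noteq> 0} \<union> {x. h x \<noteq> 0}"
  have K: "finite ?K" using assms by (simp add: fin_supp_def)
  have "nrm2 (\<lambda>x. f x + h x) = L2_set (\<lambda>x. cmod (f x + h x)) ?K"
    by (rule nrm2_superset[OF K]) auto
  also have "\<dots> \<le> L2_set (\<lambda>x. cmod (f x) + cmod (h x)) ?K"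
    by (intro L2_set_mono norm_triangle_ineq) auto
  also have "\<dots> \<le> L2_set (\<lambda>x. cmod (f x)) ?K + L2_set (\<lambda>x. cmod (h x)) ?K"
    by (rule L2_set_triangle_ineq)
  also have "\<dots> = nrm2 f + nrm2 h"
    using nrm2_superset[OF K, of f] nrm2_superset[OF K, of h] by simp
  finally show ?thesis .
qed

lemma nrm2_scale: assumes "fin_supp f" shows "nrm2 (\<lambda>x. c * f x) = cmod c * nrm2 f"
proof -
  have K: "finite {x. f x \<noteq> 0}" using assms by (simp add: fin_supp_def)
  have "nrm2 (\<lambda>x. c * f x) = L2_set (\<lambda>x. cmod (c * f x)) {x. f x \<noteq> 0}"
    by (rule nrm2_superset[OF K]) auto
  then show ?thesis by (simp add: nrm2_def norm_mult L2_set_right_distrib)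
qed

lemma dot_self: "dot f f = complex_of_real ((nrm2 f)\<^sup>2)"
proof -
  have "(nrm2 f)\<^sup>2 = (\<Sum>x\<in>{x. f x \<noteq> 0}. (cmod (f x))\<^sup>2)"
    by (simp add: nrm2_def L2_set_def sum_nonneg)
  then show ?thesis
    by (simp add: dot_def flip: complex_norm_square)
qed

lemma dot_le: assumes "fin_supp f" "fin_supp h" shows "cmod (dot f h) \<le> nrm2 f * nrm2 h"
proof -
  let ?K = "{x. f x \<noteq> 0} \<union> {x. h x \<noteq> 0}"
  have K: "finite ?K" using assms by (simp add: fin_supp_def)
  have "dot f h = (\<Sum>x\<in>?K. f x * cnj (h x))" by (rule dot_superset[OF K]) auto
  then have "cmod (dot f h) \<le> (\<Sum>x\<in>?K. cmod (f x * cnj (h x)))" by (simp add: sum_norm_le)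
  also have "\<dots> = (\<Sum>x\<in>?K. \<bar>cmod (f x)\<bar> * \<bar>cmod (h x)\<bar>)" by (simp add: norm_mult)
  also have "\<dots> \<le> L2_set (\<lambda>x. cmod (f x)) ?K * L2_set (\<lambda>x. cmod (h x)) ?K" by (rule L2_set_mult_ineq)
  also have "\<dots> = nrm2 f * nrm2 h"
    using nrm2_superset[OF K, of f] nrm2_superset[OF K, of h] by simp
  finally show ?thesis .
qed

lemma op_letter_add: "op_letter l (\<lambda>x. f x + h x) = (\<lambda>x. op_letter l f x + op_letter l h x)"
  by (rule ext) (simp add: op_letter_def split: option.splits)

lemma op_letter_scale: "op_letter l (\<lambda>x. c * f x) = (\<lambda>x. c * op_letter l f x)"
  by (rule ext) (simp add: op_letter_def split: option.splits)

text \<open>A letter is injective where it is defined, so its operator only relocates values of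
  \<open>f\<close> and drops some of them.\<close>

lemma op_letter_supp: assumes "fin_supp f"
  shows "fin_supp (op_letter l f) \<and> nrm2 (op_letter l f) \<le> nrm2 f"
proof -
  obtain g b where l: "l = (g, b)" by (cases l)
  let ?I = "{y. op_letter l f y \<noteq> 0}" and ?J = "{x. f x \<noteq> 0}"
  let ?t = "\<lambda>y. the (m l y)"
  have sub: "?t ` ?I \<subseteq> ?J" and val: "\<And>y. y \<in> ?I \<Longrightarrow> op_letter l f y = f (?t y)"
    by (auto simp: op_letter_def split: option.splits)
  have inj: "inj_on ?t ?I"
  proof (rule inj_onI)
    fix y z assume yz: "y \<in> ?I" "z \<in> ?I" "?t y = ?t z"
    then obtain x where "m l y = Some x" "m l z = Some x"
      by (auto simp: op_letter_def split: option.splits)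
    then have "m (g, \<not> b) x = Some y" "m (g, \<not> b) x = Some z" using m_adj l by auto
    then show "y = z" by simp
  qed
  have fin: "finite ?J" using assms by (simp add: fin_supp_def)
  have finI: "finite ?I" using finite_subset[OF sub fin] inj by (rule finite_imageD)
  have "(\<Sum>y\<in>?I. (cmod (op_letter l f y))\<^sup>2) = (\<Sum>y\<in>?I. (cmod (f (?t y)))\<^sup>2)"
    using val by (intro sum.cong) auto
  also have "\<dots> = (\<Sum>x\<in>?t ` ?I. (cmod (f x))\<^sup>2)" using inj by (simp add: sum.reindex)
  also have "\<dots> \<le> (\<Sum>x\<in>?J. (cmod (f x))\<^sup>2)" using sub fin by (intro sum_mono2) auto
  finally have "nrm2 (op_letter l f) \<le> nrm2 f" by (simp add: nrm2_def L2_set_def)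
  then show ?thesis using finI by (simp add: fin_supp_def)
qed

text \<open>Both sides are the same sum over pairs matched by the partial bijection, indexed by one
  member of the pair or by the other.\<close>

lemma dot_op_letter: assumes f: "fin_supp f" and h: "fin_supp h"
  shows "dot (op_letter (g, b) f) h = dot f (op_letter (g, \<not> b) h)"
proof -
  let ?l = "(g, b)"
  let ?I = "{y. op_letter ?l f y \<noteq> 0}" and ?J = "{x. f x \<noteq> 0}"
  let ?t = "\<lambda>y. the (m ?l y)"
  have val: "\<exists>x. m ?l y = Some x \<and> op_letter ?l f y = f x \<and> m (g, \<not> b) x = Some y" if "y \<in> ?I" for y
    using that m_adj by (auto simp: op_letter_def split: option.splits)
  have inj: "inj_on ?t ?I"
  proof (rule inj_onI)
    fix y z assume "y \<in> ?I" "z \<in> ?I" "?t y = ?t z"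
    then show "y = z" using val[of y] val[of z] by auto
  qed
  have "dot (op_letter ?l f) h = (\<Sum>y\<in>?I. f (?t y) * cnj (op_letter (g, \<not> b) h (?t y)))"
    unfolding dot_def
  proof (rule sum.cong)
    fix y assume "y \<in> ?I"
    then obtain x where "m ?l y = Some x" "op_letter ?l f y = f x" "m (g, \<not> b) x = Some y"
      using val by blast
    then show "op_letter ?l f y * cnj (h y) = f (?t y) * cnj (op_letter (g, \<not> b) h (?t y))"
      by (simp add: op_letter_def[of "(g, \<not> b)"])
  qed simp
  also have "\<dots> = (\<Sum>x\<in>?t ` ?I. f x * cnj (op_letter (g, \<not> b) h x))"
    using inj by (simp add: sum.reindex)
  also have "\<dots> = dot f (op_letter (g, \<not> b) h)"
    unfolding dot_def
  proof (rule sum.mono_neutral_left)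
    show "finite ?J" using f by (simp add: fin_supp_def)
    show "?t ` ?I \<subseteq> ?J" using val by fastforce
    show "\<forall>x\<in>?J - ?t ` ?I. f x * cnj (op_letter (g, \<not> b) h x) = 0"
    proof
      fix x assume x: "x \<in> ?J - ?t ` ?I"
      show "f x * cnj (op_letter (g, \<not> b) h x) = 0"
      proof (cases "m (g, \<not> b) x")
        case (Some y)
        then have "m ?l y = Some x" using m_adj by simp
        then have "y \<in> ?I" "?t y = x" using x by (auto simp: op_letter_def)
        then show ?thesis using x by blast
      qed (simp add: op_letter_def)
    qed
  qed
  finally show ?thesis .
qed

lemma op_word_add: "op_word w (\<lambda>x. f x + h x) = (\<lambda>x. op_word w f x + op_word w h x)"
proof -
  have "foldr op_letter ls (\<lambda>x. f x + h x) = (\<lambda>x. foldr op_letter ls f x + foldr op_letter ls h x)" for ls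
    by (induction ls) (simp_all add: op_letter_add)
  then show ?thesis by (simp add: op_word_def)
qed

lemma op_word_scale: "op_word w (\<lambda>x. c * f x) = (\<lambda>x. c * op_word w f x)"
proof -
  have "foldr op_letter ls (\<lambda>x. c * f x) = (\<lambda>x. c * foldr op_letter ls f x)" for ls
    by (induction ls) (simp_all add: op_letter_scale)
  then show ?thesis by (simp add: op_word_def)
qed

lemma op_word_plus: "op_word (v + w) f = op_word v (op_word w f)"
  by (simp add: op_word_def)

lemma op_word_supp: assumes "fin_supp f" shows "fin_supp (op_word w f) \<and> nrm2 (op_word w f) \<le> nrm2 f"
proof -
  have "fin_supp (foldr op_letter ls f) \<and> nrm2 (foldr op_letter ls f) \<le> nrm2 f" for ls
  proof (induction ls)
    case (Cons l ls)
    then show ?case using op_letter_supp[of "foldr op_letter ls f" l] by auto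
  qed (simp add: assms)
  then show ?thesis by (simp add: op_word_def)
qed

lemma dot_op_word: assumes "fin_supp f" "fin_supp h"
  shows "dot (op_word w f) h = dot f (op_word (adj_word w) h)"
proof -
  have "dot (op_word (Word ls) f) h = dot f (op_word (adj_word (Word ls)) h)" for ls
    using assms(2)
  proof (induction ls arbitrary: h)
    case Nil
    then show ?case by (simp add: op_word_def adj_word_def)
  next
    case (Cons l ls)
    obtain g b where l: "l = (g, b)" by (cases l)
    have supp: "fin_supp (op_word (Word ls) f)" "fin_supp (op_letter (g, \<not> b) h)"
      using op_word_supp[OF assms(1)] op_letter_supp[OF Cons.prems] by auto
    have "dot (op_word (Word (l # ls)) f) h = dot (op_letter (g, b) (op_word (Word ls) f)) h"
      by (simp add: op_word_def l)
    also have "\<dots> = dot (op_word (Word ls) f) (op_letter (g, \<not> b) h)"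
      by (rule dot_op_letter[OF supp(1) Cons.prems])
    also have "\<dots> = dot f (op_word (adj_word (Word ls)) (op_letter (g, \<not> b) h))"
      by (rule Cons.IH[OF supp(2)])
    also have "op_word (adj_word (Word ls)) (op_letter (g, \<not> b) h) = op_word (adj_word (Word (l # ls))) h"
      by (simp add: op_word_def adj_word_def l)
    finally show ?case .
  qed
  from this[of "letters w"] show ?thesis by simp
qed

lemma op_poly_superset: "finite K \<Longrightarrow> Poly_Mapping.keys p \<subseteq> K \<Longrightarrow>
    op_poly p f y = (\<Sum>w\<in>K. Poly_Mapping.lookup p w * op_word w f y)"
  unfolding op_poly_def by (intro sum.mono_neutral_left) (auto simp: in_keys_iff)

lemma op_poly_plus: "op_poly (p + q) f = (\<lambda>y. op_poly p f y + op_poly q f y)"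
proof
  fix y
  let ?K = "Poly_Mapping.keys p \<union> Poly_Mapping.keys q"
  have "op_poly (p + q) f y = (\<Sum>w\<in>?K. Poly_Mapping.lookup (p + q) w * op_word w f y)"
    using keys_add[of p q] by (intro op_poly_superset) auto
  then show "op_poly (p + q) f y = op_poly p f y + op_poly q f y"
    using op_poly_superset[of ?K p f y] op_poly_superset[of ?K q f y]
    by (simp add: lookup_add distrib_right sum.distrib)
qed

lemma op_poly_single: "op_poly (Poly_Mapping.single w c) f = (\<lambda>y. c * op_word w f y)"
  using op_poly_superset[of "{w}" "Poly_Mapping.single w c" f] by auto

lemma op_poly_0: "op_poly 0 f = (\<lambda>y. 0)"
  by (simp add: op_poly_def fun_eq_iff)

lemma op_poly_scale: "op_poly (scale c p) f = (\<lambda>y. c * op_poly p f y)"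
  by (induction p rule: poly_mapping_monomial_induct)
    (simp_all add: op_poly_0 op_poly_single scale_single scale_add op_poly_plus distrib_left mult_ac)

lemma op_poly_minus: "op_poly (p - q) f = (\<lambda>y. op_poly p f y - op_poly q f y)"
  using op_poly_plus[of p "- q" f] op_poly_scale[of "-1" q f] by (simp add: scale_minus_one)

lemma op_poly_sum: "op_poly (sum p I) f = (\<lambda>y. \<Sum>i\<in>I. op_poly (p i) f y)"
  by (induction I rule: infinite_finite_induct) (simp_all add: op_poly_0 op_poly_plus)

lemma op_poly_add_arg: "op_poly p (\<lambda>x. f x + h x) = (\<lambda>x. op_poly p f x + op_poly p h x)"
  by (simp add: op_poly_def op_word_add distrib_left sum.distrib fun_eq_iff)

lemma op_poly_scale_arg: "op_poly p (\<lambda>x. c * f x) = (\<lambda>x. c * op_poly p f x)"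
  by (simp add: op_poly_def op_word_scale sum_distrib_left mult_ac fun_eq_iff)

lemma op_poly_mult: "op_poly (p * q) f = op_poly p (op_poly q f)"
proof (induction p rule: poly_mapping_monomial_induct)
  case (single v c)
  show ?case
  proof (induction q rule: poly_mapping_monomial_induct)
    case zero
    \<comment> \<open>An operator kills the zero function by homogeneity with scalar 0; the zero is
      written as a product so that the scaling rule matches.\<close>
    have "op_word v (\<lambda>y. 0 * 0) = (\<lambda>y. 0 * op_word v (\<lambda>y. 0) y)" by (rule op_word_scale)
    then show ?case by (simp add: op_poly_0 op_poly_single)
  next
    case (single w d)
    then show ?case by (simp add: mult_single op_poly_single op_word_plus op_word_scale mult.assoc)
  next
    case (add y z)
    then show ?case by (simp add: distrib_left op_poly_plus op_poly_add_arg)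
  qed
qed (simp_all add: op_poly_0 distrib_right op_poly_plus)

lemma op_poly_supp: assumes "fin_supp f" shows "fin_supp (op_poly p f)"
  by (induction p rule: poly_mapping_monomial_induct)
    (use assms op_word_supp in \<open>simp_all add: op_poly_0 op_poly_single op_poly_plus fin_supp_scale fin_supp_add\<close>)

text \<open>Words act as contractions, so a polynomial is a finite combination of contractions; this
  makes the supremum in \<open>op_norm\<close> genuine.\<close>

lemma op_poly_bounded: "\<exists>M. \<forall>f. fin_supp f \<and> nrm2 f \<le> 1 \<longrightarrow> nrm2 (op_poly p f) \<le> M"
proof (induction p rule: poly_mapping_monomial_induct)
  case zero
  show ?case by (intro exI[of _ 0]) (simp add: op_poly_0 nrm2_def)
next
  case (single w c)
  have "nrm2 (\<lambda>y. c * op_word w f y) \<le> cmod c * 1" if "fin_supp f" "nrm2 f \<le> 1" for f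
    using op_word_supp[OF that(1), of w] that by (simp add: nrm2_scale mult_left_le)
  then show ?case by (auto simp: op_poly_single)
next
  case (add p q)
  then obtain M M' where
    "\<forall>f. fin_supp f \<and> nrm2 f \<le> 1 \<longrightarrow> nrm2 (op_poly p f) \<le> M"
    "\<forall>f. fin_supp f \<and> nrm2 f \<le> 1 \<longrightarrow> nrm2 (op_poly q f) \<le> M'" by blast
  then have "nrm2 (op_poly (p + q) f) \<le> M + M'" if "fin_supp f" "nrm2 f \<le> 1" for f
    using nrm2_add[of "op_poly p f" "op_poly q f"] op_poly_supp[OF that(1)] that
    by (fastforce simp: op_poly_plus)
  then show ?case by blast
qed

lemma le_op_norm1: assumes "fin_supp f" "nrm2 f \<le> 1" shows "nrm2 (op_poly p f) \<le> op_norm p"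
proof -
  obtain M where "\<forall>f. fin_supp f \<and> nrm2 f \<le> 1 \<longrightarrow> nrm2 (op_poly p f) \<le> M"
    using op_poly_bounded by blast
  then show ?thesis
    unfolding op_norm_def using assms by (intro cSUP_upper bdd_aboveI2[where M = M]) auto
qed

lemma op_norm_leI:
  assumes "\<And>f. fin_supp f \<Longrightarrow> nrm2 f \<le> 1 \<Longrightarrow> nrm2 (op_poly p f) \<le> M" shows "op_norm p \<le> M"
proof -
  have "(\<lambda>_. 0) \<in> {f. fin_supp f \<and> nrm2 f \<le> 1}" by (simp add: nrm2_def)
  then have "{f. fin_supp f \<and> nrm2 f \<le> 1} \<noteq> {}" by blast
  then show ?thesis unfolding op_norm_def by (rule cSUP_least) (use assms in auto)
qed

lemma op_norm_nonneg: "0 \<le> op_norm p"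
  by (rule order_trans[OF nrm2_nonneg le_op_norm1[of "\<lambda>_. 0" p]]) (simp_all add: nrm2_def)

lemma le_op_norm: assumes f: "fin_supp f" shows "nrm2 (op_poly p f) \<le> op_norm p * nrm2 f"
proof (cases "nrm2 f = 0")
  case True
  have "complex_of_real (nrm2 (op_poly p f)) = 0"
  proof -
    have "f = (\<lambda>_. 0)"
    proof
      fix x
      have "finite {x. f x \<noteq> 0}" using f by (simp add: fin_supp_def)
      then show "f x = 0" using True by (auto simp: nrm2_def L2_set_eq_0_iff)
    qed
    then have "op_poly p f = (\<lambda>x. 0)" using op_poly_scale_arg[of p 0 f] by simp
    then show ?thesis by (simp add: nrm2_def)
  qed
  then show ?thesis using True by simp
next
  case False
  then have pos: "nrm2 f > 0" using nrm2_nonneg[of f] by linarith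
  let ?c = "complex_of_real (1 / nrm2 f)"
  have "nrm2 (op_poly p (\<lambda>x. ?c * f x)) \<le> op_norm p"
  proof (rule le_op_norm1)
    show "fin_supp (\<lambda>x. ?c * f x)" using f by (rule fin_supp_scale)
    show "nrm2 (\<lambda>x. ?c * f x) \<le> 1" unfolding nrm2_scale[OF f] using pos by (simp add: norm_divide)
  qed
  then show ?thesis
    unfolding op_poly_scale_arg nrm2_scale[OF op_poly_supp[OF f]]
    using pos by (simp add: norm_divide divide_le_eq)
qed

lemma dot_op_poly: assumes "fin_supp f" "fin_supp h"
  shows "dot (op_poly p f) h = dot f (op_poly (star p) h)"
proof -
  have dot_add1: "dot (\<lambda>x. f1 x + f2 x) k = dot f1 k + dot f2 k" if "fin_supp f1" "fin_supp f2" for f1 f2 k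
  proof -
    let ?K = "{x. f1 x \<noteq> 0} \<union> {x. f2 x \<noteq> 0}"
    have K: "finite ?K" using that by (simp add: fin_supp_def)
    have "dot (\<lambda>x. f1 x + f2 x) k = (\<Sum>x\<in>?K. (f1 x + f2 x) * cnj (k x))"
      by (rule dot_superset[OF K]) auto
    then show ?thesis
      using dot_superset[OF K, of f1 k] dot_superset[OF K, of f2 k] by (simp add: distrib_right sum.distrib)
  qed
  have dot_scale1: "dot (\<lambda>x. c * k' x) k = c * dot k' k" if "fin_supp k'" for c k' k
  proof -
    have K: "finite {x. k' x \<noteq> 0}" using that by (simp add: fin_supp_def)
    have "dot (\<lambda>x. c * k' x) k = (\<Sum>x\<in>{x. k' x \<noteq> 0}. c * k' x * cnj (k x))"
      by (rule dot_superset[OF K]) auto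
    then show ?thesis by (simp add: dot_def sum_distrib_left mult.assoc)
  qed
  show ?thesis
  proof (induction p rule: poly_mapping_monomial_induct)
    case zero
    show ?case by (simp add: op_poly_0 dot_def)
  next
    case (single w c)
    have "dot f (\<lambda>y. cnj c * op_word (adj_word w) h y) = c * dot f (op_word (adj_word w) h)"
      by (simp add: dot_def sum_distrib_left mult_ac)
    then show ?case
      using dot_op_word[OF assms, of w] op_word_supp[OF assms(1), of w]
      by (simp add: op_poly_single star_single dot_scale1)
  next
    case (add p q)
    have "dot f (\<lambda>x. op_poly (star p) h x + op_poly (star q) h x) =
        dot f (op_poly (star p) h) + dot f (op_poly (star q) h)"
      by (simp add: dot_def distrib_left sum.distrib)
    then show ?case
      using add op_poly_supp[OF assms(1)] by (simp add: op_poly_plus star_add dot_add1)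
  qed
qed

lemma op_norm_scale_le: "op_norm (scale c p) \<le> cmod c * op_norm p"
  by (rule op_norm_leI)
    (simp add: op_poly_scale nrm2_scale op_poly_supp mult_left_mono le_op_norm1)

lemma op_norm_scale: "op_norm (scale c p) = cmod c * op_norm p"
proof (cases "c = 0")
  case True
  then show ?thesis using op_norm_scale_le[of 0 p] op_norm_nonneg[of 0] by simp
next
  case False
  then have "op_norm p \<le> cmod (1/c) * op_norm (scale c p)"
    using op_norm_scale_le[of "1/c" "scale c p"] by (simp add: scale_scale)
  then have "cmod c * op_norm p \<le> op_norm (scale c p)"
    using False by (simp add: norm_divide field_simps)
  then show ?thesis using op_norm_scale_le[of c p] by simp
qed

lemma op_norm_add: "op_norm (p + q) \<le> op_norm p + op_norm q"
proof (rule op_norm_leI)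
  fix f assume f: "fin_supp f" "nrm2 f \<le> 1"
  show "nrm2 (op_poly (p + q) f) \<le> op_norm p + op_norm q"
    unfolding op_poly_plus
    using nrm2_add[OF op_poly_supp[OF f(1)] op_poly_supp[OF f(1)], of p q] le_op_norm1[OF f, of p] le_op_norm1[OF f, of q]
    by linarith
qed

lemma op_norm_mult: "op_norm (p * q) \<le> op_norm p * op_norm q"
proof (rule op_norm_leI)
  fix f assume f: "fin_supp f" "nrm2 f \<le> 1"
  have "nrm2 (op_poly p (op_poly q f)) \<le> op_norm p * nrm2 (op_poly q f)"
    by (rule le_op_norm[OF op_poly_supp[OF f(1)]])
  also have "\<dots> \<le> op_norm p * op_norm q"
    by (intro mult_left_mono le_op_norm1 f op_norm_nonneg)
  finally show "nrm2 (op_poly (p * q) f) \<le> op_norm p * op_norm q" by (simp add: op_poly_mult)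
qed

text \<open>The squared length of p f is the inner product of f with its image under
  \<open>star p * p\<close>; Cauchy-Schwarz then gives the bound.\<close>

lemma op_norm_sq_le: "(op_norm p)\<^sup>2 \<le> op_norm (star p * p)"
proof -
  have "op_norm p \<le> sqrt (op_norm (star p * p))"
  proof (rule op_norm_leI, rule real_le_rsqrt)
    fix f assume f: "fin_supp f" "nrm2 f \<le> 1"
    have "(nrm2 (op_poly p f))\<^sup>2 = cmod (dot (op_poly p f) (op_poly p f))"
      by (simp add: dot_self norm_power)
    also have "dot (op_poly p f) (op_poly p f) = dot f (op_poly (star p * p) f)"
      unfolding op_poly_mult by (rule dot_op_poly[OF f(1) op_poly_supp[OF f(1)]])
    also have "cmod \<dots> \<le> nrm2 f * nrm2 (op_poly (star p * p) f)"
      by (rule dot_le[OF f(1) op_poly_supp[OF f(1)]])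
    also have "\<dots> \<le> 1 * op_norm (star p * p)"
      by (intro mult_mono le_op_norm1 f) auto
    finally show "(nrm2 (op_poly p f))\<^sup>2 \<le> op_norm (star p * p)" by simp
  qed
  then have "(op_norm p)\<^sup>2 \<le> (sqrt (op_norm (star p * p)))\<^sup>2"
    by (intro power_mono op_norm_nonneg)
  then show ?thesis by (simp add: op_norm_nonneg)
qed

lemma op_norm_star_mult: "op_norm (star p * p) = (op_norm p)\<^sup>2"
proof -
  have le: "op_norm q \<le> op_norm (star q)" for q
  proof -
    have "op_norm q * op_norm q \<le> op_norm (star q) * op_norm q"
      using op_norm_sq_le[of q] op_norm_mult[of "star q" q] by (simp add: power2_eq_square)
    then show ?thesis by (rule real_le_mult_cancel_sq) (rule op_norm_nonneg)+
  qed
  have "op_norm (star p) = op_norm p" using le[of p] le[of "star p"] by simp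
  then show ?thesis using op_norm_sq_le[of p] op_norm_mult[of "star p" p] by (simp add: power2_eq_square)
qed

lemma cstar_seminorm_op_norm: "cstar_seminorm G op_norm"
  unfolding cstar_seminorm_def
  by (simp add: op_norm_nonneg op_norm_scale op_norm_star_mult op_norm_add op_norm_mult)

lemma op_norm_eq_0: "(\<And>f. op_poly p f = (\<lambda>_. 0)) \<Longrightarrow> op_norm p = 0"
  by (rule antisym[OF op_norm_leI op_norm_nonneg]) (simp add: nrm2_def)

lemma op_poly_gen: "op_poly (gen g) f = op_letter (g, False) f"
  by (simp add: gen_def op_poly_single op_word_def)

lemma op_poly_star_gen: "op_poly (star (gen g)) f = op_letter (g, True) f"
  by (simp add: gen_def star_single adj_word_def op_poly_single op_word_def)

text \<open>The operator fixes the point mass at x, because no other point is sent to x.\<close>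

lemma op_norm_gen_fixpoint: assumes "m (g, False) x = Some x" shows "1 \<le> op_norm (gen g)"
proof -
  let ?f = "\<lambda>y. if y = x then 1 else (0::complex)"
  have f: "fin_supp ?f" "nrm2 ?f = 1" by (simp_all add: fin_supp_def nrm2_def)
  have inj: "y = x" if "m (g, False) y = Some x" for y
    using assms that m_adj[of g False y x] m_adj[of g False x x] by simp
  have "op_letter (g, False) ?f = ?f"
    using assms inj by (force simp: op_letter_def split: option.splits)
  then show ?thesis using le_op_norm1[of ?f "gen g"] f by (simp add: op_poly_gen)
qed

end

section \<open>Boundary paths\<close>

context generalized_boolean_algebra
begin

subclass bounded_lattice_bot ..

lemma diff_le: "x - y \<le> x"
  by (metis sup.cobounded1 sup_diff_inf)

definition filter_on :: "'a set \<Rightarrow> bool" where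
  "filter_on u \<longleftrightarrow> u \<noteq> {} \<and> bot \<notin> u \<and> (\<forall>x\<in>u. \<forall>y. x \<le> y \<longrightarrow> y \<in> u) \<and> (\<forall>x\<in>u. \<forall>y\<in>u. inf x y \<in> u)"

lemma filter_onD:
  assumes "filter_on u"
  shows "x \<in> u \<Longrightarrow> x \<le> y \<Longrightarrow> y \<in> u" "x \<in> u \<Longrightarrow> y \<in> u \<Longrightarrow> inf x y \<in> u"
  using assms unfolding filter_on_def by blast+

definition prime_filter :: "'a set \<Rightarrow> bool" where
  "prime_filter u \<longleftrightarrow> u \<noteq> {} \<and> bot \<notin> u \<and> (\<forall>x y. inf x y \<in> u \<longleftrightarrow> x \<in> u \<and> y \<in> u) \<and>
     (\<forall>x y. sup x y \<in> u \<longleftrightarrow> x \<in> u \<or> y \<in> u)"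

lemma prime_filter_mono: "prime_filter u \<Longrightarrow> x \<in> u \<Longrightarrow> x \<le> y \<Longrightarrow> y \<in> u"
  unfolding prime_filter_def by (metis inf.absorb1)

lemma prime_filter_diff: "prime_filter u \<Longrightarrow> x \<in> u \<Longrightarrow> y \<notin> u \<Longrightarrow> x - y \<in> u"
  unfolding prime_filter_def by (metis sup_diff_inf)

text \<open>Zorn gives a maximal filter above v. If it contained neither x nor y, it would contain
  members disjoint from x and from y, and their meet is disjoint from the join of x and y; hence it
  is prime.\<close>

lemma extend_to_prime_filter:
  assumes v: "filter_on v" obtains u where "v \<subseteq> u" "prime_filter u"
proof -
  let ?F = "{u. filter_on u \<and> v \<subseteq> u}"
  have "\<exists>u\<in>?F. \<forall>w\<in>?F. u \<subseteq> w \<longrightarrow> w = u"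
  proof (rule subset_Zorn_nonempty)
    show "?F \<noteq> {}" using v by blast
    fix C assume C: "C \<noteq> {}" "subset.chain ?F C"
    have CF: "filter_on c" "v \<subseteq> c" if "c \<in> C" for c using C(2) that by (auto simp: subset.chain_def)
    have "filter_on (\<Union>C)"
      unfolding filter_on_def
    proof (intro conjI ballI allI impI)
      show "\<Union>C \<noteq> {}" "bot \<notin> \<Union>C" using C(1) CF by (auto simp: filter_on_def)
      fix x assume "x \<in> \<Union>C"
      then obtain c where c: "c \<in> C" "x \<in> c" by blast
      show "y \<in> \<Union>C" if "x \<le> y" for y using filter_onD(1)[OF CF(1)[OF c(1)] c(2) that] c(1) by (rule UnionI[rotated])
      fix y assume "y \<in> \<Union>C"
      then obtain d where d: "d \<in> C" "y \<in> d" by blast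
      have "c \<subseteq> d \<or> d \<subseteq> c" using C(2) c(1) d(1) unfolding subset.chain_def by blast
      then show "inf x y \<in> \<Union>C"
      proof
        assume "c \<subseteq> d"
        then have "x \<in> d" using c(2) by (rule subsetD)
        then show ?thesis using filter_onD(2)[OF CF(1)[OF d(1)] _ d(2)] d(1) by (intro UnionI[of d])
      next
        assume "d \<subseteq> c"
        then have "y \<in> c" using d(2) by (rule subsetD)
        then show ?thesis using filter_onD(2)[OF CF(1)[OF c(1)] c(2)] c(1) by (intro UnionI[of c])
      qed
    qed
    then show "\<Union>C \<in> ?F" using C(1) CF(2) by blast
  qed
  then obtain u where u: "filter_on u" "v \<subseteq> u" and maximal: "\<forall>w\<in>?F. u \<subseteq> w \<longrightarrow> w = u"
    by auto
  have max: "w = u" if "filter_on w" "u \<subseteq> w" for w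
    using maximal that u(2) subset_trans by auto
  \<comment> \<open>If every member met \<open>x\<close>, the filter generated by \<open>u\<close>
    and \<open>x\<close> would be proper and strictly larger.\<close>
  have disjoint: "\<exists>m\<in>u. inf m x = bot" if "x \<notin> u" for x
  proof (rule ccontr)
    assume contra: "\<not> ?thesis"
    let ?w = "{y. \<exists>m\<in>u. inf m x \<le> y}"
    have "filter_on ?w"
      unfolding filter_on_def
    proof (intro conjI ballI allI impI)
      show "?w \<noteq> {}" using u(1) by (auto simp: filter_on_def)
      show "bot \<notin> ?w" using contra by (auto simp: bot_unique)
      show "z \<in> ?w" if "y \<in> ?w" "y \<le> z" for y z using that by (auto intro: order_trans)
      fix y z assume "y \<in> ?w" "z \<in> ?w"
      then obtain m n where mn: "m \<in> u" "n \<in> u" "inf m x \<le> y" "inf n x \<le> z" by blast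
      have "inf m n \<in> u" using mn u(1) by (auto simp: filter_on_def)
      moreover have "inf (inf m n) x \<le> inf y z"
        using mn(3,4) by (metis inf.bounded_iff inf.cobounded1 inf.cobounded2 inf_mono order_refl order_trans)
      ultimately show "inf y z \<in> ?w" by blast
    qed
    moreover have "u \<subseteq> ?w" by (auto intro: inf.cobounded1)
    ultimately have "?w = u" by (rule max)
    moreover have "x \<in> ?w" using u(1) by (auto simp: filter_on_def)
    ultimately show False using that by blast
  qed
  have "x \<in> u \<or> y \<in> u" if "sup x y \<in> u" for x y
  proof (rule ccontr)
    assume "\<not> ?thesis"
    then obtain m n where mn: "m \<in> u" "n \<in> u" "inf m x = bot" "inf n y = bot" using disjoint by blast
    have "inf (inf m n) (sup x y) = sup (inf n (inf m x)) (inf m (inf n y))"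
      by (simp add: inf_sup_distrib1 ac_simps)
    also have "\<dots> = bot" by (simp add: mn)
    finally show False using mn(1,2) u(1) that unfolding filter_on_def by metis
  qed
  then have "prime_filter u"
    using u(1) unfolding prime_filter_def filter_on_def
    by (metis inf.cobounded1 inf.cobounded2 sup.cobounded1 sup.cobounded2)
  with u(2) show thesis by (rule that)
qed

end

locale bds =
  fixes L :: "'l set" and \<theta> :: "'l \<Rightarrow> 'b::generalized_boolean_algebra \<Rightarrow> 'b"
  assumes bds: "boolean_dynamical_system L \<theta>"
begin

lemma theta_bot [simp]: "a \<in> L \<Longrightarrow> \<theta> a bot = bot"
  and theta_inf: "a \<in> L \<Longrightarrow> \<theta> a (inf A B) = inf (\<theta> a A) (\<theta> a B)"
  and theta_sup: "a \<in> L \<Longrightarrow> \<theta> a (sup A B) = sup (\<theta> a A) (\<theta> a B)"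
  using bds by (auto simp: boolean_dynamical_system_def boolean_action_def)

lemma theta_mono: "a \<in> L \<Longrightarrow> A \<le> B \<Longrightarrow> \<theta> a A \<le> \<theta> a B"
  by (metis inf.orderE inf.orderI theta_inf)

lemma word_le_range_lub:
  assumes "w \<noteq> []" "set w \<subseteq> L" shows "fold \<theta> w A \<le> range_lub (fold \<theta> w)"
proof -
  have "compact_range (fold \<theta> w)" using bds assms by (auto simp: boolean_dynamical_system_def)
  then obtain R where R: "\<forall>A. fold \<theta> w A \<le> R" "\<forall>U. (\<forall>A. fold \<theta> w A \<le> U) \<longrightarrow> R \<le> U"
    by (auto simp: compact_range_def)
  have "\<forall>A. fold \<theta> w A \<le> range_lub (fold \<theta> w)"
    unfolding range_lub_def by (rule LeastI2_order[of _ R]) (use R in auto)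
  then show ?thesis by blast
qed

lemma theta_le_range_lub: "a \<in> L \<Longrightarrow> \<theta> a A \<le> range_lub (\<theta> a)"
  using word_le_range_lub[of "[a]" A] by simp

lemma theta_domain: assumes "a \<in> L" obtains D where "\<theta> a D = range_lub (\<theta> a)"
proof -
  have "closed_domain (fold \<theta> [a])"
    using bds assms unfolding boolean_dynamical_system_def by (elim conjE allE[of _ "[a]"]) simp
  then show thesis using that by (auto simp: closed_domain_def)
qed

text \<open>Boundary paths: a label \<open>None\<close> ends the path, which is allowed only where no relation of
  type (4) applies; the entries after the end are irrelevant.\<close>

definition boundary_path :: "(nat \<Rightarrow> 'b set \<times> 'l option) \<Rightarrow> bool" where
  "boundary_path \<xi> \<longleftrightarrow> (\<forall>n. prime_filter (fst (\<xi> n)) \<and>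
     (case snd (\<xi> n) of None \<Rightarrow> fst (\<xi> n) \<inter> B_reg L \<theta> = {}
      | Some a \<Rightarrow> a \<in> L \<and> range_lub (\<theta> a) \<in> fst (\<xi> (Suc n)) \<and> fst (\<xi> n) = {A. \<theta> a A \<in> fst (\<xi> (Suc n))}))"

definition prepend :: "'l \<Rightarrow> (nat \<Rightarrow> 'b set \<times> 'l option) \<Rightarrow> nat \<Rightarrow> 'b set \<times> 'l option" where
  "prepend a \<xi> = case_nat ({A. \<theta> a A \<in> fst (\<xi> 0)}, Some a) \<xi>"

lemma prime_filter_path: "boundary_path \<xi> \<Longrightarrow> prime_filter (fst (\<xi> n))"
  by (simp add: boundary_path_def)

lemma path_label:
  assumes "boundary_path \<xi>" "snd (\<xi> n) = Some a"
  shows "a \<in> L" "range_lub (\<theta> a) \<in> fst (\<xi> (Suc n))" "fst (\<xi> n) = {A. \<theta> a A \<in> fst (\<xi> (Suc n))}"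
proof -
  have "case snd (\<xi> n) of None \<Rightarrow> fst (\<xi> n) \<inter> B_reg L \<theta> = {}
      | Some a \<Rightarrow> a \<in> L \<and> range_lub (\<theta> a) \<in> fst (\<xi> (Suc n)) \<and> fst (\<xi> n) = {A. \<theta> a A \<in> fst (\<xi> (Suc n))}"
    using assms(1) unfolding boundary_path_def by blast
  then show "a \<in> L" "range_lub (\<theta> a) \<in> fst (\<xi> (Suc n))" "fst (\<xi> n) = {A. \<theta> a A \<in> fst (\<xi> (Suc n))}"
    using assms(2) by auto
qed

lemma path_end: "boundary_path \<xi> \<Longrightarrow> snd (\<xi> n) = None \<Longrightarrow> fst (\<xi> n) \<inter> B_reg L \<theta> = {}"
  unfolding boundary_path_def by (drule spec[of _ n]) simp

lemma boundary_path_tl: "boundary_path \<xi> \<Longrightarrow> boundary_path (\<lambda>n. \<xi> (Suc n))"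
  by (simp add: boundary_path_def)

text \<open>Nonemptiness is where the closed domain enters: the D that attains the range of
  \<open>a\<close> lies in the preimage.\<close>

lemma prime_filter_preimage:
  assumes a: "a \<in> L" and u: "prime_filter u" "range_lub (\<theta> a) \<in> u"
  shows "prime_filter {A. \<theta> a A \<in> u}"
proof -
  obtain D where "\<theta> a D = range_lub (\<theta> a)" using theta_domain[OF a] .
  then have "D \<in> {A. \<theta> a A \<in> u}" using u by simp
  then show ?thesis using a u(1) by (auto simp: prime_filter_def theta_inf theta_sup)
qed

lemma boundary_path_prepend:
  assumes "a \<in> L" "boundary_path \<xi>" "range_lub (\<theta> a) \<in> fst (\<xi> 0)"
  shows "boundary_path (prepend a \<xi>)"
  unfolding boundary_path_def
proof
  fix n
  show "prime_filter (fst (prepend a \<xi> n)) \<and>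
     (case snd (prepend a \<xi> n) of None \<Rightarrow> fst (prepend a \<xi> n) \<inter> B_reg L \<theta> = {}
      | Some b \<Rightarrow> b \<in> L \<and> range_lub (\<theta> b) \<in> fst (prepend a \<xi> (Suc n)) \<and>
          fst (prepend a \<xi> n) = {A. \<theta> b A \<in> fst (prepend a \<xi> (Suc n))})"
  proof (cases n)
    case 0
    then show ?thesis
      using assms prime_filter_preimage[OF assms(1) prime_filter_path[OF assms(2)] assms(3)]
      by (simp add: prepend_def)
  next
    case (Suc k)
    have tl: "prepend a \<xi> (Suc i) = \<xi> i" for i by (simp add: prepend_def)
    show ?thesis using assms(2) unfolding boundary_path_def Suc tl by simp
  qed
qed

lemma prepend_tl:
  assumes "boundary_path \<xi>" "snd (\<xi> 0) = Some a" shows "prepend a (\<lambda>n. \<xi> (Suc n)) = \<xi>"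
proof
  fix n
  show "prepend a (\<lambda>n. \<xi> (Suc n)) n = \<xi> n"
    using path_label(3)[OF assms] assms(2) by (cases n) (auto simp: prepend_def prod_eq_iff)
qed

lemma prepend_Suc [simp]: "prepend a \<xi> (Suc n) = \<xi> n"
  and snd_prepend_0 [simp]: "snd (prepend a \<xi> 0) = Some a"
  by (simp_all add: prepend_def)

text \<open>If the filter contains a regular B, only finitely many letters leave B. Were each of
  them to kill some member of the filter, the meet of these members with B would be nonempty and
  emit no letter, against regularity. A surviving letter maps the filter to a filter base, and any
  prime filter above it can come next.\<close>

lemma path_step:
  assumes u: "prime_filter u"
  shows "\<exists>l u'. prime_filter u' \<and> (case l of None \<Rightarrow> u \<inter> B_reg L \<theta> = {}
      | Some a \<Rightarrow> a \<in> L \<and> range_lub (\<theta> a) \<in> u' \<and> u = {A. \<theta> a A \<in> u'})"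
proof (cases "u \<inter> B_reg L \<theta> = {}")
  case True
  then show ?thesis using u by (intro exI[of _ None] exI[of _ u]) simp
next
  case False
  then obtain B where B: "B \<in> u" "B \<in> B_reg L \<theta>" by blast
  have "B \<noteq> bot" using B(1) u by (auto simp: prime_filter_def)
  then have finite: "finite (Delta L \<theta> B)" using B(2) unfolding B_reg_def by blast
  have "\<exists>a\<in>Delta L \<theta> B. \<forall>C\<in>u. \<theta> a C \<noteq> bot"
  proof (rule ccontr)
    assume "\<not> ?thesis"
    then have kill: "\<And>a. a \<in> Delta L \<theta> B \<Longrightarrow> \<exists>C\<in>u. \<theta> a C = bot" by blast
    have "\<exists>C\<in>u. \<forall>a\<in>I. \<theta> a C = bot" if "finite I" "I \<subseteq> Delta L \<theta> B" for I
      using that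
    proof (induction I)
      case empty
      then show ?case using B(1) by blast
    next
      case (insert a I)
      then obtain C C' where C: "C \<in> u" "\<forall>a\<in>I. \<theta> a C = bot" "C' \<in> u" "\<theta> a C' = bot"
        using kill by (metis insert_subset)
      have "inf C C' \<in> u" using C u by (simp add: prime_filter_def)
      moreover have "\<forall>b\<in>insert a I. \<theta> b (inf C C') = bot"
        using C insert.prems by (simp add: Delta_def theta_inf subset_iff)
      ultimately show ?case by blast
    qed
    from this[OF finite order_refl] obtain C where C: "C \<in> u" "\<forall>a\<in>Delta L \<theta> B. \<theta> a C = bot"
      by blast
    have CB: "inf C B \<in> u" using C B u by (simp add: prime_filter_def)
    then have "inf C B \<noteq> bot" using u unfolding prime_filter_def by metis
    then have "0 < card (Delta L \<theta> (inf C B))" using B(2) by (simp add: B_reg_def)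
    then obtain a where a: "a \<in> L" "\<theta> a (inf C B) \<noteq> bot"
      by (auto simp: Delta_def card_gt_0_iff)
    then have "a \<in> Delta L \<theta> B" by (auto simp: Delta_def theta_inf)
    then have "\<theta> a C = bot" using C(2) by blast
    then show False using a by (simp add: theta_inf)
  qed
  then obtain a where a: "a \<in> L" "\<And>C. C \<in> u \<Longrightarrow> \<theta> a C \<noteq> bot" by (auto simp: Delta_def)
  let ?v = "{x. \<exists>C\<in>u. \<theta> a C \<le> x}"
  have "filter_on ?v"
    unfolding filter_on_def
  proof (intro conjI ballI allI impI)
    show "?v \<noteq> {}" using B(1) by blast
    show "bot \<notin> ?v" using a(2) by (auto simp: bot_unique)
    show "y \<in> ?v" if "x \<in> ?v" "x \<le> y" for x y using that by (auto intro: order_trans)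
    fix x y assume "x \<in> ?v" "y \<in> ?v"
    then obtain C D where CD: "C \<in> u" "D \<in> u" "\<theta> a C \<le> x" "\<theta> a D \<le> y" by blast
    then have "inf C D \<in> u" "\<theta> a (inf C D) \<le> inf x y"
      using u a(1) by (simp_all add: prime_filter_def theta_inf le_infI1 le_infI2)
    then show "inf x y \<in> ?v" by blast
  qed
  then obtain u' where u': "?v \<subseteq> u'" "prime_filter u'" by (rule extend_to_prime_filter)
  have mem: "\<theta> a C \<in> u'" if "C \<in> u" for C using u'(1) that by blast
  have "range_lub (\<theta> a) \<in> u'"
    using prime_filter_mono[OF u'(2) mem[OF B(1)] theta_le_range_lub[OF a(1)]] .
  \<comment> \<open>If \<open>A\<close> were missing from \<open>u\<close>, then
    \<open>B - A\<close> would belong to it, and the disjoint images of \<open>B - A\<close> and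
    \<open>A\<close> would both lie in \<open>u'\<close>.\<close>
  moreover have "A \<in> u" if A: "\<theta> a A \<in> u'" for A
  proof (rule ccontr)
    assume "A \<notin> u"
    then have "\<theta> a (B - A) \<in> u'" using mem prime_filter_diff[OF u B(1)] by blast
    then have "inf (\<theta> a (B - A)) (\<theta> a A) \<in> u'" using A u'(2) by (simp add: prime_filter_def)
    then show False using u'(2) by (simp add: theta_inf[symmetric] a(1) inf_diff_bot prime_filter_def)
  qed
  ultimately show ?thesis
    using u'(2) a(1) mem by (intro exI[of _ "Some a"] exI[of _ u']) auto
qed

text \<open>Start with a prime filter containing A and iterate a choice of next label and next
  filter. The choice continues formally past a label \<open>None\<close>, since a path is a total
  sequence.\<close>

lemma boundary_path_exists:
  assumes "A \<noteq> bot" obtains \<xi> where "boundary_path \<xi>" "A \<in> fst (\<xi> 0)"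
proof -
  have "filter_on {x. A \<le> x}"
    using assms by (auto simp: filter_on_def bot_unique intro: order_trans)
  then obtain u where u: "{x. A \<le> x} \<subseteq> u" "prime_filter u" by (rule extend_to_prime_filter)
  obtain lab nxt where step: "\<And>u. prime_filter u \<Longrightarrow> prime_filter (nxt u) \<and> (case lab u of None \<Rightarrow> u \<inter> B_reg L \<theta> = {}
      | Some a \<Rightarrow> a \<in> L \<and> range_lub (\<theta> a) \<in> nxt u \<and> u = {A. \<theta> a A \<in> nxt u})"
  proof -
    have "\<exists>q. prime_filter u \<longrightarrow> prime_filter (snd q) \<and> (case fst q of None \<Rightarrow> u \<inter> B_reg L \<theta> = {}
      | Some a \<Rightarrow> a \<in> L \<and> range_lub (\<theta> a) \<in> snd q \<and> u = {A. \<theta> a A \<in> snd q})" for u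
    proof (cases "prime_filter u")
      case True
      from path_step[OF this] obtain l u' where "prime_filter u' \<and> (case l of None \<Rightarrow> u \<inter> B_reg L \<theta> = {}
        | Some a \<Rightarrow> a \<in> L \<and> range_lub (\<theta> a) \<in> u' \<and> u = {A. \<theta> a A \<in> u'})" by (elim exE)
      then show ?thesis by (intro exI[of _ "(l, u')"]) (simp cong: option.case_cong)
    qed simp
    then obtain q where "\<And>u. prime_filter u \<longrightarrow> prime_filter (snd (q u)) \<and> (case fst (q u) of None \<Rightarrow> u \<inter> B_reg L \<theta> = {}
      | Some a \<Rightarrow> a \<in> L \<and> range_lub (\<theta> a) \<in> snd (q u) \<and> u = {A. \<theta> a A \<in> snd (q u)})"
      by (atomize_elim, intro choice allI)
    then show ?thesis by (intro that[of "\<lambda>u. snd (q u)" "\<lambda>u. fst (q u)"]) blast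
  qed
  define v where "v n = (nxt ^^ n) u" for n
  have v: "prime_filter (v n)" for n by (induction n) (use u step in \<open>simp_all add: v_def\<close>)
  have "v (Suc n) = nxt (v n)" for n by (simp add: v_def)
  then have "boundary_path (\<lambda>n. (v n, lab (v n)))"
    unfolding boundary_path_def using v step[OF v] by (simp cong: option.case_cong)
  moreover have "A \<in> v 0" using u by (auto simp: v_def)
  ultimately show thesis by (intro that) auto
qed

text \<open>Operators compose with these maps, so \<open>S a\<close> removes a first label
  \<open>a\<close> and its adjoint prepends it. On point masses this becomes the expected action:
  the generator prepends \<open>a\<close>, its adjoint removes it.\<close>

definition path_map :: "('b, 'l) bds_gen \<times> bool \<Rightarrow> (nat \<Rightarrow> 'b set \<times> 'l option) \<Rightarrow> (nat \<Rightarrow> 'b set \<times> 'l option) option" where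
  "path_map l \<xi> = (case l of
     (P A, _) \<Rightarrow> if boundary_path \<xi> \<and> A \<in> fst (\<xi> 0) then Some \<xi> else None
   | (S a, False) \<Rightarrow> if boundary_path \<xi> \<and> snd (\<xi> 0) = Some a then Some (\<lambda>n. \<xi> (Suc n)) else None
   | (S a, True) \<Rightarrow> if boundary_path \<xi> \<and> a \<in> L \<and> range_lub (\<theta> a) \<in> fst (\<xi> 0) then Some (prepend a \<xi>) else None)"

lemma path_map_simps:
  "path_map (P A, b) \<xi> = (if boundary_path \<xi> \<and> A \<in> fst (\<xi> 0) then Some \<xi> else None)"
  "path_map (S a, False) \<xi> = (if boundary_path \<xi> \<and> snd (\<xi> 0) = Some a then Some (\<lambda>n. \<xi> (Suc n)) else None)"
  "path_map (S a, True) \<xi> = (if boundary_path \<xi> \<and> a \<in> L \<and> range_lub (\<theta> a) \<in> fst (\<xi> 0) then Some (prepend a \<xi>) else None)"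
  by (simp_all add: path_map_def)

lemma path_map_S: "path_map (S a, False) \<eta> = Some \<xi> \<longleftrightarrow> path_map (S a, True) \<xi> = Some \<eta>"
proof
  assume "path_map (S a, False) \<eta> = Some \<xi>"
  then have \<eta>: "boundary_path \<eta>" "snd (\<eta> 0) = Some a" "\<xi> = (\<lambda>n. \<eta> (Suc n))"
    by (auto simp: path_map_simps split: if_splits)
  then show "path_map (S a, True) \<xi> = Some \<eta>"
    using path_label[OF \<eta>(1,2)] boundary_path_tl[OF \<eta>(1)] prepend_tl[OF \<eta>(1,2)]
    by (simp add: path_map_simps)
next
  assume "path_map (S a, True) \<xi> = Some \<eta>"
  then have "boundary_path \<xi>" "a \<in> L" "range_lub (\<theta> a) \<in> fst (\<xi> 0)" "\<eta> = prepend a \<xi>"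
    by (auto simp: path_map_simps split: if_splits)
  then show "path_map (S a, False) \<eta> = Some \<xi>"
    using boundary_path_prepend by (simp add: path_map_simps)
qed

lemma path_map_adj: "path_map (g, b) \<eta> = Some \<xi> \<longleftrightarrow> path_map (g, \<not> b) \<xi> = Some \<eta>"
proof (cases g)
  case (P A)
  then show ?thesis by (auto simp: path_map_simps)
next
  case (S a)
  then show ?thesis using path_map_S[of a \<eta> \<xi>] path_map_S[of a \<xi> \<eta>] by (cases b) auto
qed

lemma path_op_P: "op_letter path_map (P A, b) f \<xi> = (if boundary_path \<xi> \<and> A \<in> fst (\<xi> 0) then f \<xi> else 0)"
  and path_op_S: "op_letter path_map (S a, False) f \<xi> =
    (if boundary_path \<xi> \<and> snd (\<xi> 0) = Some a then f (\<lambda>n. \<xi> (Suc n)) else 0)"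
  and path_op_S_adj: "op_letter path_map (S a, True) f \<xi> =
    (if boundary_path \<xi> \<and> a \<in> L \<and> range_lub (\<theta> a) \<in> fst (\<xi> 0) then f (prepend a \<xi>) else 0)"
  by (simp_all add: op_letter_def[OF path_map_adj] path_map_simps)

lemma path_op_relation:
  assumes "r \<in> bds_rels L \<theta>" shows "op_poly path_map r f = (\<lambda>_. 0)"
  using assms
proof cases
  case (p_reg A)
  have "(if boundary_path \<xi> \<and> A \<in> fst (\<xi> 0) then f \<xi> else 0) =
      (\<Sum>a\<in>Delta L \<theta> A. if boundary_path \<xi> \<and> snd (\<xi> 0) = Some a then
        if boundary_path (\<lambda>n. \<xi> (Suc n)) \<and> \<theta> a A \<in> fst (\<xi> (Suc 0)) then
        if boundary_path (\<lambda>n. \<xi> (Suc n)) \<and> a \<in> L \<and> range_lub (\<theta> a) \<in> fst (\<xi> (Suc 0))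
        then f (prepend a (\<lambda>n. \<xi> (Suc n))) else 0 else 0 else 0)" (is "?l = sum ?h _") for \<xi>
  proof (cases "boundary_path \<xi> \<and> A \<in> fst (\<xi> 0)")
    case True
    \<comment> \<open>The path cannot end at a filter containing the regular set \<open>A\<close>,
      so it has a first label, and only the summand for this label is nonzero on it.\<close>
    then obtain a where a: "snd (\<xi> 0) = Some a" using path_end[of \<xi> 0] p_reg(2) by auto
    note lab = path_label[OF conjunct1[OF True] a]
    have \<theta>A: "\<theta> a A \<in> fst (\<xi> (Suc 0))" using lab(3) True by simp
    have "bot \<notin> fst (\<xi> n)" for n using prime_filter_path[of \<xi> n] True by (simp add: prime_filter_def)
    then have "A \<noteq> bot" "\<theta> a A \<noteq> bot" using True \<theta>A by metis+
    then have "finite (Delta L \<theta> A)" "a \<in> Delta L \<theta> A"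
      using p_reg(2) lab(1) by (auto simp: B_reg_def Delta_def)
    moreover have "?h b = (if b = a then f \<xi> else 0)" for b
      using True a lab \<theta>A boundary_path_tl[of \<xi>] prepend_tl[of \<xi> a] by simp
    ultimately show ?thesis using True by simp
  next
    case False
    have "sum ?h (Delta L \<theta> A) = 0"
      by (rule sum.neutral) (use False path_label(3)[of \<xi> 0] in auto)
    then show ?thesis using False by (simp only: if_False)
  qed
  then show ?thesis
    unfolding p_reg(1)
    by (simp add: op_poly_minus[OF path_map_adj] op_poly_sum[OF path_map_adj] op_poly_mult[OF path_map_adj]
      op_poly_gen[OF path_map_adj] op_poly_star_gen[OF path_map_adj] path_op_P path_op_S path_op_S_adj fun_eq_iff cong: if_cong)
qed (auto simp: op_poly_minus[OF path_map_adj] op_poly_plus[OF path_map_adj] op_poly_mult[OF path_map_adj]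
    op_poly_gen[OF path_map_adj] op_poly_star_gen[OF path_map_adj] path_op_P path_op_S path_op_S_adj fun_eq_iff
    boundary_path_tl path_label prepend_tl boundary_path_prepend prime_filter_def
    dest: prime_filter_path[of _ 0])

text \<open>A boundary path that starts in a filter containing A is fixed by the partial map of
  \<open>P A\<close>, so its point mass witnesses norm at least 1.\<close>

theorem faithful_seminorm:
  assumes "A \<noteq> bot"
  shows "\<exists>N. cstar_seminorm (bds_gens L) N \<and> (\<forall>r\<in>bds_rels L \<theta>. N r = 0) \<and> 1 \<le> N (gen_p A)"
proof -
  obtain \<xi> where \<xi>: "boundary_path \<xi>" "A \<in> fst (\<xi> 0)" using boundary_path_exists[OF assms] .
  show ?thesis
  proof (intro exI conjI ballI)
    show "cstar_seminorm (bds_gens L) (op_norm path_map)"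
      by (rule cstar_seminorm_op_norm[OF path_map_adj])
    show "op_norm path_map r = 0" if "r \<in> bds_rels L \<theta>" for r
      by (rule op_norm_eq_0[OF path_map_adj path_op_relation[OF that]])
    show "1 \<le> op_norm path_map (gen_p A)"
      by (rule op_norm_gen_fixpoint[OF path_map_adj, of _ \<xi>]) (use \<xi> in \<open>simp add: path_map_simps\<close>)
  qed
qed

end

section \<open>The inverse semigroup of a Boolean dynamical system\<close>

context bds
begin

lemma fold_theta_inf: "set w \<subseteq> L \<Longrightarrow> fold \<theta> w (inf A B) = inf (fold \<theta> w A) (fold \<theta> w B)"
  by (induction w arbitrary: A B) (simp_all add: theta_inf)

lemma fold_theta_bot: "set w \<subseteq> L \<Longrightarrow> fold \<theta> w bot = bot"
  by (induction w) simp_all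

lemma fold_theta_mono: "set w \<subseteq> L \<Longrightarrow> A \<le> B \<Longrightarrow> fold \<theta> w A \<le> fold \<theta> w B"
  by (induction w arbitrary: A B) (simp_all add: theta_mono)

lemma range_lub_eqI:
  assumes "\<And>A. f A \<le> f D" shows "range_lub f = f D"
  unfolding range_lub_def by (rule Least_equality) (use assms in auto)

text \<open>Some D attains the range of the first letter, and monotonicity keeps it maximal along
  the remaining letters.\<close>

lemma range_lub_Cons:
  assumes "a \<in> L" "set w \<subseteq> L" shows "range_lub (fold \<theta> (a # w)) = fold \<theta> w (range_lub (\<theta> a))"
proof -
  obtain D where D: "\<theta> a D = range_lub (\<theta> a)" using theta_domain[OF assms(1)] .
  have "range_lub (fold \<theta> (a # w)) = fold \<theta> (a # w) D"
    by (rule range_lub_eqI) (use assms D in \<open>auto intro!: fold_theta_mono theta_le_range_lub\<close>)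
  then show ?thesis by (simp add: D)
qed

text \<open>The disjunction encodes the formal top element as the range of the empty word.\<close>

definition below :: "'b \<Rightarrow> 'l list \<Rightarrow> bool" where
  "below A w \<longleftrightarrow> w = [] \<or> A \<le> range_lub (fold \<theta> w)"

lemma below_fold: "set w \<subseteq> L \<Longrightarrow> D \<le> fold \<theta> w A \<Longrightarrow> below D w"
  using word_le_range_lub[of w A] by (cases "w = []") (auto simp: below_def intro: order_trans)

lemma below_append:
  assumes "set v \<subseteq> L" "set w \<subseteq> L" "below A v" "D \<le> fold \<theta> w A"
  shows "below D (v @ w)"
proof (cases v)
  case Nil
  then show ?thesis using assms below_fold by simp
next
  case (Cons a u)
  have "A \<le> fold \<theta> u (range_lub (\<theta> a))"
    using assms(1,3) range_lub_Cons[of a u] by (simp add: below_def Cons)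
  then have "D \<le> fold \<theta> w (fold \<theta> u (range_lub (\<theta> a)))"
    using assms(2,4) fold_theta_mono order_trans by metis
  then show ?thesis using range_lub_Cons[of a "u @ w"] assms(1,2) by (simp add: below_def Cons)
qed

end

section \<open>Calculus of words for families satisfying the defining relations\<close>

locale bds_family = bds L \<theta> + cstar_algebra A
  for L :: "'l set" and \<theta> :: "'l \<Rightarrow> 'b::generalized_boolean_algebra \<Rightarrow> 'b" and A (structure) +
  fixes p :: "'b \<Rightarrow> 'a" and s :: "'l \<Rightarrow> 'a"
  assumes p_closed [simp]: "p B \<in> carrier A"
    and s_closed [simp]: "a \<in> L \<Longrightarrow> s a \<in> carrier A"
    and p_adj [simp]: "adj A (p B) = p B"
    and p_mult: "p B \<otimes> p D = p (inf B D)"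
    and p_sup: "p (sup B D) = p B \<oplus> p D \<ominus> p (inf B D)"
    and p_bot [simp]: "p bot = \<zero>"
    and s_partial_isometry: "a \<in> L \<Longrightarrow> s a \<otimes> adj A (s a) \<otimes> s a = s a"
    and p_s: "a \<in> L \<Longrightarrow> p B \<otimes> s a = s a \<otimes> p (\<theta> a B)"
    and s_s_same: "a \<in> L \<Longrightarrow> adj A (s a) \<otimes> s a = p (range_lub (\<theta> a))"
    and s_s_diff: "a \<in> L \<Longrightarrow> b \<in> L \<Longrightarrow> a \<noteq> b \<Longrightarrow> adj A (s a) \<otimes> s b = \<zero>"
    and p_reg: "B \<in> B_reg L \<theta> \<Longrightarrow> p B = finsum A (\<lambda>a. s a \<otimes> p (\<theta> a B) \<otimes> adj A (s a)) (Delta L \<theta> B)"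
begin

abbreviation "rng a \<equiv> range_lub (\<theta> a)"

lemma p_p: "x \<in> carrier A \<Longrightarrow> p B \<otimes> (p D \<otimes> x) = p (inf B D) \<otimes> x"
  by (simp add: mult_assoc[symmetric] p_mult)

lemma s_p_rng: "a \<in> L \<Longrightarrow> s a \<otimes> p (rng a) = s a"
  using s_partial_isometry[of a] by (simp add: mult_assoc s_s_same)

lemma p_rng_adj: "a \<in> L \<Longrightarrow> p (rng a) \<otimes> adj A (s a) = adj A (s a)"
  using arg_cong[OF s_p_rng, of a "adj A"] by (simp add: adj_mult)

lemma adj_s_p: "a \<in> L \<Longrightarrow> adj A (s a) \<otimes> p B = p (\<theta> a B) \<otimes> adj A (s a)"
  using arg_cong[OF p_s, of a "adj A" B] by (simp add: adj_mult)

lemma p_s_act: "a \<in> L \<Longrightarrow> x \<in> carrier A \<Longrightarrow> p B \<otimes> (s a \<otimes> x) = s a \<otimes> (p (\<theta> a B) \<otimes> x)"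
  by (simp add: mult_assoc[symmetric] p_s)

lemma adj_s_p_act: "a \<in> L \<Longrightarrow> x \<in> carrier A \<Longrightarrow> adj A (s a) \<otimes> (p B \<otimes> x) = p (\<theta> a B) \<otimes> (adj A (s a) \<otimes> x)"
  by (simp add: mult_assoc[symmetric] adj_s_p)

lemma s_p_rng_act: "a \<in> L \<Longrightarrow> x \<in> carrier A \<Longrightarrow> s a \<otimes> (p (rng a) \<otimes> x) = s a \<otimes> x"
  by (simp add: mult_assoc[symmetric] s_p_rng)

lemma p_rng_adj_act: "a \<in> L \<Longrightarrow> x \<in> carrier A \<Longrightarrow> p (rng a) \<otimes> (adj A (s a) \<otimes> x) = adj A (s a) \<otimes> x"
  by (simp add: mult_assoc[symmetric] p_rng_adj)

lemma adj_s_s_act: "a \<in> L \<Longrightarrow> x \<in> carrier A \<Longrightarrow> adj A (s a) \<otimes> (s a \<otimes> x) = p (rng a) \<otimes> x"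
  by (simp add: mult_assoc[symmetric] s_s_same)

lemma adj_s_s_act_diff: "a \<in> L \<Longrightarrow> b \<in> L \<Longrightarrow> a \<noteq> b \<Longrightarrow> x \<in> carrier A \<Longrightarrow> adj A (s a) \<otimes> (s b \<otimes> x) = \<zero>"
  by (simp add: mult_assoc[symmetric] s_s_diff)

text \<open>B is the disjoint union of B - D and its meet with D, and \<open>p\<close> is additive
  on disjoint unions.\<close>

lemma p_diff: "p (B - D) = p B \<ominus> p (inf B D)"
proof -
  have "inf (B - D) (inf B D) = bot"
    by (metis inf.left_commute inf_bot_right inf_diff_bot)
  then have "p B = p (B - D) \<oplus> p (inf B D)"
    using p_sup[of "B - D" "inf B D"] by (simp add: sup_diff_inf)
  then show ?thesis by (simp add: M.minus_eq M.a_assoc M.r_neg)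
qed

text \<open>Left multiplication by a word rather than the word itself, because the empty word would
  have to be a unit that the algebra may lack.\<close>

definition sw :: "'l list \<Rightarrow> 'a \<Rightarrow> 'a" where
  "sw w x = foldr (\<lambda>a x. s a \<otimes> x) w x"

text \<open>The adjoint of a word applies the adjoint of its first letter first, hence
  \<open>fold\<close> in place of \<open>foldr\<close>.\<close>

definition sa :: "'l list \<Rightarrow> 'a \<Rightarrow> 'a" where
  "sa w x = fold (\<lambda>a x. adj A (s a) \<otimes> x) w x"

lemma sw_simps [simp]: "sw [] x = x" "sw (a # w) x = s a \<otimes> sw w x"
  by (simp_all add: sw_def)

lemma sa_simps [simp]: "sa [] x = x" "sa (a # w) x = sa w (adj A (s a) \<otimes> x)"
  by (simp_all add: sa_def)

lemma sw_append: "sw (v @ w) x = sw v (sw w x)"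
  by (simp add: sw_def)

lemma sa_append: "sa (v @ w) x = sa w (sa v x)"
  by (simp add: sa_def)

lemma sw_closed [simp]: "set w \<subseteq> L \<Longrightarrow> x \<in> carrier A \<Longrightarrow> sw w x \<in> carrier A"
  by (induction w) simp_all

lemma sa_closed [simp]: "set w \<subseteq> L \<Longrightarrow> x \<in> carrier A \<Longrightarrow> sa w x \<in> carrier A"
  by (induction w arbitrary: x) simp_all

lemma sw_zero [simp]: "set w \<subseteq> L \<Longrightarrow> sw w \<zero> = \<zero>"
  by (induction w) simp_all

lemma sa_zero [simp]: "set w \<subseteq> L \<Longrightarrow> sa w \<zero> = \<zero>"
  by (induction w) simp_all

lemma sw_mult: "set w \<subseteq> L \<Longrightarrow> x \<in> carrier A \<Longrightarrow> y \<in> carrier A \<Longrightarrow> sw w x \<otimes> y = sw w (x \<otimes> y)"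
  by (induction w) (simp_all add: mult_assoc)

lemma sa_minus: "set w \<subseteq> L \<Longrightarrow> x \<in> carrier A \<Longrightarrow> y \<in> carrier A \<Longrightarrow> sa w (x \<ominus> y) = sa w x \<ominus> sa w y"
  by (induction w arbitrary: x y) (simp_all add: mult_minus)

lemma sw_minus: "set w \<subseteq> L \<Longrightarrow> x \<in> carrier A \<Longrightarrow> y \<in> carrier A \<Longrightarrow> sw w (x \<ominus> y) = sw w x \<ominus> sw w y"
  by (induction w) (simp_all add: mult_minus)

lemma adj_sw_mult: "set w \<subseteq> L \<Longrightarrow> x \<in> carrier A \<Longrightarrow> y \<in> carrier A \<Longrightarrow>
    adj A (sw w x) \<otimes> y = adj A x \<otimes> sa w y"
proof (induction w arbitrary: y)
  case (Cons a w)
  have "adj A (sw (a # w) x) \<otimes> y = adj A (sw w x) \<otimes> (adj A (s a) \<otimes> y)"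
    using Cons.prems by (simp add: adj_mult mult_assoc)
  also have "\<dots> = adj A x \<otimes> sa w (adj A (s a) \<otimes> y)" using Cons by simp
  finally show ?case by simp
qed simp

text \<open>The adjoint of a product of s_v, the adjoint of b and the adjoint of s_w, stated with
  operators because words are not elements.\<close>

lemma adj_sw_adj_sw: "set v \<subseteq> L \<Longrightarrow> set w \<subseteq> L \<Longrightarrow> b \<in> carrier A \<Longrightarrow>
    adj A (sw v (adj A (sw w b))) = sw w (adj A (sw v (adj A b)))"
proof (induction v)
  case (Cons a v)
  then have "adj A (sw (a # v) (adj A (sw w b))) = sw w (adj A (sw v (adj A b))) \<otimes> adj A (s a)"
    by (simp add: adj_mult)
  also have "\<dots> = sw w (adj A (sw (a # v) (adj A b)))"
    using Cons by (simp add: adj_mult sw_mult)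
  finally show ?case .
qed (simp add: adj_adj)

lemma p_sw: "set w \<subseteq> L \<Longrightarrow> x \<in> carrier A \<Longrightarrow> p B \<otimes> sw w x = sw w (p (fold \<theta> w B) \<otimes> x)"
  by (induction w arbitrary: B) (simp_all add: p_s_act)

lemma sa_p: "set w \<subseteq> L \<Longrightarrow> x \<in> carrier A \<Longrightarrow> sa w (p B \<otimes> x) = p (fold \<theta> w B) \<otimes> sa w x"
  by (induction w arbitrary: B x) (simp_all add: adj_s_p_act)

lemma sw_range:
  assumes "a \<in> L" "set w \<subseteq> L" "x \<in> carrier A"
  shows "sw (a # w) (p (range_lub (fold \<theta> (a # w))) \<otimes> x) = sw (a # w) x"
  unfolding range_lub_Cons[OF assms(1,2)]
  using s_p_rng_act[of a "sw w x"] assms by (simp add: p_sw)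

text \<open>The adjoint of a word followed by the word is the projection of its range, which
  \<open>p B\<close> absorbs because \<open>B\<close> lies below that range.\<close>

lemma p_sa_sw:
  assumes "set w \<subseteq> L" "x \<in> carrier A" "below B w"
  shows "p B \<otimes> sa w (sw w x) = p B \<otimes> x"
  using assms
proof (induction w arbitrary: x)
  case (Cons a w)
  let ?R = "fold \<theta> w (rng a)"
  have B: "B \<le> ?R" using Cons.prems range_lub_Cons[of a w] by (simp add: below_def)
  then have "below B w" using below_fold[of w B "rng a"] Cons.prems by simp
  then have "p B \<otimes> sa (a # w) (sw (a # w) x) = p B \<otimes> (p ?R \<otimes> x)"
    using Cons by (simp add: adj_s_s_act p_sw)
  then show ?case using B Cons.prems by (simp add: p_p inf.absorb1)
qed simp

section \<open>Idempotents as operators, and their derivatives along letters\<close>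

text \<open>The operator \<open>eop (w, B)\<close> is left multiplication by \<open>s\<^sub>w p\<^sub>B s\<^sub>w\<^sup>*\<close>.\<close>

definition eop :: "'l list \<times> 'b \<Rightarrow> 'a \<Rightarrow> 'a" where
  "eop f x = sw (fst f) (p (snd f) \<otimes> sa (fst f) x)"

text \<open>What an idempotent becomes when the adjoint of \<open>s a\<close> is moved across it. A
  first letter other than \<open>a\<close> gives 0, encoded as the empty word with the empty
  set.\<close>

fun der :: "'l \<Rightarrow> 'l list \<times> 'b \<Rightarrow> 'l list \<times> 'b" where
  "der a ([], B) = ([], \<theta> a B)"
| "der a (b # w, B) = (if b = a then (w, B) else ([], bot))"

definition word_in :: "'l list \<times> 'b \<Rightarrow> bool" where
  "word_in f \<longleftrightarrow> set (fst f) \<subseteq> L"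

lemma word_in_simps [simp]: "word_in (w, B) \<longleftrightarrow> set w \<subseteq> L"
  by (simp add: word_in_def)

lemma word_in_der: "word_in f \<Longrightarrow> word_in (der a f)"
  by (cases "(a, f)" rule: der.cases) auto

lemma eop_closed [simp]: "word_in f \<Longrightarrow> x \<in> carrier A \<Longrightarrow> eop f x \<in> carrier A"
  by (simp add: eop_def word_in_def)

lemma eop_minus: "word_in f \<Longrightarrow> x \<in> carrier A \<Longrightarrow> y \<in> carrier A \<Longrightarrow> eop f (x \<ominus> y) = eop f x \<ominus> eop f y"
  by (simp add: eop_def word_in_def sa_minus mult_minus sw_minus)

lemma p_eop: "word_in f \<Longrightarrow> x \<in> carrier A \<Longrightarrow> p B \<otimes> eop f x = eop f (p B \<otimes> x)"
  by (simp add: eop_def word_in_def p_sw sa_p p_p inf.commute)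

lemma adj_s_eop: "a \<in> L \<Longrightarrow> word_in f \<Longrightarrow> x \<in> carrier A \<Longrightarrow>
    adj A (s a) \<otimes> eop f x = eop (der a f) (adj A (s a) \<otimes> x)"
proof (cases "(a, f)" rule: der.cases)
  case (1 a' B)
  assume "a \<in> L" "word_in f" "x \<in> carrier A"
  then show ?thesis using 1 by (simp add: eop_def adj_s_p_act)
next
  case (2 a' b w B)
  assume prems: "a \<in> L" "word_in f" "x \<in> carrier A"
  show ?thesis
  proof (cases "b = a")
    case True
    then have f: "f = (a # w, B)" "set w \<subseteq> L" using 2 prems by auto
    \<comment> \<open>The surplus range projection commutes inward until it meets the adjoint of
      \<open>s a\<close>, which absorbs it.\<close>
    have "adj A (s a) \<otimes> eop f x = p (rng a) \<otimes> eop (w, B) (adj A (s a) \<otimes> x)"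
      using f prems by (simp add: eop_def adj_s_s_act)
    also have "\<dots> = eop (w, B) (adj A (s a) \<otimes> x)"
      using f prems by (simp add: p_eop p_rng_adj_act)
    finally show ?thesis using f by simp
  next
    case False
    then show ?thesis using 2 prems by (auto simp: eop_def adj_s_s_act_diff)
  qed
qed

lemma eop_s: "a \<in> L \<Longrightarrow> word_in f \<Longrightarrow> x \<in> carrier A \<Longrightarrow>
    eop f (s a \<otimes> x) = s a \<otimes> eop (der a f) x"
proof (cases "(a, f)" rule: der.cases)
  case (1 a' B)
  assume "a \<in> L" "word_in f" "x \<in> carrier A"
  then show ?thesis using 1 by (simp add: eop_def p_s_act)
next
  case (2 a' b w B)
  assume prems: "a \<in> L" "word_in f" "x \<in> carrier A"
  show ?thesis
  proof (cases "b = a")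
    case True
    then have f: "f = (a # w, B)" "set w \<subseteq> L" using 2 prems by auto
    have "eop f (s a \<otimes> x) = s a \<otimes> eop (w, B) (p (rng a) \<otimes> x)"
      using f prems by (simp add: eop_def adj_s_s_act)
    also have "\<dots> = s a \<otimes> eop (w, B) x"
      using f prems by (simp add: p_eop[symmetric] s_p_rng_act)
    finally show ?thesis using f by simp
  next
    case False
    then show ?thesis using 2 prems by (auto simp: eop_def adj_s_s_act_diff)
  qed
qed

definition ders :: "'l list \<Rightarrow> 'l list \<times> 'b \<Rightarrow> 'l list \<times> 'b" where
  "ders w f = fold der w f"

lemma ders_simps [simp]: "ders [] f = f" "ders (a # w) f = ders w (der a f)"
  by (simp_all add: ders_def)

lemma word_in_ders: "word_in f \<Longrightarrow> word_in (ders w f)"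
  by (induction w arbitrary: f) (simp_all add: word_in_der)

lemma sa_eop: "set w \<subseteq> L \<Longrightarrow> word_in f \<Longrightarrow> x \<in> carrier A \<Longrightarrow> sa w (eop f x) = eop (ders w f) (sa w x)"
  by (induction w arbitrary: f x) (simp_all add: adj_s_eop word_in_der)

lemma eop_sw: "set w \<subseteq> L \<Longrightarrow> word_in f \<Longrightarrow> x \<in> carrier A \<Longrightarrow> eop f (sw w x) = sw w (eop (ders w f) x)"
  by (induction w arbitrary: f) (simp_all add: eop_s word_in_der)

text \<open>Pushing the word w of f across g replaces g by its derivative along w, which commutes
  with p_B; pulling the word back restores g.\<close>

lemma eop_commute:
  assumes f: "word_in f" and g: "word_in g" and x: "x \<in> carrier A"
  shows "eop f (eop g x) = eop g (eop f x)"
proof -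
  obtain w B where [simp]: "f = (w, B)" by (cases f)
  have w: "set w \<subseteq> L" using f by simp
  have "eop f (eop g x) = sw w (p B \<otimes> eop (ders w g) (sa w x))"
    using w g x by (simp add: eop_def[of "(w, B)"] sa_eop)
  also have "\<dots> = sw w (eop (ders w g) (p B \<otimes> sa w x))"
    using w g x by (simp add: p_eop word_in_ders)
  also have "\<dots> = eop g (eop f x)"
    using w g x by (simp add: eop_def[of "(w, B)"] eop_sw)
  finally show ?thesis .
qed

definition Q :: "('l list \<times> 'b) list \<Rightarrow> 'a \<Rightarrow> 'a" where
  "Q F x = foldr (\<lambda>f y. y \<ominus> eop f y) F x"

lemma Q_simps [simp]: "Q [] x = x" "Q (f # F) x = Q F x \<ominus> eop f (Q F x)"
  by (simp_all add: Q_def)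

abbreviation "words_in F \<equiv> \<forall>f\<in>set F. word_in f"

lemma Q_closed [simp]: "words_in F \<Longrightarrow> x \<in> carrier A \<Longrightarrow> Q F x \<in> carrier A"
  by (induction F) simp_all

lemma adj_s_Q: "a \<in> L \<Longrightarrow> words_in F \<Longrightarrow> x \<in> carrier A \<Longrightarrow>
    adj A (s a) \<otimes> Q F x = Q (map (der a) F) (adj A (s a) \<otimes> x)"
  by (induction F) (simp_all add: mult_minus adj_s_eop)

lemma sa_Q: "set w \<subseteq> L \<Longrightarrow> words_in F \<Longrightarrow> x \<in> carrier A \<Longrightarrow> sa w (Q F x) = Q (map (ders w) F) (sa w x)"
  by (induction F) (simp_all add: sa_minus sa_eop)

lemma eop_Q: "word_in f \<Longrightarrow> words_in F \<Longrightarrow> x \<in> carrier A \<Longrightarrow> eop f (Q F x) = Q F (eop f x)"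
  by (induction F) (simp_all add: eop_minus eop_commute)

text \<open>A factor with the empty word is 1 - p_D, and p_B times it is the projection of B - D.
  Such factors only shrink B, until it is disjoint from all their D; the other factors commute with
  projections.\<close>

lemma remove_empty_words:
  assumes "words_in F"
  shows "\<exists>B'. B' \<le> B \<and> (\<forall>D. ([], D) \<in> set F \<longrightarrow> inf B' D = bot) \<and>
    (\<forall>x\<in>carrier A. p B \<otimes> Q F x = p B' \<otimes> Q (filter (\<lambda>f. fst f \<noteq> []) F) x)"
  using assms
proof (induction F arbitrary: B)
  case (Cons f F)
  then have wi: "word_in f" "words_in F" by auto
  show ?case
  proof (cases "fst f = []")
    case True
    then obtain D where f: "f = ([], D)" by (cases f) auto
    obtain B' where B': "B' \<le> B - D" "\<forall>D'. ([], D') \<in> set F \<longrightarrow> inf B' D' = bot"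
        "\<forall>x\<in>carrier A. p (B - D) \<otimes> Q F x = p B' \<otimes> Q (filter (\<lambda>f. fst f \<noteq> []) F) x"
      using Cons.IH[OF wi(2), of "B - D"] by blast
    have "inf B' D \<le> inf (B - D) D" using B'(1) by (rule inf_mono) simp
    then have "inf B' D = bot" by (simp add: inf_diff_bot bot_unique)
    moreover have "p B \<otimes> Q (f # F) x = p (B - D) \<otimes> Q F x" if "x \<in> carrier A" for x
      using that wi by (simp add: f eop_def mult_minus p_p p_diff minus_mult)
    ultimately show ?thesis using B' diff_le[of B D] f True by (intro exI[of _ B']) auto
  next
    case False
    obtain B' where B': "B' \<le> B" "\<forall>D'. ([], D') \<in> set F \<longrightarrow> inf B' D' = bot"
        "\<forall>x\<in>carrier A. p B \<otimes> Q F x = p B' \<otimes> Q (filter (\<lambda>f. fst f \<noteq> []) F) x"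
      using Cons.IH[OF wi(2), of B] by blast
    have "p B \<otimes> Q (f # F) x = p B' \<otimes> Q (filter (\<lambda>f. fst f \<noteq> []) (f # F)) x" if "x \<in> carrier A" for x
    proof -
      have c: "words_in (filter (\<lambda>f. fst f \<noteq> []) F)" using wi by simp
      have "p B \<otimes> Q (f # F) x = p B \<otimes> Q F x \<ominus> eop f (p B \<otimes> Q F x)"
        using wi that by (simp add: mult_minus p_eop)
      also have "\<dots> = p B' \<otimes> Q (filter (\<lambda>f. fst f \<noteq> []) (f # F)) x"
        using wi c that False B'(3) by (simp add: mult_minus p_eop)
      finally show ?thesis .
    qed
    then show ?thesis using B' False by (intro exI[of _ B']) auto
  qed
qed auto

text \<open>Orthogonality of the idempotent given by the word \<open>g\<close> and the set
  \<open>D\<close> to every idempotent of the list.\<close>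

definition misses :: "'l list \<Rightarrow> 'b \<Rightarrow> ('l list \<times> 'b) list \<Rightarrow> bool" where
  "misses g D F \<longleftrightarrow> (\<forall>f\<in>set F. \<forall>x\<in>carrier A. sw g (p D \<otimes> sa g (eop f x)) = \<zero>)"

text \<open>The bound n on word lengths drives the induction: relation (4) splits the projection
  over finitely many letters a, and the derivative along a shortens every nonempty word. An
  idempotent that escapes after a is lifted by prepending a.\<close>

lemma zero_or_misses:
  assumes "\<forall>f\<in>set F. length (fst f) \<le> n" "words_in F"
  shows "(\<forall>x\<in>carrier A. p B \<otimes> Q F x = \<zero>) \<or>
    (\<exists>g D. set g \<subseteq> L \<and> D \<noteq> bot \<and> D \<le> fold \<theta> g B \<and> misses g D F)"
  using assms
proof (induction n arbitrary: B F)
  case 0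
  obtain B' where B': "B' \<le> B" "\<forall>D. ([], D) \<in> set F \<longrightarrow> inf B' D = bot"
      "\<forall>x\<in>carrier A. p B \<otimes> Q F x = p B' \<otimes> Q (filter (\<lambda>f. fst f \<noteq> []) F) x"
    using remove_empty_words[OF 0(2), of B] by blast
  show ?case
  proof (cases "B' = bot")
    case True
    have "\<forall>x\<in>carrier A. p B \<otimes> Q F x = \<zero>" using B'(3) 0(2) by (simp add: True)
    then show ?thesis by blast
  next
    case False
    have "misses [] B' F"
      unfolding misses_def
    proof (intro ballI)
      fix f x assume f: "f \<in> set F" and x: "x \<in> carrier A"
      then have "fst f = []" using 0(1) by auto
      then obtain D where "f = ([], D)" by (cases f) auto
      then show "sw [] (p B' \<otimes> sa [] (eop f x)) = \<zero>" using B'(2) f x by (simp add: eop_def p_p)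
    qed
    then show ?thesis using False B'(1) by (intro disjI2 exI[of _ "[]"] exI[of _ B']) simp
  qed
next
  case (Suc n)
  let ?F = "filter (\<lambda>f. fst f \<noteq> []) F"
  obtain B' where B': "B' \<le> B" "\<And>D. ([], D) \<in> set F \<Longrightarrow> inf B' D = bot"
      "\<forall>x\<in>carrier A. p B \<otimes> Q F x = p B' \<otimes> Q ?F x"
    using remove_empty_words[OF Suc.prems(2), of B] by blast
  have F': "words_in ?F" using Suc.prems(2) by simp
  show ?case
  proof (cases "B' \<in> B_reg L \<theta>")
    case True
    show ?thesis
    proof (cases "\<forall>a\<in>Delta L \<theta> B'. \<forall>x\<in>carrier A. p (\<theta> a B') \<otimes> Q (map (der a) ?F) x = \<zero>")
      case zero: True
      have "p B \<otimes> Q F x = \<zero>" if x: "x \<in> carrier A" for x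
      proof -
        have Qc: "Q ?F x \<in> carrier A" using F' x by simp
        have D: "a \<in> L" if "a \<in> Delta L \<theta> B'" for a using that by (simp add: Delta_def)
        have "p B \<otimes> Q F x = p B' \<otimes> Q ?F x" using B'(3) x by blast
        also have "\<dots> = finsum A (\<lambda>a. s a \<otimes> p (\<theta> a B') \<otimes> adj A (s a) \<otimes> Q ?F x) (Delta L \<theta> B')"
          by (subst p_reg[OF True], rule finsum_mult) (use Qc D in auto)
        also have "\<dots> = \<zero>"
        proof (rule finsum_0_neutral)
          fix a assume a: "a \<in> Delta L \<theta> B'"
          have "s a \<otimes> p (\<theta> a B') \<otimes> adj A (s a) \<otimes> Q ?F x = s a \<otimes> (p (\<theta> a B') \<otimes> Q (map (der a) ?F) (adj A (s a) \<otimes> x))"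
            using D[OF a] Qc x F' by (simp add: mult_assoc adj_s_Q[symmetric])
          also have "\<dots> = \<zero>" using zero a D[OF a] x by simp
          finally show "s a \<otimes> p (\<theta> a B') \<otimes> adj A (s a) \<otimes> Q ?F x = \<zero>" .
        qed
        finally show ?thesis .
      qed
      then show ?thesis by blast
    next
      case False
      then obtain a where a: "a \<in> Delta L \<theta> B'" "\<not> (\<forall>x\<in>carrier A. p (\<theta> a B') \<otimes> Q (map (der a) ?F) x = \<zero>)"
        by blast
      have aL: "a \<in> L" using a(1) by (simp add: Delta_def)
      have wi: "words_in (map (der a) ?F)" using F' word_in_der by auto
      have "\<forall>f\<in>set (map (der a) ?F). length (fst f) \<le> n"
      proof
        fix f' assume "f' \<in> set (map (der a) ?F)"
        then obtain f where f: "f \<in> set F" "fst f \<noteq> []" "f' = der a f" by auto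
        obtain b w D where "f = (b # w, D)" using f(2) by (cases f; cases "fst f") auto
        then show "length (fst f') \<le> n" using f Suc.prems(1) by fastforce
      qed
      then obtain g D where g: "set g \<subseteq> L" "D \<noteq> bot" "D \<le> fold \<theta> g (\<theta> a B')" "misses g D (map (der a) ?F)"
        using Suc.IH[of "map (der a) ?F" "\<theta> a B'"] wi a(2) by blast
      have killed: "sw g (p D \<otimes> sa g (eop f y)) = \<zero>"
        if "f \<in> set (map (der a) ?F)" "y \<in> carrier A" for f y
        by (rule g(4)[unfolded misses_def, rule_format, OF that])
      have "misses (a # g) D F"
        unfolding misses_def
      proof (intro ballI)
        fix f x assume f: "f \<in> set F" and x: "x \<in> carrier A"
        have wf: "word_in f" using f Suc.prems(2) by blast
        have eq: "sw (a # g) (p D \<otimes> sa (a # g) (eop f x)) =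
            s a \<otimes> sw g (p D \<otimes> sa g (eop (der a f) (adj A (s a) \<otimes> x)))"
          using aL wf x by (simp add: adj_s_eop)
        show "sw (a # g) (p D \<otimes> sa (a # g) (eop f x)) = \<zero>"
        proof (cases "fst f = []")
          case True
          then obtain E where E: "f = ([], E)" by (cases f) auto
          \<comment> \<open>Members with the empty word were removed before taking derivatives. They
            are missed because \<open>B'\<close> is disjoint from their sets, which the action
            preserves.\<close>
          have "inf D (fold \<theta> g (\<theta> a E)) \<le> inf (fold \<theta> g (\<theta> a B')) (fold \<theta> g (\<theta> a E))"
            using g(3) by (rule inf_mono) simp
          also have "\<dots> = fold \<theta> g (\<theta> a (inf B' E))" using aL g(1) by (simp add: fold_theta_inf theta_inf)
          also have "\<dots> = bot" using B'(2) f E aL g(1) by (simp add: fold_theta_bot)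
          finally have "inf D (fold \<theta> g (\<theta> a E)) = bot" by (simp add: bot_unique)
          then have "sw g (p D \<otimes> sa g (eop (der a f) (adj A (s a) \<otimes> x))) = \<zero>"
            unfolding E using aL g(1) x by (simp add: eop_def sa_p p_p)
          then show ?thesis unfolding eq using aL by simp
        next
          case False
          then have "der a f \<in> set (map (der a) ?F)" using f by auto
          then have "sw g (p D \<otimes> sa g (eop (der a f) (adj A (s a) \<otimes> x))) = \<zero>"
            by (rule killed) (use aL x in simp)
          then show ?thesis unfolding eq using aL by simp
        qed
      qed
      moreover have "D \<le> fold \<theta> (a # g) B"
        using g(3) fold_theta_mono[OF g(1) theta_mono[OF aL B'(1)]] by simp
      ultimately show ?thesis using g aL by (intro disjI2 exI[of _ "a # g"] exI[of _ D]) simp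
    qed
  next
    case False
    \<comment> \<open>Failure of regularity: some nonempty part of \<open>B'\<close> emits no letter
      or infinitely many.\<close>
    then obtain E where E: "E \<noteq> bot" "E \<le> B'" "infinite (Delta L \<theta> E) \<or> Delta L \<theta> E = {}"
      by (auto simp: B_reg_def card_gt_0_iff)
    show ?thesis
    proof (cases "Delta L \<theta> E = {}")
      case True
      \<comment> \<open>No letter leaves \<open>E\<close>, so its projection annihilates every
        \<open>s b\<close>; this handles nonempty words, and disjointness from \<open>B'\<close>
        handles empty ones.\<close>
      have "misses [] E F"
        unfolding misses_def
      proof (intro ballI)
        fix f x assume f: "f \<in> set F" and x: "x \<in> carrier A"
        obtain w D where wD: "f = (w, D)" by (cases f)
        show "sw [] (p E \<otimes> sa [] (eop f x)) = \<zero>"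
        proof (cases w)
          case Nil
          have "inf E D \<le> inf B' D" using E(2) by (rule inf_mono) simp
          also have "\<dots> = bot" using B'(2) f wD Nil by simp
          finally have "inf E D = bot" by (simp add: bot_unique)
          then show ?thesis using x wD Nil by (simp add: eop_def p_p)
        next
          case (Cons b u)
          have "word_in f" using Suc.prems(2) f by blast
          then have "b \<in> L" "set u \<subseteq> L" by (auto simp: wD Cons)
          moreover have "\<theta> b E = bot" using True \<open>b \<in> L\<close> by (auto simp: Delta_def)
          ultimately show ?thesis using x wD Cons by (simp add: eop_def p_s_act)
        qed
      qed
      then show ?thesis using E(1,2) B'(1) by (intro disjI2 exI[of _ "[]"] exI[of _ E]) auto
    next
      case nonempty: False
      then have inf: "infinite (Delta L \<theta> E)" using E(3) by blast
      \<comment> \<open>Only finitely many first letters occur, so one of the infinitely many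
        letters leaving \<open>E\<close> starts no word of the list. On empty words
        \<open>hd\<close> is unspecified, which can exclude at most one further letter.\<close>
      have "finite ((\<lambda>f. hd (fst f)) ` set F)" by simp
      then obtain a where a: "a \<in> Delta L \<theta> E" "a \<notin> (\<lambda>f. hd (fst f)) ` set F"
        using inf by (meson finite_subset subsetI)
      have aL: "a \<in> L" "\<theta> a E \<noteq> bot" using a(1) by (auto simp: Delta_def)
      have "misses [a] (\<theta> a E) F"
        unfolding misses_def
      proof (intro ballI)
        fix f x assume f: "f \<in> set F" and x: "x \<in> carrier A"
        obtain w D where wD: "f = (w, D)" by (cases f)
        show "sw [a] (p (\<theta> a E) \<otimes> sa [a] (eop f x)) = \<zero>"
        proof (cases w)
          case Nil
          have "inf E D \<le> inf B' D" using E(2) by (rule inf_mono) simp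
          also have "\<dots> = bot" using B'(2) f wD Nil by simp
          finally have "inf E D = bot" by (simp add: bot_unique)
          then have "inf (\<theta> a E) (\<theta> a D) = bot" using aL(1) by (simp add: theta_inf[symmetric])
          then show ?thesis using x wD Nil aL(1) by (simp add: eop_def adj_s_p_act p_p)
        next
          case (Cons b u)
          have "word_in f" using Suc.prems(2) f by blast
          then have b: "b \<in> L" "set u \<subseteq> L" by (auto simp: wD Cons)
          have "b \<noteq> a" using a(2) f wD Cons by force
          then show ?thesis using x wD Cons b aL(1) by (simp add: eop_def adj_s_s_act_diff)
        qed
      qed
      moreover have "\<theta> a E \<le> fold \<theta> [a] B" using E(2) B'(1) aL(1) by (auto intro: theta_mono)
      ultimately show ?thesis using aL by (intro disjI2 exI[of _ "[a]"] exI[of _ "\<theta> a E"]) auto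
    qed
  qed
qed

section \<open>The inverse semigroup and its idempotents\<close>

definition T_el :: "'l list \<Rightarrow> 'b \<Rightarrow> 'l list \<Rightarrow> 'a" where
  "T_el v B w = sw v (adj A (sw w (p B)))"

abbreviation "el f \<equiv> T_el (fst f) (snd f) (fst f)"

text \<open>Containment of B in the ranges of v and w is not imposed, which simplifies closure under
  products; \<open>T_el_below\<close> restores it by changing B but not the element.\<close>

definition T :: "'a set" where
  "T = {T_el v B w | v B w. set v \<subseteq> L \<and> set w \<subseteq> L}"

lemma T_el_closed [simp]: "set v \<subseteq> L \<Longrightarrow> set w \<subseteq> L \<Longrightarrow> T_el v B w \<in> carrier A"
  by (simp add: T_el_def)

lemma T_closed: "t \<in> T \<Longrightarrow> t \<in> carrier A"
  by (auto simp: T_def)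

lemma adj_T_el: "set v \<subseteq> L \<Longrightarrow> set w \<subseteq> L \<Longrightarrow> adj A (T_el v B w) = T_el w B v"
  by (simp add: T_el_def adj_sw_adj_sw)

lemma adj_T: "t \<in> T \<Longrightarrow> adj A t \<in> T"
  unfolding T_def using adj_T_el by fastforce

lemma T_el_mult: "set v \<subseteq> L \<Longrightarrow> set w \<subseteq> L \<Longrightarrow> x \<in> carrier A \<Longrightarrow> T_el v B w \<otimes> x = sw v (p B \<otimes> sa w x)"
  by (simp add: T_el_def sw_mult adj_sw_mult)

lemma el_mult: "word_in f \<Longrightarrow> x \<in> carrier A \<Longrightarrow> el f \<otimes> x = eop f x"
  by (simp add: T_el_mult word_in_def eop_def)

lemma p_adj_sw: "set w \<subseteq> L \<Longrightarrow> p B \<otimes> adj A (sw w (p D)) = adj A (sw w (p (inf D B)))"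
  using adj_mult[of "sw w (p D)" "p B"] by (simp add: sw_mult p_mult)

lemma T_s: "a \<in> L \<Longrightarrow> t \<in> T \<Longrightarrow> s a \<otimes> t \<in> T"
proof -
  assume a: "a \<in> L" and "t \<in> T"
  then obtain v B w where t: "t = T_el v B w" "set v \<subseteq> L" "set w \<subseteq> L" by (auto simp: T_def)
  have "s a \<otimes> t = T_el (a # v) B w" by (simp add: t T_el_def)
  then show ?thesis unfolding T_def using a t by fastforce
qed

lemma T_p: "t \<in> T \<Longrightarrow> p D \<otimes> t \<in> T"
proof -
  assume "t \<in> T"
  then obtain v B w where t: "t = T_el v B w" "set v \<subseteq> L" "set w \<subseteq> L" by (auto simp: T_def)
  have "p D \<otimes> t = T_el v (inf B (fold \<theta> v D)) w" using t by (simp add: T_el_def p_sw p_adj_sw)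
  then show ?thesis unfolding T_def using t by blast
qed

lemma T_zero: "\<zero> \<in> T"
proof -
  have "\<zero> = T_el [] bot []" by (simp add: T_el_def)
  then show ?thesis unfolding T_def by fastforce
qed

text \<open>An empty left word lets the letter pass to the right word, a matching first letter
  cancels up to a range projection, and any other first letter gives zero.\<close>

lemma T_adj_s: "a \<in> L \<Longrightarrow> t \<in> T \<Longrightarrow> adj A (s a) \<otimes> t \<in> T"
proof -
  assume a: "a \<in> L" and "t \<in> T"
  then obtain v B w where t: "t = T_el v B w" "set v \<subseteq> L" "set w \<subseteq> L" by (auto simp: T_def)
  show ?thesis
  proof (cases v)
    case Nil
    have "adj A (s a) \<otimes> adj A (sw w (p B)) = adj A (sw w (p B) \<otimes> s a)"
      using a t by (simp add: adj_mult)
    also have "sw w (p B) \<otimes> s a = sw (w @ [a]) (p (\<theta> a B))"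
      using a t by (simp add: sw_mult p_s sw_append)
    finally have "adj A (s a) \<otimes> t = T_el [] (\<theta> a B) (w @ [a])" by (simp add: t Nil T_el_def)
    then show ?thesis unfolding T_def using a t by fastforce
  next
    case (Cons b u)
    show ?thesis
    proof (cases "b = a")
      case True
      have "T_el u B w \<in> T" unfolding T_def using t Cons by fastforce
      then have "p (rng a) \<otimes> T_el u B w \<in> T" by (rule T_p)
      moreover have "adj A (s a) \<otimes> t = p (rng a) \<otimes> T_el u B w"
        using a t Cons True by (simp add: T_el_def adj_s_s_act)
      ultimately show ?thesis by simp
    next
      case False
      then have "adj A (s a) \<otimes> t = \<zero>" using a t Cons by (simp add: T_el_def adj_s_s_act_diff)
      then show ?thesis using T_zero by simp
    qed
  qed
qed

lemma T_mult: assumes "t \<in> T" "t' \<in> T" shows "t \<otimes> t' \<in> T"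
proof -
  obtain v B w where t: "t = T_el v B w" "set v \<subseteq> L" "set w \<subseteq> L" using assms(1) by (auto simp: T_def)
  have sa: "sa w y \<in> T" if "y \<in> T" "set w \<subseteq> L" for y w
    using that by (induction w arbitrary: y) (simp_all add: T_adj_s)
  have sw: "sw v y \<in> T" if "y \<in> T" "set v \<subseteq> L" for y v
    using that by (induction v) (simp_all add: T_s)
  have "t \<otimes> t' = sw v (p B \<otimes> sa w t')" using t T_closed[OF assms(2)] by (simp add: T_el_mult)
  then show ?thesis using sa sw T_p t assms(2) by simp
qed

text \<open>Words absorb the projection of their range, so B may be cut down to the range of
  \<open>v\<close> and, through the adjoint, to that of \<open>w\<close>. The second cut preserves
  the first condition.\<close>

lemma T_el_below:
  assumes "set v \<subseteq> L" "set w \<subseteq> L"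
  obtains D where "T_el v B w = T_el v D w" "below D v" "below D w"
    "D \<le> B"
proof -
  have left: "\<exists>D\<le>B. below D v \<and> T_el v B w = T_el v D w" if "set v \<subseteq> L" "set w \<subseteq> L" for v w B
  proof (cases v)
    case (Cons a u)
    let ?R = "range_lub (fold \<theta> (a # u))"
    have "T_el v B w = sw (a # u) (p ?R \<otimes> adj A (sw w (p B)))"
      unfolding T_el_def Cons by (rule sw_range[symmetric]) (use that Cons in auto)
    also have "\<dots> = T_el v (inf B ?R) w" using that by (simp add: T_el_def p_adj_sw Cons)
    finally show ?thesis using Cons by (intro exI[of _ "inf B ?R"]) (simp add: below_def)
  qed (auto simp: below_def)
  obtain D where D: "D \<le> B" "below D v" "T_el v B w = T_el v D w" using left[OF assms] by blast
  obtain E where E: "E \<le> D" "below E w" "T_el w D v = T_el w E v" using left[OF assms(2,1), of D] by blast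
  have "T_el v D w = T_el v E w" using arg_cong[OF E(3), of "adj A"] assms by (simp add: adj_T_el)
  moreover have "below E v" using D(2) E(1) by (auto simp: below_def)
  ultimately show thesis using that[of E] D E by auto
qed

lemma T_el_T_el_adj:
  assumes "set v \<subseteq> L" "set w \<subseteq> L" "below B w"
  shows "T_el v B w \<otimes> T_el w B v = T_el v B v"
  using assms by (simp add: T_el_mult) (simp add: T_el_def p_sa_sw p_adj_sw)

lemma T_cases:
  assumes "t \<in> T"
  obtains v B w where "t = T_el v B w" "set v \<subseteq> L" "set w \<subseteq> L" "below B v" "below B w"
  using assms T_el_below unfolding T_def by (smt (verit) mem_Collect_eq)

lemma T_range_projection: assumes "t \<in> T" obtains f where "word_in f" "t \<otimes> adj A t = el f" "el f \<otimes> t = t" "below (snd f) (fst f)"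
proof -
  obtain v B w where t: "t = T_el v B w" "set v \<subseteq> L" "set w \<subseteq> L" "below B v" "below B w"
    using T_cases[OF assms] .
  have "t \<otimes> adj A t = el (v, B)" using t by (simp add: adj_T_el T_el_T_el_adj)
  moreover have "el (v, B) \<otimes> t = t"
    using t by (simp add: T_el_mult) (simp add: T_el_def p_sa_sw p_adj_sw)
  ultimately show thesis using that[of "(v, B)"] t by simp
qed

lemma el_adj: "word_in f \<Longrightarrow> adj A (el f) = el f"
  by (simp add: adj_T_el word_in_def)

lemma el_closed: "word_in f \<Longrightarrow> el f \<in> carrier A"
  by (simp add: word_in_def)

lemma el_in_T: "word_in f \<Longrightarrow> el f \<in> T"
  unfolding T_def word_in_def by blast

text \<open>The operators commute, so the commutator d multiplies everything to zero from the left,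
  in particular its own adjoint; the C*-identity then gives d = 0.\<close>

lemma el_commute:
  assumes f: "word_in f" and g: "word_in g"
  shows "el f \<otimes> el g = el g \<otimes> el f"
proof -
  have assoc: "(el f \<otimes> el g) \<otimes> x = eop f (eop g x)"
    if "word_in f" "word_in g" "x \<in> carrier A" for f g x
    using that by (subst mult_assoc) (simp_all add: el_closed el_mult)
  have eq: "(el f \<otimes> el g) \<otimes> x = (el g \<otimes> el f) \<otimes> x" if "x \<in> carrier A" for x
    using f g that by (simp only: assoc eop_commute[OF f g])
  let ?d = "el f \<otimes> el g \<ominus> el g \<otimes> el f"
  have dc: "?d \<in> carrier A" using f g by (simp add: el_closed)
  have "?d \<otimes> adj A ?d = \<zero>"
    using eq[of "adj A ?d"] f g dc by (simp add: minus_mult el_closed)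
  then have "nrm A (adj A (adj A ?d) \<otimes> adj A ?d) = 0" using dc by (simp add: adj_adj)
  then have "nrm A ?d = 0" using cstar_identity[of "adj A ?d"] dc by (simp add: nrm_adj)
  then show ?thesis using dc f g by (simp add: nrm_eq_0 minus_eq_zero_iff el_closed)
qed

text \<open>As in any inverse semigroup, an idempotent \<open>e = e e\<^sup>* e\<close> equals \<open>(e e\<^sup>*)(e\<^sup>* e)\<close> up to
  commuting the two projections, hence is selfadjoint.\<close>

lemma idempotent_T:
  assumes e: "e \<in> T" "e \<otimes> e = e"
  obtains f where "word_in f" "e = el f" "below (snd f) (fst f)"
proof -
  have ec: "e \<in> carrier A" using T_closed[OF e(1)] .
  have ac: "adj A e \<in> carrier A" using ec by simp
  obtain f where f: "word_in f" "e \<otimes> adj A e = el f" "el f \<otimes> e = e" "below (snd f) (fst f)"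
    using T_range_projection[OF e(1)] .
  obtain g where g: "word_in g" "adj A e \<otimes> adj A (adj A e) = el g" "el g \<otimes> adj A e = adj A e"
    using T_range_projection[OF adj_T[OF e(1)]] .
  note g(2)[unfolded adj_adj[OF ec]]
  note g = g(1) this g(3)
  have ee: "e \<otimes> adj A e \<otimes> e = e" using f(2,3) by simp
  have aa: "adj A e \<otimes> adj A e = adj A e" using arg_cong[OF e(2), of "adj A"] ec by (simp add: adj_mult)
  have "adj A e = adj A e \<otimes> e \<otimes> adj A e" using g(2,3) by simp
  \<comment> \<open>Idempotency doubles the middle factor and exposes the two projections that
    commute.\<close>
  also have "\<dots> = (adj A e \<otimes> e) \<otimes> (e \<otimes> adj A e)"
    using ec ac e(2) mult_assoc mult_closed by metis
  also have "\<dots> = (e \<otimes> adj A e) \<otimes> (adj A e \<otimes> e)"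
    unfolding f(2) g(2) by (rule el_commute[OF g(1) f(1)])
  also have "\<dots> = e \<otimes> (adj A e \<otimes> adj A e) \<otimes> e"
    using ec ac by (simp add: mult_assoc)
  also have "\<dots> = e" unfolding aa by (rule ee)
  finally have "adj A e = e" .
  then have "e = el f" using f(2) e(2) by simp
  with f show thesis using that by blast
qed

lemma el_idem: assumes "word_in f" shows "el f \<otimes> el f = el f"
proof -
  obtain D where D: "el f = T_el (fst f) D (fst f)" "below D (fst f)"
    using T_el_below[of "fst f" "fst f" "snd f"] assms unfolding word_in_def by metis
  show ?thesis unfolding D(1) by (rule T_el_T_el_adj) (use assms D(2) in \<open>auto simp: word_in_def\<close>)
qed

lemma idempotents_T: "idempotents A T = {el f | f. word_in f \<and> below (snd f) (fst f)}"
  unfolding idempotents_def using idempotent_T el_idem el_in_T by (auto; metis)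

lemma idempotent_mult:
  assumes "e \<in> idempotents A T" "e' \<in> idempotents A T"
  shows "e \<otimes> e' \<in> idempotents A T" "e \<otimes> e' = e' \<otimes> e"
proof -
  obtain f g where fg: "e = el f" "e' = el g" "word_in f" "word_in g"
    using assms by (auto simp: idempotents_T)
  show comm: "e \<otimes> e' = e' \<otimes> e" unfolding fg(1,2) by (rule el_commute[OF fg(3,4)])
  have c: "e \<in> carrier A" "e' \<in> carrier A" using fg el_closed by auto
  have "(e \<otimes> e') \<otimes> (e \<otimes> e') = e \<otimes> (e' \<otimes> e) \<otimes> e'" using c by (simp add: mult_assoc)
  also have "\<dots> = (e \<otimes> e) \<otimes> (e' \<otimes> e')" unfolding comm[symmetric] using c by (simp add: mult_assoc)
  also have "\<dots> = e \<otimes> e'" unfolding fg using fg el_idem by simp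
  finally show "e \<otimes> e' \<in> idempotents A T"
    using T_mult assms by (simp add: idempotents_def)
qed

end

section \<open>Tightness\<close>

context unital_cstar_algebra
begin

definition co_prod :: "'a list \<Rightarrow> 'a" where
  "co_prod zs = foldr (\<otimes>) (map (\<lambda>z. \<one> \<ominus> z) zs) \<one>"

lemma co_prod_simps [simp]: "co_prod [] = \<one>" "co_prod (z # zs) = (\<one> \<ominus> z) \<otimes> co_prod zs"
  by (simp_all add: co_prod_def)

lemma co_prod_closed [simp]: "set zs \<subseteq> carrier A \<Longrightarrow> co_prod zs \<in> carrier A"
  by (induction zs) simp_all

lemma co_prod_commute:
  "x \<in> carrier A \<Longrightarrow> set zs \<subseteq> carrier A \<Longrightarrow> (\<And>z. z \<in> set zs \<Longrightarrow> x \<otimes> z = z \<otimes> x) \<Longrightarrow>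
    x \<otimes> co_prod zs = co_prod zs \<otimes> x"
proof (induction zs)
  case (Cons z zs)
  have c: "\<one> \<ominus> z \<in> carrier A" "co_prod zs \<in> carrier A" using Cons.prems by auto
  have "x \<otimes> (\<one> \<ominus> z) = (\<one> \<ominus> z) \<otimes> x" using Cons.prems by (simp add: mult_minus minus_mult)
  then have "x \<otimes> co_prod (z # zs) = (\<one> \<ominus> z) \<otimes> (x \<otimes> co_prod zs)"
    using c Cons.prems(1) by (simp add: mult_assoc[symmetric])
  also have "x \<otimes> co_prod zs = co_prod zs \<otimes> x" using Cons by simp
  finally show ?case using c Cons.prems(1) by (simp add: mult_assoc)
qed simp

lemma mult_co_prod:
  "x \<in> carrier A \<Longrightarrow> set zs \<subseteq> carrier A \<Longrightarrow> (\<And>z. z \<in> set zs \<Longrightarrow> x \<otimes> z = \<zero>) \<Longrightarrow>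
    x \<otimes> co_prod zs = x"
  by (induction zs) (simp_all add: mult_assoc[symmetric] mult_minus)

lemma co_prod_mult:
  "x \<in> carrier A \<Longrightarrow> set zs \<subseteq> carrier A \<Longrightarrow> (\<And>z. z \<in> set zs \<Longrightarrow> z \<otimes> x = \<zero>) \<Longrightarrow>
    co_prod zs \<otimes> x = x"
  by (induction zs) (simp_all add: mult_assoc minus_mult)

text \<open>Orthogonality makes all mixed terms of the expanded product vanish.\<close>

lemma co_prod_orthogonal:
  assumes "distinct as" "\<And>a. a \<in> set as \<Longrightarrow> z a \<in> carrier A"
    "\<And>a b. a \<in> set as \<Longrightarrow> b \<in> set as \<Longrightarrow> a \<noteq> b \<Longrightarrow> z a \<otimes> z b = \<zero>"
  shows "co_prod (map z as) = \<one> \<ominus> finsum A z (set as)"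
  using assms
proof (induction as)
  case (Cons a as)
  have c: "set (map z as) \<subseteq> carrier A" "z a \<in> carrier A" using Cons.prems by auto
  have fc: "finsum A z (set as) \<in> carrier A" using c by (intro M.finsum_closed) auto
  have "z a \<otimes> co_prod (map z as) = z a"
    using Cons.prems c by (intro mult_co_prod) auto
  then have "co_prod (map z (a # as)) = co_prod (map z as) \<ominus> z a"
    using c by (simp add: minus_mult)
  also have "\<dots> = \<one> \<ominus> finsum A z (set as) \<ominus> z a" using Cons by simp
  also have "\<dots> = \<one> \<ominus> (z a \<oplus> finsum A z (set as))"
    using c fc by (simp add: M.minus_eq M.minus_add M.a_ac)
  also have "z a \<oplus> finsum A z (set as) = finsum A z (set (a # as))"
    using Cons.prems c by (simp add: M.finsum_insert Pi_def)
  finally show ?case .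
qed simp

context
  fixes zs :: "'a list"
  assumes proj: "\<And>z. z \<in> set zs \<Longrightarrow> is_projection A z"
    and comm: "\<And>y z. y \<in> set zs \<Longrightarrow> z \<in> set zs \<Longrightarrow> y \<otimes> z = z \<otimes> y"
begin

lemma co_prod_projection: "is_projection A (co_prod zs)"
  using proj comm
proof (induction zs)
  case Nil
  then show ?case by (simp add: is_projection_def)
next
  case (Cons z zs)
  have c: "z \<in> carrier A" "z \<otimes> z = z" "adj A z = z" "set zs \<subseteq> carrier A"
    using Cons.prems(1) by (auto simp: is_projection_def)
  define q where "q = \<one> \<ominus> z"
  define r where "r = co_prod zs"
  have r: "r \<in> carrier A" "r \<otimes> r = r" "adj A r = r"
    using Cons by (auto simp: is_projection_def r_def)
  have "z \<otimes> r = r \<otimes> z" unfolding r_def using c Cons.prems(2) by (intro co_prod_commute) auto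
  then have qr: "q \<otimes> r = r \<otimes> q" using c r by (simp add: q_def mult_minus minus_mult)
  have q: "q \<in> carrier A" "q \<otimes> q = q" "adj A q = q"
    using c by (simp_all add: q_def mult_minus minus_mult adj_minus)
  have "(q \<otimes> r) \<otimes> (q \<otimes> r) = q \<otimes> (r \<otimes> q) \<otimes> r" using q(1) r(1) by (simp add: mult_assoc)
  also have "\<dots> = (q \<otimes> q) \<otimes> (r \<otimes> r)" unfolding qr[symmetric] using q(1) r(1) by (simp add: mult_assoc)
  finally have "(q \<otimes> r) \<otimes> (q \<otimes> r) = q \<otimes> r" using q r by simp
  moreover have "adj A (q \<otimes> r) = q \<otimes> r" using q r qr by (simp add: adj_mult)
  ultimately show ?case using q r by (simp add: is_projection_def q_def r_def)
qed

lemma proj_closed: "set zs \<subseteq> carrier A"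
  using proj by (auto simp: is_projection_def)

lemma mem_mult_co_prod: assumes "z \<in> set zs" shows "z \<otimes> co_prod zs = \<zero>"
proof -
  have "z \<otimes> co_prod ys = \<zero>" if "z \<in> set ys" "set ys \<subseteq> set zs" for ys
    using that
  proof (induction ys)
    case (Cons y ys)
    have c: "z \<in> carrier A" "y \<in> carrier A" "set ys \<subseteq> carrier A" "z \<otimes> z = z"
      using assms proj Cons.prems by (auto simp: is_projection_def)
    have eq: "z \<otimes> co_prod (y # ys) = (z \<ominus> z \<otimes> y) \<otimes> co_prod ys"
      using c by (simp add: mult_assoc[symmetric] mult_minus)
    show ?case
    proof (cases "z = y")
      case True
      then show ?thesis unfolding eq using c by simp
    next
      case False
      then have IH: "z \<otimes> co_prod ys = \<zero>" using Cons by auto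
      have "z \<otimes> y = y \<otimes> z" using comm assms Cons.prems by auto
      then show ?thesis unfolding eq using c IH by (simp add: minus_mult mult_assoc)
    qed
  qed simp
  then show ?thesis using assms by blast
qed

text \<open>De Morgan for commuting projections. If v is an upper bound, 1 - v is orthogonal to
  every z, so the product of the 1 - z fixes it; this gives minimality.\<close>

lemma proj_sup_eq: "proj_sup A (set zs) = \<one> \<ominus> co_prod zs"
proof -
  define r where "r = co_prod zs"
  define u where "u = \<one> \<ominus> r"
  have r: "r \<in> carrier A" "r \<otimes> r = r" "adj A r = r"
    using co_prod_projection by (auto simp: is_projection_def r_def)
  have u: "u \<in> carrier A" "is_projection A u"
    using r by (simp_all add: is_projection_def u_def mult_minus minus_mult adj_minus)
  have ub: "proj_le A z u" if "z \<in> set zs" for z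
  proof -
    have "z \<in> carrier A" using proj_closed that by blast
    then show ?thesis
      using mem_mult_co_prod[OF that] r(1) by (simp add: proj_le_def u_def r_def mult_minus)
  qed
  have least: "proj_le A u v" if v: "is_projection A v" "\<forall>z\<in>set zs. proj_le A z v" for v
  proof -
    have vc: "v \<in> carrier A" using v(1) by (simp add: is_projection_def)
    have "r \<otimes> (\<one> \<ominus> v) = \<one> \<ominus> v"
      unfolding r_def using v vc proj_closed
      by (intro co_prod_mult) (auto simp: mult_minus proj_le_def subset_iff)
    then have "u \<otimes> (\<one> \<ominus> v) = \<zero>" using vc r by (simp add: u_def minus_mult)
    then have "u \<ominus> u \<otimes> v = \<zero>" using vc u by (simp add: mult_minus)
    then show ?thesis using vc u minus_eq_zero_iff[of u "u \<otimes> v"] by (simp add: proj_le_def)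
  qed
  have "proj_sup A (set zs) = u"
    unfolding proj_sup_def
  proof (rule the_equality)
    show "is_projection A u \<and> (\<forall>p\<in>set zs. proj_le A p u) \<and>
      (\<forall>v. is_projection A v \<and> (\<forall>p\<in>set zs. proj_le A p v) \<longrightarrow> proj_le A u v)"
      using u ub least by blast
  next
    fix v
    assume v: "is_projection A v \<and> (\<forall>p\<in>set zs. proj_le A p v) \<and>
      (\<forall>w. is_projection A w \<and> (\<forall>p\<in>set zs. proj_le A p w) \<longrightarrow> proj_le A v w)"
    \<comment> \<open>Antisymmetry of \<open>proj_le\<close>: for projections, taking adjoints
      reverses the order of the product and identifies the two equations.\<close>
    then have "u \<otimes> v = u" "v \<otimes> u = v" using u(2) ub least by (auto simp: proj_le_def)
    moreover have "adj A (u \<otimes> v) = v \<otimes> u" "adj A u = u"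
      using u v by (auto simp: adj_mult is_projection_def)
    ultimately show "v = u" by metis
  qed
  then show ?thesis by (simp add: u_def r_def)
qed

text \<open>This turns the inequality in the definition of tightness into a single equation that can
  be tested by multiplication.\<close>

lemma proj_le_sup_iff:
  assumes "q \<in> carrier A" shows "proj_le A q (proj_sup A (set zs)) \<longleftrightarrow> q \<otimes> co_prod zs = \<zero>"
proof -
  have c: "co_prod zs \<in> carrier A" using proj_closed by simp
  have "q \<otimes> (\<one> \<ominus> co_prod zs) = q \<ominus> q \<otimes> co_prod zs" using c assms by (simp add: mult_minus)
  moreover have "q \<ominus> x = q \<longleftrightarrow> x = \<zero>" if "x \<in> carrier A" for x
  proof
    assume "q \<ominus> x = q"
    then have "q \<ominus> (q \<ominus> x) = \<zero>" using assms by simp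
    moreover have "q \<ominus> (q \<ominus> x) = x"
      using assms that by (simp add: M.minus_eq M.minus_add M.r_neg1 M.r_neg2)
    ultimately show "x = \<zero>" by simp
  qed (use assms in simp)
  ultimately show ?thesis unfolding proj_le_def proj_sup_eq using c assms by simp
qed

end

end

section \<open>Tightness of the inclusion for faithful families\<close>

locale faithful_bds_family = bds_family L \<theta> A p s
  for L :: "'l set" and \<theta> :: "'l \<Rightarrow> 'b::generalized_boolean_algebra \<Rightarrow> 'b"
    and A :: "('a, 'm) cstar_scheme" (structure) and p :: "'b \<Rightarrow> 'a" and s :: "'l \<Rightarrow> 'a" +
  assumes faithful: "D \<noteq> bot \<Longrightarrow> p D \<noteq> \<zero>"
begin

text \<open>Stripping the word from both sides would make p_D vanish, against faithfulness.\<close>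

lemma el_nonzero:
  assumes w: "set w \<subseteq> L" and D: "below D w" "D \<noteq> bot" shows "el (w, D) \<noteq> \<zero>"
proof
  assume "el (w, D) = \<zero>"
  then have "sw w (adj A (sw w (p D))) = \<zero>" by (simp add: T_el_def)
  then have "p D \<otimes> sa w (sw w (adj A (sw w (p D)))) = \<zero>" using w by simp
  then have "p D \<otimes> adj A (sw w (p D)) = \<zero>" using p_sa_sw[OF w _ D(1)] w by simp
  then have "adj A (sw w (p D)) = \<zero>" using w by (simp add: p_adj_sw)
  then have "sw w (p D) = \<zero>" using w adj_adj[of "sw w (p D)"] by simp
  then have "p D \<otimes> sa w (sw w (p D)) = \<zero>" using w by simp
  then have "p D = \<zero>" using p_sa_sw[OF w _ D(1), of "p D"] by (simp add: p_mult)
  then show False using faithful[OF D(2)] by simp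
qed

text \<open>For f = (v, B) the dichotomy \<open>zero_or_misses\<close> is applied to B and the
  derivatives of F along v. An idempotent escaping at g becomes a nonzero one at v @ g that lies
  below f and misses F, against the hypothesis.\<close>

lemma no_idempotent_below_imp_zero:
  assumes f: "word_in f" "below (snd f) (fst f)" and F: "words_in F"
    and no: "\<And>d. d \<in> idempotents A T \<Longrightarrow> d \<noteq> \<zero> \<Longrightarrow> d \<otimes> el f = d \<Longrightarrow> \<exists>g\<in>set F. d \<otimes> el g \<noteq> \<zero>"
    and x: "x \<in> carrier A"
  shows "el f \<otimes> Q F x = \<zero>"
proof -
  obtain v B where [simp]: "f = (v, B)" by (cases f)
  have v: "set v \<subseteq> L" "below B v" using f by auto
  let ?F = "map (ders v) F"
  have F': "words_in ?F" using F word_in_ders by auto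
  have zero: "\<forall>x\<in>carrier A. p B \<otimes> Q ?F x = \<zero>"
  proof (rule ccontr)
    assume "\<not> ?thesis"
    moreover have "\<exists>n. \<forall>f\<in>set ?F. length (fst f) \<le> n"
      by (intro exI[of _ "Max ((\<lambda>f. length (fst f)) ` set ?F)"]) simp
    ultimately obtain g D where g: "set g \<subseteq> L" "D \<noteq> bot" "D \<le> fold \<theta> g B" "misses g D ?F"
      using zero_or_misses[of ?F _ B] F' by blast
    have vg: "set (v @ g) \<subseteq> L" using v g by simp
    have bvg: "below D (v @ g)" using below_append v g by blast
    let ?d = "el (v @ g, D)"
    have dE: "?d \<in> idempotents A T" unfolding idempotents_T using vg bvg by force
    have d0: "?d \<noteq> \<zero>" by (rule el_nonzero[OF vg bvg g(2)])
    have dc: "?d \<in> carrier A" using vg by simp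
    have "el f \<otimes> ?d = sw v (p B \<otimes> sa v (sw v (sw g (adj A (sw (v @ g) (p D))))))"
      using v g vg dc by (simp add: T_el_mult) (simp add: T_el_def sw_append)
    also have "\<dots> = sw v (p B \<otimes> sw g (adj A (sw (v @ g) (p D))))"
      using v g vg by (simp add: p_sa_sw)
    also have "\<dots> = sw v (sw g (adj A (sw (v @ g) (p (inf D (fold \<theta> g B))))))"
      using v g vg by (simp add: p_sw p_adj_sw del: set_append)
    also have "\<dots> = ?d" using g(3) by (simp add: T_el_def sw_append inf.absorb1)
    finally have fd: "el f \<otimes> ?d = ?d" .
    then have "?d \<otimes> el f = ?d" using el_commute[of f "(v @ g, D)"] vg f by simp
    then obtain h where h: "h \<in> set F" "?d \<otimes> el h \<noteq> \<zero>" using no[OF dE d0] by blast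
    have wh: "word_in h" using F h by blast
    have hc: "el h \<in> carrier A" using wh by (simp add: el_closed)
    \<comment> \<open>Inserting \<open>el h\<close> a second time rewrites the product as a value of
      \<open>eop h\<close>, the form in which \<open>misses\<close> is stated.\<close>
    have "?d \<otimes> el h = ?d \<otimes> eop h (el h)" using el_mult[OF wh hc] el_idem[OF wh] by simp
    also have "\<dots> = sw (v @ g) (p D \<otimes> sa (v @ g) (eop h (el h)))"
      using T_el_mult[OF vg vg, of "eop h (el h)" D] wh hc by simp
    also have "\<dots> = sw v (sw g (p D \<otimes> sa g (eop (ders v h) (sa v (el h)))))"
      using v wh hc by (simp add: sw_append sa_append sa_eop)
    also have "\<dots> = \<zero>"
    proof -
      have "ders v h \<in> set ?F" using h(1) by simp
      then have "sw g (p D \<otimes> sa g (eop (ders v h) (sa v (el h)))) = \<zero>"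
        by (rule g(4)[unfolded misses_def, rule_format]) (use hc v in simp_all)
      then show ?thesis using v by simp
    qed
    finally show False using h(2) by simp
  qed
  have "el f \<otimes> Q F x = sw v (p B \<otimes> Q ?F (sa v x))"
    using v F x by (simp add: T_el_mult sa_Q)
  also have "\<dots> = \<zero>" using zero v x by simp
  finally show ?thesis .
qed

text \<open>With \<open>yop\<close>, this describes how the product in the definition of tightness
  acts on the algebra: here the factors x, there the factors 1 - y.\<close>

definition xop :: "'a list \<Rightarrow> 'a \<Rightarrow> 'a" where
  "xop xs b = foldr (\<otimes>) xs b"

definition yop :: "'a list \<Rightarrow> 'a \<Rightarrow> 'a" where
  "yop ys b = foldr (\<lambda>y c. c \<ominus> y \<otimes> c) ys b"

lemma op_simps [simp]: "xop [] b = b" "xop (x # xs) b = x \<otimes> xop xs b"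
  "yop [] b = b" "yop (y # ys) b = yop ys b \<ominus> y \<otimes> yop ys b"
  by (simp_all add: xop_def yop_def)

abbreviation "E \<equiv> idempotents A T"

lemma E_closed: "e \<in> E \<Longrightarrow> e \<in> carrier A"
  using T_closed by (auto simp: idempotents_def)

lemma E_adj: "e \<in> E \<Longrightarrow> adj A e = e"
  using el_adj by (auto simp: idempotents_T)

lemma xop_E:
  assumes "set xs \<subseteq> E" "e \<in> E"
  shows "xop xs e \<in> E \<and> (\<forall>x\<in>set xs. xop xs e \<otimes> x = xop xs e) \<and> (\<forall>y\<in>carrier A. xop xs (e \<otimes> y) = xop xs e \<otimes> y)"
  using assms
proof (induction xs)
  case (Cons x xs)
  let ?X = "xop xs e"
  have IH: "?X \<in> E" "\<And>x. x \<in> set xs \<Longrightarrow> ?X \<otimes> x = ?X" "\<And>y. y \<in> carrier A \<Longrightarrow> xop xs (e \<otimes> y) = ?X \<otimes> y"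
    using Cons by auto
  have x: "x \<in> E" "x \<otimes> x = x" using Cons.prems by (auto simp: idempotents_def)
  have c: "x \<in> carrier A" "?X \<in> carrier A" using E_closed x IH by auto
  have "(x \<otimes> ?X) \<otimes> x = x \<otimes> (x \<otimes> ?X)"
    by (simp only: mult_assoc[OF c(1) c(2) c(1)] idempotent_mult(2)[OF IH(1) x(1)])
  also have "\<dots> = x \<otimes> ?X" using c x by (simp add: mult_assoc[symmetric])
  finally have "(x \<otimes> ?X) \<otimes> x = x \<otimes> ?X" .
  moreover have "(x \<otimes> ?X) \<otimes> x' = x \<otimes> ?X" if "x' \<in> set xs" for x'
    using IH(2)[OF that] c E_closed[of x'] that Cons.prems by (simp add: mult_assoc subset_iff)
  ultimately show ?case using idempotent_mult(1)[OF x(1) IH(1)] IH(3) c by (simp add: mult_assoc)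
qed (use assms E_closed in auto)

lemma yop_Q:
  assumes "set ys \<subseteq> E"
  obtains F where "words_in F" "map el F = ys" "\<And>b. b \<in> carrier A \<Longrightarrow> yop ys b = Q F b"
proof -
  have "\<exists>F. words_in F \<and> map el F = ys \<and> (\<forall>b\<in>carrier A. yop ys b = Q F b)"
    using assms
  proof (induction ys)
    case (Cons y ys)
    then obtain F where F: "words_in F" "map el F = ys" "\<forall>b\<in>carrier A. yop ys b = Q F b" by auto
    obtain f where f: "y = el f" "word_in f" using Cons.prems by (auto simp: idempotents_T)
    have "yop (y # ys) b = Q (f # F) b" if "b \<in> carrier A" for b
      using F f that by (simp add: el_mult)
    then show ?case using F f by (intro exI[of _ "f # F"]) auto
  qed auto
  then show thesis using that by blast
qed

text \<open>The factor e supplies an idempotent to start from even if \<open>xs\<close> is empty;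
  multiplied by the x it is an idempotent f. A nonzero d below f that is orthogonal to all y lies in
  the covered set, hence meets some z, so no idempotent escapes.\<close>

lemma cover_zero:
  assumes xs: "set xs \<subseteq> E" and ys: "set ys \<subseteq> E"
    and cover: "is_cover A (idempotents_between A T (set xs) (set ys)) (set zs)"
    and e: "e \<in> E" and b: "b \<in> carrier A"
  shows "xop xs (yop (ys @ zs) (e \<otimes> b)) = \<zero>"
proof -
  have zs: "set zs \<subseteq> E" using cover by (auto simp: is_cover_def idempotents_between_def)
  obtain F where F: "words_in F" "map el F = ys @ zs" "\<And>b. b \<in> carrier A \<Longrightarrow> yop (ys @ zs) b = Q F b"
    using yop_Q[of "ys @ zs"] ys zs by auto
  obtain h where h: "e = el h" "word_in h" using e by (auto simp: idempotents_T)
  let ?X = "xop xs e"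
  have X: "?X \<in> E" "\<And>x. x \<in> set xs \<Longrightarrow> ?X \<otimes> x = ?X" "\<And>y. y \<in> carrier A \<Longrightarrow> xop xs (e \<otimes> y) = ?X \<otimes> y"
    using xop_E[OF xs e] by auto
  obtain f where f: "?X = el f" "word_in f" "below (snd f) (fst f)" using X(1) by (auto simp: idempotents_T)
  have "yop (ys @ zs) (e \<otimes> b) = e \<otimes> Q F b"
    using F h b by (simp add: el_mult eop_Q el_closed)
  then have "xop xs (yop (ys @ zs) (e \<otimes> b)) = ?X \<otimes> Q F b" using X(3) F(1) b by simp
  also have "\<dots> = \<zero>"
    unfolding f(1)
  proof (rule no_idempotent_below_imp_zero[OF f(2,3) F(1) _ b])
    fix d assume d: "d \<in> E" "d \<noteq> \<zero>" "d \<otimes> el f = d"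
    show "\<exists>g\<in>set F. d \<otimes> el g \<noteq> \<zero>"
    proof (rule ccontr)
      assume "\<not> ?thesis"
      then have "\<forall>z\<in>set (map el F). d \<otimes> z = \<zero>" by auto
      then have orth: "\<And>z. z \<in> set ys \<union> set zs \<Longrightarrow> d \<otimes> z = \<zero>" unfolding F(2) by auto
      have "d \<otimes> x = d" if "x \<in> set xs" for x
      proof -
        have "d \<otimes> x = d \<otimes> (?X \<otimes> x)"
          using d(1,3) f(1) X(1) E_closed xs that by (metis mult_assoc subsetD)
        then show ?thesis using X(2)[OF that] d(3) f(1) by simp
      qed
      then have "d \<in> idempotents_between A T (set xs) (set ys)"
        using d(1) orth by (simp add: idempotents_between_def)
      then obtain z where z: "z \<in> set zs" "z \<otimes> d \<noteq> \<zero>" using cover d(2) unfolding is_cover_def by blast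
      then show False using orth[of z] idempotent_mult(2)[OF d(1), of z] zs by auto
    qed
  qed
  finally show ?thesis .
qed

text \<open>The product to be annihilated, times the complement of the supremum, acts as zero on
  every e b by \<open>cover_zero\<close>; \<open>dense\<close> extends this to the whole algebra,
  where the action separates elements.\<close>

theorem tight_unitization_incl:
  assumes dense: "\<And>q b. q \<in> carrier (min_unitization A) \<Longrightarrow>
      (\<And>e b. e \<in> E \<Longrightarrow> b \<in> carrier A \<Longrightarrow> lact q (e \<otimes> b) = \<zero>) \<Longrightarrow> b \<in> carrier A \<Longrightarrow> lact q b = \<zero>"
  shows "tight_representation A T (min_unitization A) unitization_incl"
proof -
  let ?M = "min_unitization A" and ?j = unitization_incl
  interpret MM: unital_cstar_algebra ?M by (rule unital_cstar_algebra_MU)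
  have rep: "representation A T ?M ?j"
    unfolding representation_def
    using MM.unital_cstar_algebra_axioms T_closed
    by (auto simp: unitization_incl_hom) (simp add: unitization_incl_def MU_ops)
  have lact_minus: "lact (\<one>\<^bsub>?M\<^esub> \<ominus>\<^bsub>?M\<^esub> ?j y) c = c \<ominus> y \<otimes> c" if "y \<in> carrier A" "c \<in> carrier A" for y c
  proof -
    have one: "fst \<one>\<^bsub>?M\<^esub> \<in> carrier A" using MU_carrier[OF MM.one_closed] .
    have "lact (\<one>\<^bsub>?M\<^esub> \<ominus>\<^bsub>?M\<^esub> ?j y) c = lact \<one>\<^bsub>?M\<^esub> c \<ominus> y \<otimes> c"
      using that one MU_minus[OF MM.one_closed unitization_incl_closed[OF that(1)]]
      by (simp add: lact_def unitization_incl_def minus_mult) (simp add: M.minus_eq M.a_ac)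
    then show ?thesis using that by (simp add: lact_one)
  qed
  have x_part: "lact (foldr (\<otimes>\<^bsub>?M\<^esub>) (map ?j xs) m) b = xop xs (lact m b) \<and> foldr (\<otimes>\<^bsub>?M\<^esub>) (map ?j xs) m \<in> carrier ?M"
    if "set xs \<subseteq> carrier A" "m \<in> carrier ?M" "b \<in> carrier A" for xs m b
    using that
  proof (induction xs)
    case (Cons x xs)
    have "lact (foldr (\<otimes>\<^bsub>?M\<^esub>) (map ?j xs) m) b \<in> carrier A"
      by (intro lact_closed MU_carrier) (use Cons in auto)
    then show ?case using Cons MU_carrier by (simp add: lact_mult lact_incl)
  qed simp
  have y_part: "lact (foldr (\<otimes>\<^bsub>?M\<^esub>) (map (\<lambda>y. \<one>\<^bsub>?M\<^esub> \<ominus>\<^bsub>?M\<^esub> ?j y) ys) m) b = yop ys (lact m b) \<and>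
      foldr (\<otimes>\<^bsub>?M\<^esub>) (map (\<lambda>y. \<one>\<^bsub>?M\<^esub> \<ominus>\<^bsub>?M\<^esub> ?j y) ys) m \<in> carrier ?M"
    if "set ys \<subseteq> carrier A" "m \<in> carrier ?M" "b \<in> carrier A" for ys m b
    using that
  proof (induction ys)
    case (Cons y ys)
    let ?r = "foldr (\<otimes>\<^bsub>?M\<^esub>) (map (\<lambda>y. \<one>\<^bsub>?M\<^esub> \<ominus>\<^bsub>?M\<^esub> ?j y) ys) m"
    have r: "?r \<in> carrier ?M" using Cons by auto
    have c: "lact ?r b \<in> carrier A" "?r \<in> carrier ?M"
      using lact_closed[OF MU_carrier[OF r] Cons.prems(3)] r by auto
    have d: "\<one>\<^bsub>?M\<^esub> \<ominus>\<^bsub>?M\<^esub> ?j y \<in> carrier ?M" using Cons.prems by simp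
    have "lact ((\<one>\<^bsub>?M\<^esub> \<ominus>\<^bsub>?M\<^esub> ?j y) \<otimes>\<^bsub>?M\<^esub> ?r) b = lact (\<one>\<^bsub>?M\<^esub> \<ominus>\<^bsub>?M\<^esub> ?j y) (lact ?r b)"
      by (rule lact_mult) (use c d MU_carrier Cons.prems in auto)
    also have "\<dots> = lact ?r b \<ominus> y \<otimes> lact ?r b" using lact_minus c Cons.prems by simp
    finally show ?case using Cons c d by simp
  qed simp
  have tight: "proj_le ?M
      (foldr (\<otimes>\<^bsub>?M\<^esub>) (map ?j xs @ map (\<lambda>y. \<one>\<^bsub>?M\<^esub> \<ominus>\<^bsub>?M\<^esub> ?j y) ys) \<one>\<^bsub>?M\<^esub>) (proj_sup ?M (?j ` Z))"
    if xs: "set xs \<subseteq> E" and ys: "set ys \<subseteq> E" and Z: "finite Z"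
      and cover: "is_cover A (idempotents_between A T (set xs) (set ys)) Z" for xs ys Z
  proof -
    obtain zs where zs: "set zs = Z" using finite_list[OF Z] by blast
    have ZE: "Z \<subseteq> E" using cover by (auto simp: is_cover_def idempotents_between_def)
    have cl: "set xs \<subseteq> carrier A" "set ys \<subseteq> carrier A" "set zs \<subseteq> carrier A"
      using xs ys ZE zs E_closed by auto
    let ?q = "foldr (\<otimes>\<^bsub>?M\<^esub>) (map ?j xs @ map (\<lambda>y. \<one>\<^bsub>?M\<^esub> \<ominus>\<^bsub>?M\<^esub> ?j y) ys) \<one>\<^bsub>?M\<^esub>"
    let ?r = "MM.co_prod (map ?j zs)"
    have r: "?r = foldr (\<otimes>\<^bsub>?M\<^esub>) (map (\<lambda>y. \<one>\<^bsub>?M\<^esub> \<ominus>\<^bsub>?M\<^esub> ?j y) zs) \<one>\<^bsub>?M\<^esub>"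
      by (simp add: MM.co_prod_def comp_def)
    have rc: "?r \<in> carrier ?M" unfolding r using y_part[OF cl(3) MM.one_closed, of \<zero>] by simp
    have qc: "?q \<in> carrier ?M"
      using x_part[OF cl(1), of _ \<zero>] y_part[OF cl(2) MM.one_closed, of \<zero>] by simp
    have act: "lact (?q \<otimes>\<^bsub>?M\<^esub> ?r) b = xop xs (yop (ys @ zs) b)" if b: "b \<in> carrier A" for b
    proof -
      have "lact ?r b = yop zs b"
        unfolding r using y_part[OF cl(3) MM.one_closed b] b by (simp add: lact_one)
      moreover have "lact ?r b \<in> carrier A" using rc b MU_carrier by simp
      moreover have "lact ?q c = xop xs (yop ys c)" if "c \<in> carrier A" for c
        using x_part[OF cl(1) _ that] y_part[OF cl(2) MM.one_closed that] that by (simp add: lact_one)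
      ultimately show ?thesis
        using lact_mult[of ?q ?r b] qc rc b MU_carrier by (simp add: yop_def)
    qed
    have prod_c: "?q \<otimes>\<^bsub>?M\<^esub> ?r \<in> carrier ?M" using qc rc by simp
    have "?q \<otimes>\<^bsub>?M\<^esub> ?r = \<zero>\<^bsub>?M\<^esub>"
    proof (rule MU_definite[OF prod_c], rule dense[OF prod_c])
      fix e b assume eb: "e \<in> E" "b \<in> carrier A"
      show "lact (?q \<otimes>\<^bsub>?M\<^esub> ?r) (e \<otimes> b) = \<zero>"
        using act[of "e \<otimes> b"] cover_zero[OF xs ys _ eb] cover zs E_closed[OF eb(1)] eb(2) by simp
    qed
    moreover have "proj_le ?M ?q (proj_sup ?M (set (map ?j zs))) \<longleftrightarrow> ?q \<otimes>\<^bsub>?M\<^esub> ?r = \<zero>\<^bsub>?M\<^esub>"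
    proof (rule MM.proj_le_sup_iff[OF _ _ qc])
      fix z assume "z \<in> set (map ?j zs)"
      then obtain e where e: "z = ?j e" "e \<in> E" using ZE zs by auto
      then have "e \<otimes> e = e" by (simp add: idempotents_def)
      then show "is_projection ?M z"
        using e E_closed[OF e(2)] E_adj[OF e(2)] unitization_incl_hom(1)[of e e] unitization_incl_hom(3)[of e]
        by (simp add: is_projection_def)
    next
      fix y z assume "y \<in> set (map ?j zs)" "z \<in> set (map ?j zs)"
      then obtain e e' where e: "y = ?j e" "e \<in> E" "z = ?j e'" "e' \<in> E" using ZE zs by auto
      then show "y \<otimes>\<^bsub>?M\<^esub> z = z \<otimes>\<^bsub>?M\<^esub> y"
        using idempotent_mult(2)[OF e(2,4)] E_closed by (simp add: unitization_incl_hom(1)[symmetric])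
    qed
    ultimately show ?thesis by (simp add: zs)
  qed
  show ?thesis unfolding tight_representation_def using rep tight by blast
qed

end

text \<open>Uniqueness as functions requires fixing the values outside the carrier; restriction
  yields the extensional representative.\<close>

lemma unital_star_hom_restrict:
  assumes A: "unital_cstar_algebra A" and h: "unital_star_hom A B h"
  shows "unital_star_hom A B (restrict h (carrier A))"
proof -
  interpret A: unital_cstar_algebra A by (rule A)
  show ?thesis using h unfolding unital_star_hom_def ring_hom_def by (auto simp: Pi_iff)
qed

section \<open>The universal property\<close>

context bds
begin

lemma P_gens: "P B \<in> bds_gens L" and S_gens: "a \<in> L \<Longrightarrow> S a \<in> bds_gens L"
  by (auto simp: bds_gens_def)

lemma rels_free: "bds_rels L \<theta> \<subseteq> free_star_algebra (bds_gens L)"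
proof
  fix r assume "r \<in> bds_rels L \<theta>"
  then show "r \<in> free_star_algebra (bds_gens L)"
    by cases (auto simp: P_gens S_gens Delta_def intro!: free_sum)
qed

text \<open>A seminorm vanishing on the relations does not distinguish p from its adjoint or its
  square, so its value t satisfies t * t = t; the squared value at \<open>gen_s a\<close> is the
  value at a projection.\<close>

lemma gens_bounded:
  assumes "g \<in> bds_gens L"
  shows "\<exists>M. \<forall>N\<in>{N. cstar_seminorm (bds_gens L) N \<and> (\<forall>r\<in>bds_rels L \<theta>. N r = 0)}. N (gen g) \<le> M"
proof -
  have "N (gen g) \<le> 1" if N: "cstar_seminorm (bds_gens L) N" "\<forall>r\<in>bds_rels L \<theta>. N r = 0" for N
  proof -
    let ?F = "free_star_algebra (bds_gens L)"
    have rel_eq: "N x = N y" if "x - y \<in> bds_rels L \<theta>" "x \<in> ?F" "y \<in> ?F" for x y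
      using seminorm_diff[OF N(1) that(2,3)] N(2) that(1) by simp
    have p: "N (gen_p B) \<le> 1" for B
    proof -
      have F: "gen_p B \<in> ?F" by (simp add: P_gens)
      \<comment> \<open>The relation only says that the difference of p and its adjoint has seminorm
        0; submultiplicativity carries this over to the products.\<close>
      have "N (star (gen_p B) * gen_p B - gen_p B * gen_p B) \<le> N (star (gen_p B) - gen_p B) * N (gen_p B)"
        using seminorm_mult[OF N(1), of "star (gen_p B) - gen_p B" "gen_p B"] F by (simp add: left_diff_distrib)
      also have "\<dots> = 0" using N(2) by (simp add: bds_rels.p_selfadjoint)
      finally have "N (star (gen_p B) * gen_p B) = N (gen_p B * gen_p B)"
        using seminorm_diff[OF N(1), of "star (gen_p B) * gen_p B" "gen_p B * gen_p B"] F by simp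
      also have "\<dots> = N (gen_p B)" by (rule rel_eq) (use F in \<open>auto intro: bds_rels.p_idempotent\<close>)
      finally have "N (gen_p B) * N (gen_p B) = N (gen_p B) * 1"
        using seminorm_star_mult[OF N(1) F] by (simp add: power2_eq_square)
      then show ?thesis by auto
    qed
    show ?thesis
    proof (cases g)
      case (P B)
      then show ?thesis using p by simp
    next
      case (S a)
      then have a: "a \<in> L" using assms by (auto simp: bds_gens_def)
      have F: "gen_s a \<in> ?F" using a by (simp add: S_gens)
      have "(N (gen_s a))\<^sup>2 = N (star (gen_s a) * gen_s a)" using seminorm_star_mult[OF N(1) F] by simp
      also have "\<dots> = N (gen_p (range_lub (\<theta> a)))"
        by (rule rel_eq) (use F a in \<open>auto simp: P_gens intro: bds_rels.s_s_same\<close>)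
      also have "\<dots> \<le> 1" by (rule p)
      finally show ?thesis
        using seminorm_nonneg[OF N(1) F] by (simp add: S power_le_one_iff)
    qed
  qed
  then show ?thesis by blast
qed

lemma bounded_seminorms: "x \<in> free_star_algebra (bds_gens L) \<Longrightarrow>
    bdd_above ((\<lambda>N. N x) ` {N. cstar_seminorm (bds_gens L) N \<and> (\<forall>r\<in>bds_rels L \<theta>. N r = 0)})"
  using gens_bounded by (rule bounded_on_free_star_algebra)

end

sublocale bds \<subseteq> pres: presentation "bds_gens L" "bds_rels L \<theta>"
  by unfold_locales (rule cstar_seminorm_universal_norm[OF bounded_seminorms])

context bds
begin

abbreviation "pp B \<equiv> pres.\<iota> (gen_p B)"
abbreviation "ss a \<equiv> pres.\<iota> (gen_s a)"

lemma relation_eq: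
  assumes "x - y \<in> bds_rels L \<theta>" "x \<in> pres.F" "y \<in> pres.F" shows "pres.\<iota> x = pres.\<iota> y"
proof -
  have "pres.\<iota> (x - y) = \<zero>\<^bsub>pres.U\<^esub>"
    using assms universal_norm_relation[OF bounded_seminorms rels_free assms(1)]
    by (simp add: pres.map_eq_0_iff)
  then show ?thesis using assms by (simp add: pres.map_minus pres.U.minus_eq_zero_iff)
qed

lemma relation_0: assumes "x \<in> bds_rels L \<theta>" "x \<in> pres.F" shows "pres.\<iota> x = \<zero>\<^bsub>pres.U\<^esub>"
  using relation_eq[of x 0] assms by simp

lemma gens_free [simp]: "gen_p B \<in> pres.F" "a \<in> L \<Longrightarrow> gen_s a \<in> pres.F"
  by (simp_all add: P_gens S_gens)

text \<open>The seminorm built from boundary paths takes part in the supremum defining the universal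
  norm.\<close>

lemma pp_nonzero: assumes "D \<noteq> bot" shows "pp D \<noteq> \<zero>\<^bsub>pres.U\<^esub>"
proof -
  obtain N where N: "cstar_seminorm (bds_gens L) N" "\<forall>r\<in>bds_rels L \<theta>. N r = 0" "1 \<le> N (gen_p D)"
    using faithful_seminorm[OF assms] by blast
  have "N (gen_p D) \<le> pres.N (gen_p D)" by (rule le_universal_norm[OF bounded_seminorms N(1)]) (use N(2) in simp_all)
  then show ?thesis using N(3) by (simp add: pres.map_eq_0_iff)
qed

lemma faithful_bds_family_U: "faithful_bds_family L \<theta> pres.U pp ss"
proof
  fix B D a b
  show "pp B \<in> carrier pres.U" by simp
  show "ss a \<in> carrier pres.U" if "a \<in> L" using that by simp
  show "adj pres.U (pp B) = pp B"
    using relation_eq[OF bds_rels.p_selfadjoint, of B] by (simp add: pres.map_star)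
  show "pp B \<otimes>\<^bsub>pres.U\<^esub> pp D = pp (inf B D)"
    using relation_eq[OF bds_rels.p_inf, of B D] by (simp add: pres.map_mult)
  show "pp (sup B D) = pp B \<oplus>\<^bsub>pres.U\<^esub> pp D \<ominus>\<^bsub>pres.U\<^esub> pp (inf B D)"
    using relation_eq[OF bds_rels.p_sup, of B D] by (simp add: pres.map_add pres.map_minus)
  show "pp bot = \<zero>\<^bsub>pres.U\<^esub>" using relation_0[OF bds_rels.p_bot] by simp
  show "ss a \<otimes>\<^bsub>pres.U\<^esub> adj pres.U (ss a) \<otimes>\<^bsub>pres.U\<^esub> ss a = ss a" if "a \<in> L"
    using relation_eq[OF bds_rels.s_partial_isometry, of a] that by (simp add: pres.map_mult pres.map_star)
  show "pp B \<otimes>\<^bsub>pres.U\<^esub> ss a = ss a \<otimes>\<^bsub>pres.U\<^esub> pp (\<theta> a B)" if "a \<in> L"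
    using relation_eq[OF bds_rels.p_s, of a B] that by (simp add: pres.map_mult)
  show "adj pres.U (ss a) \<otimes>\<^bsub>pres.U\<^esub> ss a = pp (range_lub (\<theta> a))" if "a \<in> L"
    using relation_eq[OF bds_rels.s_s_same, of a] that by (simp add: pres.map_mult pres.map_star)
  show "adj pres.U (ss a) \<otimes>\<^bsub>pres.U\<^esub> ss b = \<zero>\<^bsub>pres.U\<^esub>" if "a \<in> L" "b \<in> L" "a \<noteq> b"
    using relation_0[OF bds_rels.s_s_diff, of a b] that by (simp add: pres.map_mult pres.map_star)
  show "pp B = finsum pres.U (\<lambda>a. ss a \<otimes>\<^bsub>pres.U\<^esub> pp (\<theta> a B) \<otimes>\<^bsub>pres.U\<^esub> adj pres.U (ss a)) (Delta L \<theta> B)"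
    if "B \<in> B_reg L \<theta>"
  proof -
    have aL: "a \<in> L" if "a \<in> Delta L \<theta> B" for a using that by (simp add: Delta_def)
    have "pp B = pres.\<iota> (\<Sum>a\<in>Delta L \<theta> B. gen_s a * gen_p (\<theta> a B) * star (gen_s a))"
      by (rule relation_eq[OF bds_rels.p_reg[OF that]]) (use aL in \<open>auto intro!: free_sum\<close>)
    also have "\<dots> = finsum pres.U (\<lambda>a. pres.\<iota> (gen_s a * gen_p (\<theta> a B) * star (gen_s a))) (Delta L \<theta> B)"
      by (rule pres.map_sum) (use aL in auto)
    also have "\<dots> = finsum pres.U (\<lambda>a. ss a \<otimes>\<^bsub>pres.U\<^esub> pp (\<theta> a B) \<otimes>\<^bsub>pres.U\<^esub> adj pres.U (ss a)) (Delta L \<theta> B)"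
      by (rule pres.U.M.finsum_cong') (use aL in \<open>auto simp: pres.map_mult pres.map_star\<close>)
    finally show ?thesis .
  qed
  show "pp D \<noteq> \<zero>\<^bsub>pres.U\<^esub>" if "D \<noteq> bot" using pp_nonzero that .
qed

end

sublocale bds \<subseteq> C: faithful_bds_family L \<theta> pres.U "\<lambda>B. pres.\<iota> (gen_p B)" "\<lambda>a. pres.\<iota> (gen_s a)"
  by (rule faithful_bds_family_U)

context bds
begin

lemma s_word_simps [simp]: "s_word [] = 1" "s_word (a # w) = gen_s a * s_word w"
  by (simp_all add: s_word_def)

lemma s_word_free: "set w \<subseteq> L \<Longrightarrow> x \<in> pres.F \<Longrightarrow> s_word w * x \<in> pres.F"
  by (induction w) (simp_all add: mult.assoc)

lemma map_s_word: "set w \<subseteq> L \<Longrightarrow> x \<in> pres.F \<Longrightarrow> pres.\<iota> (s_word w * x) = C.sw w (pres.\<iota> x)"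
  by (induction w) (simp_all add: mult.assoc pres.map_mult s_word_free)

lemma map_T_el:
  assumes "set v \<subseteq> L" "set w \<subseteq> L"
  shows "pres.\<iota> (s_word v * gen_p B * star (s_word w)) = C.T_el v B w"
proof -
  have "s_word v * gen_p B * star (s_word w) = s_word v * star (s_word w * star (gen_p B))"
    by (simp add: star_mult mult.assoc)
  then have "pres.\<iota> (s_word v * gen_p B * star (s_word w)) = C.sw v (pres.\<iota> (star (s_word w * star (gen_p B))))"
    using assms by (simp add: map_s_word s_word_free)
  also have "pres.\<iota> (star (s_word w * star (gen_p B))) = adj pres.U (C.sw w (pp B))"
    using assms by (simp add: pres.map_star s_word_free map_s_word)
  finally show ?thesis by (simp add: C.T_el_def)
qed

lemma T_el_mem: "set v \<subseteq> L \<Longrightarrow> set w \<subseteq> L \<Longrightarrow> C.T_el v B w \<in> C.T"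
  unfolding C.T_def by blast

text \<open>The side conditions only normalise: \<open>T_cases\<close> brings every element into a
  form with the containments, and if the ranges are disjoint the element is zero, which is listed
  separately.\<close>

lemma bds_semigroup_eq: "bds_semigroup L \<theta> = C.T"
proof
  show "bds_semigroup L \<theta> \<subseteq> C.T"
    unfolding bds_semigroup_def bds_map_def bds_cstar_def
    by (auto simp: map_T_el T_el_mem C.T_zero)
  show "C.T \<subseteq> bds_semigroup L \<theta>"
  proof
    fix t assume "t \<in> C.T"
    then obtain v B w where t: "t = C.T_el v B w" "set v \<subseteq> L" "set w \<subseteq> L" "below B v" "below B w"
      by (rule C.T_cases)
    let ?R = "top_inf (word_range \<theta> v) (word_range \<theta> w)"
    have below: "below_top B ?R"
      using t(4,5) by (auto simp: word_range_def below_def)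
    show "t \<in> bds_semigroup L \<theta>"
    proof (cases "?R = Some bot")
      case True
      then have "B = bot" using below by (simp add: bot_unique)
      then have "t = \<zero>\<^bsub>pres.U\<^esub>" using t by (simp add: C.T_el_def)
      then show ?thesis by (simp add: bds_semigroup_def bds_cstar_def)
    next
      case False
      then show ?thesis
        unfolding bds_semigroup_def bds_map_def t(1) map_T_el[OF t(2,3), symmetric]
        using t(2,3) below by blast
    qed
  qed
qed

lemma pp_el: "pp B = C.T_el [] B []"
  by (simp add: C.T_el_def)

lemma pp_E: "pp B \<in> C.E"
proof -
  have "C.T_el [] B [] \<in> C.E"
    unfolding C.idempotents_T by (rule CollectI, rule exI[of _ "([], B)"]) (simp add: below_def)
  then show ?thesis by (simp only: pp_el[symmetric])
qed

lemma ss_T: "a \<in> L \<Longrightarrow> ss a \<in> C.T"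
proof -
  assume a: "a \<in> L"
  have "ss a = C.T_el [a] (range_lub (\<theta> a)) []" using a by (simp add: C.T_el_def C.s_p_rng)
  then show ?thesis using a T_el_mem[of "[a]" "[]"] by simp
qed

lemma pp_T: "pp B \<in> C.T"
  using pp_E by (simp add: idempotents_def)

lemma range_projection_E: assumes "t \<in> C.T" obtains e where "e \<in> C.E" "e \<otimes>\<^bsub>pres.U\<^esub> t = t"
proof -
  obtain f where f: "C.word_in f" "t \<otimes>\<^bsub>pres.U\<^esub> adj pres.U t = C.el f" "C.el f \<otimes>\<^bsub>pres.U\<^esub> t = t"
      "below (snd f) (fst f)"
    by (rule C.T_range_projection[OF assms])
  have "C.el f \<in> C.E" unfolding C.idempotents_T using f by blast
  then show thesis using f(3) by (rule that)
qed

lemma gens_cases: "g \<in> bds_gens L \<Longrightarrow> (\<exists>B. g = P B) \<or> (\<exists>a\<in>L. g = S a)"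
  unfolding bds_gens_def by blast

lemma gen_T: "g \<in> bds_gens L \<Longrightarrow> pres.\<iota> (gen g) \<in> C.T"
  using gens_cases[of g] pp_T ss_T by auto

lemma star_gen_T: "g \<in> bds_gens L \<Longrightarrow> pres.\<iota> (star (gen g)) \<in> C.T"
  using C.adj_T[OF gen_T] by (simp add: pres.map_star)

section \<open>Supports consisting of finitely many idempotents\<close>

abbreviation "MU \<equiv> min_unitization pres.U"

text \<open>An algebraic substitute for membership of c in the closed right ideal generated by Z: a
  left multiplier that kills the ideal kills c.\<close>

definition supports :: "(nat \<Rightarrow> ('b, 'l) bds_gen star_poly) set set \<Rightarrow> (nat \<Rightarrow> ('b, 'l) bds_gen star_poly) set \<Rightarrow> bool"
  where "supports Z c \<longleftrightarrow> (\<forall>q\<in>carrier MU.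
    (\<forall>z\<in>Z. \<forall>b\<in>carrier pres.U. pres.U.lact q (z \<otimes>\<^bsub>pres.U\<^esub> b) = \<zero>\<^bsub>pres.U\<^esub>) \<longrightarrow>
    pres.U.lact q c = \<zero>\<^bsub>pres.U\<^esub>)"

lemma supportsI:
  assumes "\<And>q. q \<in> carrier MU \<Longrightarrow> fst q \<in> carrier pres.U \<Longrightarrow>
    (\<And>z b. z \<in> Z \<Longrightarrow> b \<in> carrier pres.U \<Longrightarrow> pres.U.lact q (z \<otimes>\<^bsub>pres.U\<^esub> b) = \<zero>\<^bsub>pres.U\<^esub>) \<Longrightarrow>
    pres.U.lact q c = \<zero>\<^bsub>pres.U\<^esub>"
  shows "supports Z c"
  unfolding supports_def by (intro ballI impI assms) (simp_all add: pres.U.MU_carrier)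

lemma supportsD:
  assumes "supports Z c" "q \<in> carrier MU"
    "\<And>z b. z \<in> Z \<Longrightarrow> b \<in> carrier pres.U \<Longrightarrow> pres.U.lact q (z \<otimes>\<^bsub>pres.U\<^esub> b) = \<zero>\<^bsub>pres.U\<^esub>"
  shows "pres.U.lact q c = \<zero>\<^bsub>pres.U\<^esub>"
  using assms(1)[unfolded supports_def, rule_format, OF assms(2)] assms(3) by simp

lemma T_supported:
  assumes "t \<in> C.T" shows "\<exists>Z. finite Z \<and> Z \<subseteq> C.E \<and> supports Z t"
proof -
  obtain e where e: "e \<in> C.E" "e \<otimes>\<^bsub>pres.U\<^esub> t = t" using assms by (rule range_projection_E)
  have "supports {e} t"
  proof (rule supportsI)
    fix q assume "\<And>z b. z \<in> {e} \<Longrightarrow> b \<in> carrier pres.U \<Longrightarrow> pres.U.lact q (z \<otimes>\<^bsub>pres.U\<^esub> b) = \<zero>\<^bsub>pres.U\<^esub>"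
    from this[of e t] show "pres.U.lact q t = \<zero>\<^bsub>pres.U\<^esub>"
      unfolding e(2) using C.T_closed[OF assms] by simp
  qed
  then show ?thesis using e(1) by (intro exI[of _ "{e}"]) simp
qed

text \<open>A generator or its adjoint is fixed by its range projection, a product inherits the
  support of its left factor, and a sum has the union as support.\<close>

lemma left_support:
  assumes "x \<in> pres.F"
  shows "\<exists>Z. finite Z \<and> Z \<subseteq> C.E \<and> supports Z (pres.\<iota> x)"
  using assms
proof (induction rule: free_star_algebra_induct)
  case zero
  have "supports {} (pres.\<iota> 0)" by (rule supportsI) simp
  then show ?case by (intro exI[of _ "{}"]) simp
next
  case (scale c x)
  then obtain Z where Z: "finite Z" "Z \<subseteq> C.E" "supports Z (pres.\<iota> x)" by blast
  have "supports Z (pres.\<iota> (Defs.scale c x))"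
  proof (rule supportsI)
    fix q assume q: "q \<in> carrier MU" "fst q \<in> carrier pres.U"
      and z: "\<And>z b. z \<in> Z \<Longrightarrow> b \<in> carrier pres.U \<Longrightarrow> pres.U.lact q (z \<otimes>\<^bsub>pres.U\<^esub> b) = \<zero>\<^bsub>pres.U\<^esub>"
    have "pres.U.lact q (pres.\<iota> x) = \<zero>\<^bsub>pres.U\<^esub>" by (rule supportsD[OF Z(3) q(1) z])
    then show "pres.U.lact q (pres.\<iota> (Defs.scale c x)) = \<zero>\<^bsub>pres.U\<^esub>"
      using q(2) scale(1) by (simp add: pres.map_scale pres.U.lact_smult)
  qed
  then show ?case using Z(1,2) by blast
next
  case (gen g)
  then show ?case by (intro T_supported gen_T)
next
  case (star g)
  then show ?case by (intro T_supported star_gen_T)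
next
  case (mult x y)
  then obtain Z where Z: "finite Z" "Z \<subseteq> C.E" "supports Z (pres.\<iota> x)" by blast
  have "supports Z (pres.\<iota> (x * y))"
  proof (rule supportsI)
    fix q assume q: "q \<in> carrier MU" "fst q \<in> carrier pres.U"
      and z: "\<And>z b. z \<in> Z \<Longrightarrow> b \<in> carrier pres.U \<Longrightarrow> pres.U.lact q (z \<otimes>\<^bsub>pres.U\<^esub> b) = \<zero>\<^bsub>pres.U\<^esub>"
    have "pres.U.lact q (pres.\<iota> (x * y)) = pres.U.lact q (pres.\<iota> x) \<otimes>\<^bsub>pres.U\<^esub> pres.\<iota> y"
      using mult(1,2) q(2)
      by (simp add: pres.map_mult pres.U.lact_def pres.U.distr_left pres.U.mult_assoc pres.U.smult_mult_left)
    also have "pres.U.lact q (pres.\<iota> x) = \<zero>\<^bsub>pres.U\<^esub>" by (rule supportsD[OF Z(3) q(1) z])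
    finally show "pres.U.lact q (pres.\<iota> (x * y)) = \<zero>\<^bsub>pres.U\<^esub>" using mult(2) by simp
  qed
  then show ?case using Z(1,2) by blast
next
  case (add x y)
  then obtain Z Z' where Z: "finite Z" "Z \<subseteq> C.E" "supports Z (pres.\<iota> x)"
    and Z': "finite Z'" "Z' \<subseteq> C.E" "supports Z' (pres.\<iota> y)" by blast
  have "supports (Z \<union> Z') (pres.\<iota> (x + y))"
  proof (rule supportsI)
    fix q assume q: "q \<in> carrier MU" "fst q \<in> carrier pres.U"
      and z: "\<And>z b. z \<in> Z \<union> Z' \<Longrightarrow> b \<in> carrier pres.U \<Longrightarrow> pres.U.lact q (z \<otimes>\<^bsub>pres.U\<^esub> b) = \<zero>\<^bsub>pres.U\<^esub>"
    have "pres.U.lact q (pres.\<iota> (x + y)) = pres.U.lact q (pres.\<iota> x) \<oplus>\<^bsub>pres.U\<^esub> pres.U.lact q (pres.\<iota> y)"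
      using add(1,2) q(2)
      by (simp add: pres.map_add pres.U.lact_def pres.U.distr_right pres.U.smult_add pres.U.M.a_ac)
    also have "pres.U.lact q (pres.\<iota> x) = \<zero>\<^bsub>pres.U\<^esub>" by (rule supportsD[OF Z(3) q(1) z]) auto
    also have "pres.U.lact q (pres.\<iota> y) = \<zero>\<^bsub>pres.U\<^esub>" by (rule supportsD[OF Z'(3) q(1) z]) auto
    finally show "pres.U.lact q (pres.\<iota> (x + y)) = \<zero>\<^bsub>pres.U\<^esub>" by simp
  qed
  then show ?case using Z(1,2) Z'(1,2) by (intro exI[of _ "Z \<union> Z'"]) simp
qed

text \<open>Left actions are continuous, and the polynomials, each supported by finitely many
  idempotents, are dense.\<close>

lemma lact_dense:
  assumes q: "q \<in> carrier MU"
    and zero: "\<And>e b. e \<in> C.E \<Longrightarrow> b \<in> carrier pres.U \<Longrightarrow> pres.U.lact q (e \<otimes>\<^bsub>pres.U\<^esub> b) = \<zero>\<^bsub>pres.U\<^esub>"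
    and b: "b \<in> carrier pres.U"
  shows "pres.U.lact q b = \<zero>\<^bsub>pres.U\<^esub>"
proof -
  obtain x where x: "\<forall>n. x n \<in> pres.F" "pres.U.conv (\<lambda>n. pres.\<iota> (x n)) b" by (rule pres.map_dense[OF b])
  have "pres.U.lact q (pres.\<iota> (x n)) = \<zero>\<^bsub>pres.U\<^esub>" for n
  proof -
    obtain Z where Z: "Z \<subseteq> C.E" "supports Z (pres.\<iota> (x n))" using left_support[OF x(1)[rule_format]] by blast
    show ?thesis by (rule supportsD[OF Z(2) q zero[OF subsetD[OF Z(1)]]])
  qed
  then have "pres.U.conv (\<lambda>n. pres.U.lact q (pres.\<iota> (x n))) \<zero>\<^bsub>pres.U\<^esub>"
    using pres.U.conv_const[OF pres.U.M.zero_closed] by simp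
  moreover have "pres.U.conv (\<lambda>n. pres.U.lact q (pres.\<iota> (x n))) (pres.U.lact q b)"
    unfolding pres.U.lact_def
    by (intro pres.U.conv_add pres.U.conv_mult pres.U.conv_const pres.U.conv_smult x(2) pres.U.MU_carrier[OF q])
  ultimately show ?thesis using pres.U.conv_unique by blast
qed

theorem tight_incl: "tight_representation pres.U C.T MU unitization_incl"
  by (rule C.tight_unitization_incl[OF lact_dense])

text \<open>If \<open>e\<close> is a unit and \<open>x\<close> approximates it to within less than 1, no nonzero idempotent
  annihilates the finitely many range projections occurring in \<open>x\<close>.\<close>

lemma unit_imp_finite_cover:
  assumes e: "is_unit pres.U e"
  obtains Z where "finite Z" "is_cover pres.U C.E Z"
proof -
  have ec: "e \<in> carrier pres.U" using e by (simp add: is_unit_def)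
  obtain x where x: "\<forall>n. x n \<in> pres.F" "pres.U.conv (\<lambda>n. pres.\<iota> (x n)) e" by (rule pres.map_dense[OF ec])
  obtain n where n: "nrm pres.U (pres.\<iota> (x n) \<ominus>\<^bsub>pres.U\<^esub> e) < 1"
  proof -
    have "(\<lambda>n. nrm pres.U (pres.\<iota> (x n) \<ominus>\<^bsub>pres.U\<^esub> e)) \<longlonglongrightarrow> 0" using x(2) by (simp add: pres.U.conv_def)
    then have "\<forall>\<^sub>F n in sequentially. nrm pres.U (pres.\<iota> (x n) \<ominus>\<^bsub>pres.U\<^esub> e) < 1"
      by (rule order_tendstoD) simp
    then show thesis using that by (auto simp: eventually_sequentially)
  qed
  obtain Z where Z: "finite Z" "Z \<subseteq> C.E" "supports Z (pres.\<iota> (x n))"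
    using left_support[OF x(1)[rule_format]] by blast
  have "\<exists>z\<in>Z. z \<otimes>\<^bsub>pres.U\<^esub> f \<noteq> \<zero>\<^bsub>pres.U\<^esub>" if f: "f \<in> C.E" "f \<noteq> \<zero>\<^bsub>pres.U\<^esub>" for f
  proof (rule ccontr)
    assume contra: "\<not> ?thesis"
    have fc: "f \<in> carrier pres.U" using C.E_closed f by blast
    have fz: "f \<otimes>\<^bsub>pres.U\<^esub> z = \<zero>\<^bsub>pres.U\<^esub>" if "z \<in> Z" for z
      using contra that C.idempotent_mult(2)[OF f(1), of z] Z(2) by auto
    have "pres.U.lact (unitization_incl f) (z \<otimes>\<^bsub>pres.U\<^esub> b) = \<zero>\<^bsub>pres.U\<^esub>"
      if "z \<in> Z" "b \<in> carrier pres.U" for z b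
      using fz[OF that(1)] fc that Z(2) C.E_closed[of z]
      by (simp add: pres.U.lact_incl subset_iff pres.U.mult_assoc[symmetric])
    then have "pres.U.lact (unitization_incl f) (pres.\<iota> (x n)) = \<zero>\<^bsub>pres.U\<^esub>"
      by (rule supportsD[OF Z(3) pres.U.unitization_incl_closed[OF fc]])
    then have fx: "f \<otimes>\<^bsub>pres.U\<^esub> pres.\<iota> (x n) = \<zero>\<^bsub>pres.U\<^esub>"
      using fc x(1) by (simp add: pres.U.lact_incl)
    \<comment> \<open>Since f annihilates the approximation and is fixed by e, its norm is at most
      itself times a number below 1.\<close>
    have "f \<otimes>\<^bsub>pres.U\<^esub> (pres.\<iota> (x n) \<ominus>\<^bsub>pres.U\<^esub> e) = \<ominus>\<^bsub>pres.U\<^esub> f"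
      using fc ec x(1) fx e by (simp add: pres.U.mult_minus pres.U.zero_minus is_unit_def)
    then have "nrm pres.U f \<le> nrm pres.U f * nrm pres.U (pres.\<iota> (x n) \<ominus>\<^bsub>pres.U\<^esub> e)"
      using pres.U.nrm_mult[of f "pres.\<iota> (x n) \<ominus>\<^bsub>pres.U\<^esub> e"] fc ec x(1) by (simp add: pres.U.nrm_a_inv)
    moreover have "nrm pres.U f > 0" using f(2) fc pres.U.nrm_eq_0[of f] pres.U.nrm_nonneg[of f] by fastforce
    ultimately show False using n by (metis mult.right_neutral mult_less_cancel_left_pos not_le)
  qed
  then have "is_cover pres.U C.E Z" using Z(2) by (auto simp: is_cover_def)
  with Z(1) show thesis by (rule that)
qed

section \<open>The homomorphism induced by a tight representation\<close>

context
  fixes B :: "('x, 'n) cstar_scheme" and \<rho>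
  assumes tight: "tight_representation pres.U C.T B \<rho>"
begin

lemma rep:
  shows rep_unital: "unital_cstar_algebra B" and rep_closed: "t \<in> C.T \<Longrightarrow> \<rho> t \<in> carrier B"
    and rep_zero: "\<rho> \<zero>\<^bsub>pres.U\<^esub> = \<zero>\<^bsub>B\<^esub>"
    and rep_mult: "t \<in> C.T \<Longrightarrow> t' \<in> C.T \<Longrightarrow> \<rho> (t \<otimes>\<^bsub>pres.U\<^esub> t') = \<rho> t \<otimes>\<^bsub>B\<^esub> \<rho> t'"
    and rep_adj: "t \<in> C.T \<Longrightarrow> \<rho> (adj pres.U t) = adj B (\<rho> t)"
  using tight by (auto simp: tight_representation_def representation_def)

interpretation B: unital_cstar_algebra B by (rule rep_unital)

lemma E_T: "e \<in> C.E \<Longrightarrow> e \<in> C.T"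
  by (simp add: idempotents_def)

text \<open>Tightness with Y empty, as an equation by \<open>proj_le_sup_iff\<close>: a
  representation sends idempotents to commuting projections.\<close>

lemma tight_apply:
  assumes xs: "set xs \<subseteq> C.E"
    and cover: "is_cover pres.U (idempotents_between pres.U C.T (set xs) {}) (set zs)"
  shows "foldr (\<otimes>\<^bsub>B\<^esub>) (map \<rho> xs) \<one>\<^bsub>B\<^esub> \<otimes>\<^bsub>B\<^esub> B.co_prod (map \<rho> zs) = \<zero>\<^bsub>B\<^esub>"
proof -
  have zs: "set zs \<subseteq> C.E" using cover by (auto simp: is_cover_def idempotents_between_def)
  have "foldr (\<otimes>\<^bsub>B\<^esub>) (map \<rho> xs) \<one>\<^bsub>B\<^esub> \<in> carrier B"
    using xs by (induction xs) (auto intro: rep_closed E_T)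
  moreover have "proj_le B (foldr (\<otimes>\<^bsub>B\<^esub>) (map \<rho> xs) \<one>\<^bsub>B\<^esub>) (proj_sup B (set (map \<rho> zs)))"
  proof -
    have "\<forall>xs ys Z. set xs \<subseteq> C.E \<and> set ys \<subseteq> C.E \<and> finite Z \<and>
        is_cover pres.U (idempotents_between pres.U C.T (set xs) (set ys)) Z \<longrightarrow>
        proj_le B (foldr (\<otimes>\<^bsub>B\<^esub>) (map \<rho> xs @ map (\<lambda>y. \<one>\<^bsub>B\<^esub> \<ominus>\<^bsub>B\<^esub> \<rho> y) ys) \<one>\<^bsub>B\<^esub>) (proj_sup B (\<rho> ` Z))"
      using tight unfolding tight_representation_def by blast
    from this[rule_format, of xs "[]" "set zs"] show ?thesis using xs cover by simp
  qed
  ultimately show ?thesis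
  proof (subst (asm) B.proj_le_sup_iff)
    fix z assume "z \<in> set (map \<rho> zs)"
    then obtain e where e: "z = \<rho> e" "e \<in> C.E" using zs by auto
    have "e \<otimes>\<^bsub>pres.U\<^esub> e = e" using e(2) by (simp add: idempotents_def)
    then show "is_projection B z"
      using e rep_mult[OF E_T E_T, of e e] rep_adj[OF E_T, of e] C.E_adj[of e] rep_closed[OF E_T, of e]
      by (simp add: is_projection_def)
  next
    fix y z assume "y \<in> set (map \<rho> zs)" "z \<in> set (map \<rho> zs)"
    then obtain e e' where e: "y = \<rho> e" "e \<in> C.E" "z = \<rho> e'" "e' \<in> C.E" using zs by auto
    then show "y \<otimes>\<^bsub>B\<^esub> z = z \<otimes>\<^bsub>B\<^esub> y"
      using C.idempotent_mult(2)[OF e(2,4)] rep_mult[OF E_T E_T, of e e'] rep_mult[OF E_T E_T, of e' e] by simp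
  qed
qed

text \<open>Additivity in the universal algebra shows that nothing nonzero below the union is
  orthogonal to both parts. Tightness then gives r (1 - p) (1 - q) = 0 for the images, and expanding
  with r p = p and r q = q yields the formula.\<close>

lemma rep_sup: "\<rho> (pp (sup D D')) = \<rho> (pp D) \<oplus>\<^bsub>B\<^esub> \<rho> (pp D') \<ominus>\<^bsub>B\<^esub> \<rho> (pp (inf D D'))"
proof -
  let ?s = "pp (sup D D')"
  have below: "pp D \<otimes>\<^bsub>pres.U\<^esub> ?s = pp D" "pp D' \<otimes>\<^bsub>pres.U\<^esub> ?s = pp D'"
    "?s \<otimes>\<^bsub>pres.U\<^esub> pp D = pp D" "?s \<otimes>\<^bsub>pres.U\<^esub> pp D' = pp D'"
    by (simp_all add: C.p_mult inf.absorb1 inf.absorb2)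
  have "is_cover pres.U (idempotents_between pres.U C.T (set [?s]) {}) (set [pp D, pp D'])"
    unfolding is_cover_def
  proof (intro conjI ballI impI)
    show "set [pp D, pp D'] \<subseteq> idempotents_between pres.U C.T (set [?s]) {}"
      using pp_E below by (auto simp: idempotents_between_def)
    fix x assume x: "x \<in> idempotents_between pres.U C.T (set [?s]) {}" "x \<noteq> \<zero>\<^bsub>pres.U\<^esub>"
    then have xE: "x \<in> C.E" "x \<otimes>\<^bsub>pres.U\<^esub> ?s = x" by (auto simp: idempotents_between_def)
    have xc: "x \<in> carrier pres.U" using xE C.E_closed by blast
    show "\<exists>z\<in>set [pp D, pp D']. z \<otimes>\<^bsub>pres.U\<^esub> x \<noteq> \<zero>\<^bsub>pres.U\<^esub>"
    proof (rule ccontr)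
      assume "\<not> ?thesis"
      then have z: "pp D \<otimes>\<^bsub>pres.U\<^esub> x = \<zero>\<^bsub>pres.U\<^esub>" "pp D' \<otimes>\<^bsub>pres.U\<^esub> x = \<zero>\<^bsub>pres.U\<^esub>" by auto
      have "pp (inf D D') \<otimes>\<^bsub>pres.U\<^esub> x = pp D \<otimes>\<^bsub>pres.U\<^esub> (pp D' \<otimes>\<^bsub>pres.U\<^esub> x)"
        using xc by (simp add: C.p_p)
      then have "?s \<otimes>\<^bsub>pres.U\<^esub> x = \<zero>\<^bsub>pres.U\<^esub>"
        unfolding C.p_sup using xc z by (simp add: pres.U.minus_mult pres.U.distr_left)
      then show False using x(2) xE C.idempotent_mult(2)[OF xE(1) pp_E, of "sup D D'"] by simp
    qed
  qed
  then have "foldr (\<otimes>\<^bsub>B\<^esub>) (map \<rho> [?s]) \<one>\<^bsub>B\<^esub> \<otimes>\<^bsub>B\<^esub> B.co_prod (map \<rho> [pp D, pp D']) = \<zero>\<^bsub>B\<^esub>"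
    by (intro tight_apply) (use pp_E in auto)
  moreover have c: "\<rho> (pp X) \<in> carrier B" for X using rep_closed[OF pp_T] .
  moreover have m: "\<rho> ?s \<otimes>\<^bsub>B\<^esub> \<rho> (pp (inf D D')) = \<rho> (pp (inf D D'))" "\<rho> ?s \<otimes>\<^bsub>B\<^esub> \<rho> (pp D) = \<rho> (pp D)" "\<rho> ?s \<otimes>\<^bsub>B\<^esub> \<rho> (pp D') = \<rho> (pp D')"
    "\<rho> (pp D) \<otimes>\<^bsub>B\<^esub> \<rho> (pp D') = \<rho> (pp (inf D D'))"
    using rep_mult[OF pp_T pp_T] below 
    by (simp_all add: C.p_mult inf.absorb2 le_infI1 flip: rep_mult[OF pp_T pp_T])
  ultimately have "\<rho> ?s \<ominus>\<^bsub>B\<^esub> \<rho> (pp D) \<ominus>\<^bsub>B\<^esub> (\<rho> (pp D') \<ominus>\<^bsub>B\<^esub> \<rho> (pp (inf D D'))) = \<zero>\<^bsub>B\<^esub>"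
    by (simp add: B.mult_minus B.minus_mult B.mult_assoc[symmetric])
  then have eq: "\<rho> ?s \<ominus>\<^bsub>B\<^esub> \<rho> (pp D) = \<rho> (pp D') \<ominus>\<^bsub>B\<^esub> \<rho> (pp (inf D D'))"
    using c by (simp add: B.minus_eq_zero_iff)
  have "\<rho> ?s = (\<rho> ?s \<ominus>\<^bsub>B\<^esub> \<rho> (pp D)) \<oplus>\<^bsub>B\<^esub> \<rho> (pp D)"
    using c by (simp add: B.M.minus_eq B.M.a_assoc B.M.l_neg)
  also have "\<dots> = \<rho> (pp D) \<oplus>\<^bsub>B\<^esub> \<rho> (pp D') \<ominus>\<^bsub>B\<^esub> \<rho> (pp (inf D D'))"
    unfolding eq using c by (simp add: B.M.minus_eq B.M.a_ac)
  finally show ?thesis .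
qed

text \<open>Relation (4) in the universal algebra gives the covering property. The covering
  idempotents are pairwise orthogonal, so the product of their complements is 1 minus a sum;
  tightness equates the image of p_D with its product by that sum, and p_D absorbs into each
  summand.\<close>

lemma rep_reg:
  assumes D: "D \<in> B_reg L \<theta>"
  shows "\<rho> (pp D) = finsum B (\<lambda>a. \<rho> (ss a) \<otimes>\<^bsub>B\<^esub> \<rho> (pp (\<theta> a D)) \<otimes>\<^bsub>B\<^esub> adj B (\<rho> (ss a))) (Delta L \<theta> D)"
proof -
  let ?\<Delta> = "Delta L \<theta> D"
  have aL: "a \<in> L" if "a \<in> ?\<Delta>" for a using that by (simp add: Delta_def)
  have "finite ?\<Delta>"
  \<comment> \<open>\<open>B_reg\<close> constrains nonempty sets only and contains the empty one,
    which is therefore treated apart.\<close>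
  proof (cases "D = bot")
    case True
    then have "?\<Delta> = {}" by (auto simp: Delta_def)
    then show ?thesis by simp
  qed (use D in \<open>auto simp: B_reg_def\<close>)
  then obtain as where as: "set as = ?\<Delta>" "distinct as" using finite_distinct_list by blast
  define z where "z a = C.T_el [a] (\<theta> a D) [a]" for a
  have z: "z a = ss a \<otimes>\<^bsub>pres.U\<^esub> pp (\<theta> a D) \<otimes>\<^bsub>pres.U\<^esub> adj pres.U (ss a)" if "a \<in> L" for a
    using that by (simp add: z_def C.T_el_def pres.U.adj_mult pres.U.mult_assoc)
  have zE: "z a \<in> C.E" if "a \<in> L" for a
    unfolding C.idempotents_T z_def using that theta_le_range_lub[of a D]
    by (intro CollectI exI[of _ "([a], \<theta> a D)"]) (simp add: below_def)
  have zc: "z a \<in> carrier pres.U" if "a \<in> L" for a using zE that C.E_closed by blast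
  have zD: "z a \<otimes>\<^bsub>pres.U\<^esub> pp D = z a" if "a \<in> L" for a
    using that by (simp add: z pres.U.mult_assoc C.adj_s_p C.p_p)
  have sum: "pp D = finsum pres.U z ?\<Delta>"
    unfolding C.p_reg[OF D] by (rule pres.U.M.finsum_cong') (use aL z zc in auto)
  have orth: "z a \<otimes>\<^bsub>pres.U\<^esub> z b = \<zero>\<^bsub>pres.U\<^esub>" if "a \<in> L" "b \<in> L" "a \<noteq> b" for a b
    using that by (simp add: z pres.U.mult_assoc C.adj_s_s_act_diff)
  have "is_cover pres.U (idempotents_between pres.U C.T (set [pp D]) {}) (set (map z as))"
    unfolding is_cover_def
  proof (intro conjI ballI impI)
    show "set (map z as) \<subseteq> idempotents_between pres.U C.T (set [pp D]) {}"
      using zE zD aL as(1) by (auto simp: idempotents_between_def)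
    fix x assume x: "x \<in> idempotents_between pres.U C.T (set [pp D]) {}" "x \<noteq> \<zero>\<^bsub>pres.U\<^esub>"
    then have xE: "x \<in> C.E" "x \<otimes>\<^bsub>pres.U\<^esub> pp D = x" by (auto simp: idempotents_between_def)
    have xc: "x \<in> carrier pres.U" using xE C.E_closed by blast
    show "\<exists>y\<in>set (map z as). y \<otimes>\<^bsub>pres.U\<^esub> x \<noteq> \<zero>\<^bsub>pres.U\<^esub>"
    proof (rule ccontr)
      assume "\<not> ?thesis"
      then have "z a \<otimes>\<^bsub>pres.U\<^esub> x = \<zero>\<^bsub>pres.U\<^esub>" if "a \<in> ?\<Delta>" for a using that as(1) by auto
      then have "finsum pres.U z ?\<Delta> \<otimes>\<^bsub>pres.U\<^esub> x = \<zero>\<^bsub>pres.U\<^esub>"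
        using xc zc aL by (subst pres.U.finsum_mult) (auto intro!: pres.U.finsum_0_neutral)
      then show False using x(2) xE sum C.idempotent_mult(2)[OF xE(1) pp_E, of D] by simp
    qed
  qed
  then have tight0: "foldr (\<otimes>\<^bsub>B\<^esub>) (map \<rho> [pp D]) \<one>\<^bsub>B\<^esub> \<otimes>\<^bsub>B\<^esub> B.co_prod (map \<rho> (map z as)) = \<zero>\<^bsub>B\<^esub>"
    by (intro tight_apply) (use pp_E in auto)
  have c: "\<rho> (pp X) \<in> carrier B" for X using rep_closed[OF pp_T] .
  have \<rho>z: "\<rho> (z a) \<in> carrier B" if "a \<in> L" for a using rep_closed E_T zE that by blast
  have "B.co_prod (map (\<lambda>a. \<rho> (z a)) as) = \<one>\<^bsub>B\<^esub> \<ominus>\<^bsub>B\<^esub> finsum B (\<lambda>a. \<rho> (z a)) (set as)"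
  proof (rule B.co_prod_orthogonal[OF as(2)])
    show "\<rho> (z a) \<in> carrier B" if "a \<in> set as" for a using \<rho>z aL as(1) that by blast
    show "\<rho> (z a) \<otimes>\<^bsub>B\<^esub> \<rho> (z b) = \<zero>\<^bsub>B\<^esub>" if "a \<in> set as" "b \<in> set as" "a \<noteq> b" for a b
      using rep_mult[OF E_T[OF zE] E_T[OF zE], of a b] orth[of a b] aL as(1) that rep_zero by auto
  qed
  moreover have fc: "finsum B (\<lambda>a. \<rho> (z a)) ?\<Delta> \<in> carrier B"
    using \<rho>z aL by (intro B.M.finsum_closed) auto
  ultimately have "\<rho> (pp D) \<ominus>\<^bsub>B\<^esub> \<rho> (pp D) \<otimes>\<^bsub>B\<^esub> finsum B (\<lambda>a. \<rho> (z a)) ?\<Delta> = \<zero>\<^bsub>B\<^esub>"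
    using tight0 c by (simp add: comp_def as(1) B.mult_minus)
  then have "\<rho> (pp D) = \<rho> (pp D) \<otimes>\<^bsub>B\<^esub> finsum B (\<lambda>a. \<rho> (z a)) ?\<Delta>"
    using B.minus_eq_zero_iff c fc by simp
  also have "\<dots> = finsum B (\<lambda>a. \<rho> (pp D) \<otimes>\<^bsub>B\<^esub> \<rho> (z a)) ?\<Delta>"
    using c \<rho>z aL by (intro B.mult_finsum) auto
  also have "\<dots> = finsum B (\<lambda>a. \<rho> (ss a) \<otimes>\<^bsub>B\<^esub> \<rho> (pp (\<theta> a D)) \<otimes>\<^bsub>B\<^esub> adj B (\<rho> (ss a))) ?\<Delta>"
  proof (rule B.M.finsum_cong')
    fix a assume "a \<in> ?\<Delta>"
    then have a: "a \<in> L" by (rule aL)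
    have "\<rho> (pp D) \<otimes>\<^bsub>B\<^esub> \<rho> (z a) = \<rho> (pp D \<otimes>\<^bsub>pres.U\<^esub> z a)"
      using rep_mult[OF pp_T E_T[OF zE[OF a]]] by simp
    also have "pp D \<otimes>\<^bsub>pres.U\<^esub> z a = z a" using C.idempotent_mult(2)[OF pp_E zE[OF a]] zD[OF a] by simp
    also have "\<rho> (z a) = \<rho> (ss a) \<otimes>\<^bsub>B\<^esub> \<rho> (pp (\<theta> a D)) \<otimes>\<^bsub>B\<^esub> adj B (\<rho> (ss a))"
      using a by (simp add: z rep_mult rep_adj C.T_mult pp_T ss_T C.adj_T)
    finally show "\<rho> (pp D) \<otimes>\<^bsub>B\<^esub> \<rho> (z a) = \<rho> (ss a) \<otimes>\<^bsub>B\<^esub> \<rho> (pp (\<theta> a D)) \<otimes>\<^bsub>B\<^esub> adj B (\<rho> (ss a))" .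
  qed (use aL c ss_T rep_closed in auto)
  finally show ?thesis .
qed

text \<open>The value 0 outside \<open>L\<close> makes the assignment total, as evaluation requires;
  the free algebra on \<open>bds_gens L\<close> contains no such letters.\<close>

definition gen_image :: "('b, 'l) bds_gen \<Rightarrow> 'x" where
  "gen_image g = (case g of P D \<Rightarrow> \<rho> (pp D) | S a \<Rightarrow> if a \<in> L then \<rho> (ss a) else \<zero>\<^bsub>B\<^esub>)"

lemma gen_image_simps [simp]: "gen_image (P D) = \<rho> (pp D)" "a \<in> L \<Longrightarrow> gen_image (S a) = \<rho> (ss a)"
  by (simp_all add: gen_image_def)

lemma gen_image_closed: "gen_image g \<in> carrier B"
  by (cases g) (auto simp: gen_image_def rep_closed pp_T ss_T)

lemmas eval_simps = B.eval_poly_minus[OF gen_image_closed] B.eval_poly_add[OF gen_image_closed]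
  B.eval_poly_mult[OF gen_image_closed] B.eval_poly_star[OF gen_image_closed]
  B.eval_poly_gen[OF gen_image_closed] B.eval_poly_sum[OF gen_image_closed]
  B.eval_poly_scale[OF gen_image_closed]

lemma eval_relation: assumes "r \<in> bds_rels L \<theta>" shows "B.eval_poly gen_image r = \<zero>\<^bsub>B\<^esub>"
proof -
  have m: "\<rho> t \<otimes>\<^bsub>B\<^esub> \<rho> t' = \<rho> (t \<otimes>\<^bsub>pres.U\<^esub> t')" if "t \<in> C.T" "t' \<in> C.T" for t t'
    using rep_mult that by simp
  have j: "adj B (\<rho> t) = \<rho> (adj pres.U t)" if "t \<in> C.T" for t using rep_adj that by simp
  note T = pp_T ss_T C.adj_T[OF ss_T] C.T_mult rep_closed
  show ?thesis
    using assms
  proof cases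
    case (p_selfadjoint A)
    then show ?thesis by (simp add: eval_simps j pp_T rep_closed)
  next
    case (p_idempotent A)
    then show ?thesis by (simp add: eval_simps m pp_T C.p_mult rep_closed)
  next
    case (s_partial_isometry a)
    then show ?thesis by (simp add: eval_simps m j T C.s_partial_isometry)
  next
    case (p_inf A D)
    then show ?thesis by (simp add: eval_simps m pp_T C.p_mult rep_closed)
  next
    case (p_sup A D)
    then show ?thesis by (simp add: eval_simps rep_sup[symmetric] pp_T rep_closed)
  next
    case p_bot
    then show ?thesis by (simp add: eval_simps rep_zero)
  next
    case (p_s a A)
    then show ?thesis by (simp add: eval_simps m T C.p_s)
  next
    case (s_s_same a)
    then show ?thesis by (simp add: eval_simps m j T C.s_s_same)
  next
    case (s_s_diff a b)
    then show ?thesis by (simp add: eval_simps m j T C.s_s_diff rep_zero)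
  next
    case (p_reg A)
    have aL: "a \<in> L" if "a \<in> Delta L \<theta> A" for a using that by (simp add: Delta_def)
    have "B.eval_poly gen_image r = \<rho> (pp A) \<ominus>\<^bsub>B\<^esub>
        finsum B (\<lambda>a. gen_image (S a) \<otimes>\<^bsub>B\<^esub> \<rho> (pp (\<theta> a A)) \<otimes>\<^bsub>B\<^esub> adj B (gen_image (S a))) (Delta L \<theta> A)"
      unfolding p_reg(1) by (simp add: eval_simps)
    also have "finsum B (\<lambda>a. gen_image (S a) \<otimes>\<^bsub>B\<^esub> \<rho> (pp (\<theta> a A)) \<otimes>\<^bsub>B\<^esub> adj B (gen_image (S a))) (Delta L \<theta> A) =
        finsum B (\<lambda>a. \<rho> (ss a) \<otimes>\<^bsub>B\<^esub> \<rho> (pp (\<theta> a A)) \<otimes>\<^bsub>B\<^esub> adj B (\<rho> (ss a))) (Delta L \<theta> A)"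
      by (rule B.M.finsum_cong') (use aL T in auto)
    also have "\<dots> = \<rho> (pp A)" by (rule rep_reg[OF p_reg(2), symmetric])
    finally show ?thesis using rep_closed[OF pp_T] by simp
  qed
qed

text \<open>Evaluation at the images is a seminorm vanishing on the relations, so it is dominated by
  the universal norm and extends. Agreement with \<open>\<rho>\<close> then spreads from the
  generators along words, because all partial products stay in T.\<close>

lemma exists_star_hom:
  obtains h where "star_hom pres.U B h" "\<And>t. t \<in> C.T \<Longrightarrow> h t = \<rho> t"
proof -
  let ?\<pi> = "B.eval_poly gen_image"
  have le: "nrm B (?\<pi> x) \<le> pres.N x" if "x \<in> pres.F" for x
    by (rule le_universal_norm[OF bounded_seminorms B.cstar_seminorm_eval[OF gen_image_closed] _ that])
      (simp_all add: eval_relation)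
  obtain h where h: "star_hom pres.U B h" "\<And>x. x \<in> pres.F \<Longrightarrow> h (pres.\<iota> x) = ?\<pi> x"
    by (rule pres.universal_property[OF B.cstar_algebra_axioms, of ?\<pi>])
      (simp_all add: eval_simps B.eval_poly_closed[OF gen_image_closed] le)
  have hm: "h (x \<otimes>\<^bsub>pres.U\<^esub> y) = h x \<otimes>\<^bsub>B\<^esub> h y" if "x \<in> carrier pres.U" "y \<in> carrier pres.U" for x y
    using h(1) that by (simp add: star_hom_def)
  have hj: "h (adj pres.U x) = adj B (h x)" if "x \<in> carrier pres.U" for x
    using h(1) that by (simp add: star_hom_def)
  have hp: "h (pp D) = \<rho> (pp D)" for D using h(2)[of "gen_p D"] by (simp add: eval_simps)
  have hs: "h (ss a) = \<rho> (ss a)" if "a \<in> L" for a using h(2)[of "gen_s a"] that by (simp add: eval_simps)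
  have sw: "C.sw w x \<in> C.T \<and> h (C.sw w x) = \<rho> (C.sw w x)" if "set w \<subseteq> L" "x \<in> C.T" "h x = \<rho> x" for w x
    using that(1)
  proof (induction w)
    case (Cons a w)
    then have IH: "C.sw w x \<in> C.T" "h (C.sw w x) = \<rho> (C.sw w x)" and a: "a \<in> L" by auto
    then show ?case using C.T_closed[OF IH(1)] by (simp add: C.T_s hm hs rep_mult ss_T)
  qed (use that in simp)
  have "h t = \<rho> t" if "t \<in> C.T" for t
  proof -
    obtain v D w where t: "t = C.T_el v D w" "set v \<subseteq> L" "set w \<subseteq> L" using \<open>t \<in> C.T\<close> by (auto simp: C.T_def)
    have 1: "C.sw w (pp D) \<in> C.T \<and> h (C.sw w (pp D)) = \<rho> (C.sw w (pp D))" using sw[OF t(3) pp_T hp] .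
    then have "h (adj pres.U (C.sw w (pp D))) = \<rho> (adj pres.U (C.sw w (pp D)))"
      using C.T_closed by (simp add: hj rep_adj)
    then show ?thesis
      using sw[OF t(2) C.adj_T] 1 by (simp add: t(1) C.T_el_def)
  qed
  with h(1) show thesis by (rule that)
qed

lemma exists_unital_star_hom:
  "\<exists>\<psi>\<in>extensional (carrier MU). unital_star_hom MU B \<psi> \<and>
    (\<forall>t\<in>C.T. \<psi> (unitization_incl t) = \<rho> t)"
proof -
  obtain h where h: "star_hom pres.U B h" "\<And>t. t \<in> C.T \<Longrightarrow> h t = \<rho> t" using exists_star_hom by blast
  have hc: "h x \<in> carrier B" if "x \<in> carrier pres.U" for x using h(1) that by (auto simp: star_hom_def)
  have unit: "h e = \<one>\<^bsub>B\<^esub>" if e: "is_unit pres.U e" for e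
  proof -
    obtain Z where Z: "finite Z" "is_cover pres.U C.E Z" by (rule unit_imp_finite_cover[OF e])
    obtain zs where zs: "set zs = Z" using finite_list[OF Z(1)] by blast
    have ZE: "Z \<subseteq> C.E" using Z(2) by (simp add: is_cover_def)
    have ec: "e \<in> carrier pres.U" using e by (simp add: is_unit_def)
    have \<rho>c: "set (map \<rho> zs) \<subseteq> carrier B" using ZE zs rep_closed E_T by auto
    \<comment> \<open>With X and Y empty the covered set is all of E, and the empty product is 1;
      tightness then forces the complements of the cover to multiply to 0.\<close>
    have between: "idempotents_between pres.U C.T (set []) {} = C.E" by (auto simp: idempotents_between_def)
    have "foldr (\<otimes>\<^bsub>B\<^esub>) (map \<rho> []) \<one>\<^bsub>B\<^esub> \<otimes>\<^bsub>B\<^esub> B.co_prod (map \<rho> zs) = \<zero>\<^bsub>B\<^esub>"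
      by (rule tight_apply) (use Z(2) zs between in auto)
    then have zero: "B.co_prod (map \<rho> zs) = \<zero>\<^bsub>B\<^esub>" using \<rho>c by simp
    let ?x = "\<one>\<^bsub>B\<^esub> \<ominus>\<^bsub>B\<^esub> h e"
    have xc: "?x \<in> carrier B" using hc ec by simp
    \<comment> \<open>1 - h e is orthogonal to the image of every idempotent, so multiplying by the
      complements leaves it unchanged, although their product is 0.\<close>
    have "?x \<otimes>\<^bsub>B\<^esub> B.co_prod (map \<rho> zs) = ?x"
    proof (rule B.mult_co_prod[OF xc \<rho>c])
      fix z assume "z \<in> set (map \<rho> zs)"
      then obtain f where f: "z = \<rho> f" "f \<in> C.E" using ZE zs by auto
      have fc: "f \<in> carrier pres.U" using f C.E_closed by blast
      have "h e \<otimes>\<^bsub>B\<^esub> h f = h f"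
        using h(1) ec fc e unfolding star_hom_def is_unit_def by metis
      then show "?x \<otimes>\<^bsub>B\<^esub> z = \<zero>\<^bsub>B\<^esub>"
        using hc ec fc f h(2)[OF E_T[OF f(2)]] rep_closed[OF E_T[OF f(2)]] by (simp add: B.minus_mult)
    qed
    then have "?x = \<zero>\<^bsub>B\<^esub>" unfolding zero using xc by simp
    then show ?thesis using B.minus_eq_zero_iff[of "\<one>\<^bsub>B\<^esub>" "h e"] hc[OF ec] by simp
  qed
  let ?\<psi> = "\<lambda>x. h (fst x) \<oplus>\<^bsub>B\<^esub> snd x \<odot>\<^bsub>B\<^esub> \<one>\<^bsub>B\<^esub>"
  have "unital_star_hom MU B ?\<psi>"
    by (rule pres.U.unitization_extend[OF rep_unital h(1) unit])
  then have hom: "unital_star_hom MU B (restrict ?\<psi> (carrier MU))"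
    by (rule unital_star_hom_restrict[OF pres.U.unital_cstar_algebra_MU])
  have "restrict ?\<psi> (carrier MU) (unitization_incl t) = \<rho> t" if t: "t \<in> C.T" for t
  proof -
    have tc: "t \<in> carrier pres.U" using C.T_closed t by blast
    then show ?thesis using h(2)[OF t] hc[OF tc] by (simp add: unitization_incl_def[of t, symmetric]) (simp add: unitization_incl_def)
  qed
  with hom show ?thesis by (intro bexI[of _ "restrict ?\<psi> (carrier MU)"]) auto
qed

text \<open>On polynomials both maps equal evaluation at the images; contractivity carries this to
  limits, and the rest of the unitization is spanned by the unit.\<close>

lemma unital_star_hom_unique:
  assumes \<psi>: "unital_star_hom MU B \<psi>" "\<And>t. t \<in> C.T \<Longrightarrow> \<psi> (unitization_incl t) = \<rho> t"
    and \<psi>': "unital_star_hom MU B \<psi>'" "\<And>t. t \<in> C.T \<Longrightarrow> \<psi>' (unitization_incl t) = \<rho> t"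
    and x: "x \<in> carrier MU"
  shows "\<psi> x = \<psi>' x"
proof -
  let ?M = MU and ?j = unitization_incl
  interpret M: unital_cstar_algebra ?M by (rule pres.U.unital_cstar_algebra_MU)
  have eval: "\<phi> (?j (pres.\<iota> y)) = B.eval_poly gen_image y"
    if \<phi>: "unital_star_hom ?M B \<phi>" "\<And>t. t \<in> C.T \<Longrightarrow> \<phi> (?j t) = \<rho> t" and y: "y \<in> pres.F" for \<phi> y
  proof -
    note hom = unital_star_homD[OF \<phi>(1)]
    have gens: "\<phi> (?j (pres.\<iota> (gen g))) = gen_image g" if "g \<in> bds_gens L" for g
      using gens_cases[OF that] \<phi>(2)[OF pp_T] \<phi>(2)[OF ss_T] by auto
    show ?thesis
      using y
    proof (induction rule: free_star_algebra_induct)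
      case zero
      have "?j \<zero>\<^bsub>pres.U\<^esub> = \<zero>\<^bsub>?M\<^esub>" by (simp add: unitization_incl_def pres.U.MU_ops)
      moreover have "\<phi> \<zero>\<^bsub>?M\<^esub> = \<zero>\<^bsub>B\<^esub>"
        using hom(5)[of "\<zero>\<^bsub>?M\<^esub>" 0] hom(1)[of "\<zero>\<^bsub>?M\<^esub>"] by simp
      ultimately show ?case by (simp add: B.eval_poly_0[OF gen_image_closed])
    next
      case (scale c x)
      then show ?case by (simp add: pres.map_scale pres.U.unitization_incl_hom hom(5) eval_simps)
    next
      case (gen g)
      then show ?case by (simp add: gens eval_simps)
    next
      case (star g)
      then show ?case by (simp add: pres.map_star pres.U.unitization_incl_hom hom(6) gens eval_simps)
    next
      case (mult x y)
      then show ?case by (simp add: pres.map_mult pres.U.unitization_incl_hom hom(2) eval_simps)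
    next
      case (add x y)
      then show ?case by (simp add: pres.map_add pres.U.unitization_incl_hom hom(3) eval_simps)
    qed
  qed
  have conv: "B.conv (\<lambda>n. B.eval_poly gen_image (y n)) (\<phi> (?j a))"
    if \<phi>: "unital_star_hom ?M B \<phi>" "\<And>t. t \<in> C.T \<Longrightarrow> \<phi> (?j t) = \<rho> t"
      and y: "\<And>n. y n \<in> pres.F" "pres.U.conv (\<lambda>n. pres.\<iota> (y n)) a" for \<phi> y a
  proof (rule B.convI)
    note hom = unital_star_homD[OF \<phi>(1)]
    have a: "a \<in> carrier pres.U" using y(2) by (simp add: pres.U.conv_def)
    show "(\<lambda>n. nrm pres.U (pres.\<iota> (y n) \<ominus>\<^bsub>pres.U\<^esub> a)) \<longlonglongrightarrow> 0" using y(2) by (simp add: pres.U.conv_def)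
    show "B.eval_poly gen_image (y n) \<in> carrier B" for n by (rule B.eval_poly_closed[OF gen_image_closed])
    show "\<phi> (?j a) \<in> carrier B" using a hom(1) by simp
    show "nrm B (B.eval_poly gen_image (y n) \<ominus>\<^bsub>B\<^esub> \<phi> (?j a)) \<le> nrm pres.U (pres.\<iota> (y n) \<ominus>\<^bsub>pres.U\<^esub> a)" for n
    proof -
      let ?d = "pres.\<iota> (y n) \<ominus>\<^bsub>pres.U\<^esub> a"
      have d: "?d = pres.\<iota> (y n) \<oplus>\<^bsub>pres.U\<^esub> (-1) \<odot>\<^bsub>pres.U\<^esub> a"
        using a by (simp add: pres.U.M.minus_eq pres.U.smult_uminus)
      have dc: "?d \<in> carrier pres.U" using a y(1) by simp
      have "\<phi> (?j ?d) = \<phi> (?j (pres.\<iota> (y n))) \<oplus>\<^bsub>B\<^esub> (-1) \<odot>\<^bsub>B\<^esub> \<phi> (?j a)"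
        unfolding d pres.U.unitization_incl_hom(2,4) using a y(1) by (subst hom(3)) (simp_all add: hom(5))
      also have "\<dots> = B.eval_poly gen_image (y n) \<ominus>\<^bsub>B\<^esub> \<phi> (?j a)"
        using eval[OF \<phi> y(1)] a hom(1) by (simp add: B.M.minus_eq B.smult_uminus)
      finally have "nrm B (B.eval_poly gen_image (y n) \<ominus>\<^bsub>B\<^esub> \<phi> (?j a)) = nrm B (\<phi> (?j ?d))" by simp
      also have "\<dots> \<le> nrm ?M (?j ?d)"
        by (rule unital_star_hom_contractive[OF M.unital_cstar_algebra_axioms rep_unital \<phi>(1)]) (use dc in simp)
      also have "\<dots> = nrm pres.U ?d"
        using dc by (simp add: pres.U.MU_ops(6) unitization_incl_def pres.U.opn_fst)
      finally show ?thesis .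
    qed
  qed
  have incl: "\<psi> (?j a) = \<psi>' (?j a)" if a: "a \<in> carrier pres.U" for a
  proof -
    obtain y where y: "\<forall>n. y n \<in> pres.F" "pres.U.conv (\<lambda>n. pres.\<iota> (y n)) a" by (rule pres.map_dense[OF a])
    have "B.conv (\<lambda>n. B.eval_poly gen_image (y n)) (\<psi> (?j a))" by (rule conv[OF \<psi> _ y(2)]) (use y(1) in auto)
    moreover have "B.conv (\<lambda>n. B.eval_poly gen_image (y n)) (\<psi>' (?j a))" by (rule conv[OF \<psi>' _ y(2)]) (use y(1) in auto)
    ultimately show ?thesis by (rule B.conv_unique)
  qed
  have fx: "fst x \<in> carrier pres.U" by (rule pres.U.MU_carrier[OF x])
  note h = unital_star_homD[OF \<psi>(1)] and h' = unital_star_homD[OF \<psi>'(1)]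
  have "\<psi> (?j (fst x) \<oplus>\<^bsub>?M\<^esub> snd x \<odot>\<^bsub>?M\<^esub> \<one>\<^bsub>?M\<^esub>) = \<psi>' (?j (fst x) \<oplus>\<^bsub>?M\<^esub> snd x \<odot>\<^bsub>?M\<^esub> \<one>\<^bsub>?M\<^esub>)"
    using fx incl[OF fx] by (simp add: h(3,4,5) h'(3,4,5))
  then show ?thesis using pres.U.MU_decomp[OF x] by simp
qed

theorem exists_unique_unital_star_hom:
  "\<exists>!\<psi>. \<psi> \<in> extensional (carrier MU) \<and>
    unital_star_hom MU B \<psi> \<and> (\<forall>t\<in>C.T. \<psi> (unitization_incl t) = \<rho> t)"
proof (rule ex_ex1I)
  show "\<exists>\<psi>. \<psi> \<in> extensional (carrier MU) \<and>
    unital_star_hom MU B \<psi> \<and> (\<forall>t\<in>C.T. \<psi> (unitization_incl t) = \<rho> t)"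
    using exists_unital_star_hom by blast
  fix \<psi> \<psi>'
  assume 1: "\<psi> \<in> extensional (carrier MU) \<and>
      unital_star_hom MU B \<psi> \<and> (\<forall>t\<in>C.T. \<psi> (unitization_incl t) = \<rho> t)"
    and 2: "\<psi>' \<in> extensional (carrier MU) \<and>
      unital_star_hom MU B \<psi>' \<and> (\<forall>t\<in>C.T. \<psi>' (unitization_incl t) = \<rho> t)"
  show "\<psi> = \<psi>'"
    by (rule extensionalityI[of _ "carrier MU"])
      (use 1 2 unital_star_hom_unique[of \<psi> \<psi>'] in auto)
qed

end

end

theorem theorem7p11:
  fixes L :: "'l set" and \<theta> :: "'l \<Rightarrow> 'b::generalized_boolean_algebra \<Rightarrow> 'b"
  assumes "boolean_dynamical_system L \<theta>"
  shows "tight_representation (bds_cstar L \<theta>) (bds_semigroup L \<theta>)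
           (min_unitization (bds_cstar L \<theta>)) unitization_incl \<and>
         (\<forall>(A :: 'a cstar) \<rho>.
           tight_representation (bds_cstar L \<theta>) (bds_semigroup L \<theta>) A \<rho> \<longrightarrow>
           (\<exists>!\<psi>. \<psi> \<in> extensional (carrier (min_unitization (bds_cstar L \<theta>))) \<and>
                 unital_star_hom (min_unitization (bds_cstar L \<theta>)) A \<psi> \<and>
                 (\<forall>t\<in>bds_semigroup L \<theta>. \<psi> (unitization_incl t) = \<rho> t)))"
proof -
  interpret bds L \<theta> by (rule bds.intro[OF assms])
  show ?thesis
    unfolding bds_semigroup_eq bds_cstar_def
    using tight_incl exists_unique_unital_star_hom by blast
qed

end
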